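(* For every $\alpha\in(0,1)$ and $\gamma>0$, the law of the $\alpha$-Sun random variable $\mathbf{X}_{\alpha,\gamma}$ is a generalized Gamma convolution (GGC).
   Context: For $\alpha\in(0,1)$ and $\gamma>0$, the $\alpha$-Sun random variable $\mathbf{X}_{\alpha,\gamma}$ (Fréchet case) is the positive random variable whose smooth probability density $h_{\alpha,\gamma}$ on $(0,\infty)$ solves the integro-differential equation $$h_{\alpha,\gamma}(x)=\frac{\gamma}{x}\int_0^x\frac{h_{\alpha,\gamma}(u)}{(x-\alpha u)^{\gamma}}\,du,\qquad x>0.$$ (It is known that such a density exists, and the equation together with $\int_0^\infty h_{\alpha,\gamma}(x)\,dx=1$ determines the law.) The law of a positive random variable $X$ is called a generalized Gamma convolution (GGC) if $X\stackrel{d}{=}\int_0^\infty a(t)\,d\mathbf{\Gamma}_t$, where $a:[0,\infty)\to[0,\infty)$ is a deterministic measurable function which is suitably integrable (so that the integral is a.s. finite, i.e. $\int_0^\infty\log(1+a(t))\,dt<\infty$), and $\{\mathbf{\Gamma}_t,\,t\ge0\}$ is the standard Gamma subordinator, i.e. the Lévy process with $\mathbb{E}[e^{-\lambda\mathbf{\Gamma}_t}]=(1+\lambda)^{-t}$ for $\lambda,t\ge0$. Equivalently, $X$ is infinitely divisible (without drift) with a Lévy measure on $(0,\infty)$ having a density $f$ such that $x\mapsto xf(x)$ is completely monotone on $(0,\infty)$. *)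

theory Defs
  imports "HOL-Probability.Probability"
begin

text \<open>
  The paths are required to have the stated properties for every outcome. Left limits need not be
  demanded: they exist because the paths are nondecreasing. Only times \<open>t \<ge> 0\<close> are meaningful.
\<close>

locale subordinator = prob_space M
  for M :: "'w measure" and X :: "real \<Rightarrow> 'w \<Rightarrow> real" +
  assumes measurable_X: "\<And>t. 0 \<le> t \<Longrightarrow> X t \<in> borel_measurable M"
    and start_zero: "\<And>\<omega>. \<omega> \<in> space M \<Longrightarrow> X 0 \<omega> = 0"
    and nondecreasing: "\<And>\<omega>. \<omega> \<in> space M \<Longrightarrow> mono_on {0..} (\<lambda>t. X t \<omega>)"
    and right_continuous:
      "\<And>\<omega> t. \<omega> \<in> space M \<Longrightarrow> 0 \<le> t \<Longrightarrow> continuous (at_right t) (\<lambda>s. X s \<omega>)"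
    and independent_increments:
      "\<And>(t :: nat \<Rightarrow> real) n. 0 \<le> t 0 \<Longrightarrow> mono t \<Longrightarrow>
        indep_vars (\<lambda>_. borel) (\<lambda>i \<omega>. X (t (Suc i)) \<omega> - X (t i) \<omega>) {..<n}"
    and stationary_increments:
      "\<And>s t. 0 \<le> s \<Longrightarrow> 0 \<le> t \<Longrightarrow>
        distr M borel (\<lambda>\<omega>. X (s + t) \<omega> - X s \<omega>) = distr M borel (X t)"

locale standard_gamma_subordinator = subordinator M G
  for M :: "'w measure" and G :: "real \<Rightarrow> 'w \<Rightarrow> real" +
  assumes laplace_transform:
    "\<And>u t. 0 \<le> u \<Longrightarrow> 0 \<le> t \<Longrightarrow> expectation (\<lambda>\<omega>. exp (- u * G t \<omega>)) = (1 + u) powr (- t)"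

text \<open>
  The integral of \<open>a\<close> over \<open>[0, \<infinity>)\<close> with respect to a nondecreasing path is the pathwise
  Lebesgue-Stieltjes integral. The path is extended by its value at \<open>0\<close> to negative times, so
  no mass is put on \<open>(-\<infinity>, 0]\<close>. The function \<open>enn2real\<close> maps an infinite integral to \<open>0\<close>.
\<close>

definition path_integral :: "(real \<Rightarrow> real) \<Rightarrow> (real \<Rightarrow> 'w \<Rightarrow> real) \<Rightarrow> 'w \<Rightarrow> real" where
  "path_integral a X \<omega> =
     enn2real (\<integral>\<^sup>+t\<in>{0..}. ennreal (a t) \<partial>interval_measure (\<lambda>s. X (max 0 s) \<omega>))"

text \<open>
  Only the law of the integral matters, and it does not depend on which standard Gamma subordinator
  is used; the type \<open>real \<Rightarrow> real\<close> of the outcomes is that of the canonical path space.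
\<close>

definition generalized_gamma_convolution :: "real measure \<Rightarrow> bool" where
  "generalized_gamma_convolution \<mu> \<longleftrightarrow>
     (AE x in \<mu>. 0 < x) \<and>
     (\<exists>a :: real \<Rightarrow> real.
        a \<in> borel_measurable (restrict_space borel {0..}) \<and>
        (\<forall>t\<ge>0. 0 \<le> a t) \<and>
        (\<integral>\<^sup>+t\<in>{0..}. ennreal (ln (1 + a t)) \<partial>lborel) < \<infinity> \<and>
        (\<exists>(M :: (real \<Rightarrow> real) measure) G.
           standard_gamma_subordinator M G \<and> \<mu> = distr M borel (path_integral a G)))"

text \<open>Only the values of \<open>h\<close> on \<open>(0, \<infinity>)\<close> are constrained.\<close>

definition alpha_sun_density :: "real \<Rightarrow> real \<Rightarrow> (real \<Rightarrow> real) \<Rightarrow> bool" where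
  "alpha_sun_density \<alpha> \<gamma> h \<longleftrightarrow>
     (\<forall>k. \<forall>x>0. (deriv ^^ k) h field_differentiable (at x)) \<and>
     (\<forall>x>0. 0 \<le> h x) \<and>
     (LINT x:{0<..}|lborel. h x) = 1 \<and>
     (\<forall>x>0. h x = \<gamma> / x * (LINT u:{0<..<x}|lborel. h u / (x - \<alpha> * u) powr \<gamma>))"

definition alpha_sun_variable :: "'a measure \<Rightarrow> real \<Rightarrow> real \<Rightarrow> ('a \<Rightarrow> real) \<Rightarrow> bool" where
  "alpha_sun_variable M \<alpha> \<gamma> X \<longleftrightarrow>
     (\<exists>h. alpha_sun_density \<alpha> \<gamma> h \<and>
          distributed M lborel X (\<lambda>x. ennreal (h x) * indicator {0<..} x))"

end

theory Submission
  imports Defs "HOL-Complex_Analysis.Complex_Analysis" "HOL-Real_Asymp.Real_Asymp"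
begin

text \<open>
  Let \<open>X\<close> have the \<open>\<alpha>\<close>-Sun law with density \<open>f\<close> and put \<open>G l = E (1 + l X)\<^sup>-\<^sup>k\<close>. Call \<open>\<psi>\<close> hyperbolically
  completely monotone of order two if \<open>\<psi> x * \<psi> y\<close> is a mixture of the functions
  \<open>exp (- p (x + y) - q x y)\<close> with \<open>p, q \<ge> 0\<close>. By Fubini, the equation of \<open>f\<close> gives
  \<open>\<integral> f \<psi> = \<gamma> \<integral> f T\<psi>\<close>, where \<open>T\<psi> u = \<integral>\<^bsub>x > u\<^esub> \<psi> x / (x (x - \<alpha> u)\<^sup>\<gamma>) dx\<close>, and \<open>T\<close> preserves this class.
  The iterates of \<open>T\<close> on \<open>(1 + l x)\<^sup>-\<^sup>k\<close> are tested against laws that concentrate, so \<open>G\<close> is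
  a limit of rescaled functions of the class, and \<open>G (u v) * G (u / v)\<close> is an alternating function of
  \<open>w = v + 1 / v \<ge> 2\<close>.

  As a function of \<open>w\<close> this product extends holomorphically to the plane cut along \<open>(-\<infinity>, -2]\<close>, and
  it equals \<open>|F (u e\<^sup>i\<^sup>\<eta>)|\<^sup>2\<close> at \<open>w = 2 cos \<eta>\<close>, where \<open>F\<close> is the analytic continuation of \<open>G\<close>. Its
  Taylor coefficients at \<open>3\<close> alternate in sign, so \<open>|F (u e\<^sup>i\<^sup>\<eta>)|\<close> increases with \<open>|\<eta>|\<close>. Hence \<open>F\<close> has
  no zeros, and on the line \<open>Im z = \<pi>\<close> the imaginary part of \<open>- log F (e\<^sup>\<beta>\<^sup>z)\<close> is nondecreasing.
  Cauchy's formula on the strip represents \<open>- ln (G (e\<^sup>\<beta>\<^sup>x))\<close> as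
  \<open>\<integral> K t / (1 + e\<^sup>t\<^sup>-\<^sup>x) dt\<close> with \<open>K \<ge> 0\<close> nondecreasing. With \<open>X / k\<close> for \<open>X\<close>, \<open>k \<longrightarrow> \<infinity>\<close> and \<open>\<beta> \<longrightarrow> 1\<close>,
  Helly's selection theorem gives the same representation of \<open>- ln (E exp (- e\<^sup>x X))\<close>. Slicing \<open>K\<close>
  horizontally turns it into \<open>\<integral> ln (1 + e\<^sup>x a t) dt\<close>, the Laplace exponent of the Gamma integral of \<open>a\<close>.
\<close>

section \<open>Hyperbolically completely monotone functions of order two\<close>

text \<open>A Laplace transform need not continue beyond the right half plane, whereas the modulus
  argument needs all of |arg z| < \<pi>. Hence the detour through E (1 + l X)^(-k), whose kernel is
  singular only on the negative axis; the Laplace transform returns because (1 + l X / k)^(-k) tends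
  to exp (- l X). The exponent \<beta> < 1 keeps the horizontal lines Im z = \<pi> and Im z = -\<pi>
  inside the domain of F (exp (\<beta> z)), so no boundary values on the cut enter Cauchy's formula.

  Two invariances of the product \<psi> (u v) * \<psi> (u / v) let the iterates of T be renormalised
  freely: a factor x^p in \<psi> contributes only the constant u^(2 p), and a dilation of the
  argument only changes u. In the limit it is not the mixing measure that is kept but only the sign
  of finite differences in w. These signs pass to pointwise limits without any compactness argument,
  and analyticity turns them back into signs of derivatives.\<close>

lemma ennreal_powr_minus_eq_nn_integral:
  fixes z g :: real
  assumes "0 < z" "0 < g"
  shows "ennreal (z powr (- g)) =
    (\<integral>\<^sup>+s. ennreal (indicator {0<..} s * (s powr (g - 1) / Gamma g * exp (- (s * z)))) \<partial>lborel)"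
proof -
  define C where "C = Gamma g"
  have G: "C > 0" using assms by (simp add: C_def Gamma_real_pos)
  have "ennreal C = (\<integral>\<^sup>+ t. ennreal (indicat_real {0..} t * t powr (g - 1) / exp t) \<partial>lborel)"
    unfolding C_def by (rule Gamma_conv_nn_integral_real) fact
  also have "\<dots> = ennreal \<bar>z\<bar> * (\<integral>\<^sup>+ t. ennreal (indicat_real {0..} (0 + z * t) * (0 + z * t) powr (g - 1) / exp (0 + z * t)) \<partial>lborel)"
    using assms by (subst nn_integral_real_affine[where c=z and t=0]) auto
  also have "\<dots> = (\<integral>\<^sup>+ t. ennreal z * ennreal (indicat_real {0..} (z * t) * (z * t) powr (g - 1) / exp (z * t)) \<partial>lborel)"
    using assms by (subst nn_integral_cmult) auto
  also have "\<dots> = (\<integral>\<^sup>+s. ennreal (C * z powr g) * ennreal (indicator {0<..} s * (s powr (g - 1) / C * exp (- (s * z)))) \<partial>lborel)"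
  proof (intro nn_integral_cong_AE)
    have "AE s in lborel. s \<noteq> (0::real)" by (rule AE_lborel_singleton)
    then show "AE t in lborel. ennreal z * ennreal (indicat_real {0..} (z * t) * (z * t) powr (g - 1) / exp (z * t)) =
      ennreal (C * z powr g) * ennreal (indicator {0<..} t * (t powr (g - 1) / C * exp (- (t * z))))"
    proof eventually_elim
      case (elim t)
      show ?case
      proof (cases "t > 0")
        case True
        have "z * ((z * t) powr (g - 1) / exp (z * t)) = (C * z powr g) * (t powr (g - 1) / C * exp (- (t * z)))"
          using True assms G by (simp add: powr_mult powr_diff exp_minus field_simps)
        then show ?thesis using True assms G by (simp flip: ennreal_mult')
      qed (use elim assms in \<open>auto simp: zero_le_mult_iff indicator_def\<close>)
    qed
  qed
  also have "\<dots> = ennreal (C * z powr g) * (\<integral>\<^sup>+s. ennreal (indicator {0<..} s * (s powr (g - 1) / C * exp (- (s * z)))) \<partial>lborel)"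
    by (rule nn_integral_cmult) auto
  finally have *: "ennreal (C) = ennreal (C * z powr g) * (\<integral>\<^sup>+s. ennreal (indicator {0<..} s * (s powr (g - 1) / C * exp (- (s * z)))) \<partial>lborel)" (is "_ = _ * ?I") .
  have "ennreal (z powr (- g)) = ennreal (z powr (- g) / C) * ennreal (C)"
    using assms G by (subst ennreal_mult'[symmetric]) auto
  also have "\<dots> = ennreal (z powr (- g) / C) * ennreal (C * z powr g) * ?I"
    by (subst *) (simp add: mult.assoc)
  also have "ennreal (z powr (- g) / C) * ennreal (C * z powr g) = 1"
    using assms G by (subst ennreal_mult'[symmetric]) (auto simp: powr_minus field_simps)
  finally show ?thesis by (simp add: C_def)
qed

lemma ennreal_inverse_eq_nn_integral:
  fixes z :: real
  assumes "0 < z"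
  shows "ennreal (1 / z) = (\<integral>\<^sup>+s. ennreal (indicator {0<..} s * exp (- (s * z))) \<partial>lborel)"
proof -
  have "ennreal (1 / z) = ennreal (z powr (- 1))" using assms by (simp add: powr_minus_divide)
  also have "\<dots> = (\<integral>\<^sup>+s. ennreal (indicator {0<..} s * (s powr (1 - 1) / Gamma 1 * exp (- (s * z)))) \<partial>lborel)"
    by (rule ennreal_powr_minus_eq_nn_integral) (use assms in auto)
  also have "\<dots> = (\<integral>\<^sup>+s. ennreal (indicator {0<..} s * exp (- (s * z))) \<partial>lborel)"
    by (intro nn_integral_cong) (auto simp: indicator_def)
  finally show ?thesis .
qed

text \<open>
  The exponent is normalised so that \<open>m\<close> has total mass \<open>(\<psi> 1)\<^sup>2\<close>.
\<close>

definition hcm2 :: "(real \<Rightarrow> ennreal) \<Rightarrow> bool" where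
  "hcm2 \<psi> \<longleftrightarrow> \<psi> \<in> borel_measurable borel \<and>
     (\<exists>m :: (real \<times> real) measure. finite_measure m \<and> sets m = sets (borel \<Otimes>\<^sub>M borel) \<and>
        (AE z in m. 0 \<le> fst z \<and> 0 \<le> snd z) \<and>
        (\<forall>x>0. \<forall>y>0. \<psi> x * \<psi> y =
           (\<integral>\<^sup>+z. ennreal (exp (2 * fst z + snd z - fst z * (x + y) - snd z * (x * y))) \<partial>m)))"

text \<open>An arbitrary mixing space with weight \<open>W\<close> is allowed, since the weighted
  measure can be pushed forward by \<open>(P, Q)\<close>. Its total mass is the product at x = y =
  1, so \<open>\<psi> 1 < \<infinity>\<close> is what makes the image measure finite.\<close>

lemma hcm2I:
  fixes \<psi> :: "real \<Rightarrow> ennreal" and N :: "'b measure" and W :: "'b \<Rightarrow> ennreal" and P Q :: "'b \<Rightarrow> real"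
  assumes [measurable]: "\<psi> \<in> borel_measurable borel" "W \<in> borel_measurable N"
    "P \<in> borel_measurable N" "Q \<in> borel_measurable N"
    and nn: "AE \<omega> in N. W \<omega> \<noteq> 0 \<longrightarrow> 0 \<le> P \<omega> \<and> 0 \<le> Q \<omega>"
    and fin: "\<psi> 1 < \<infinity>"
    and eq: "\<And>x y. 0 < x \<Longrightarrow> 0 < y \<Longrightarrow>
      \<psi> x * \<psi> y = (\<integral>\<^sup>+\<omega>. W \<omega> * ennreal (exp (- (P \<omega> * (x + y)) - Q \<omega> * (x * y))) \<partial>N)"
  shows "hcm2 \<psi>"
proof -
  define d where "d = density N (\<lambda>\<omega>. W \<omega> * ennreal (exp (- (P \<omega> * 2) - Q \<omega>)))"
  define m where "m = distr d (borel \<Otimes>\<^sub>M borel) (\<lambda>\<omega>. (P \<omega>, Q \<omega>))"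
  have [measurable]: "P \<in> borel_measurable d" "Q \<in> borel_measurable d" by (simp_all add: d_def)
  have "emeasure d (space d) = \<psi> 1 * \<psi> 1"
    unfolding d_def by (subst emeasure_density, simp, simp, subst eq) (auto intro!: nn_integral_cong)
  also have "\<dots> < \<infinity>" using fin by (simp add: ennreal_mult_less_top)
  finally have "finite_measure d" by (intro finite_measureI) auto
  then have "finite_measure m" unfolding m_def by (intro finite_measure.finite_measure_distr) auto
  moreover have "AE z in m. 0 \<le> fst z \<and> 0 \<le> snd z"
  proof -
    have "AE \<omega> in d. 0 \<le> P \<omega> \<and> 0 \<le> Q \<omega>"
      unfolding d_def by (subst AE_density, simp) (use nn in eventually_elim, auto)
    then show ?thesis unfolding m_def by (subst AE_distr_iff) auto
  qed
  moreover have "\<psi> x * \<psi> y = (\<integral>\<^sup>+z. ennreal (exp (2 * fst z + snd z - fst z * (x + y) - snd z * (x * y))) \<partial>m)"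
    if "0 < x" "0 < y" for x y
  proof -
    have [measurable]: "(\<lambda>z. ennreal (exp (2 * fst z + snd z - fst z * (x + y) - snd z * (x * y)))) \<in> borel_measurable (borel \<Otimes>\<^sub>M borel)"
      by measurable
    have "(\<integral>\<^sup>+z. ennreal (exp (2 * fst z + snd z - fst z * (x + y) - snd z * (x * y))) \<partial>m) =
      (\<integral>\<^sup>+\<omega>. ennreal (exp (2 * P \<omega> + Q \<omega> - P \<omega> * (x + y) - Q \<omega> * (x * y))) \<partial>d)"
      unfolding m_def by (subst nn_integral_distr) auto
    also have "\<dots> = (\<integral>\<^sup>+\<omega>. W \<omega> * ennreal (exp (- (P \<omega> * 2) - Q \<omega>)) * ennreal (exp (2 * P \<omega> + Q \<omega> - P \<omega> * (x + y) - Q \<omega> * (x * y))) \<partial>N)"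
      unfolding d_def by (subst nn_integral_density) auto
    also have "\<dots> = (\<integral>\<^sup>+\<omega>. W \<omega> * ennreal (exp (- (P \<omega> * (x + y)) - Q \<omega> * (x * y))) \<partial>N)"
      by (auto intro!: nn_integral_cong simp: mult.assoc algebra_simps simp flip: ennreal_mult' exp_add)
    finally show ?thesis using eq[OF that] by simp
  qed
  ultimately show ?thesis unfolding hcm2_def by (auto intro!: exI[of _ m] simp: m_def)
qed

text \<open>The factor 1 / (x y) is the integral of exp (- s x y) over s > 0, which merely adds
  \<open>s\<close> to the coefficient of x y in the exponent.\<close>

lemma hcm2_divide:
  assumes "hcm2 \<psi>" "\<psi> 1 < \<infinity>"
  shows "hcm2 (\<lambda>x. ennreal (1 / x) * \<psi> x)"
proof -
  from assms(1) obtain m :: "(real \<times> real) measure" where [measurable]: "\<psi> \<in> borel_measurable borel" and m: "finite_measure m"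
    and sm[measurable_cong]: "sets m = sets (borel \<Otimes>\<^sub>M borel)" and nn: "AE z in m. 0 \<le> fst z \<and> 0 \<le> snd z"
    and eq: "\<And>x y. 0 < x \<Longrightarrow> 0 < y \<Longrightarrow> \<psi> x * \<psi> y = (\<integral>\<^sup>+z. ennreal (exp (2 * fst z + snd z - fst z * (x + y) - snd z * (x * y))) \<partial>m)"
    unfolding hcm2_def by blast
  interpret finite_measure m by fact
  interpret P: pair_sigma_finite m "lborel :: real measure" ..
  show ?thesis
  proof (rule hcm2I[where N = "m \<Otimes>\<^sub>M lborel" and P = "\<lambda>(z, s). fst z" and Q = "\<lambda>(z, s). snd z + s"
        and W = "\<lambda>(z, s). ennreal (indicator {0<..} s * exp (2 * fst z + snd z))"])
    have nnp: "AE z in m \<Otimes>\<^sub>M (lborel :: real measure). 0 \<le> fst (fst z) \<and> 0 \<le> snd (fst z)"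
    proof (rule P.AE_pair_measure)
      show "{\<omega> \<in> space (m \<Otimes>\<^sub>M lborel). 0 \<le> fst (fst \<omega>) \<and> 0 \<le> snd (fst \<omega>)} \<in> sets (m \<Otimes>\<^sub>M (lborel :: real measure))"
        by measurable
    qed (use nn in auto)
    show "AE \<omega> in m \<Otimes>\<^sub>M lborel. (case \<omega> of (z, s) \<Rightarrow> ennreal (indicat_real {0<..} s * exp (2 * fst z + snd z))) \<noteq> 0 \<longrightarrow>
       0 \<le> (case \<omega> of (z, s) \<Rightarrow> fst z) \<and> 0 \<le> (case \<omega> of (z, s) \<Rightarrow> snd z + s)"
      using nnp by eventually_elim (auto simp: indicator_def split: if_splits)
    show "ennreal (1 / 1) * \<psi> 1 < \<infinity>" using assms(2) by simp
    fix x y :: real assume xy: "0 < x" "0 < y"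
    have "ennreal (1 / x) * \<psi> x * (ennreal (1 / y) * \<psi> y) = (\<psi> x * \<psi> y) * ennreal (1 / (x * y))"
      using xy by (simp add: ennreal_mult'[symmetric] ac_simps)
    also have "\<dots> = (\<integral>\<^sup>+z. ennreal (exp (2 * fst z + snd z - fst z * (x + y) - snd z * (x * y))) * ennreal (1 / (x * y)) \<partial>m)"
      by (subst eq[OF xy], subst nn_integral_multc) auto
    also have "\<dots> = (\<integral>\<^sup>+z. (\<integral>\<^sup>+s. ennreal (exp (2 * fst z + snd z - fst z * (x + y) - snd z * (x * y))) * ennreal (indicator {0<..} s * exp (- (s * (x * y)))) \<partial>lborel) \<partial>m)"
      using xy by (subst ennreal_inverse_eq_nn_integral, simp, subst nn_integral_cmult) auto
    also have "\<dots> = (\<integral>\<^sup>+z. (\<integral>\<^sup>+s. (case (z, s) of (z, s) \<Rightarrow> ennreal (indicat_real {0<..} s * exp (2 * fst z + snd z))) *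
           ennreal (exp (- ((case (z, s) of (z, s) \<Rightarrow> fst z) * (x + y)) - (case (z, s) of (z, s) \<Rightarrow> snd z + s) * (x * y))) \<partial>lborel) \<partial>m)"
      by (intro nn_integral_cong) (auto simp: indicator_def simp flip: ennreal_mult' exp_add intro!: arg_cong[where f=ennreal] simp: algebra_simps)
    also have "\<dots> = (\<integral>\<^sup>+\<omega>. (case \<omega> of (z, s) \<Rightarrow> ennreal (indicat_real {0<..} s * exp (2 * fst z + snd z))) *
           ennreal (exp (- ((case \<omega> of (z, s) \<Rightarrow> fst z) * (x + y)) - (case \<omega> of (z, s) \<Rightarrow> snd z + s) * (x * y))) \<partial>(m \<Otimes>\<^sub>M lborel))"
      by (rule lborel.nn_integral_fst) measurable
    finally show "ennreal (1 / x) * \<psi> x * (ennreal (1 / y) * \<psi> y) = \<dots>" .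
  qed measurable
qed

text \<open>Integrating out \<open>w\<close> leaves 1 / (B + E v), and the substitution v = B t then
  makes \<open>A\<close> and \<open>B\<close> occur only through their product. Below,
  \<open>A\<close> and \<open>B\<close> are affine in y and x, so the product is a polynomial in x +
  y and x y.\<close>

lemma nn_integral_exp_product:
  fixes A B E :: real
  assumes "0 < A" "0 < B" "0 \<le> E"
  shows "(\<integral>\<^sup>+v. \<integral>\<^sup>+w. ennreal (indicator {0<..} v * indicator {0<..} w * exp (- (v * A) - w * B - E * v * w)) \<partial>lborel \<partial>lborel) =
    (\<integral>\<^sup>+t. ennreal (indicator {0<..} t * (1 / (1 + E * t) * exp (- (t * (A * B))))) \<partial>lborel)"
proof -
  have "(\<integral>\<^sup>+w. ennreal (indicator {0<..} v * indicator {0<..} w * exp (- (v * A) - w * B - E * v * w)) \<partial>lborel) =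
     ennreal (indicator {0<..} v * exp (- (v * A)) / (B + E * v))" for v :: real
  proof (cases "v > 0")
    case True
    have "(\<integral>\<^sup>+w. ennreal (indicator {0<..} v * indicator {0<..} w * exp (- (v * A) - w * B - E * v * w)) \<partial>lborel) =
       (\<integral>\<^sup>+w. ennreal (exp (- (v * A))) * ennreal (indicator {0<..} w * exp (- (w * (B + E * v)))) \<partial>lborel)"
      using True by (intro nn_integral_cong) (auto simp: indicator_def simp flip: ennreal_mult' exp_add simp: algebra_simps)
    also have "\<dots> = ennreal (exp (- (v * A))) * ennreal (1 / (B + E * v))"
      using True assms by (subst nn_integral_cmult, simp, subst ennreal_inverse_eq_nn_integral) (auto intro!: add_pos_nonneg)
    finally show ?thesis using True by (simp flip: ennreal_mult')
  qed simp
  then have "(\<integral>\<^sup>+v. \<integral>\<^sup>+w. ennreal (indicator {0<..} v * indicator {0<..} w * exp (- (v * A) - w * B - E * v * w)) \<partial>lborel \<partial>lborel) =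
     (\<integral>\<^sup>+v. ennreal (indicator {0<..} v * exp (- (v * A)) / (B + E * v)) \<partial>lborel)" by simp
  also have "\<dots> = ennreal \<bar>B\<bar> * (\<integral>\<^sup>+t. ennreal (indicator {0<..} (0 + B * t) * exp (- ((0 + B * t) * A)) / (B + E * (0 + B * t))) \<partial>lborel)"
    using assms by (subst nn_integral_real_affine[where c=B and t=0]) auto
  also have "\<dots> = (\<integral>\<^sup>+t. ennreal B * ennreal (indicator {0<..} (B * t) * exp (- ((B * t) * A)) / (B + E * (B * t))) \<partial>lborel)"
    using assms by (subst nn_integral_cmult) auto
  also have "\<dots> = (\<integral>\<^sup>+t. ennreal (indicator {0<..} t * (1 / (1 + E * t) * exp (- (t * (A * B))))) \<partial>lborel)"
  proof (intro nn_integral_cong)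
    fix t :: real
    show "ennreal B * ennreal (indicator {0<..} (B * t) * exp (- ((B * t) * A)) / (B + E * (B * t))) =
      ennreal (indicator {0<..} t * (1 / (1 + E * t) * exp (- (t * (A * B)))))"
    proof (cases "t > 0")
      case True
      have "1 + E * t > 0" using True assms by (intro add_pos_nonneg) auto
      have "B * (exp (- ((B * t) * A)) / (B + E * (B * t))) = B * exp (- ((B * t) * A)) / (B * (1 + E * t))"
        by (simp add: algebra_simps)
      also have "\<dots> = 1 / (1 + E * t) * exp (- (t * (A * B)))"
        using assms \<open>1 + E * t > 0\<close> by (simp add: ac_simps)
      finally show ?thesis using True assms by (simp flip: ennreal_mult')
    qed (use assms in \<open>auto simp: indicator_def zero_less_mult_iff\<close>)
  qed
  finally show ?thesis .
qed

text \<open>After the Gamma integral for the two powers, with variable s, the exponent is bilinear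
  in the integration variables v and w: the coefficient of v is p + D y, that of w is p + D x and
  that of v w is E, where D = q + c s and E = q + s. By \<open>nn_integral_exp_product\<close> only
  exp (- t (p + D x) (p + D y)) is left, and (p + D x) (p + D y) = p^2 + p D (x + y) + D^2 x y has
  nonnegative coefficients. This is the closure property on which everything rests.\<close>

lemma hcm2_integral:
  fixes c g :: real
  assumes "hcm2 \<psi>" and c: "0 < c" and g: "0 < g"
    and fin: "(\<integral>\<^sup>+v. ennreal (indicator {0<..} v * (c * 1 + v) powr (- g)) * \<psi> (1 + v) \<partial>lborel) < \<infinity>"
  shows "hcm2 (\<lambda>x. \<integral>\<^sup>+v. ennreal (indicator {0<..} v * (c * x + v) powr (- g)) * \<psi> (x + v) \<partial>lborel)"
proof -
  define D where "D = (\<lambda>\<omega>::(real\<times>real)\<times>real. snd (fst \<omega>) + c * snd \<omega>)"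
  define E where "E = (\<lambda>\<omega>::(real\<times>real)\<times>real. snd (fst \<omega>) + snd \<omega>)"
  have [measurable]: "D \<in> borel_measurable ((borel \<Otimes>\<^sub>M borel) \<Otimes>\<^sub>M borel)" "E \<in> borel_measurable ((borel \<Otimes>\<^sub>M borel) \<Otimes>\<^sub>M borel)"
     unfolding D_def E_def by (measurable, measurable)
  from assms(1) obtain m :: "(real \<times> real) measure" where [measurable]: "\<psi> \<in> borel_measurable borel" and m: "finite_measure m"
    and sm[measurable_cong]: "sets m = sets (borel \<Otimes>\<^sub>M borel)" and nn: "AE z in m. 0 \<le> fst z \<and> 0 \<le> snd z"
    and eq: "\<And>x y. 0 < x \<Longrightarrow> 0 < y \<Longrightarrow> \<psi> x * \<psi> y = (\<integral>\<^sup>+z. ennreal (exp (2 * fst z + snd z - fst z * (x + y) - snd z * (x * y))) \<partial>m)"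
    unfolding hcm2_def by blast
  interpret finite_measure m by fact
  interpret P: pair_sigma_finite m "lborel :: real measure" ..
  define K where "K = m \<Otimes>\<^sub>M (lborel :: real measure)"
  have Ksf: "sigma_finite_measure K" unfolding K_def by (intro sigma_finite_pair_measure sigma_finite_measure_axioms lborel.sigma_finite_measure_axioms)
  interpret K: sigma_finite_measure K by fact
  interpret KP: pair_sigma_finite K "lborel :: real measure" ..
  interpret LK: pair_sigma_finite "lborel \<Otimes>\<^sub>M lborel :: (real \<times> real) measure" K
    by (intro pair_sigma_finite.intro Ksf sigma_finite_pair_measure lborel.sigma_finite_measure_axioms)
  have [measurable_cong]: "sets K = sets ((borel \<Otimes>\<^sub>M borel) \<Otimes>\<^sub>M borel)"
    unfolding K_def by (intro sets_pair_measure_cong) (simp_all add: sm)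
  define h where "h = (\<lambda>\<omega>::(real\<times>real)\<times>real. ennreal (indicator {0<..} (snd \<omega>) * (snd \<omega> powr (g - 1) / Gamma g) * exp (2 * fst (fst \<omega>) + snd (fst \<omega>))))"
  have [measurable]: "h \<in> borel_measurable ((borel \<Otimes>\<^sub>M borel) \<Otimes>\<^sub>M borel)" unfolding h_def by measurable
  have G: "Gamma g > 0" using g by (simp add: Gamma_real_pos)
  have key: "\<psi> X * \<psi> Y * ennreal ((X' * Y') powr (- g)) =
     (\<integral>\<^sup>+\<omega>. h \<omega> * ennreal (exp (- (fst (fst \<omega>) * (X + Y)) - snd (fst \<omega>) * (X * Y) - snd \<omega> * (X' * Y'))) \<partial>K)"
    if "0 < X" "0 < Y" "0 < X'" "0 < Y'" for X Y X' Y'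
  proof -
    have "\<psi> X * \<psi> Y * ennreal ((X' * Y') powr (- g)) =
      (\<integral>\<^sup>+z. ennreal (exp (2 * fst z + snd z - fst z * (X + Y) - snd z * (X * Y))) * ennreal ((X' * Y') powr (- g)) \<partial>m)"
      by (subst eq[OF that(1,2)], subst nn_integral_multc) auto
    also have "\<dots> = (\<integral>\<^sup>+z. (\<integral>\<^sup>+s. ennreal (exp (2 * fst z + snd z - fst z * (X + Y) - snd z * (X * Y))) *
       ennreal (indicator {0<..} s * (s powr (g - 1) / Gamma g * exp (- (s * (X' * Y'))))) \<partial>lborel) \<partial>m)"
      using that g by (subst ennreal_powr_minus_eq_nn_integral, simp, simp, subst nn_integral_cmult) auto
    also have "\<dots> = (\<integral>\<^sup>+z. (\<integral>\<^sup>+s. h (z, s) * ennreal (exp (- (fst (fst (z, s)) * (X + Y)) - snd (fst (z, s)) * (X * Y) - snd (z, s) * (X' * Y'))) \<partial>lborel) \<partial>m)"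
      using G by (intro nn_integral_cong) (auto simp: h_def indicator_def simp flip: ennreal_mult' exp_add intro!: arg_cong[where f=ennreal] simp: algebra_simps)
    also have "\<dots> = (\<integral>\<^sup>+\<omega>. h \<omega> * ennreal (exp (- (fst (fst \<omega>) * (X + Y)) - snd (fst \<omega>) * (X * Y) - snd \<omega> * (X' * Y'))) \<partial>K)"
      unfolding K_def by (rule lborel.nn_integral_fst) measurable
    finally show ?thesis .
  qed
  have nnK: "AE \<omega> in K. 0 \<le> fst (fst \<omega>) \<and> 0 \<le> snd (fst \<omega>)"
    unfolding K_def
  proof (rule P.AE_pair_measure)
    show "{\<omega> \<in> space (m \<Otimes>\<^sub>M lborel). 0 \<le> fst (fst \<omega>) \<and> 0 \<le> snd (fst \<omega>)} \<in> sets (m \<Otimes>\<^sub>M (lborel :: real measure))"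
      by measurable
  qed (use nn in auto)
  show ?thesis
  proof (rule hcm2I[where N = "K \<Otimes>\<^sub>M lborel"
        and P = "\<lambda>(\<omega>, t). fst (fst \<omega>) + t * fst (fst \<omega>) * D \<omega>"
        and Q = "\<lambda>(\<omega>, t). snd (fst \<omega>) + c\<^sup>2 * snd \<omega> + t * (D \<omega>)\<^sup>2"
        and W = "\<lambda>(\<omega>, t). h \<omega> * ennreal (indicator {0<..} t * (1 / (1 + E \<omega> * t)) * exp (- (t * (fst (fst \<omega>))\<^sup>2)))"])
    have "AE \<omega> in K \<Otimes>\<^sub>M (lborel :: real measure). 0 \<le> fst (fst (fst \<omega>)) \<and> 0 \<le> snd (fst (fst \<omega>))"
    proof (rule KP.AE_pair_measure)
      show "{\<omega> \<in> space (K \<Otimes>\<^sub>M lborel). 0 \<le> fst (fst (fst \<omega>)) \<and> 0 \<le> snd (fst (fst \<omega>))} \<in> sets (K \<Otimes>\<^sub>M (lborel :: real measure))"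
        unfolding K_def by measurable
    qed (use nnK in auto)
    then show "AE \<omega> in K \<Otimes>\<^sub>M lborel. (case \<omega> of (\<omega>, t) \<Rightarrow> h \<omega> * ennreal (indicator {0<..} t * (1 / (1 + E \<omega> * t)) * exp (- (t * (fst (fst \<omega>))\<^sup>2)))) \<noteq> 0 \<longrightarrow>
       0 \<le> (case \<omega> of (\<omega>, t) \<Rightarrow> fst (fst \<omega>) + t * fst (fst \<omega>) * D \<omega>) \<and>
       0 \<le> (case \<omega> of (\<omega>, t) \<Rightarrow> snd (fst \<omega>) + c\<^sup>2 * snd \<omega> + t * (D \<omega>)\<^sup>2)"
    proof eventually_elim
      case (elim w)
      show ?case
      proof (cases "snd (fst w) > 0 \<and> snd w > 0")
        case True
        then have "0 \<le> D (fst w)" using c elim by (auto simp: D_def)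
        then show ?thesis using True elim by (auto split: prod.splits)
      qed (auto simp: h_def indicator_def split: prod.splits)
    qed
    show "(\<integral>\<^sup>+v. ennreal (indicator {0<..} v * (c * 1 + v) powr (- g)) * \<psi> (1 + v) \<partial>lborel) < \<infinity>" by fact
    fix x y :: real assume xy: "0 < x" "0 < y"
    define f where "f = (\<lambda>(v::real) (w::real). ennreal (indicator {0<..} v * indicator {0<..} w))"
    define R where "R = (\<lambda>v w (\<omega>::(real\<times>real)\<times>real). exp (- (fst (fst \<omega>) * (x + v + (y + w))) - snd (fst \<omega>) * ((x + v) * (y + w)) - snd \<omega> * ((c * x + v) * (c * y + w))))"
    have "(\<integral>\<^sup>+v. ennreal (indicator {0<..} v * (c * x + v) powr (- g)) * \<psi> (x + v) \<partial>lborel) *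
      (\<integral>\<^sup>+w. ennreal (indicator {0<..} w * (c * y + w) powr (- g)) * \<psi> (y + w) \<partial>lborel) =
      (\<integral>\<^sup>+v. \<integral>\<^sup>+w. (ennreal (indicator {0<..} v * (c * x + v) powr (- g)) * \<psi> (x + v)) *
         (ennreal (indicator {0<..} w * (c * y + w) powr (- g)) * \<psi> (y + w)) \<partial>lborel \<partial>lborel)"
      by (subst nn_integral_multc[symmetric], simp, intro nn_integral_cong, subst nn_integral_cmult) auto
    also have "\<dots> = (\<integral>\<^sup>+v. \<integral>\<^sup>+w. f v w * (\<integral>\<^sup>+\<omega>. h \<omega> * ennreal (R v w \<omega>) \<partial>K) \<partial>lborel \<partial>lborel)"
    proof (intro nn_integral_cong)
      fix v w :: real
      show "(ennreal (indicator {0<..} v * (c * x + v) powr (- g)) * \<psi> (x + v)) *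
         (ennreal (indicator {0<..} w * (c * y + w) powr (- g)) * \<psi> (y + w)) = f v w * (\<integral>\<^sup>+\<omega>. h \<omega> * ennreal (R v w \<omega>) \<partial>K)"
      proof (cases "v > 0 \<and> w > 0")
        case True
        have pos: "0 < x + v" "0 < y + w" "0 < c * x + v" "0 < c * y + w"
          using True xy c by (auto intro!: add_pos_pos)
        have "(\<integral>\<^sup>+\<omega>. h \<omega> * ennreal (R v w \<omega>) \<partial>K) = \<psi> (x + v) * \<psi> (y + w) * ennreal (((c * x + v) * (c * y + w)) powr (- g))"
          unfolding R_def by (rule key[symmetric]) (use pos in auto)
        also have "ennreal (((c * x + v) * (c * y + w)) powr (- g)) = ennreal ((c * x + v) powr (- g)) * ennreal ((c * y + w) powr (- g))"
          using pos by (subst powr_mult) (auto simp flip: ennreal_mult')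
        finally show ?thesis using True by (simp add: f_def mult_ac)
      qed (auto simp: f_def indicator_def)
    qed
    also have "\<dots> = (\<integral>\<^sup>+v. \<integral>\<^sup>+w. (\<integral>\<^sup>+\<omega>. f v w * (h \<omega> * ennreal (R v w \<omega>)) \<partial>K) \<partial>lborel \<partial>lborel)"
      unfolding R_def by (subst nn_integral_cmult) auto
    also have "\<dots> = (\<integral>\<^sup>+v. \<integral>\<^sup>+w. (\<integral>\<^sup>+\<omega>. f (fst (v, w)) (snd (v, w)) * (h \<omega> * ennreal (R (fst (v, w)) (snd (v, w)) \<omega>)) \<partial>K) \<partial>lborel \<partial>lborel)"
      by simp
    also have "\<dots> = (\<integral>\<^sup>+z. (\<integral>\<^sup>+\<omega>. f (fst z) (snd z) * (h \<omega> * ennreal (R (fst z) (snd z) \<omega>)) \<partial>K) \<partial>(lborel \<Otimes>\<^sub>M lborel))"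
      unfolding R_def f_def by (rule lborel.nn_integral_fst) measurable
    also have "\<dots> = (\<integral>\<^sup>+\<omega>. (\<integral>\<^sup>+z. f (fst z) (snd z) * (h \<omega> * ennreal (R (fst z) (snd z) \<omega>)) \<partial>(lborel \<Otimes>\<^sub>M lborel)) \<partial>K)"
      unfolding R_def f_def by (rule LK.Fubini'[symmetric]) measurable
    also have "\<dots> = (\<integral>\<^sup>+\<omega>. (\<integral>\<^sup>+v. \<integral>\<^sup>+w. f v w * (h \<omega> * ennreal (R v w \<omega>)) \<partial>lborel \<partial>lborel) \<partial>K)"
      unfolding R_def f_def by (subst lborel.nn_integral_fst[symmetric]) (auto simp: )
    also have "\<dots> = (\<integral>\<^sup>+\<omega>. (\<integral>\<^sup>+t. (case (\<omega>, t) of (\<omega>, t) \<Rightarrow> h \<omega> * ennreal (indicator {0<..} t * (1 / (1 + E \<omega> * t)) * exp (- (t * (fst (fst \<omega>))\<^sup>2)))) *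
       ennreal (exp (- ((case (\<omega>, t) of (\<omega>, t) \<Rightarrow> fst (fst \<omega>) + t * fst (fst \<omega>) * D \<omega>) * (x + y)) -
          (case (\<omega>, t) of (\<omega>, t) \<Rightarrow> snd (fst \<omega>) + c\<^sup>2 * snd \<omega> + t * (D \<omega>)\<^sup>2) * (x * y))) \<partial>lborel) \<partial>K)"
      using nnK
    proof (intro nn_integral_cong_AE, eventually_elim)
      fix \<omega> :: "(real \<times> real) \<times> real"
      assume nn': "0 \<le> fst (fst \<omega>) \<and> 0 \<le> snd (fst \<omega>)"
      define p q s where "p = fst (fst \<omega>)" and "q = snd (fst \<omega>)" and "s = snd \<omega>"
      show "(\<integral>\<^sup>+v. \<integral>\<^sup>+w. f v w * (h \<omega> * ennreal (R v w \<omega>)) \<partial>lborel \<partial>lborel) = (\<integral>\<^sup>+t. (case (\<omega>, t) of (\<omega>, t) \<Rightarrow> h \<omega> * ennreal (indicator {0<..} t * (1 / (1 + E \<omega> * t)) * exp (- (t * (fst (fst \<omega>))\<^sup>2)))) *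
       ennreal (exp (- ((case (\<omega>, t) of (\<omega>, t) \<Rightarrow> fst (fst \<omega>) + t * fst (fst \<omega>) * D \<omega>) * (x + y)) -
          (case (\<omega>, t) of (\<omega>, t) \<Rightarrow> snd (fst \<omega>) + c\<^sup>2 * snd \<omega> + t * (D \<omega>)\<^sup>2) * (x * y))) \<partial>lborel)"
      \<comment> \<open>The weight \<open>h\<close> vanishes for s \<le> 0. For s > 0 the number D
        is positive even if p = q = 0, so both integrals over v and w converge.\<close>
      proof (cases "s > 0")
        case False
        then have "h \<omega> = 0" by (simp add: h_def s_def)
        then show ?thesis by simp
      next
        case True
        have pq: "0 \<le> p" "0 \<le> q" using nn' by (auto simp: p_def q_def)
        have Dp: "D \<omega> > 0" "E \<omega> \<ge> 0" using True pq c by (auto simp: D_def E_def p_def q_def s_def intro!: add_nonneg_pos)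
        define e where "e = exp (- (p * (x + y)) - (q + c\<^sup>2 * s) * (x * y))"
        have R: "R v w \<omega> = e * exp (- (v * (p + D \<omega> * y)) - w * (p + D \<omega> * x) - E \<omega> * v * w)" for v w
          unfolding R_def e_def D_def E_def p_def q_def s_def exp_add[symmetric]
          by (intro arg_cong[where f=exp]) (simp add: algebra_simps power2_eq_square)
        have e0: "0 \<le> e" by (simp add: e_def)
        have "(\<integral>\<^sup>+v. \<integral>\<^sup>+w. f v w * (h \<omega> * ennreal (R v w \<omega>)) \<partial>lborel \<partial>lborel) =
          (\<integral>\<^sup>+v. \<integral>\<^sup>+w. (h \<omega> * ennreal e) * ennreal (indicator {0<..} v * indicator {0<..} w * exp (- (v * (p + D \<omega> * y)) - w * (p + D \<omega> * x) - E \<omega> * v * w)) \<partial>lborel \<partial>lborel)"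
          unfolding R f_def using e0 by (intro nn_integral_cong) (simp add: ennreal_mult' mult_ac)
        also have "\<dots> = (h \<omega> * ennreal e) * (\<integral>\<^sup>+v. \<integral>\<^sup>+w. ennreal (indicator {0<..} v * indicator {0<..} w * exp (- (v * (p + D \<omega> * y)) - w * (p + D \<omega> * x) - E \<omega> * v * w)) \<partial>lborel \<partial>lborel)"
          by (simp add: nn_integral_cmult)
        also have "\<dots> = (h \<omega> * ennreal e) * (\<integral>\<^sup>+t. ennreal (indicator {0<..} t * (1 / (1 + E \<omega> * t) * exp (- (t * ((p + D \<omega> * y) * (p + D \<omega> * x)))))) \<partial>lborel)"
          using Dp pq xy by (subst nn_integral_exp_product) (auto intro!: add_nonneg_pos)
        also have "\<dots> = (\<integral>\<^sup>+t. (h \<omega> * ennreal e) * ennreal (indicator {0<..} t * (1 / (1 + E \<omega> * t) * exp (- (t * ((p + D \<omega> * y) * (p + D \<omega> * x)))))) \<partial>lborel)"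
          by (simp add: nn_integral_cmult)
        also have "\<dots> = (\<integral>\<^sup>+t. (h \<omega> * ennreal (indicator {0<..} t * (1 / (1 + E \<omega> * t)) * exp (- (t * p\<^sup>2)))) *
           ennreal (exp (- ((p + t * p * D \<omega>) * (x + y)) - (q + c\<^sup>2 * s + t * (D \<omega>)\<^sup>2) * (x * y))) \<partial>lborel)"
        proof (intro nn_integral_cong)
          fix t :: real
          have "e * exp (- (t * ((p + D \<omega> * y) * (p + D \<omega> * x)))) =
            exp (- (t * p\<^sup>2)) * exp (- ((p + t * p * D \<omega>) * (x + y)) - (q + c\<^sup>2 * s + t * (D \<omega>)\<^sup>2) * (x * y))"
            unfolding e_def exp_add[symmetric] by (intro arg_cong[where f=exp]) (simp add: algebra_simps power2_eq_square)
          then have "ennreal e * ennreal (indicator {0<..} t * (1 / (1 + E \<omega> * t) * exp (- (t * ((p + D \<omega> * y) * (p + D \<omega> * x)))))) =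
            ennreal (indicator {0<..} t * (1 / (1 + E \<omega> * t)) * exp (- (t * p\<^sup>2))) *
             ennreal (exp (- ((p + t * p * D \<omega>) * (x + y)) - (q + c\<^sup>2 * s + t * (D \<omega>)\<^sup>2) * (x * y)))"
            using e0 Dp by (auto simp flip: ennreal_mult' simp: indicator_def)
          then show "(h \<omega> * ennreal e) * ennreal (indicator {0<..} t * (1 / (1 + E \<omega> * t) * exp (- (t * ((p + D \<omega> * y) * (p + D \<omega> * x)))))) =
            (h \<omega> * ennreal (indicator {0<..} t * (1 / (1 + E \<omega> * t)) * exp (- (t * p\<^sup>2)))) *
           ennreal (exp (- ((p + t * p * D \<omega>) * (x + y)) - (q + c\<^sup>2 * s + t * (D \<omega>)\<^sup>2) * (x * y)))"
            by (simp add: mult.assoc)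
        qed
        finally show ?thesis by (simp add: p_def q_def s_def)
      qed
    qed
    also have "\<dots> = (\<integral>\<^sup>+\<omega>. (case \<omega> of (\<omega>, t) \<Rightarrow> h \<omega> * ennreal (indicator {0<..} t * (1 / (1 + E \<omega> * t)) * exp (- (t * (fst (fst \<omega>))\<^sup>2)))) *
       ennreal (exp (- ((case \<omega> of (\<omega>, t) \<Rightarrow> fst (fst \<omega>) + t * fst (fst \<omega>) * D \<omega>) * (x + y)) -
          (case \<omega> of (\<omega>, t) \<Rightarrow> snd (fst \<omega>) + c\<^sup>2 * snd \<omega> + t * (D \<omega>)\<^sup>2) * (x * y))) \<partial>(K \<Otimes>\<^sub>M lborel))"
      by (rule lborel.nn_integral_fst) measurable
    finally show "(\<integral>\<^sup>+v. ennreal (indicator {0<..} v * (c * x + v) powr (- g)) * \<psi> (x + v) \<partial>lborel) *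
      (\<integral>\<^sup>+w. ennreal (indicator {0<..} w * (c * y + w) powr (- g)) * \<psi> (y + w) \<partial>lborel) = \<dots>" .
  qed measurable
qed

section \<open>Alternating functions\<close>

fun mixed_difference :: "(real \<Rightarrow> real) \<Rightarrow> real list \<Rightarrow> real \<Rightarrow> real" where
  "mixed_difference f [] w = f w"
| "mixed_difference f (h # hs) w = mixed_difference f hs w - mixed_difference f hs (w + h)"

text \<open>Complete monotonicity on [2, \<infinity>) in difference form; the empty list gives
  nonnegativity. No differentiability is asked, so that the property is stable under pointwise
  limits.\<close>

definition alternating_differences :: "(real \<Rightarrow> real) \<Rightarrow> bool" where
  "alternating_differences f \<longleftrightarrow> (\<forall>hs w. (\<forall>h\<in>set hs. 0 < h) \<longrightarrow> 2 \<le> w \<longrightarrow> 0 \<le> mixed_difference f hs w)"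

lemma mixed_difference_limit:
  assumes "\<And>w. 2 \<le> w \<Longrightarrow> (\<lambda>n. f n w) \<longlonglongrightarrow> g w" "\<forall>h\<in>set hs. 0 < h" "2 \<le> w"
  shows "(\<lambda>n. mixed_difference (f n) hs w) \<longlonglongrightarrow> mixed_difference g hs w"
  using assms(2,3) by (induction hs arbitrary: w) (auto intro!: tendsto_diff assms(1))

lemma alternating_differences_limit:
  assumes "\<And>n. alternating_differences (f n)" "\<And>w. 2 \<le> w \<Longrightarrow> (\<lambda>n. f n w) \<longlonglongrightarrow> g w"
  shows "alternating_differences g"
  unfolding alternating_differences_def
proof (intro allI impI)
  fix hs :: "real list" and w :: real assume *: "\<forall>h\<in>set hs. 0 < h" "2 \<le> w"
  show "0 \<le> mixed_difference g hs w"
    by (rule LIMSEQ_le_const[OF mixed_difference_limit[OF assms(2) *]])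
       (use assms(1) * in \<open>auto simp: alternating_differences_def\<close>)
qed

text \<open>
  The larger solution \<open>v\<close> of \<open>v + 1 / v = w\<close>; the square root of a negative number is negative, and
  only \<open>w \<ge> 2\<close> matters.
\<close>

definition joukowski_inverse :: "real \<Rightarrow> real" where
  "joukowski_inverse w = (w + sqrt (w\<^sup>2 - 4)) / 2"

lemma joukowski_inverse:
  assumes "2 \<le> w"
  shows "0 < joukowski_inverse w" "joukowski_inverse w + 1 / joukowski_inverse w = w"
proof -
  have *: "2\<^sup>2 \<le> w\<^sup>2" using assms by (intro power_mono) auto
  then have s: "(sqrt (w\<^sup>2 - 4))\<^sup>2 = w\<^sup>2 - 4" by simp
  show p: "0 < joukowski_inverse w" using assms * by (auto simp: joukowski_inverse_def intro!: add_pos_nonneg)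
  have "joukowski_inverse w * joukowski_inverse w + 1 = w * joukowski_inverse w"
    using s by (simp add: joukowski_inverse_def field_simps power2_eq_square)
  then show "joukowski_inverse w + 1 / joukowski_inverse w = w" using p by (simp add: field_simps)
qed

text \<open>For x = u v and y = u / v one has x + y = u w and x y = u^2. The product is thus a
  mixture of exp (- p u w), and each difference with step h multiplies the integrand by 1 - exp (- p
  u h) \<ge> 0.\<close>

lemma alternating_differences_hcm2:
  fixes G :: "real \<Rightarrow> real" and u :: real
  assumes "hcm2 (\<lambda>x. ennreal (G x))" and G0: "\<And>x. 0 \<le> G x" and u: "0 < u"
  shows "alternating_differences (\<lambda>w. G (u * joukowski_inverse w) * G (u / joukowski_inverse w))"
proof -
  from assms(1) obtain m :: "(real \<times> real) measure" where "finite_measure m"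
    and sm[measurable_cong]: "sets m = sets (borel \<Otimes>\<^sub>M borel)" and nn: "AE z in m. 0 \<le> fst z \<and> 0 \<le> snd z"
    and eq: "\<And>x y. 0 < x \<Longrightarrow> 0 < y \<Longrightarrow> ennreal (G x) * ennreal (G y) =
      (\<integral>\<^sup>+z. ennreal (exp (2 * fst z + snd z - fst z * (x + y) - snd z * (x * y))) \<partial>m)"
    unfolding hcm2_def by blast
  define e where "e = (\<lambda>w (z :: real \<times> real). exp (2 * fst z + snd z - fst z * u * w - snd z * u\<^sup>2))"
  define f where "f = (\<lambda>w. G (u * joukowski_inverse w) * G (u / joukowski_inverse w))"
  have f: "has_bochner_integral m (e w) (f w)" if "2 \<le> w" for w
  proof (rule has_bochner_integral_nn_integral)
    note j = joukowski_inverse[OF that]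
    have s: "u * joukowski_inverse w + u / joukowski_inverse w = u * w"
      using arg_cong[OF j(2), of "\<lambda>x. u * x"] by (simp add: ring_distribs)
    have p: "(u * joukowski_inverse w) * (u / joukowski_inverse w) = u\<^sup>2"
      using j(1) by (simp add: power2_eq_square)
    show "(\<integral>\<^sup>+z. ennreal (e w z) \<partial>m) = ennreal (f w)"
      unfolding f_def e_def ennreal_mult'[OF G0] using j(1) u
      by (subst eq, simp, simp, subst s, subst p) (simp add: mult.assoc)
    show "e w \<in> borel_measurable m" unfolding e_def by measurable
  qed (auto simp: f_def e_def G0)
  have D: "has_bochner_integral m (\<lambda>z. e w z * (\<Prod>h\<leftarrow>hs. 1 - exp (- (fst z * u * h)))) (mixed_difference f hs w)"
    if "\<forall>h\<in>set hs. 0 < h" "2 \<le> w" for hs w using that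
  proof (induction hs arbitrary: w)
    case Nil
    then show ?case using f by simp
  next
    case (Cons h hs)
    have "has_bochner_integral m (\<lambda>z. e w z * (\<Prod>h\<leftarrow>hs. 1 - exp (- (fst z * u * h))) - e (w + h) z * (\<Prod>h\<leftarrow>hs. 1 - exp (- (fst z * u * h))))
      (mixed_difference f hs w - mixed_difference f hs (w + h))"
      using Cons by (intro has_bochner_integral_diff Cons.IH) auto
    moreover have "e (w + h) z = e w z * exp (- (fst z * u * h))" for z
      unfolding e_def exp_add[symmetric] by (intro arg_cong[where f=exp]) (simp add: algebra_simps)
    ultimately show ?case by (simp add: algebra_simps)
  qed
  have "0 \<le> mixed_difference f hs w" if "\<forall>h\<in>set hs. 0 < h" "2 \<le> w" for hs w
  proof -
    have "mixed_difference f hs w = (\<integral>z. e w z * (\<Prod>h\<leftarrow>hs. 1 - exp (- (fst z * u * h))) \<partial>m)"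
      using D[OF that] by (simp add: has_bochner_integral_iff)
    moreover have "0 \<le> \<dots>"
    proof (rule integral_nonneg_AE, use nn in eventually_elim)
      case (elim z)
      have "0 \<le> (\<Prod>h\<leftarrow>hs. 1 - exp (- (fst z * u * h)))"
        using that(1) elim u by (intro prod_list_nonneg) auto
      then show ?case by (simp add: e_def)
    qed
    ultimately show ?thesis by simp
  qed
  then show ?thesis unfolding alternating_differences_def f_def by blast
qed

lemma mixed_difference_cong:
  assumes "\<And>w. 2 \<le> w \<Longrightarrow> f w = g w" "\<forall>h\<in>set hs. 0 < h" "2 \<le> w"
  shows "mixed_difference f hs w = mixed_difference g hs w"
  using assms(2,3) by (induction hs arbitrary: w) (auto simp: assms(1))

lemma alternating_differences_cong:
  assumes "\<And>w. 2 \<le> w \<Longrightarrow> f w = g w"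
  shows "alternating_differences f \<longleftrightarrow> alternating_differences g"
  unfolding alternating_differences_def using mixed_difference_cong[of f g, OF assms] by fastforce

lemma mixed_difference_cmult: "mixed_difference (\<lambda>w. c * f w) hs w = c * mixed_difference f hs w"
  by (induction hs arbitrary: w) (auto simp: algebra_simps)

lemma alternating_differences_cmult:
  "alternating_differences f \<Longrightarrow> 0 \<le> c \<Longrightarrow> alternating_differences (\<lambda>w. c * f w)"
  by (simp add: alternating_differences_def mixed_difference_cmult)

text \<open>The Gamma integral of ((1 + x) (1 + y))^(-k) has the exponent t (1 + x) (1 + y) = t + t
  (x + y) + t x y, so \<open>P\<close> and \<open>Q\<close> are both the integration
  variable.\<close>

lemma hcm2_base:
  assumes "0 < (k::real)"
  shows "hcm2 (\<lambda>x. ennreal (indicator {0<..} x * (1 + x) powr (- k)))"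
proof (rule hcm2I[where N = lborel and P = "\<lambda>t. t" and Q = "\<lambda>t. t" and
     W = "\<lambda>t. ennreal (indicator {0<..} t * (t powr (k - 1) / Gamma k * exp (- t)))"])
  fix x y :: real assume xy: "0 < x" "0 < y"
  have p: "0 < (1 + x) * (1 + y)" using xy by (auto intro!: mult_pos_pos)
  have "ennreal (indicator {0<..} x * (1 + x) powr (- k)) * ennreal (indicator {0<..} y * (1 + y) powr (- k)) = ennreal (((1 + x) * (1 + y)) powr (- k))"
    using xy by (simp add: powr_mult ennreal_mult')
  also have "\<dots> = (\<integral>\<^sup>+s. ennreal (indicator {0<..} s * (s powr (k - 1) / Gamma k * exp (- (s * ((1 + x) * (1 + y)))))) \<partial>lborel)"
    by (rule ennreal_powr_minus_eq_nn_integral) (use p assms in auto)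
  also have "\<dots> = (\<integral>\<^sup>+t. ennreal (indicator {0<..} t * (t powr (k - 1) / Gamma k * exp (- t))) * ennreal (exp (- (t * (x + y)) - t * (x * y))) \<partial>lborel)"
    by (intro nn_integral_cong)
       (auto simp: indicator_def simp flip: ennreal_mult'' exp_add intro!: arg_cong[where f=ennreal] simp: algebra_simps)
  finally show "ennreal (indicator {0<..} x * (1 + x) powr (- k)) * ennreal (indicator {0<..} y * (1 + y) powr (- k)) = \<dots>" .
qed (auto simp: indicator_def)

section \<open>Iterating the Sun equation\<close>

lemma has_bochner_integral_le:
  fixes f g :: "'a \<Rightarrow> real"
  assumes "has_bochner_integral M f x" "has_bochner_integral M g y" "\<And>z. f z \<le> g z"
  shows "x \<le> y"
  using assms by (metis has_bochner_integral_integrable has_bochner_integral_integral_eq integrable.intros integral_mono)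

text \<open>
  After the substitution \<open>x = u y\<close>, the operator \<open>T\<close> maps \<open>u powr (- k) * \<phi> u\<close> to
  \<open>u powr (- (k + g)) * sun_op a g k \<phi> u\<close>; splitting off the power keeps the iterates bounded.
\<close>

definition sun_kernel :: "real \<Rightarrow> real \<Rightarrow> real \<Rightarrow> real \<Rightarrow> real" where
  "sun_kernel a g k y = indicator {1<..} y * (y powr (- 1 - k) * (y - a) powr (- g))"

lemma sun_kernel_nonneg [simp]: "0 \<le> sun_kernel a g k y"
  by (simp add: sun_kernel_def)

lemma sun_kernel_measurable [measurable]: "sun_kernel a g k \<in> borel_measurable borel"
  unfolding sun_kernel_def by measurable

definition sun_op :: "real \<Rightarrow> real \<Rightarrow> real \<Rightarrow> (real \<Rightarrow> ennreal) \<Rightarrow> real \<Rightarrow> ennreal" where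
  "sun_op a g k \<phi> u = (\<integral>\<^sup>+y. ennreal (sun_kernel a g k y) * \<phi> (u * y) \<partial>lborel)"

lemma sun_op_measurable [measurable]:
  assumes [measurable]: "\<phi> \<in> borel_measurable borel"
  shows "sun_op a g k \<phi> \<in> borel_measurable borel"
  unfolding sun_op_def by measurable

text \<open>The kernel exponent \<open>g * n\<close> in the step after the n-th is the power of u
  split off so far: every application of the operator lowers it by \<open>g\<close>.\<close>

primrec sun_iter :: "real \<Rightarrow> real \<Rightarrow> (real \<Rightarrow> ennreal) \<Rightarrow> nat \<Rightarrow> real \<Rightarrow> ennreal" where
  "sun_iter a g \<phi> 0 = \<phi>"
| "sun_iter a g \<phi> (Suc n) = sun_op a g (g * n) (sun_iter a g \<phi> n)"

lemma sun_iter_measurable [measurable]: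
  "\<phi> \<in> borel_measurable borel \<Longrightarrow> sun_iter a g \<phi> n \<in> borel_measurable borel"
  by (induction n) auto

lemma sun_iter_scale: "sun_iter a g (\<lambda>x. \<phi> (l * x)) n u = sun_iter a g \<phi> n (l * u)"
  by (induction n arbitrary: u) (auto simp: sun_op_def mult.assoc)

definition sun_mass :: "real \<Rightarrow> real \<Rightarrow> real \<Rightarrow> real" where
  "sun_mass a g k = enn2real (\<integral>\<^sup>+y. ennreal (sun_kernel a g k y) \<partial>lborel)"

lemma sun_mass_nonneg: "0 \<le> sun_mass a g k"
  by (simp add: sun_mass_def)

lemma nn_integral_powr_Ioi:
  fixes p :: real
  assumes "0 < p"
  shows "(\<integral>\<^sup>+y. ennreal (indicator {1<..} y * y powr (- 1 - p)) \<partial>lborel) = ennreal (1 / p)"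
proof -
  have "(\<integral>\<^sup>+y. ennreal (indicator {1<..} y * y powr (- 1 - p)) \<partial>lborel) =
     (\<integral>\<^sup>+y. ennreal (y powr (- 1 - p)) * indicator {1..} y \<partial>lborel)"
  proof (intro nn_integral_cong_AE)
    have "AE y in lborel. y \<noteq> (1::real)" by (rule AE_lborel_singleton)
    then show "AE y in lborel. ennreal (indicator {1<..} y * y powr (- 1 - p)) = ennreal (y powr (- 1 - p)) * indicator {1..} y"
      by eventually_elim (auto simp: indicator_def)
  qed
  also have "\<dots> = ennreal (0 - (- (1 powr (- p)) / p))"
  proof (rule nn_integral_FTC_atLeast)
    show "((\<lambda>y. - (y powr (- p)) / p) \<longlongrightarrow> 0) at_top"
      using assms by real_asymp
    fix y :: real assume "1 \<le> y"
    then show "DERIV (\<lambda>y. - (y powr (- p)) / p) y :> y powr (- 1 - p)"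
      using assms by (auto intro!: derivative_eq_intros simp: powr_diff powr_minus field_simps)
  qed auto
  finally show ?thesis by simp
qed

locale sun_params =
  fixes a g :: real
  assumes a: "0 < a" "a < 1" and g: "0 < g"
begin

text \<open>For y > 1 one has (1 - a) y \<le> y - a \<le> y. So the kernel lies between y^(-1-k-g)
  and a constant multiple of it, and its mass is of exact order 1 / (k + g).\<close>

lemma kernel_le: "sun_kernel a g k y \<le> (1 - a) powr (- g) * (indicator {1<..} y * y powr (- 1 - (k + g)))"
proof (cases "y > 1")
  case True
  have "(y - a) powr (- g) \<le> ((1 - a) * y) powr (- g)"
  proof (rule powr_mono2')
    show "(1 - a) * y \<le> y - a" using True a by (simp add: algebra_simps)
  qed (use True a g in auto)
  also have "\<dots> = (1 - a) powr (- g) * y powr (- g)" using True a by (simp add: powr_mult)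
  finally have "y powr (- 1 - k) * (y - a) powr (- g) \<le> y powr (- 1 - k) * ((1 - a) powr (- g) * y powr (- g))"
    by (intro mult_left_mono) auto
  also have "\<dots> = (1 - a) powr (- g) * y powr (- 1 - (k + g))" using True
    by (simp add: powr_add[symmetric] algebra_simps)
  finally show ?thesis using True by (simp add: sun_kernel_def)
qed (simp add: sun_kernel_def)

lemma kernel_ge: "indicator {1<..} y * y powr (- 1 - (k + g)) \<le> sun_kernel a g k y"
proof (cases "y > 1")
  case True
  have "y powr (- g) \<le> (y - a) powr (- g)"
    by (rule powr_mono2') (use True a g in auto)
  then have "y powr (- 1 - k) * y powr (- g) \<le> y powr (- 1 - k) * (y - a) powr (- g)"
    by (intro mult_left_mono) auto
  also have "y powr (- 1 - k) * y powr (- g) = y powr (- 1 - (k + g))" using True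
    by (simp add: powr_add[symmetric] algebra_simps)
  finally show ?thesis using True by (simp add: sun_kernel_def)
qed (simp add: sun_kernel_def)

lemma nn_integral_kernel_le:
  assumes "0 \<le> k"
  shows "(\<integral>\<^sup>+y. ennreal (sun_kernel a g k y) \<partial>lborel) \<le> ennreal ((1 - a) powr (- g) / (k + g))"
proof -
  have "(\<integral>\<^sup>+y. ennreal (sun_kernel a g k y) \<partial>lborel) \<le>
     (\<integral>\<^sup>+y. ennreal ((1 - a) powr (- g)) * ennreal (indicator {1<..} y * y powr (- 1 - (k + g))) \<partial>lborel)"
    by (intro nn_integral_mono) (simp add: kernel_le flip: ennreal_mult')
  also have "\<dots> = ennreal ((1 - a) powr (- g)) * ennreal (1 / (k + g))"
    using assms g by (subst nn_integral_cmult, simp, subst nn_integral_powr_Ioi) auto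
  finally show ?thesis by (simp flip: ennreal_mult')
qed

lemma nn_integral_kernel:
  assumes "0 \<le> k"
  shows "(\<integral>\<^sup>+y. ennreal (sun_kernel a g k y) \<partial>lborel) = ennreal (sun_mass a g k)"
proof -
  have "(\<integral>\<^sup>+y. ennreal (sun_kernel a g k y) \<partial>lborel) < \<infinity>"
    using nn_integral_kernel_le[OF assms] by (rule le_less_trans) simp
  then show ?thesis by (simp add: sun_mass_def)
qed

lemma sun_mass_le: "0 \<le> k \<Longrightarrow> sun_mass a g k \<le> (1 - a) powr (- g) / (k + g)"
  using nn_integral_kernel_le[of k] g by (simp add: nn_integral_kernel)

lemma sun_mass_ge:
  assumes "0 \<le> k"
  shows "1 / (k + g) \<le> sun_mass a g k"
proof -
  have "ennreal (1 / (k + g)) = (\<integral>\<^sup>+y. ennreal (indicator {1<..} y * y powr (- 1 - (k + g))) \<partial>lborel)"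
    using assms g by (subst nn_integral_powr_Ioi) auto
  also have "\<dots> \<le> (\<integral>\<^sup>+y. ennreal (sun_kernel a g k y) \<partial>lborel)"
    by (intro nn_integral_mono ennreal_leI kernel_ge)
  finally show ?thesis using assms by (simp add: nn_integral_kernel sun_mass_nonneg)
qed

lemma sun_mass_pos: "0 \<le> k \<Longrightarrow> 0 < sun_mass a g k"
  using less_le_trans[OF _ sun_mass_ge[of k], of 0] g by simp

lemma has_bochner_integral_kernel:
  assumes "0 \<le> k" shows "has_bochner_integral lborel (sun_kernel a g k) (sun_mass a g k)"
  by (rule has_bochner_integral_nn_integral[OF _ _ sun_mass_nonneg nn_integral_kernel[OF assms]]) simp_all

text \<open>The kernels for k and k + g differ by the factor 1 - y^(-g). Comparing after this factor
  is extracted gives 1 / (k + g) - 1 / (k + 2 g), which is of order k^(-2); bounding the two masses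
  separately would only give order 1 / k.\<close>

lemma sun_mass_diff:
  assumes "0 \<le> k"
  shows "sun_mass a g k - sun_mass a g (k + g) \<le> (1 - a) powr (- g) * (g / ((k + g) * (k + 2 * g)))"
proof -
  let ?p = "\<lambda>k (y::real). indicator {1<..} y * y powr (- 1 - k)"
  have P: "has_bochner_integral lborel (?p p) (1 / p)" if "0 < p" for p
    by (rule has_bochner_integral_nn_integral) (use that nn_integral_powr_Ioi in auto)
  have "has_bochner_integral lborel (\<lambda>y. sun_kernel a g k y - sun_kernel a g (k + g) y) (sun_mass a g k - sun_mass a g (k + g))"
    using assms g by (intro has_bochner_integral_diff has_bochner_integral_kernel) auto
  moreover have "has_bochner_integral lborel (\<lambda>y. (1 - a) powr (- g) * (?p (k + g) y - ?p (k + 2 * g) y)) ((1 - a) powr (- g) * (1 / (k + g) - 1 / (k + 2 * g)))"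
    using assms g by (intro has_bochner_integral_mult_right has_bochner_integral_diff P) auto
  moreover have le: "sun_kernel a g k y - sun_kernel a g (k + g) y \<le> (1 - a) powr (- g) * (?p (k + g) y - ?p (k + 2 * g) y)" for y
    proof (cases "y > 1")
      case True
      have 1: "sun_kernel a g k y - sun_kernel a g (k + g) y = (1 - y powr (- g)) * sun_kernel a g k y"
        using True by (simp add: sun_kernel_def algebra_simps powr_add[symmetric])
      have "y powr (- g) \<le> y powr 0" using True g by (intro powr_mono) auto
      then have "(1 - y powr (- g)) * sun_kernel a g k y \<le> (1 - y powr (- g)) * ((1 - a) powr (- g) * (?p (k + g) y))"
        using True kernel_le[of k y] by (intro mult_left_mono) auto
      also have "\<dots> = (1 - a) powr (- g) * (?p (k + g) y - ?p (k + 2 * g) y)"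
        using True by (simp add: algebra_simps powr_add[symmetric])
      finally show ?thesis using 1 by simp
    qed (simp add: sun_kernel_def)
  ultimately have "sun_mass a g k - sun_mass a g (k + g) \<le> (1 - a) powr (- g) * (1 / (k + g) - 1 / (k + 2 * g))"
    by (rule has_bochner_integral_le)
  also have "1 / (k + g) - 1 / (k + 2 * g) = g / ((k + g) * (k + 2 * g))"
    using assms g by (simp add: field_simps)
  finally show ?thesis .
qed

text \<open>The left-hand side will turn out to be the variance of \<open>u powr (- g)\<close> under
  the n-th biased law, divided by its squared mean. Its decay like 1 / n is the source of
  concentration.\<close>

lemma sun_mass_ratio:
  "sun_mass a g (g * n) / sun_mass a g (g * Suc n) - 1 \<le> (1 - a) powr (- g) / (real n + 1)"
proof -
  define k where "k = g * real n"
  have k: "0 \<le> k" using g by (simp add: k_def)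
  have k1: "g * Suc n = k + g" by (simp add: k_def algebra_simps)
  define J where "J = sun_mass a g (k + g)"
  have J: "1 / (k + 2 * g) \<le> J" using sun_mass_ge[of "k + g"] k g by (simp add: J_def add.assoc)
  have p: "0 < 1 / (k + 2 * g)" using k g by simp
  have J0: "J > 0" using J p by linarith
  then have "sun_mass a g k / J - 1 = (sun_mass a g k - J) / J" by (simp add: diff_divide_distrib)
  also have "\<dots> \<le> ((1 - a) powr (- g) * (g / ((k + g) * (k + 2 * g)))) / J"
    using sun_mass_diff[OF k] J0 unfolding J_def by (intro divide_right_mono) simp_all
  also have "\<dots> \<le> ((1 - a) powr (- g) * (g / ((k + g) * (k + 2 * g)))) / (1 / (k + 2 * g))"
  proof (rule divide_left_mono)
    show "0 < J * (1 / (k + 2 * g))" using J0 p by (rule mult_pos_pos)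
    show "0 \<le> (1 - a) powr (- g) * (g / ((k + g) * (k + 2 * g)))" using k g by simp
  qed (rule J)
  also have "\<dots> = (1 - a) powr (- g) * (g / (k + g))"
  proof -
    have "k + 2 * g \<noteq> 0" "k + g \<noteq> 0" using k g by auto
    then show ?thesis by simp
  qed
  also have "g / (k + g) = 1 / (real n + 1)"
  proof -
    have "k + g = g * (real n + 1)" by (simp add: k_def algebra_simps)
    then show ?thesis using g by simp
  qed
  finally show ?thesis unfolding J_def k1[symmetric] by (simp only: k_def) simp
qed

definition sun_norm :: "nat \<Rightarrow> real" where "sun_norm n = (\<Prod>i<n. sun_mass a g (g * real (i::nat)))"

lemma sun_norm_pos: "0 < sun_norm n"
  unfolding sun_norm_def using g by (intro prod_pos) (auto intro!: sun_mass_pos)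

lemma sun_iter_const: "sun_iter a g (\<lambda>_. 1) n u = ennreal (sun_norm n)"
proof (induction n arbitrary: u)
  case (Suc n)
  have "sun_iter a g (\<lambda>_. 1) (Suc n) u = ennreal (sun_mass a g (g * n)) * ennreal (sun_norm n)"
    using g by (simp add: sun_op_def Suc nn_integral_multc nn_integral_kernel)
  then show ?case using sun_mass_pos[of "g * n"] g by (simp add: sun_norm_def ennreal_mult' mult.commute)
qed (simp add: sun_norm_def)

lemma sun_iter_mono: "(\<And>x. 0 < x \<Longrightarrow> \<phi> x \<le> \<psi> x) \<Longrightarrow> 0 < u \<Longrightarrow> sun_iter a g \<phi> n u \<le> sun_iter a g \<psi> n u"
proof (induction n arbitrary: u)
  case (Suc n)
  show ?case unfolding sun_iter.simps sun_op_def
  proof (intro nn_integral_mono)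
    fix y show "ennreal (sun_kernel a g (g * n) y) * sun_iter a g \<phi> n (u * y) \<le> ennreal (sun_kernel a g (g * n) y) * sun_iter a g \<psi> n (u * y)"
      using Suc by (cases "y > 1") (auto simp: sun_kernel_def intro!: mult_left_mono)
  qed
qed auto

text \<open>By \<open>sun_iter_scale\<close> a change of the argument is a dilation of the function,
  so monotonicity in the argument reduces to monotonicity in the function at the point 1.\<close>

lemma sun_iter_antimono:
  assumes "\<And>x y. 0 < x \<Longrightarrow> x \<le> y \<Longrightarrow> \<phi> y \<le> \<phi> x" "0 < u" "u \<le> v"
  shows "sun_iter a g \<phi> n v \<le> sun_iter a g \<phi> n u"
proof -
  have "sun_iter a g \<phi> n v = sun_iter a g (\<lambda>x. \<phi> (v * x)) n 1" by (simp add: sun_iter_scale)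
  also have "\<dots> \<le> sun_iter a g (\<lambda>x. \<phi> (u * x)) n 1"
    using assms by (intro sun_iter_mono) (auto intro!: assms(1))
  also have "\<dots> = sun_iter a g \<phi> n u" by (simp add: sun_iter_scale)
  finally show ?thesis .
qed

lemma hcm2_cong:
  assumes "hcm2 \<psi>" "\<psi>' \<in> borel_measurable borel" "\<And>x. 0 < x \<Longrightarrow> \<psi>' x = \<psi> x"
  shows "hcm2 \<psi>'"
proof -
  from assms(1) obtain m :: "(real \<times> real) measure" where "finite_measure m" "sets m = sets (borel \<Otimes>\<^sub>M borel)"
    "AE z in m. 0 \<le> fst z \<and> 0 \<le> snd z"
    "\<forall>x>0. \<forall>y>0. \<psi> x * \<psi> y = (\<integral>\<^sup>+z. ennreal (exp (2 * fst z + snd z - fst z * (x + y) - snd z * (x * y))) \<partial>m)"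
    unfolding hcm2_def by blast
  then show ?thesis unfolding hcm2_def using assms(2,3) by (intro conjI exI[of _ m]) simp_all
qed

text \<open>With x = u + v the factor x - a u of the Sun kernel becomes (1 - a) u + v. So each step
  is a division by the argument followed by the integral of \<open>hcm2_integral\<close> with c = 1
  - a; the substitution v = u (y - 1) matches it with \<open>sun_op\<close>. The bound by 1 keeps
  the values at 1 finite throughout.\<close>

lemma hcm2_sun_iter:
  assumes "hcm2 \<phi>" "\<And>x. 0 < x \<Longrightarrow> \<phi> x \<le> 1"
  shows "hcm2 (\<lambda>u. ennreal (u powr (- (g * n))) * sun_iter a g \<phi> n u)"
proof (induction n)
  case 0
  show ?case using assms(1)
    by (rule hcm2_cong) (use assms(1) in \<open>auto simp: hcm2_def\<close>)
next
  case (Suc n)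
  define \<psi> where "\<psi> = (\<lambda>u. ennreal (u powr (- (g * n))) * sun_iter a g \<phi> n u)"
  have [measurable]: "\<phi> \<in> borel_measurable borel" using assms(1) by (simp add: hcm2_def)
  have [measurable]: "\<psi> \<in> borel_measurable borel" unfolding \<psi>_def by measurable
  have bd: "sun_iter a g \<phi> n u \<le> ennreal (sun_norm n)" if "0 < u" for u n
    using sun_iter_mono[of \<phi> "\<lambda>_. 1" u n] assms(2) that by (simp add: sun_iter_const)
  have \<psi>1: "\<psi> 1 < \<infinity>" using le_less_trans[OF bd[of 1 n]] unfolding \<psi>_def by simp
  have eq: "(\<integral>\<^sup>+v. ennreal (indicator {0<..} v * ((1 - a) * x + v) powr (- g)) * (ennreal (1 / (x + v)) * \<psi> (x + v)) \<partial>lborel) =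
    ennreal (x powr (- (g * Suc n))) * sun_iter a g \<phi> (Suc n) x" if x: "0 < x" for x
  proof -
    define q where "q = (\<lambda>v. ennreal (indicator {0<..} v * ((1 - a) * x + v) powr (- g)) * (ennreal (1 / (x + v)) * \<psi> (x + v)))"
    have [measurable]: "q \<in> borel_measurable borel" unfolding q_def by measurable
    have "(\<integral>\<^sup>+v. q v \<partial>lborel) = ennreal \<bar>x\<bar> * (\<integral>\<^sup>+y. q (- x + x * y) \<partial>lborel)"
      using x by (intro nn_integral_real_affine) auto
    also have "\<dots> = (\<integral>\<^sup>+y. ennreal x * q (- x + x * y) \<partial>lborel)"
      using x by (subst nn_integral_cmult) auto
    also have "\<dots> = (\<integral>\<^sup>+y. ennreal (x powr (- (g * Suc n))) * (ennreal (sun_kernel a g (g * n) y) * sun_iter a g \<phi> n (x * y)) \<partial>lborel)"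
    proof (intro nn_integral_cong)
      fix y :: real
      show "ennreal x * q (- x + x * y) =
        ennreal (x powr (- (g * Suc n))) * (ennreal (sun_kernel a g (g * n) y) * sun_iter a g \<phi> n (x * y))"
      proof (cases "y > 1")
        case True
        have xy: "(1 - a) * x + (- x + x * y) = x * (y - a)" "- x + x * y > 0" "0 < x * (y - a)"
          using x True a by (auto simp: algebra_simps)
        have "x * (x * (y - a)) powr (- g) * (1 / (x * y)) * (x * y) powr (- (g * n)) =
          x powr (- (g * Suc n)) * (y powr (- 1 - g * n) * (y - a) powr (- g))"
        proof -
          define z where "z = y - a"
          have z: "z > 0" using True a by (simp add: z_def)
          have "x * (x * z) powr (- g) * (1 / (x * y)) * (x * y) powr (- (g * n)) =
            x powr (- (g * Suc n)) * (y powr (- 1 - g * n) * z powr (- g))"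
            using x True z by (simp add: powr_mult powr_diff powr_minus powr_add field_simps)
          then show ?thesis unfolding z_def .
        qed
        then have "ennreal x * ennreal ((x * (y - a)) powr (- g)) * ennreal (1 / (x * y)) * ennreal ((x * y) powr (- (g * n))) =
          ennreal (x powr (- (g * Suc n))) * ennreal (y powr (- 1 - g * n) * (y - a) powr (- g))"
          using x True by (simp flip: ennreal_mult')
        moreover have "q (- x + x * y) = ennreal ((x * (y - a)) powr (- g)) * (ennreal (1 / (x * y)) * \<psi> (x * y))"
          unfolding q_def xy(1) using xy(2) by simp
        then have "ennreal x * q (- x + x * y) = ennreal x * ennreal ((x * (y - a)) powr (- g)) * ennreal (1 / (x * y)) * ennreal ((x * y) powr (- (g * n))) * sun_iter a g \<phi> n (x * y)"
          unfolding \<psi>_def by (simp only: mult.assoc)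
        ultimately show ?thesis using True unfolding sun_kernel_def by (simp add: mult.assoc)
      next
        case False
        then have "x * y \<le> x * 1" using x by (intro mult_left_mono) auto
        then have "\<not> 0 < - x + x * y" by simp
        then have "q (- x + x * y) = 0" unfolding q_def by (simp only: indicator_def greaterThan_iff if_False) simp
        then show ?thesis using False by (simp add: sun_kernel_def)
      qed
    qed
    also have "\<dots> = ennreal (x powr (- (g * Suc n))) * sun_iter a g \<phi> (Suc n) x"
      unfolding sun_iter.simps sun_op_def by (subst nn_integral_cmult) auto
    finally show ?thesis unfolding q_def .
  qed
  have "hcm2 (\<lambda>x. \<integral>\<^sup>+v. ennreal (indicator {0<..} v * ((1 - a) * x + v) powr (- g)) * (ennreal (1 / (x + v)) * \<psi> (x + v)) \<partial>lborel)"
  proof (rule hcm2_integral[OF hcm2_divide])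
    show "hcm2 \<psi>" using Suc by (simp add: \<psi>_def)
    show "(\<integral>\<^sup>+v. ennreal (indicator {0<..} v * ((1 - a) * 1 + v) powr (- g)) * (ennreal (1 / (1 + v)) * \<psi> (1 + v)) \<partial>lborel) < \<infinity>"
      using le_less_trans[OF bd[of 1 "Suc n"]] by (subst eq) (simp_all del: sun_iter.simps)
  qed (use a g \<psi>1 in auto)
  then show ?case by (rule hcm2_cong) (use eq in \<open>auto simp del: sun_iter.simps\<close>)
qed

end

section \<open>Transfer of the Sun equation to test functions, and concentration of the biased
  laws\<close>

locale sun_law = sun_params +
  fixes f :: "real \<Rightarrow> ennreal"
  assumes f_measurable [measurable]: "f \<in> borel_measurable borel"
    and f_nonpos: "\<And>x. x \<le> 0 \<Longrightarrow> f x = 0"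
    and f_mass: "(\<integral>\<^sup>+x. f x \<partial>lborel) = 1"
    and f_eq: "\<And>x. 0 < x \<Longrightarrow> f x = (\<integral>\<^sup>+u. ennreal (indicator {0<..<x} u * (g / x * (x - a * u) powr (- g))) * f u \<partial>lborel)"
begin

text \<open>Tonelli's theorem moves the kernel of the equation onto the test function; in the inner
  integral the substitution x = u y pulls out u^(-(k + g)). Working in \<open>ennreal\<close> means
  that no negative moment has to be known to be finite beforehand.\<close>

lemma f_transfer_step:
  assumes [measurable]: "\<Phi> \<in> borel_measurable borel"
  shows "(\<integral>\<^sup>+u. f u * (ennreal (u powr (- k)) * \<Phi> u) \<partial>lborel) =
    ennreal g * (\<integral>\<^sup>+u. f u * (ennreal (u powr (- (k + g))) * sun_op a g k \<Phi> u) \<partial>lborel)"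
proof -
  define K where "K = (\<lambda>x u. ennreal (indicator {0<..} u * (indicator {0<..} (x - u) * (g / x * (x - a * u) powr (- g)))))"
  define \<psi> where "\<psi> = (\<lambda>x. ennreal (x powr (- k)) * \<Phi> x)"
  have [measurable]: "\<psi> \<in> borel_measurable borel" unfolding \<psi>_def by measurable
  have [measurable]: "(\<lambda>(x, u). K x u) \<in> borel_measurable (borel \<Otimes>\<^sub>M borel)" unfolding K_def by measurable
  have [measurable]: "(\<lambda>x. K x u) \<in> borel_measurable borel" "(\<lambda>v. K w v) \<in> borel_measurable borel" for u w unfolding K_def by (measurable, measurable)
  have fx: "f x = (\<integral>\<^sup>+u. K x u * f u \<partial>lborel)" for x
  proof (cases "x > 0")
    case True
    then show ?thesis by (subst f_eq) (auto simp: K_def indicator_def intro!: nn_integral_cong)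
  next
    case False
    then have "K x u = 0" for u by (auto simp: K_def indicator_def)
    then show ?thesis using False by (simp add: f_nonpos)
  qed
  have "(\<integral>\<^sup>+u. f u * \<psi> u \<partial>lborel) = (\<integral>\<^sup>+x. (\<integral>\<^sup>+u. K x u * f u * \<psi> x \<partial>lborel) \<partial>lborel)"
    by (subst fx, subst nn_integral_multc) auto
  also have "\<dots> = (\<integral>\<^sup>+u. (\<integral>\<^sup>+x. K x u * f u * \<psi> x \<partial>lborel) \<partial>lborel)"
    by (rule lborel_pair.Fubini') (simp add: split_beta')
  also have "\<dots> = (\<integral>\<^sup>+u. ennreal g * (f u * (ennreal (u powr (- (k + g))) * sun_op a g k \<Phi> u)) \<partial>lborel)"
  proof (intro nn_integral_cong)
    fix u :: real
    show "(\<integral>\<^sup>+x. K x u * f u * \<psi> x \<partial>lborel) = ennreal g * (f u * (ennreal (u powr (- (k + g))) * sun_op a g k \<Phi> u))"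
    proof (cases "u > 0")
      case False then show ?thesis by (simp add: f_nonpos)
    next
      case True
      have "(\<integral>\<^sup>+x. K x u * f u * \<psi> x \<partial>lborel) = f u * (\<integral>\<^sup>+x. K x u * \<psi> x \<partial>lborel)"
        by (subst nn_integral_cmult[symmetric]) (auto intro!: nn_integral_cong simp: mult_ac)
      also have "(\<integral>\<^sup>+x. K x u * \<psi> x \<partial>lborel) = ennreal \<bar>u\<bar> * (\<integral>\<^sup>+y. K (0 + u * y) u * \<psi> (0 + u * y) \<partial>lborel)"
        using True by (intro nn_integral_real_affine) auto
      also have "\<dots> = (\<integral>\<^sup>+y. ennreal u * (K (u * y) u * \<psi> (u * y)) \<partial>lborel)"
        using True by (subst nn_integral_cmult) auto
      also have "\<dots> = (\<integral>\<^sup>+y. (ennreal g * ennreal (u powr (- (k + g)))) * (ennreal (sun_kernel a g k y) * \<Phi> (u * y)) \<partial>lborel)"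
      proof (intro nn_integral_cong)
        fix y :: real
        show "ennreal u * (K (u * y) u * \<psi> (u * y)) = (ennreal g * ennreal (u powr (- (k + g)))) * (ennreal (sun_kernel a g k y) * \<Phi> (u * y))"
        proof (cases "y > 1")
          case y: True
          define z where "z = y - a"
          have z: "z > 0" using y a by (simp add: z_def)
          have uz: "u * y - a * u = u * z" by (simp add: z_def algebra_simps)
          have "u * (g / (u * y) * (u * z) powr (- g)) * (u * y) powr (- k) = g * u powr (- (k + g)) * (y powr (- 1 - k) * z powr (- g))"
            using True z y by (simp add: powr_mult powr_diff powr_minus powr_add field_simps)
          then have *: "ennreal u * ennreal (g / (u * y) * (u * z) powr (- g)) * ennreal ((u * y) powr (- k)) =
            ennreal g * ennreal (u powr (- (k + g))) * ennreal (y powr (- 1 - k) * z powr (- g))"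
            using True z y g by (simp flip: ennreal_mult')
          have "K (u * y) u = ennreal (g / (u * y) * (u * z) powr (- g))"
            using True y by (simp add: K_def uz)
          then have "ennreal u * (K (u * y) u * \<psi> (u * y)) = ennreal u * ennreal (g / (u * y) * (u * z) powr (- g)) * ennreal ((u * y) powr (- k)) * \<Phi> (u * y)"
            unfolding \<psi>_def by (simp only: mult.assoc)
          then show ?thesis unfolding * using y by (simp add: sun_kernel_def z_def mult.assoc)
        next
          case False
          then have "u * y \<le> u * 1" using True by (intro mult_left_mono) auto
          then have "K (u * y) u = 0" by (simp add: K_def)
          then show ?thesis using False by (simp add: sun_kernel_def)
        qed
      qed
      also have "\<dots> = (ennreal g * ennreal (u powr (- (k + g)))) * sun_op a g k \<Phi> u"
        unfolding sun_op_def by (rule nn_integral_cmult) measurable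
      finally show ?thesis by (simp add: mult_ac)
    qed
  qed
  also have "\<dots> = ennreal g * (\<integral>\<^sup>+u. f u * (ennreal (u powr (- (k + g))) * sun_op a g k \<Phi> u) \<partial>lborel)"
    by (rule nn_integral_cmult) measurable
  finally show ?thesis unfolding \<psi>_def .
qed

lemma f_transfer:
  assumes [measurable]: "\<phi> \<in> borel_measurable borel"
  shows "(\<integral>\<^sup>+u. f u * \<phi> u \<partial>lborel) =
    ennreal (g ^ n) * (\<integral>\<^sup>+u. f u * (ennreal (u powr (- (g * n))) * sun_iter a g \<phi> n u) \<partial>lborel)"
proof (induction n)
  case 0
  show ?case by (auto intro!: nn_integral_cong simp: f_nonpos)
next
  case (Suc n)
  have k: "g * real n + g = g * real (Suc n)" by (simp add: algebra_simps)
  have "(\<integral>\<^sup>+u. f u * \<phi> u \<partial>lborel) = ennreal (g ^ n) * (\<integral>\<^sup>+u. f u * (ennreal (u powr (- (g * n))) * sun_iter a g \<phi> n u) \<partial>lborel)"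
    by (rule Suc)
  also have "\<dots> = ennreal (g ^ n) * (ennreal g * (\<integral>\<^sup>+u. f u * (ennreal (u powr (- (g * Suc n))) * sun_iter a g \<phi> (Suc n) u) \<partial>lborel))"
    unfolding k[symmetric] sun_iter.simps by (subst f_transfer_step) simp_all
  also have "ennreal (g ^ n) * (ennreal g * I) = ennreal (g ^ Suc n) * I" for I
    using g by (simp add: ennreal_mult' mult_ac)
  finally show ?case .
qed

definition weight :: "nat \<Rightarrow> real" where "weight n = g ^ n * sun_norm n"

lemma weight_pos: "0 < weight n"
  using g sun_norm_pos by (simp add: weight_def)

lemma weight_Suc: "weight (Suc n) = g * sun_mass a g (g * n) * weight n"
  by (simp add: weight_def sun_norm_def)

text \<open>Apply \<open>f_transfer\<close> to the constant 1: its iterates are the constants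
  \<open>sun_norm n\<close>, so the total mass 1 is \<open>weight n\<close> times the moment. In
  particular the negative moments of these orders are finite.\<close>

lemma f_moment: "(\<integral>\<^sup>+u. f u * ennreal (u powr (- (g * n))) \<partial>lborel) = ennreal (1 / weight n)"
proof -
  have "1 = (\<integral>\<^sup>+u. f u * 1 \<partial>lborel)" by (simp add: f_mass)
  also have "\<dots> = ennreal (g ^ n) * (\<integral>\<^sup>+u. f u * ennreal (u powr (- (g * n))) * ennreal (sun_norm n) \<partial>lborel)"
    by (subst f_transfer[of _ n]) (simp_all add: sun_iter_const mult.assoc)
  also have "\<dots> = ennreal (weight n) * (\<integral>\<^sup>+u. f u * ennreal (u powr (- (g * n))) \<partial>lborel)"
    using g sun_norm_pos[of n] by (subst nn_integral_multc) (auto simp: weight_def ennreal_mult' mult_ac)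
  finally have *: "1 = ennreal (weight n) * (\<integral>\<^sup>+u. f u * ennreal (u powr (- (g * n))) \<partial>lborel)" .
  have "ennreal (1 / weight n) = ennreal (1 / weight n) * (ennreal (weight n) * (\<integral>\<^sup>+u. f u * ennreal (u powr (- (g * n))) \<partial>lborel))"
    by (simp flip: *)
  also have "\<dots> = (\<integral>\<^sup>+u. f u * ennreal (u powr (- (g * n))) \<partial>lborel)"
    using weight_pos[of n] by (simp add: mult.assoc[symmetric] flip: ennreal_mult'')
  finally show ?thesis by simp
qed

text \<open>
  The variance of \<open>u powr (- g)\<close> under \<open>biased n\<close> is \<open>O (1 / n)\<close> times its squared mean, which is why
  the biased laws concentrate at \<open>centre n\<close>.
\<close>

definition biased :: "nat \<Rightarrow> real measure" where
  "biased n = density lborel (\<lambda>u. f u * ennreal (weight n * u powr (- (g * n))))"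

lemma sets_biased [simp, measurable_cong]: "sets (biased n) = sets borel"
  by (simp add: biased_def)

lemma nn_integral_biased:
  "h \<in> borel_measurable borel \<Longrightarrow> (\<integral>\<^sup>+u. h u \<partial>biased n) = ennreal (weight n) * (\<integral>\<^sup>+u. f u * (ennreal (u powr (- (g * n))) * h u) \<partial>lborel)"
proof -
  assume [measurable]: "h \<in> borel_measurable borel"
  have "(\<integral>\<^sup>+u. h u \<partial>biased n) = (\<integral>\<^sup>+u. f u * ennreal (weight n * u powr (- (g * n))) * h u \<partial>lborel)"
    unfolding biased_def by (subst nn_integral_density) auto
  also have "\<dots> = (\<integral>\<^sup>+u. ennreal (weight n) * (f u * (ennreal (u powr (- (g * n))) * h u)) \<partial>lborel)"
    using weight_pos[of n] by (intro nn_integral_cong) (simp add: ennreal_mult' mult_ac)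
  also have "\<dots> = ennreal (weight n) * (\<integral>\<^sup>+u. f u * (ennreal (u powr (- (g * n))) * h u) \<partial>lborel)"
    by (rule nn_integral_cmult) measurable
  finally show ?thesis .
qed

lemma AE_biased_pos: "AE u in biased n. 0 < u"
  unfolding biased_def by (subst AE_density) (auto intro!: AE_I2 simp: f_nonpos intro: ccontr)

lemma biased_moment: "(\<integral>\<^sup>+u. ennreal (u powr (- (g * i))) \<partial>biased n) = ennreal (weight n / weight (n + i))"
proof -
  have "(\<integral>\<^sup>+u. ennreal (u powr (- (g * i))) \<partial>biased n) =
    ennreal (weight n) * (\<integral>\<^sup>+u. f u * ennreal (u powr (- (g * (n + i)))) \<partial>lborel)"
    by (subst nn_integral_biased, measurable)
       (auto intro!: arg_cong[where f="\<lambda>x. ennreal (weight n) * x"] nn_integral_cong simp: algebra_simps powr_add[symmetric] simp flip: ennreal_mult')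
  also have "\<dots> = ennreal (weight n) * ennreal (1 / weight (n + i))"
    by (subst f_moment[symmetric]) simp
  finally show ?thesis using weight_pos[of n] by (simp flip: ennreal_mult')
qed

lemma prob_space_biased: "prob_space (biased n)"
proof (rule prob_spaceI)
  have "emeasure (biased n) (space (biased n)) = (\<integral>\<^sup>+u. 1 \<partial>biased n)" by simp
  also have "\<dots> = (\<integral>\<^sup>+u. ennreal (u powr (- (g * real 0))) \<partial>biased n)"
    by (intro nn_integral_cong_AE, use AE_biased_pos[of n] in eventually_elim) simp
  also have "\<dots> = 1" by (subst biased_moment) (use weight_pos[of n] in auto)
  finally show "emeasure (biased n) (space (biased n)) = 1" .
qed

text \<open>The point at which \<open>u powr (- g)\<close> takes its mean value under
  \<open>biased n\<close>.\<close>

definition centre :: "nat \<Rightarrow> real" where "centre n = (weight n / weight (Suc n)) powr (- 1 / g)"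

lemma centre_pos: "0 < centre n"
  using weight_pos[of n] weight_pos[of "Suc n"] by (simp add: centre_def)

lemma biased_concentration:
  assumes s: "1 < s"
  shows "measure (biased n) {u. \<not> (centre n / s \<le> u \<and> u \<le> s * centre n)} \<le>
     (1 - a) powr (- g) / ((1 - s powr (- g))\<^sup>2 * (real n + 1))"
proof -
  interpret prob_space "biased n" by (rule prob_space_biased)
  define m where "m = weight n / weight (Suc n)"
  \<comment> \<open>With r = s^(-g), leaving the window around the centre moves
    \<open>u powr (- g)\<close> from its mean m by at least m (1 - r) on the right, and by at least
    m (1 / r - 1) on the left. The latter is no smaller because (2 - r) r \<le> 1, so Chebyshev's
    inequality with the threshold \<open>\<eta> * m\<close> covers both sides.\<close>
  define \<eta> where "\<eta> = 1 - s powr (- g)"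
  define W where "W = (\<lambda>u::real. u powr (- g))"
  have [measurable]: "W \<in> borel_measurable borel" unfolding W_def by measurable
  have m: "m > 0" using weight_pos[of n] weight_pos[of "Suc n"] by (simp add: m_def)
  have cm: "centre n powr (- g) = m" using m g by (simp add: centre_def m_def[symmetric] powr_powr)
  have sg: "s powr (- g) < 1" using s g powr_less_mono[of "- g" 0 s] by simp
  have \<eta>: "\<eta> > 0" using sg by (simp add: \<eta>_def)
  have W1: "has_bochner_integral (biased n) W m"
    by (rule has_bochner_integral_nn_integral) (use biased_moment[where i=1 and n=n] m in \<open>auto simp: W_def m_def\<close>)
  have W2': "(W u)\<^sup>2 = u powr (- (g * real 2))" for u
    by (simp add: W_def power2_eq_square powr_add[symmetric] mult.commute)
  have W2: "has_bochner_integral (biased n) (\<lambda>u. (W u)\<^sup>2) (weight n / weight (n + 2))"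
    by (rule has_bochner_integral_nn_integral) (use biased_moment[where i=2 and n=n] weight_pos[of n] weight_pos[of "n + 2"] in \<open>auto simp: W2' less_imp_le\<close>)
  have var: "variance W \<le> m\<^sup>2 * ((1 - a) powr (- g) / (real n + 1))"
  proof -
    have "variance W = weight n / weight (n + 2) - m\<^sup>2"
      using W1 W2 by (subst variance_eq) (auto simp: has_bochner_integral_iff)
    also have "\<dots> = m\<^sup>2 * (sun_mass a g (g * n) / sun_mass a g (g * Suc n) - 1)"
      using weight_pos[of n] sun_mass_pos[of "g * n"] sun_mass_pos[of "g * Suc n"] g
      by (simp add: m_def weight_Suc field_simps power2_eq_square)
    also have "\<dots> \<le> m\<^sup>2 * ((1 - a) powr (- g) / (real n + 1))"
      by (intro mult_left_mono sun_mass_ratio) auto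
    finally show ?thesis .
  qed
  have "measure (biased n) {u. \<not> (centre n / s \<le> u \<and> u \<le> s * centre n)} \<le> prob {u \<in> space (biased n). \<eta> * m \<le> \<bar>W u - expectation W\<bar>}"
  proof (rule finite_measure_mono_AE)
    show "AE u in biased n. u \<in> {u. \<not> (centre n / s \<le> u \<and> u \<le> s * centre n)} \<longrightarrow> u \<in> {u \<in> space (biased n). \<eta> * m \<le> \<bar>W u - expectation W\<bar>}"
      using AE_biased_pos
    proof eventually_elim
      case (elim u)
      have e: "expectation W = m" using W1 by (simp add: has_bochner_integral_iff)
      have "\<eta> * m \<le> \<bar>W u - m\<bar>" if "u < centre n / s"
      proof -
        have "(centre n / s) powr (- g) \<le> u powr (- g)" using that elim g by (intro powr_mono2') auto
        moreover have "(centre n / s) powr (- g) = m / s powr (- g)" using s centre_pos[of n] cm by (simp add: powr_divide)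
        moreover have "m + \<eta> * m \<le> m / s powr (- g)"
        proof -
          define r where "r = s powr (- g)"
          have r: "0 < r" "r < 1" using sg s by (auto simp: r_def)
          have "(2 - r) * r \<le> 1" using zero_le_power2[of "1 - r"] by (simp add: power2_eq_square algebra_simps)
          then have "m * ((2 - r) * r) \<le> m * 1" using m by (intro mult_left_mono) auto
          then have "m * (2 - r) \<le> m / r" using r by (simp add: field_simps)
          then show ?thesis by (simp add: \<eta>_def r_def algebra_simps)
        qed
        ultimately show ?thesis by (simp add: W_def)
      qed
      moreover have "\<eta> * m \<le> \<bar>W u - m\<bar>" if "s * centre n < u"
      proof -
        have "u powr (- g) \<le> (s * centre n) powr (- g)" using that s centre_pos[of n] g by (intro powr_mono2') auto
        also have "\<dots> = s powr (- g) * m" using s centre_pos[of n] cm by (simp add: powr_mult)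
        finally show ?thesis by (simp add: W_def \<eta>_def algebra_simps)
      qed
      ultimately show ?case by (auto simp: e not_le sets_eq_imp_space_eq[OF sets_biased])
    qed
  qed measurable
  also have "\<dots> \<le> variance W / (\<eta> * m)\<^sup>2"
    by (rule Chebyshev_inequality) (use W2 \<eta> m in \<open>auto simp: has_bochner_integral_iff\<close>)
  also have "\<dots> \<le> m\<^sup>2 * ((1 - a) powr (- g) / (real n + 1)) / (\<eta> * m)\<^sup>2"
    by (intro divide_right_mono var) auto
  also have "\<dots> = (1 - a) powr (- g) / (\<eta>\<^sup>2 * (real n + 1))"
  proof -
    have "(\<eta> * m)\<^sup>2 = m\<^sup>2 * \<eta>\<^sup>2" by (simp add: power_mult_distrib)
    then show ?thesis using m by (simp add: mult.commute)
  qed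
  finally show ?thesis by (simp add: \<eta>_def)
qed

section \<open>Recovering the transform from normalised iterates\<close>

definition sun_approx :: "(real \<Rightarrow> real) \<Rightarrow> nat \<Rightarrow> real \<Rightarrow> real" where
  "sun_approx \<phi> n x = enn2real (sun_iter a g (\<lambda>x. ennreal (\<phi> x)) n x) / sun_norm n"

context
  fixes \<phi> :: "real \<Rightarrow> real"
  assumes \<phi>_measurable [measurable]: "\<phi> \<in> borel_measurable borel"
    and \<phi>_nonneg: "\<And>x. 0 \<le> \<phi> x" and \<phi>_le: "\<And>x. 0 < x \<Longrightarrow> \<phi> x \<le> 1"
    and \<phi>_antimono: "\<And>x y. 0 < x \<Longrightarrow> x \<le> y \<Longrightarrow> \<phi> y \<le> \<phi> x"
begin

lemma sun_iter_le_norm: "0 < x \<Longrightarrow> sun_iter a g (\<lambda>x. ennreal (\<phi> x)) n x \<le> ennreal (sun_norm n)"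
  using sun_iter_mono[of "\<lambda>x. ennreal (\<phi> x)" "\<lambda>_. 1" x n] \<phi>_le by (simp add: sun_iter_const)

lemma sun_approx_eq: "0 < x \<Longrightarrow> sun_iter a g (\<lambda>x. ennreal (\<phi> x)) n x = ennreal (sun_norm n * sun_approx \<phi> n x)"
  using sun_iter_le_norm[of x n] sun_norm_pos[of n] by (auto simp: sun_approx_def ennreal_enn2real_if top_unique)

lemma sun_approx_nonneg: "0 \<le> sun_approx \<phi> n x"
  using sun_norm_pos[of n] by (simp add: sun_approx_def)

lemma sun_approx_le: "0 < x \<Longrightarrow> sun_approx \<phi> n x \<le> 1"
proof -
  assume x: "0 < x"
  have "ennreal (sun_norm n * sun_approx \<phi> n x) \<le> ennreal (sun_norm n * 1)"
    using sun_iter_le_norm[OF x] unfolding sun_approx_eq[OF x] by simp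
  then show ?thesis using sun_norm_pos[of n] by (simp add: ennreal_le_iff)
qed

lemma sun_approx_antimono: "0 < x \<Longrightarrow> x \<le> y \<Longrightarrow> sun_approx \<phi> n y \<le> sun_approx \<phi> n x"
proof -
  assume x: "0 < x" "x \<le> y"
  then have "sun_iter a g (\<lambda>x. ennreal (\<phi> x)) n y \<le> sun_iter a g (\<lambda>x. ennreal (\<phi> x)) n x"
    by (intro sun_iter_antimono) (auto intro: ennreal_leI \<phi>_antimono)
  then have "ennreal (sun_norm n * sun_approx \<phi> n y) \<le> ennreal (sun_norm n * sun_approx \<phi> n x)"
    using x by (simp add: sun_approx_eq)
  then show ?thesis using sun_norm_pos[of n] sun_approx_nonneg by (simp add: ennreal_le_iff)
qed

lemma sun_approx_measurable [measurable]: "sun_approx \<phi> n \<in> borel_measurable borel"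
  unfolding sun_approx_def by measurable

text \<open>The constants of \<open>n\<close> transfers combine to \<open>weight n\<close>, the
  normalisation of \<open>biased n\<close>. The left-hand side does not depend on \<open>n\<close>,
  while on the right the averaging law becomes more and more concentrated.\<close>

lemma f_integral_eq_biased:
  assumes l: "0 < l"
  shows "(LINT u|density lborel f. \<phi> (l * u)) = (LINT u|biased n. sun_approx \<phi> n (l * u))"
proof -
  have "(\<integral>\<^sup>+u. ennreal (\<phi> (l * u)) \<partial>density lborel f) = (\<integral>\<^sup>+u. f u * ennreal (\<phi> (l * u)) \<partial>lborel)"
    by (subst nn_integral_density) auto
  also have "\<dots> = ennreal (g ^ n) * (\<integral>\<^sup>+u. f u * (ennreal (u powr (- (g * n))) * sun_iter a g (\<lambda>x. ennreal (\<phi> x)) n (l * u)) \<partial>lborel)"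
    by (subst f_transfer[of _ n], measurable, subst sun_iter_scale[of _ _ "\<lambda>x. ennreal (\<phi> x)"]) simp
  also have "\<dots> = ennreal (g ^ n) * (\<integral>\<^sup>+u. ennreal (sun_norm n) * (f u * (ennreal (u powr (- (g * n))) * ennreal (sun_approx \<phi> n (l * u)))) \<partial>lborel)"
  proof (intro arg_cong[where f="\<lambda>x. ennreal (g ^ n) * x"] nn_integral_cong)
    fix u :: real
    show "f u * (ennreal (u powr (- (g * n))) * sun_iter a g (\<lambda>x. ennreal (\<phi> x)) n (l * u)) =
      ennreal (sun_norm n) * (f u * (ennreal (u powr (- (g * n))) * ennreal (sun_approx \<phi> n (l * u))))"
    proof (cases "u > 0")
      case True
      then show ?thesis using l sun_norm_pos[of n] by (subst sun_approx_eq) (auto simp: ennreal_mult' mult_ac)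
    qed (simp add: f_nonpos)
  qed
  also have "\<dots> = ennreal (g ^ n) * (ennreal (sun_norm n) * (\<integral>\<^sup>+u. f u * (ennreal (u powr (- (g * n))) * ennreal (sun_approx \<phi> n (l * u))) \<partial>lborel))"
    by (subst nn_integral_cmult) auto
  also have "\<dots> = (\<integral>\<^sup>+u. ennreal (sun_approx \<phi> n (l * u)) \<partial>biased n)"
    using g sun_norm_pos[of n] by (subst nn_integral_biased) (auto simp: weight_def ennreal_mult' mult.assoc)
  finally show ?thesis
    by (simp add: integral_eq_nn_integral \<phi>_nonneg sun_approx_nonneg)
qed

text \<open>Outside an event of probability at most \<open>\<delta>\<close>, the argument
  \<open>l * u\<close> lies between \<open>centre n * (l / s)\<close> and
  \<open>centre n * (l * s)\<close>. The iterate is nonincreasing with values between 0 and 1, so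
  the average is trapped between its values at these two points up to
  \<open>\<delta>\<close>.\<close>

lemma sun_approx_bounds:
  fixes l s :: real and n :: nat
  assumes l: "0 < l" and s: "1 < s"
  defines "\<delta> \<equiv> (1 - a) powr (- g) / ((1 - s powr (- g))\<^sup>2 * (real n + 1))"
  shows "sun_approx \<phi> n (centre n * (l * s)) \<le> (LINT u|density lborel f. \<phi> (l * u)) + \<delta>"
    and "(LINT u|density lborel f. \<phi> (l * u)) \<le> sun_approx \<phi> n (centre n * (l / s)) + \<delta>"
proof -
  interpret prob_space "biased n" by (rule prob_space_biased)
  define B where "B = {u. \<not> (centre n / s \<le> u \<and> u \<le> s * centre n)}"
  have [measurable]: "B \<in> sets borel" unfolding B_def by measurable
  have PB: "prob B \<le> \<delta>" unfolding B_def \<delta>_def by (rule biased_concentration[OF s])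
  have c: "centre n > 0" by (rule centre_pos)
  have int: "integrable (biased n) (\<lambda>u. sun_approx \<phi> n (l * u))"
  proof (rule integrable_const_bound[where B=1])
    show "AE u in biased n. norm (sun_approx \<phi> n (l * u)) \<le> 1"
      using AE_biased_pos by eventually_elim (use l sun_approx_nonneg sun_approx_le in auto)
  qed measurable
  have intB: "integrable (biased n) (\<lambda>u. indicat_real B u)"
    by (rule integrable_const_bound[where B=1]) (auto simp: indicator_def)
  have EB: "expectation (indicat_real B) = prob B" by simp
  have AE: "AE u in biased n. sun_approx \<phi> n (centre n * (l * s)) - indicator B u \<le> sun_approx \<phi> n (l * u) \<and>
      sun_approx \<phi> n (l * u) \<le> sun_approx \<phi> n (centre n * (l / s)) + indicator B u"
    using AE_biased_pos
  proof eventually_elim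
    case (elim u)
    show ?case
    proof (cases "u \<in> B")
      case True
      have "sun_approx \<phi> n (centre n * (l * s)) \<le> 1" "sun_approx \<phi> n (l * u) \<le> 1"
        using c l s elim by (auto intro!: sun_approx_le)
      then show ?thesis using True sun_approx_nonneg[of n "l * u"] sun_approx_nonneg[of n "centre n * (l / s)"] by auto
    next
      case False
      then have u: "centre n / s \<le> u" "u \<le> s * centre n" by (auto simp: B_def)
      have 1: "centre n * (l / s) \<le> l * u" using mult_left_mono[OF u(1), of l] l by (simp add: mult_ac)
      have 2: "l * u \<le> centre n * (l * s)" using mult_left_mono[OF u(2), of l] l by (simp add: mult_ac)
      show ?thesis using False elim l c s 1 2
        by (auto intro!: sun_approx_antimono)
    qed
  qed
  have "sun_approx \<phi> n (centre n * (l * s)) - prob B = expectation (\<lambda>u. sun_approx \<phi> n (centre n * (l * s)) - indicator B u)"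
    using intB by (simp add: prob_space)
  also have "\<dots> \<le> expectation (\<lambda>u. sun_approx \<phi> n (l * u))"
    using AE by (intro integral_mono_AE int Bochner_Integration.integrable_diff intB) auto
  finally show "sun_approx \<phi> n (centre n * (l * s)) \<le> (LINT u|density lborel f. \<phi> (l * u)) + \<delta>"
    using PB by (simp add: f_integral_eq_biased[OF l, of n])
  have "expectation (\<lambda>u. sun_approx \<phi> n (l * u)) \<le> expectation (\<lambda>u. sun_approx \<phi> n (centre n * (l / s)) + indicator B u)"
    using AE by (intro integral_mono_AE int Bochner_Integration.integrable_add intB) auto
  also have "\<dots> = sun_approx \<phi> n (centre n * (l / s)) + prob B"
    using intB by (simp add: prob_space)
  finally show "(LINT u|density lborel f. \<phi> (l * u)) \<le> sun_approx \<phi> n (centre n * (l / s)) + \<delta>"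
    using PB by (simp add: f_integral_eq_biased[OF l, of n])
qed

text \<open>Using the two bounds at l / s and l * s puts the iterate at \<open>centre n * l\<close>
  between values of the limit function at these two points, up to an error of order 1 / n for fixed
  \<open>s\<close>. Continuity at \<open>l\<close> lets \<open>s\<close> be taken close to
  1.\<close>

lemma sun_approx_limit:
  assumes l: "0 < l" and cont: "isCont (\<lambda>l. LINT u|density lborel f. \<phi> (l * u)) l"
  shows "(\<lambda>n. sun_approx \<phi> n (centre n * l)) \<longlonglongrightarrow> (LINT u|density lborel f. \<phi> (l * u))"
proof (rule LIMSEQ_I)
  fix e :: real assume e: "0 < e"
  define F where "F = (\<lambda>l. LINT u|density lborel f. \<phi> (l * u))"
  obtain d where d: "0 < d" "\<And>x. \<bar>x - l\<bar> < d \<Longrightarrow> \<bar>F x - F l\<bar> < e / 2"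
    using cont e unfolding continuous_at_eps_delta F_def[symmetric] dist_real_def by (metis half_gt_zero)
  define s where "s = 1 + d / (2 * (l + d))"
  have s: "1 < s" using d l by (simp add: s_def)
  have ls: "\<bar>l * s - l\<bar> < d"
  proof -
    have "l * s - l = d * (l / (2 * (l + d)))" by (simp add: s_def field_simps)
    also have "\<dots> < d * 1" using d l by (intro mult_strict_left_mono) (auto simp: field_simps)
    finally show ?thesis using s l by simp
  qed
  have ls': "\<bar>l / s - l\<bar> < d"
  proof -
    have "l - l / s = (l * s - l) / s" using s by (simp add: field_simps)
    also have "\<dots> \<le> (l * s - l) / 1" using s l by (intro divide_left_mono) auto
    finally have "l - l / s < d" using ls by simp
    moreover have "l / s \<le> l" using s l by (simp add: field_simps)
    ultimately show ?thesis by simp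
  qed
  define \<delta> where "\<delta> = (\<lambda>n. (1 - a) powr (- g) / ((1 - s powr (- g))\<^sup>2 * (real n + 1)))"
  have "\<delta> \<longlonglongrightarrow> 0"
  proof -
    have "(\<lambda>n. (1 - a) powr (- g) / (1 - s powr (- g))\<^sup>2 * (1 / (real n + 1))) \<longlonglongrightarrow> (1 - a) powr (- g) / (1 - s powr (- g))\<^sup>2 * 0"
      by (intro tendsto_intros) real_asymp
    then show ?thesis by (simp add: \<delta>_def)
  qed
  then obtain n0 where n0: "\<And>n. n0 \<le> n \<Longrightarrow> \<bar>\<delta> n\<bar> < e / 2"
    using e unfolding LIMSEQ_iff by (metis half_gt_zero diff_zero real_norm_def)
  show "\<exists>no. \<forall>n\<ge>no. norm (sun_approx \<phi> n (centre n * l) - (LINT u|density lborel f. \<phi> (l * u))) < e"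
  proof (intro exI[of _ n0] allI impI)
    fix n assume n: "n0 \<le> n"
    have "sun_approx \<phi> n (centre n * l) \<le> F (l / s) + \<delta> n"
      using sun_approx_bounds(1)[of "l / s" s n] l s by (simp add: F_def \<delta>_def)
    moreover have "F (l * s) \<le> sun_approx \<phi> n (centre n * l) + \<delta> n"
      using sun_approx_bounds(2)[of "l * s" s n] l s by (simp add: F_def \<delta>_def)
    ultimately show "norm (sun_approx \<phi> n (centre n * l) - (LINT u|density lborel f. \<phi> (l * u))) < e"
      using d(2)[OF ls] d(2)[OF ls'] n0[OF n] F_def[THEN fun_cong, of l] unfolding real_norm_def by linarith
  qed
qed

end

definition power_transform :: "nat \<Rightarrow> real \<Rightarrow> real" where
  "power_transform k l = (LINT u|density lborel f. (1 + l * u) powr (- real k))"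

lemma prob_space_f: "prob_space (density lborel f)"
  by (rule prob_spaceI) (simp add: emeasure_density f_mass)

lemma AE_f_pos: "AE u in density lborel f. 0 < u"
  by (subst AE_density) (auto intro!: AE_I2 simp: f_nonpos intro: ccontr)

lemma power_transform_isCont:
  assumes l: "0 < l"
  shows "isCont (power_transform k) l"
proof -
  interpret prob_space "density lborel f" by (rule prob_space_f)
  show ?thesis unfolding continuous_at_sequentially
  proof (intro allI impI)
    fix X :: "nat \<Rightarrow> real" assume X: "X \<longlonglongrightarrow> l"
    have ev: "eventually (\<lambda>n. 0 < X n) sequentially" using order_tendstoD(1)[OF X l] .
    then obtain n0 where n0: "\<And>n. n0 \<le> n \<Longrightarrow> 0 < X n" by (auto simp: eventually_sequentially)
    have "(\<lambda>n. power_transform k (X (n + n0))) \<longlonglongrightarrow> power_transform k l"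
      unfolding power_transform_def
    proof (rule integral_dominated_convergence[where w="\<lambda>_. 1"])
      show "AE u in density lborel f. (\<lambda>n. (1 + X (n + n0) * u) powr (- real k)) \<longlonglongrightarrow> (1 + l * u) powr (- real k)"
        using AE_f_pos
      proof eventually_elim
        case (elim u)
        have "1 + l * u \<noteq> 0" using elim l by (smt (verit) mult_pos_pos)
        then show ?case using LIMSEQ_ignore_initial_segment[OF X, of n0] by (intro tendsto_intros) auto
      qed
      show "AE u in density lborel f. norm ((1 + X (n + n0) * u) powr (- real k)) \<le> 1" for n
        using AE_f_pos
      proof eventually_elim
        case (elim u)
        have "0 < X (n + n0)" by (rule n0) simp
        then have "1 \<le> 1 + X (n + n0) * u" using elim by simp
        then have "(1 + X (n + n0) * u) powr (- real k) \<le> (1 + X (n + n0) * u) powr 0"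
          by (intro powr_mono) auto
        then show ?case using \<open>1 \<le> 1 + X (n + n0) * u\<close> by simp
      qed
    qed measurable
    then show "(power_transform k \<circ> X) \<longlonglongrightarrow> power_transform k l"
      unfolding o_def by (rule LIMSEQ_offset)
  qed
qed

theorem alternating_power_transform:
  assumes k: "1 \<le> k" and u: "0 < u"
  shows "alternating_differences (\<lambda>w. power_transform k (u * joukowski_inverse w) * power_transform k (u / joukowski_inverse w))"
proof -
  define \<phi> where "\<phi> = (\<lambda>x::real. indicator {0<..} x * (1 + x) powr (- real k))"
  have \<phi>m [measurable]: "\<phi> \<in> borel_measurable borel" unfolding \<phi>_def by measurable
  have \<phi>0: "0 \<le> \<phi> x" for x by (simp add: \<phi>_def)
  have \<phi>1: "\<phi> x \<le> 1" if "0 < x" for x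
    using powr_mono[of "- real k" 0 "1 + x"] that by (simp add: \<phi>_def)
  have \<phi>a: "\<phi> y \<le> \<phi> x" if "0 < x" "x \<le> y" for x y
    using that by (auto simp: \<phi>_def intro!: powr_mono2')
  have hc: "hcm2 (\<lambda>x. ennreal (\<phi> x))" unfolding \<phi>_def by (rule hcm2_base) (use k in auto)
  have pt: "(LINT u|density lborel f. \<phi> (l * u)) = power_transform k l" if "0 < l" for l
    unfolding power_transform_def
    by (rule integral_cong_AE, measurable, use AE_f_pos in eventually_elim) (use that in \<open>simp add: \<phi>_def\<close>)
  have cont: "isCont (\<lambda>l. LINT u|density lborel f. \<phi> (l * u)) l" if "0 < l" for l
  proof -
    have "\<forall>\<^sub>F x in nhds l. 0 < x" using that by (intro eventually_nhds_in_open[of "{0<..}", simplified]) auto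
    then have "\<forall>\<^sub>F x in nhds l. (LINT u|density lborel f. \<phi> (x * u)) = power_transform k x"
      by eventually_elim (rule pt)
    then show ?thesis using power_transform_isCont[OF that] by (subst isCont_cong)
  qed
  \<comment> \<open>\<open>H n\<close> is the iterate with its power restored, the form to which
    \<open>hcm2_sun_iter\<close> applies. In the product at v j and v / j the powers of j cancel, so
    passing between \<open>H n\<close> and \<open>sun_approx\<close> costs a factor free of
    \<open>w\<close>.\<close>
  define H where "H = (\<lambda>n x. x powr (- (g * real n)) * (sun_norm n * sun_approx \<phi> n x))"
  have H0: "0 \<le> H n x" for n x
    using sun_norm_pos[of n] sun_approx_nonneg[OF \<phi>m \<phi>0 \<phi>1 \<phi>a, of n x] by (simp add: H_def)
  have hcH: "hcm2 (\<lambda>x. ennreal (H n x))" for n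
  proof (rule hcm2_cong[OF hcm2_sun_iter[OF hc, of n]])
    show "(\<lambda>x. ennreal (H n x)) \<in> borel_measurable borel" unfolding H_def sun_approx_def by measurable
    show "ennreal (H n x) = ennreal (x powr (- (g * real n))) * sun_iter a g (\<lambda>x. ennreal (\<phi> x)) n x" if "0 < x" for x
      using sun_approx_eq[OF \<phi>m \<phi>0 \<phi>1 \<phi>a that, of n] by (simp add: H_def ennreal_mult')
    show "ennreal (\<phi> x) \<le> 1" if "0 < x" for x using \<phi>1[OF that] by simp
  qed
  have S: "sun_approx \<phi> n x = x powr (g * real n) / sun_norm n * H n x" if "0 < x" for n x
    using that sun_norm_pos[of n] by (simp add: H_def powr_minus)
  show ?thesis
  proof (rule alternating_differences_limit)
    fix n
    define v where "v = centre n * u"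
    have v: "0 < v" using u centre_pos by (simp add: v_def)
    have "alternating_differences (\<lambda>w. (v powr (g * real n) / sun_norm n)\<^sup>2 * (H n (v * joukowski_inverse w) * H n (v / joukowski_inverse w)))"
      by (intro alternating_differences_cmult alternating_differences_hcm2 hcH H0 v) simp
    then show "alternating_differences (\<lambda>w. sun_approx \<phi> n (centre n * (u * joukowski_inverse w)) * sun_approx \<phi> n (centre n * (u / joukowski_inverse w)))"
    proof (subst alternating_differences_cong)
      fix w :: real assume "2 \<le> w"
      then have j: "0 < joukowski_inverse w" by (rule joukowski_inverse)
      have "sun_approx \<phi> n (v * joukowski_inverse w) * sun_approx \<phi> n (v / joukowski_inverse w) =
        (v powr (g * real n) / sun_norm n)\<^sup>2 * (H n (v * joukowski_inverse w) * H n (v / joukowski_inverse w))"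
        using v j by (subst (1 2) S) (auto simp: powr_mult powr_divide power2_eq_square)
      then show "sun_approx \<phi> n (centre n * (u * joukowski_inverse w)) * sun_approx \<phi> n (centre n * (u / joukowski_inverse w)) =
        (v powr (g * real n) / sun_norm n)\<^sup>2 * (H n (v * joukowski_inverse w) * H n (v / joukowski_inverse w))"
        by (simp add: v_def mult.assoc)
    qed
  next
    fix w :: real assume "2 \<le> w"
    then have j: "0 < joukowski_inverse w" by (rule joukowski_inverse)
    show "(\<lambda>n. sun_approx \<phi> n (centre n * (u * joukowski_inverse w)) * sun_approx \<phi> n (centre n * (u / joukowski_inverse w)))
      \<longlonglongrightarrow> power_transform k (u * joukowski_inverse w) * power_transform k (u / joukowski_inverse w)"
    proof (intro tendsto_mult)
      show "(\<lambda>n. sun_approx \<phi> n (centre n * (u * joukowski_inverse w))) \<longlonglongrightarrow> power_transform k (u * joukowski_inverse w)"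
        "(\<lambda>n. sun_approx \<phi> n (centre n * (u / joukowski_inverse w))) \<longlonglongrightarrow> power_transform k (u / joukowski_inverse w)"
        by (subst pt[symmetric], use u j in simp, intro sun_approx_limit[OF \<phi>m \<phi>0 \<phi>1 \<phi>a] cont; use u j in simp)+
    qed
  qed
qed

section \<open>Mass of the law near zero\<close>

lemma weight_le: "weight n \<le> ((1 - a) powr (- g)) ^ n / fact n"
proof (induction n)
  case (Suc n)
  have "weight (Suc n) = (g * sun_mass a g (g * n)) * weight n" by (simp add: weight_Suc)
  also have "g * sun_mass a g (g * n) \<le> (1 - a) powr (- g) / (real n + 1)"
  proof -
    have "g * sun_mass a g (g * n) \<le> g * ((1 - a) powr (- g) / (g * n + g))"
      using g by (intro mult_left_mono sun_mass_le) auto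
    also have "g * n + g = g * (real n + 1)" by (simp add: algebra_simps)
    finally show ?thesis using g by simp
  qed
  then have "(g * sun_mass a g (g * n)) * weight n \<le> ((1 - a) powr (- g) / (real n + 1)) * (((1 - a) powr (- g)) ^ n / fact n)"
    using Suc weight_pos[of n] by (intro mult_mono) auto
  also have "\<dots> = ((1 - a) powr (- g)) ^ Suc n / fact (Suc n)"
    by (simp add: algebra_simps)
  finally show ?case by simp
qed (simp add: weight_def sun_norm_def)

text \<open>Without mass on the left of \<open>e\<close>, the negative moments of order
  \<open>g * n\<close> would be at most e^(-g n), whereas \<open>weight_le\<close> forces them to
  grow at least like n! / C^n. Positive mass near zero is what later rules out a drift.\<close>

theorem f_mass_near_zero:
  assumes e: "0 < e"
  shows "measure (density lborel f) {..e} > 0"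
proof (rule ccontr)
  interpret prob_space "density lborel f" by (rule prob_space_f)
  assume "\<not> ?thesis"
  then have "measure (density lborel f) {..e} = 0" using measure_nonneg[of "density lborel f" "{..e}"] by linarith
  then have "emeasure (density lborel f) {..e} = 0" by (simp add: emeasure_eq_measure)
  then have AE: "AE u in density lborel f. u \<notin> {..e}" by (intro AE_not_in null_setsI) auto
  have le: "1 / weight n \<le> e powr (- (g * n))" for n
  proof -
    have "ennreal (1 / weight n) = (\<integral>\<^sup>+u. ennreal (u powr (- (g * n))) \<partial>density lborel f)"
      by (subst nn_integral_density) (auto simp: f_moment)
    also have "\<dots> \<le> (\<integral>\<^sup>+u. ennreal (e powr (- (g * n))) \<partial>density lborel f)"
      by (intro nn_integral_mono_AE, use AE in eventually_elim) (use e g in \<open>auto intro!: ennreal_leI powr_mono2'\<close>)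
    also have "\<dots> = ennreal (e powr (- (g * n)))" using emeasure_space_1 by (simp del: space_density)
    finally show ?thesis by simp
  qed
  define z where "z = e powr (- g) * (1 - a) powr (- g)"
  have "1 \<le> z ^ n / fact n" for n
  proof -
    have "1 = 1 / weight n * weight n" using weight_pos[of n] by simp
    also have "\<dots> \<le> e powr (- (g * n)) * (((1 - a) powr (- g)) ^ n / fact n)"
      using weight_pos[of n] by (intro mult_mono le weight_le) auto
    also have "e powr (- (g * n)) = (e powr (- g)) ^ n" using e by (simp add: powr_realpow[symmetric] powr_powr)
    finally show ?thesis by (simp add: z_def power_mult_distrib)
  qed
  moreover have "(\<lambda>n. z ^ n / fact n) \<longlonglongrightarrow> 0"
    using summable_LIMSEQ_zero[OF summable_exp[of z]] by (simp add: divide_inverse mult.commute)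
  ultimately show False
    using LIMSEQ_le_const[of "\<lambda>n. z ^ n / fact n" 0 1] by auto
qed

end

section \<open>Power mixtures in the slit plane\<close>

text \<open>Only a local bound for \<open>f\<close> itself is assumed. Cauchy's inequality on discs
  of half the radius bounds the derivative, hence the difference quotients, by a constant, which is
  integrable because the measure is finite. Measurability of \<open>f' z0\<close> comes for free, as
  it is a limit of difference quotients.\<close>

lemma has_field_derivative_integral:
  fixes f f' :: "complex \<Rightarrow> 'a \<Rightarrow> complex"
  assumes M: "finite_measure M" and S: "open S" "z0 \<in> S"
    and meas: "\<And>z. z \<in> S \<Longrightarrow> f z \<in> borel_measurable M"
    and der: "\<And>z x. z \<in> S \<Longrightarrow> x \<in> space M \<Longrightarrow> ((\<lambda>z. f z x) has_field_derivative f' z x) (at z)"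
    and bd: "\<And>z. z \<in> S \<Longrightarrow> \<exists>r>0. \<exists>B. cball z r \<subseteq> S \<and> (\<forall>w\<in>cball z r. \<forall>x\<in>space M. norm (f w x) \<le> B)"
  shows "((\<lambda>z. LINT x|M. f z x) has_field_derivative (LINT x|M. f' z0 x)) (at z0)"
proof -
  interpret finite_measure M by fact
  obtain r B where r: "0 < r" and sub: "cball z0 r \<subseteq> S" and B: "\<And>w x. w \<in> cball z0 r \<Longrightarrow> x \<in> space M \<Longrightarrow> norm (f w x) \<le> B"
    using bd[OF S(2)] by blast
  have int: "integrable M (f w)" if "w \<in> cball z0 r" for w
    by (rule integrable_const_bound[where B=B]) (use that B meas sub in auto)
  have d': "norm (f' w x) \<le> B / (r / 2)" if w: "w \<in> cball z0 (r / 2)" and x: "x \<in> space M" for w x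
  proof -
    have cb: "cball w (r / 2) \<subseteq> cball z0 r" using w r by (intro cball_subset_cball_iff[THEN iffD2]) (auto simp: dist_commute)
    have hol: "(\<lambda>z. f z x) holomorphic_on S" using der x S by (auto simp: holomorphic_on_open)
    have "norm ((deriv ^^ 1) (\<lambda>z. f z x) w) \<le> fact 1 * B / (r / 2) ^ 1"
    proof (rule Cauchy_inequality)
      show "(\<lambda>z. f z x) holomorphic_on ball w (r / 2)"
        using hol by (rule holomorphic_on_subset) (use cb sub in \<open>auto simp: subset_iff\<close>)
      show "continuous_on (cball w (r / 2)) (\<lambda>z. f z x)"
        using holomorphic_on_imp_continuous_on[OF hol] by (rule continuous_on_subset) (use cb sub in auto)
      show "norm (f y x) \<le> B" if "norm (w - y) = r / 2" for y
        using that cb x by (intro B) (auto simp: subset_iff dist_norm)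
    qed (use r in auto)
    moreover have "w \<in> S" using w r sub by (auto simp: subset_iff)
    then have "deriv (\<lambda>z. f z x) w = f' w x" using der x by (intro DERIV_imp_deriv) auto
    ultimately show ?thesis by simp
  qed
  have cb2: "cball z0 (r / 2) \<subseteq> S"
    by (rule subset_trans[OF subset_cball sub]) (use r in simp)
  have quot: "norm ((f w x - f z0 x) / (w - z0)) \<le> B / (r / 2)" if w: "w \<in> cball z0 (r / 2)" "w \<noteq> z0" and x: "x \<in> space M" for w x
  proof -
    have "norm (f w x - f z0 x) \<le> B / (r / 2) * norm (w - z0)"
    proof (rule field_differentiable_bound[where S="cball z0 (r / 2)"])
      show "((\<lambda>z. f z x) has_field_derivative f' z x) (at z within cball z0 (r / 2))" if "z \<in> cball z0 (r / 2)" for z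
        by (rule has_field_derivative_at_within[OF der[OF subsetD[OF cb2 that] x]])
    qed (use w r d' x in auto)
    then show ?thesis using w(2) by (simp only: norm_divide) (subst pos_divide_le_eq, auto)
  qed
  show ?thesis
    unfolding has_field_derivative_iff tendsto_at_iff_sequentially
  proof (intro allI impI)
    fix X :: "nat \<Rightarrow> complex" assume X: "\<forall>i. X i \<in> UNIV - {z0}" "X \<longlonglongrightarrow> z0"
    have "\<forall>\<^sub>F n in sequentially. X n \<in> ball z0 (r / 2)"
      using X(2) r by (intro topological_tendstoD) auto
    then obtain n0 where n0: "\<And>n. n0 \<le> n \<Longrightarrow> X n \<in> cball z0 (r / 2)"
      unfolding eventually_sequentially using ball_subset_cball by blast
    have Xr: "X (n + n0) \<in> cball z0 r" for n using n0[of "n + n0"] r by auto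
    have "(\<lambda>n. LINT x|M. (f (X (n + n0)) x - f z0 x) / (X (n + n0) - z0)) \<longlonglongrightarrow> (LINT x|M. f' z0 x)"
    proof (rule integral_dominated_convergence[where w="\<lambda>_. B / (r / 2)"])
      have lim: "(\<lambda>n. (f (X (n + n0)) x - f z0 x) / (X (n + n0) - z0)) \<longlonglongrightarrow> f' z0 x" if "x \<in> space M" for x
        using der[OF S(2) that] X LIMSEQ_ignore_initial_segment[of _ _ n0]
        unfolding has_field_derivative_iff tendsto_at_iff_sequentially o_def by blast
      then show "AE x in M. (\<lambda>n. (f (X (n + n0)) x - f z0 x) / (X (n + n0) - z0)) \<longlonglongrightarrow> f' z0 x" by auto
      show m: "(\<lambda>x. (f (X (n + n0)) x - f z0 x) / (X (n + n0) - z0)) \<in> borel_measurable M" for n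
        by (intro borel_measurable_divide borel_measurable_diff meas[OF S(2)] meas[OF subsetD[OF sub Xr]]) auto
      show "f' z0 \<in> borel_measurable M"
        by (rule borel_measurable_LIMSEQ_metric[OF m lim])
      show "AE x in M. norm ((f (X (n + n0)) x - f z0 x) / (X (n + n0) - z0)) \<le> B / (r / 2)" for n
        using n0[of "n + n0"] X(1) by (intro AE_I2 quot) auto
    qed auto
    also have "(\<lambda>n. LINT x|M. (f (X (n + n0)) x - f z0 x) / (X (n + n0) - z0)) =
       (\<lambda>n. ((LINT x|M. f (X (n + n0)) x) - (LINT x|M. f z0 x)) / (X (n + n0) - z0))"
    proof
      fix n
      have "(LINT x|M. (f (X (n + n0)) x - f z0 x) / (X (n + n0) - z0)) = (LINT x|M. f (X (n + n0)) x - f z0 x) / (X (n + n0) - z0)"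
        by (rule integral_divide_zero)
      also have "(LINT x|M. f (X (n + n0)) x - f z0 x) = (LINT x|M. f (X (n + n0)) x) - (LINT x|M. f z0 x)"
        using r by (intro Bochner_Integration.integral_diff int Xr) auto
      finally show "(LINT x|M. (f (X (n + n0)) x - f z0 x) / (X (n + n0) - z0)) =
        ((LINT x|M. f (X (n + n0)) x) - (LINT x|M. f z0 x)) / (X (n + n0) - z0)" .
    qed
    finally show "((\<lambda>y. ((LINT x|M. f y x) - (LINT x|M. f z0 x)) / (y - z0)) \<circ> X) \<longlonglongrightarrow> (LINT x|M. f' z0 x)"
      unfolding o_def by (rule LIMSEQ_offset)
  qed
qed

text \<open>For z = r e^(i \<theta>) with |\<theta>| < \<pi> this is cos (\<theta> / 2), written
  through real parts so that no branch of the argument enters.\<close>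

definition slit_angle :: "complex \<Rightarrow> real" where
  "slit_angle z = sqrt ((1 + Re z / norm z) / 2)"

lemma slit_angle_pos: "z \<notin> \<real>\<^sub>\<le>\<^sub>0 \<Longrightarrow> 0 < slit_angle z"
proof -
  assume z: "z \<notin> \<real>\<^sub>\<le>\<^sub>0"
  have "- norm z < Re z"
  proof (rule ccontr)
    assume "\<not> - norm z < Re z"
    then have 1: "norm z \<le> - Re z" by simp
    then have "(norm z)\<^sup>2 \<le> (- Re z)\<^sup>2" by (intro power_mono) auto
    then have "Im z = 0" by (simp add: cmod_power2)
    moreover have "Re z \<le> 0" using 1 norm_ge_zero[of z] by linarith
    ultimately show False using z by (simp add: complex_nonpos_Reals_iff)
  qed
  moreover have "0 < norm z" using z by auto
  ultimately show ?thesis by (simp add: slit_angle_def field_simps)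
qed

text \<open>The difference of the squares of the two sides is sin (\<theta> / 2)^2 (1 - |z| x)^2,
  where \<theta> is the angle of z.\<close>

lemma norm_one_plus_ge:
  assumes z: "z \<notin> \<real>\<^sub>\<le>\<^sub>0" and x: "0 \<le> x"
  shows "slit_angle z * (1 + norm z * x) \<le> norm (1 + z * of_real x)"
proof -
  have z0: "0 < norm z" using z by auto
  define c where "c = Re z / norm z"
  have Re: "Re z = c * norm z" using z0 by (simp add: c_def)
  have c1: "\<bar>c\<bar> \<le> 1" using abs_Re_le_cmod[of z] z0 by (simp add: c_def abs_divide field_simps)
  have "(norm (1 + z * of_real x))\<^sup>2 = 1 + 2 * (c * norm z) * x + (norm z)\<^sup>2 * x\<^sup>2"
    by (simp add: cmod_power2 flip: Re) (simp add: power2_eq_square algebra_simps)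
  also have "\<dots> = (slit_angle z * (1 + norm z * x))\<^sup>2 + (1 - c) / 2 * (1 - norm z * x)\<^sup>2"
    using c1 by (simp add: power_mult_distrib slit_angle_def c_def[symmetric]) (simp add: power2_eq_square field_simps)
  also have "\<dots> \<ge> (slit_angle z * (1 + norm z * x))\<^sup>2" using c1 by simp
  finally show ?thesis by (rule power2_le_imp_le) simp
qed

lemma continuous_on_slit_angle: "continuous_on (- \<real>\<^sub>\<le>\<^sub>0) slit_angle"
  unfolding slit_angle_def by (intro continuous_intros) auto

locale power_mixture =
  fixes \<mu> :: "real measure" and k :: nat
  assumes prob: "prob_space \<mu>" and sets_\<mu> [simp, measurable_cong]: "sets \<mu> = sets borel"
    and pos: "AE x in \<mu>. 0 < x" and k: "1 \<le> k"
begin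

sublocale prob_space \<mu> by (rule prob)

text \<open>The indicator confines x to the positive half-line, where 1 + z x has no zero off the
  cut. Thus the integrand is holomorphic in z for every x, as
  \<open>has_field_derivative_integral\<close> demands, and not merely for almost every x.\<close>

definition F :: "complex \<Rightarrow> complex" where
  "F z = (LINT x|\<mu>. indicator {0<..} x / (1 + z * of_real x) ^ k)"

definition F' :: "complex \<Rightarrow> complex" where
  "F' z = (LINT x|\<mu>. - of_nat k * of_real x * indicator {0<..} x / (1 + z * of_real x) ^ (Suc k))"

definition G :: "real \<Rightarrow> real" where
  "G l = (LINT x|\<mu>. (1 + l * x) powr (- real k))"

lemma nonzero: "(z :: complex) \<notin> \<real>\<^sub>\<le>\<^sub>0 \<Longrightarrow> 0 \<le> x \<Longrightarrow> 1 + z * of_real x \<noteq> 0"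
proof -
  assume z: "z \<notin> \<real>\<^sub>\<le>\<^sub>0" and x: "0 \<le> x"
  have "0 < slit_angle z * (1 + norm z * x)" using slit_angle_pos[OF z] x by (intro mult_pos_pos add_pos_nonneg) auto
  also have "\<dots> \<le> norm (1 + z * of_real x)" by (rule norm_one_plus_ge[OF z x])
  finally show ?thesis by auto
qed

lemma F_kernel_norm:
  assumes z: "z \<notin> \<real>\<^sub>\<le>\<^sub>0" and x: "0 < x"
  shows "norm (1 / (1 + z * of_real x) ^ k) \<le> (1 + norm z * x) powr (- real k) / slit_angle z ^ k"
proof -
  have p: "0 < 1 + norm z * x" using x by (intro add_pos_nonneg) auto
  have "norm (1 / (1 + z * of_real x) ^ k) = 1 / norm (1 + z * of_real x) ^ k" by (simp add: norm_divide norm_power)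
  also have "\<dots> \<le> 1 / (slit_angle z * (1 + norm z * x)) ^ k"
    using slit_angle_pos[OF z] p nonzero[OF z, of x] x
    by (intro divide_left_mono power_mono norm_one_plus_ge[OF z] mult_pos_pos zero_less_power) (auto intro!: mult_nonneg_nonneg)
  also have "\<dots> = (1 + norm z * x) powr (- real k) / slit_angle z ^ k"
    using p by (simp only: power_mult_distrib powr_minus powr_realpow) (simp add: divide_inverse mult.commute)
  finally show ?thesis .
qed

lemma F_has_field_derivative:
  assumes "z \<notin> \<real>\<^sub>\<le>\<^sub>0" shows "(F has_field_derivative F' z) (at z)"
  unfolding F_def F'_def
proof (rule has_field_derivative_integral[where S="- \<real>\<^sub>\<le>\<^sub>0"])
  show "finite_measure \<mu>" by (rule finite_measure_axioms)
  show "open (- \<real>\<^sub>\<le>\<^sub>0 :: complex set)" by (simp add: open_Compl)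
  show "z \<in> - \<real>\<^sub>\<le>\<^sub>0" using assms by simp
  show "(\<lambda>x. indicator {0<..} x / (1 + z * of_real x) ^ k) \<in> borel_measurable \<mu>" for z :: complex
    by measurable
  show "((\<lambda>z. indicator {0<..} x / (1 + z * of_real x) ^ k) has_field_derivative
     - of_nat k * of_real x * indicator {0<..} x / (1 + z * of_real x) ^ Suc k) (at z)" if "z \<in> - \<real>\<^sub>\<le>\<^sub>0" for z :: complex and x :: real
  proof (cases "x > 0")
    case True
    then have nz: "1 + z * of_real x \<noteq> 0" using nonzero[of z x] that by auto
    obtain j where j: "k = Suc j" using k by (cases k) auto
    define q where "q = 1 + z * of_real x"
    define p where "p = q ^ j"
    have qp: "q \<noteq> 0" "p \<noteq> 0" using nz by (auto simp: q_def p_def)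
    have "((\<lambda>z. 1 + z * of_real x) has_field_derivative of_real x) (at z)"
      by (auto intro!: derivative_eq_intros)
    then have "((\<lambda>z. (1 + z * of_real x) ^ Suc j) has_field_derivative of_nat (Suc j) * (of_real x * p)) (at z)"
      using DERIV_power_Suc[of "\<lambda>z. 1 + z * of_real x" "of_real x" z UNIV j] by (simp add: q_def p_def)
    then have "((\<lambda>z. inverse ((1 + z * of_real x) ^ Suc j)) has_field_derivative
        - (of_nat (Suc j) * (of_real x * p) * inverse ((q * p) ^ Suc (Suc 0)))) (at z)"
      using DERIV_inverse_fun[of "\<lambda>z. (1 + z * of_real x) ^ Suc j" _ z UNIV] nz by (simp add: q_def p_def)
    also have "- (of_nat (Suc j) * (of_real x * p) * inverse ((q * p) ^ Suc (Suc 0))) = - of_nat k * of_real x / q ^ Suc k"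
      using qp unfolding j power_Suc p_def[symmetric] by (simp add: field_simps del: of_nat_Suc)
    also have "(\<lambda>z. inverse ((1 + z * complex_of_real x) ^ Suc j)) = (\<lambda>z. 1 / (1 + z * of_real x) ^ k)"
      unfolding j by (simp only: inverse_eq_divide)
    finally show ?thesis using True by (simp add: q_def)
  qed auto
  fix z :: complex assume z: "z \<in> - \<real>\<^sub>\<le>\<^sub>0"
  obtain r where r: "0 < r" "cball z r \<subseteq> - \<real>\<^sub>\<le>\<^sub>0"
    using z open_contains_cball[of "- \<real>\<^sub>\<le>\<^sub>0 :: complex set"] by (auto simp: open_Compl)
  have "continuous_on (cball z r) slit_angle" by (rule continuous_on_subset[OF continuous_on_slit_angle r(2)])
  then obtain w0 where w0: "w0 \<in> cball z r" "\<And>w. w \<in> cball z r \<Longrightarrow> slit_angle w0 \<le> slit_angle w"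
    using continuous_attains_inf[of "cball z r" slit_angle] r(1) by (auto simp: cball_eq_empty)
  have p0: "0 < slit_angle w0" using w0(1) r(2) by (intro slit_angle_pos) auto
  have "norm (indicator {0<..} x / (1 + w * of_real x) ^ k) \<le> 1 / slit_angle w0 ^ k" if w: "w \<in> cball z r" for w and x :: real
  proof (cases "x > 0")
    case True
    have wS: "w \<notin> \<real>\<^sub>\<le>\<^sub>0" using w r by auto
    have "norm (1 / (1 + w * of_real x) ^ k) \<le> (1 + norm w * x) powr (- real k) / slit_angle w ^ k"
      by (rule F_kernel_norm[OF wS True])
    also have "\<dots> \<le> 1 / slit_angle w ^ k"
    proof (intro divide_right_mono)
      have "(1 + norm w * x) powr (- real k) \<le> (1 + norm w * x) powr 0" using True by (intro powr_mono) auto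
      moreover have "1 + norm w * x > 0" using True by (intro add_pos_nonneg) auto
      ultimately show "(1 + norm w * x) powr (- real k) \<le> 1" by simp
    qed (use slit_angle_pos[OF wS] in auto)
    also have "\<dots> \<le> 1 / slit_angle w0 ^ k" using p0 w0(2)[OF w] by (intro divide_left_mono power_mono mult_pos_pos zero_less_power) auto
    finally show ?thesis using True by simp
  qed (use p0 in auto)
  then show "\<exists>r>0. \<exists>B. cball z r \<subseteq> - \<real>\<^sub>\<le>\<^sub>0 \<and> (\<forall>w\<in>cball z r. \<forall>x\<in>space \<mu>. norm (indicator {0<..} x / (1 + w * of_real x) ^ k :: complex) \<le> B)"
    using r by blast
qed

lemma F_holomorphic: "F holomorphic_on - \<real>\<^sub>\<le>\<^sub>0"
  using F_has_field_derivative by (auto simp: holomorphic_on_open open_Compl)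

lemma G_integrable: "0 \<le> l \<Longrightarrow> integrable \<mu> (\<lambda>x. (1 + l * x) powr (- real k))"
proof (rule integrable_const_bound[where B=1])
  assume l: "0 \<le> l"
  show "AE x in \<mu>. norm ((1 + l * x) powr (- real k)) \<le> 1"
    using pos
  proof eventually_elim
    case (elim x)
    then have "0 \<le> l * x" using l by simp
    then have "(1 + l * x) powr (- real k) \<le> (1 + l * x) powr 0" by (intro powr_mono) auto
    then show ?case using \<open>0 \<le> l * x\<close> by simp
  qed
qed measurable

lemma F_of_real: "0 < l \<Longrightarrow> F (of_real l) = of_real (G l)"
proof -
  assume l: "0 < l"
  have "F (of_real l) = (LINT x|\<mu>. of_real ((1 + l * x) powr (- real k)))"
    unfolding F_def
  proof (rule integral_cong_AE)
    show "AE x in \<mu>. indicator {0<..} x / (1 + of_real l * of_real x) ^ k = (of_real ((1 + l * x) powr (- real k)) :: complex)"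
      using pos
    proof eventually_elim
      case (elim x)
      have "1 + l * x > 0" using elim l by (intro add_pos_pos) auto
      then have "(1 + l * x) powr (- real k) = 1 / (1 + l * x) ^ k" by (simp add: powr_minus powr_realpow divide_inverse)
      then show ?case using elim by simp
    qed
  qed measurable
  then show ?thesis by (simp add: G_def)
qed

lemma G_pos: "0 \<le> l \<Longrightarrow> 0 < G l"
  unfolding G_def
proof (rule expectation_greater[OF G_integrable])
  assume l: "0 \<le> l"
  show "AE x in \<mu>. 0 < (1 + l * x) powr (- real k)"
    using pos
  proof eventually_elim
    case (elim x)
    then have "0 \<le> l * x" using l by simp
    then show ?case by simp
  qed
qed

text \<open>With r = |z| x, the integrand of z F' is at most a constant times r / (1 + r) * (1 +
  r)^(-k), and either factor may be bounded by 1. Dropping the power gives a bound that vanishes as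
  z tends to 0, used at the left end of the strip; dropping the fraction gives a multiple of
  \<open>G (norm z)\<close>, used for the boundedness of the logarithmic derivative.\<close>

lemma F'_norm_le:
  assumes z: "z \<notin> \<real>\<^sub>\<le>\<^sub>0"
  shows "norm (z * F' z) \<le> real k * (1 - (LINT x|\<mu>. 1 / (1 + norm z * x))) / slit_angle z ^ Suc k" (is ?A)
    and "norm (z * F' z) \<le> real k * G (norm z) / slit_angle z ^ Suc k" (is ?B)
proof -
  let ?n = "norm z"
  define h where "h = (\<lambda>x. real k * (?n * x / (1 + ?n * x) * (1 + ?n * x) powr (- real k)) / slit_angle z ^ Suc k)"
  have p: "0 < slit_angle z" by (rule slit_angle_pos[OF z])
  have le: "norm (z * (- of_nat k * of_real x * indicator {0<..} x / (1 + z * of_real x) ^ Suc k)) \<le> h x" if "0 < x" for x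
  proof -
    have q: "0 < 1 + ?n * x" using that by (intro add_pos_nonneg) auto
    have "norm (z * (- of_nat k * of_real x * indicator {0<..} x / (1 + z * of_real x) ^ Suc k)) =
       real k * (?n * x) / norm (1 + z * of_real x) ^ Suc k"
      using that by (simp add: norm_mult norm_divide norm_power)
    also have "\<dots> \<le> real k * (?n * x) / (slit_angle z * (1 + ?n * x)) ^ Suc k"
      using p q nonzero[OF z, of x] that
      by (intro divide_left_mono power_mono norm_one_plus_ge[OF z] mult_pos_pos zero_less_power) (auto intro!: mult_nonneg_nonneg)
    also have "\<dots> = h x"
    proof -
      define Q where "Q = 1 + ?n * x"
      have Q: "Q > 0" using q by (simp add: Q_def)
      have "?n * x / Q * Q powr (- real k) = ?n * x / Q ^ Suc k"
        using Q by (simp add: powr_minus powr_realpow field_simps)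
      then show ?thesis unfolding h_def Q_def[symmetric] by (simp only: power_mult_distrib) (simp add: mult.commute)
    qed
    finally show ?thesis .
  qed
  have bd1: "x / (1 + x) \<le> 1" "0 \<le> x / (1 + x)" "1 - 1 / (1 + x) = x / (1 + x)" if "0 \<le> x" for x :: real
    using that by (auto simp: field_simps)
  have pw: "(1 + x) powr (- real k) \<le> 1" if "0 \<le> x" for x :: real
    using powr_mono[of "- real k" 0 "1 + x"] that by simp
  have hB: "h x \<le> real k * (1 + ?n * x) powr (- real k) / slit_angle z ^ Suc k" "h x \<le> real k * (1 - 1 / (1 + ?n * x)) / slit_angle z ^ Suc k" "0 \<le> h x" if "0 < x" for x
  proof -
    have nx: "0 \<le> ?n * x" using that by simp
    show "h x \<le> real k * (1 + ?n * x) powr (- real k) / slit_angle z ^ Suc k"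
      unfolding h_def using p bd1[OF nx] by (intro divide_right_mono mult_left_mono mult_left_le_one_le) auto
    show "h x \<le> real k * (1 - 1 / (1 + ?n * x)) / slit_angle z ^ Suc k"
      unfolding h_def bd1(3)[OF nx] using p bd1(1,2)[OF nx] pw[OF nx] by (intro divide_right_mono mult_left_mono mult_right_le_one_le) auto
    show "0 \<le> h x" unfolding h_def using p nx by (intro divide_nonneg_pos mult_nonneg_nonneg[OF _ mult_nonneg_nonneg]) auto
  qed
  have i1: "integrable \<mu> (\<lambda>x. 1 / (1 + ?n * x))"
  proof (rule integrable_const_bound[where B=1])
    show "AE x in \<mu>. norm (1 / (1 + ?n * x)) \<le> 1" using pos
    proof eventually_elim
      case (elim x)
      then have "0 \<le> ?n * x" by simp
      then show ?case by simp
    qed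
  qed measurable
  have iB: "integrable \<mu> (\<lambda>x. real k * (1 + ?n * x) powr (- real k) / slit_angle z ^ Suc k)"
    by (intro integrable_divide integrable_mult_right G_integrable) simp
  have iA: "integrable \<mu> (\<lambda>x. real k * (1 - 1 / (1 + ?n * x)) / slit_angle z ^ Suc k)"
    by (intro integrable_divide integrable_mult_right Bochner_Integration.integrable_diff i1) auto
  have hm [measurable]: "h \<in> borel_measurable \<mu>" unfolding h_def by measurable
  have ih: "integrable \<mu> h"
  proof (rule Bochner_Integration.integrable_bound[OF iB hm], use pos in eventually_elim)
    case (elim x)
    show ?case unfolding real_norm_def using hB(1)[OF elim] hB(3)[OF elim] by linarith
  qed
  have "norm (z * F' z) = norm (LINT x|\<mu>. z * (- of_nat k * of_real x * indicator {0<..} x / (1 + z * of_real x) ^ Suc k))"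
    unfolding F'_def by (simp only: integral_mult_right_zero)
  also have "\<dots> \<le> (LINT x|\<mu>. indicator {0<..} x * h x)"
  proof (rule Bochner_Integration.integral_norm_bound_integral)
    show i: "integrable \<mu> (\<lambda>x. indicator {0<..} x * h x)"
      by (rule Bochner_Integration.integrable_bound[OF ih]) (auto simp: indicator_def)
    show *: "norm (z * (- of_nat k * of_real x * indicator {0<..} x / (1 + z * of_real x) ^ Suc k)) \<le> indicator {0<..} x * h x" for x
      using le[of x] by (cases "x > 0") auto
    show "integrable \<mu> (\<lambda>x. z * (- of_nat k * of_real x * indicator {0<..} x / (1 + z * of_real x) ^ Suc k))"
    proof (rule Bochner_Integration.integrable_bound[OF i _ AE_I2])
      show "norm (z * (- of_nat k * of_real x * indicator {0<..} x / (1 + z * of_real x) ^ Suc k)) \<le> norm (indicator {0<..} x * h x)" for x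
        using *[of x] by simp
    qed measurable
  qed
  finally have *: "norm (z * F' z) \<le> (LINT x|\<mu>. indicator {0<..} x * h x)" .
  have ij: "integrable \<mu> (\<lambda>x. indicator {0<..} x * h x)"
      by (rule Bochner_Integration.integrable_bound[OF ih]) (auto simp: indicator_def)
  have "(LINT x|\<mu>. indicator {0<..} x * h x) \<le> (LINT x|\<mu>. real k * (1 + ?n * x) powr (- real k) / slit_angle z ^ Suc k)"
    by (rule integral_mono_AE[OF ij iB], use pos in eventually_elim) (use hB(1) in simp)
  then show ?B using * by (simp add: G_def)
  have "(LINT x|\<mu>. indicator {0<..} x * h x) \<le> (LINT x|\<mu>. real k * (1 - 1 / (1 + ?n * x)) / slit_angle z ^ Suc k)"
    by (rule integral_mono_AE[OF ij iA], use pos in eventually_elim) (use hB(2) in simp)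
  also have "\<dots> = real k * (1 - (LINT x|\<mu>. 1 / (1 + norm z * x))) / slit_angle z ^ Suc k"
    using i1 by (simp add: prob_space)
  finally show ?A using * by simp
qed

lemma F_cnj: "F (cnj z) = cnj (F z)"
proof -
  have "cnj (F z) = (LINT x|\<mu>. cnj (indicator {0<..} x / (1 + z * of_real x) ^ k))"
    unfolding F_def by (rule Bochner_Integration.integral_cnj[symmetric])
  also have "\<dots> = F (cnj z)" unfolding F_def
    by (intro Bochner_Integration.integral_cong) (auto simp: indicator_def)
  finally show ?thesis by simp
qed

lemma G_tendsto_1: "(G \<longlongrightarrow> 1) (at_right 0)" and inverse_tendsto_1: "((\<lambda>r. LINT x|\<mu>. 1 / (1 + r * x)) \<longlongrightarrow> 1) (at_right 0)"
proof -
  have gen: "((\<lambda>r. LINT x|\<mu>. (1 + r * x) powr (- real j)) \<longlongrightarrow> 1) (at_right 0)" for j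
    unfolding tendsto_at_iff_sequentially
  proof (intro allI impI)
    fix X :: "nat \<Rightarrow> real" assume X: "\<forall>i. X i \<in> {0<..} - {0}" "X \<longlonglongrightarrow> 0"
    have "(\<lambda>n. LINT x|\<mu>. (1 + X n * x) powr (- real j)) \<longlonglongrightarrow> (LINT x|\<mu>. 1)"
    proof (rule integral_dominated_convergence[where w="\<lambda>_. 1"])
      show "AE x in \<mu>. (\<lambda>n. (1 + X n * x) powr (- real j)) \<longlonglongrightarrow> 1"
      proof (rule AE_I2)
        fix x
        have "(\<lambda>n. (1 + X n * x) powr (- real j)) \<longlonglongrightarrow> (1 + 0 * x) powr (- real j)"
          by (intro tendsto_intros X) auto
        then show "(\<lambda>n. (1 + X n * x) powr (- real j)) \<longlonglongrightarrow> 1" by simp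
      qed
      show "AE x in \<mu>. norm ((1 + X n * x) powr (- real j)) \<le> 1" for n
        using pos
      proof eventually_elim
        case (elim x)
        have "0 < X n" using X by auto
        then have "0 \<le> X n * x" using elim by simp
        then show ?case using powr_mono[of "- real j" 0 "1 + X n * x"] by simp
      qed
    qed measurable
    then show "((\<lambda>r. LINT x|\<mu>. (1 + r * x) powr (- real j)) \<circ> X) \<longlonglongrightarrow> 1" by (simp add: o_def prob_space)
  qed
  show "(G \<longlongrightarrow> 1) (at_right 0)" using gen[of k] by (simp add: G_def[abs_def])
  have "(LINT x|\<mu>. 1 / (1 + r * x)) = (LINT x|\<mu>. (1 + r * x) powr (- real 1))" if "0 < r" for r
    by (rule integral_cong_AE, measurable, use pos in eventually_elim) (use that in \<open>simp add: powr_minus_divide add_pos_pos\<close>)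
  then have "\<forall>\<^sub>F r in at_right 0. (LINT x|\<mu>. (1 + r * x) powr (- real 1)) = (LINT x|\<mu>. 1 / (1 + r * x))"
    by (auto simp: eventually_at_filter)
  then show "((\<lambda>r. LINT x|\<mu>. 1 / (1 + r * x)) \<longlongrightarrow> 1) (at_right 0)" by (rule Lim_transform_eventually[OF gen])
qed

end

section \<open>Alternating functions with a holomorphic extension\<close>

lemma mixed_difference_shift:
  "mixed_difference (\<lambda>w. f w - f (w + h)) hs w = mixed_difference f (h # hs) w"
proof (induction hs arbitrary: w)
  case (Cons h' hs)
  have "mixed_difference (\<lambda>w. f w - f (w + h)) (h' # hs) w =
    (mixed_difference f hs w - mixed_difference f hs (w + h)) - (mixed_difference f hs (w + h') - mixed_difference f hs (w + h' + h))"
    using Cons[of w] Cons[of "w + h'"] by simp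
  then show ?case by (simp add: add_ac)
qed simp

lemma alternating_differences_shift:
  assumes "alternating_differences f" "0 < h"
  shows "alternating_differences (\<lambda>w. f w - f (w + h))"
  unfolding alternating_differences_def mixed_difference_shift
proof (intro allI impI)
  fix hs :: "real list" and w :: real assume "\<forall>h\<in>set hs. 0 < h" "2 \<le> w"
  then have "\<forall>h\<in>set (h # hs). 0 < h" using assms(2) by simp
  then show "0 \<le> mixed_difference f (h # hs) w"
    using assms(1) \<open>2 \<le> w\<close> unfolding alternating_differences_def by blast
qed

text \<open>A difference quotient (R w - R (w + h)) / h of an alternating function is alternating,
  and so is its limit as h tends to 0. The limit exists and is the negative of the derivative
  because \<Psi> is holomorphic near [2, \<infinity>).\<close>

lemma alternating_differences_derivs:
  fixes \<Psi> :: "complex \<Rightarrow> complex" and f :: "real \<Rightarrow> real"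
  assumes hol: "\<Psi> holomorphic_on D" "open D" and D: "\<And>w. 2 \<le> w \<Longrightarrow> of_real w \<in> D"
    and eq: "\<And>w. 2 \<le> w \<Longrightarrow> \<Psi> (of_real w) = of_real (f w)" and alt: "alternating_differences f"
  shows "alternating_differences (\<lambda>w. Re ((- 1) ^ j * (deriv ^^ j) \<Psi> (of_real w)))"
proof (induction j)
  case 0
  show ?case using alt by (subst alternating_differences_cong[of _ f]) (auto simp: eq)
next
  case (Suc j)
  define R where "R = (\<lambda>w. Re ((- 1) ^ j * (deriv ^^ j) \<Psi> (of_real w)))"
  define h where "h = (\<lambda>n. inverse (real (Suc n)))"
  have h: "h n > 0" for n by (simp add: h_def)
  have h0: "(\<lambda>n. complex_of_real (h n)) \<longlonglongrightarrow> 0"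
    using tendsto_of_real[OF LIMSEQ_inverse_real_of_nat, where ?'a = complex] by (simp add: h_def)
  show ?case
  proof (rule alternating_differences_limit)
    fix n
    show "alternating_differences (\<lambda>w. inverse (h n) * (R w - R (w + h n)))"
      by (intro alternating_differences_cmult alternating_differences_shift h) (use Suc h[of n] in \<open>auto simp: R_def\<close>)
  next
    fix w :: real assume w: "2 \<le> w"
    have "((deriv ^^ j) \<Psi> has_field_derivative (deriv ^^ Suc j) \<Psi> (of_real w)) (at (of_real w))"
      using holomorphic_derivI[OF holomorphic_higher_deriv[OF hol] hol(2) D[OF w]] by simp
    then have "((\<lambda>z. (- 1) ^ j * (deriv ^^ j) \<Psi> z) has_field_derivative (- 1) ^ j * (deriv ^^ Suc j) \<Psi> (of_real w)) (at (of_real w))"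
      by (rule DERIV_cmult)
    then have lim: "(\<lambda>n. ((- 1) ^ j * (deriv ^^ j) \<Psi> (of_real w + of_real (h n)) - (- 1) ^ j * (deriv ^^ j) \<Psi> (of_real w)) / of_real (h n)) \<longlonglongrightarrow>
       (- 1) ^ j * (deriv ^^ Suc j) \<Psi> (of_real w)"
      unfolding DERIV_def tendsto_at_iff_sequentially o_def
      using h h0 by (elim allE[of _ "\<lambda>n. complex_of_real (h n)"] impE) (auto simp: less_imp_neq[symmetric])
    have "(\<lambda>n. - Re (((- 1) ^ j * (deriv ^^ j) \<Psi> (of_real w + of_real (h n)) - (- 1) ^ j * (deriv ^^ j) \<Psi> (of_real w)) / of_real (h n))) \<longlonglongrightarrow>
       - Re ((- 1) ^ j * (deriv ^^ Suc j) \<Psi> (of_real w))"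
      by (intro tendsto_minus tendsto_Re lim)
    also have "(\<lambda>n. - Re (((- 1) ^ j * (deriv ^^ j) \<Psi> (of_real w + of_real (h n)) - (- 1) ^ j * (deriv ^^ j) \<Psi> (of_real w)) / of_real (h n))) =
      (\<lambda>n. inverse (h n) * (R w - R (w + h n)))"
    proof
      fix n
      show "- Re (((- 1) ^ j * (deriv ^^ j) \<Psi> (of_real w + of_real (h n)) - (- 1) ^ j * (deriv ^^ j) \<Psi> (of_real w)) / of_real (h n)) =
        inverse (h n) * (R w - R (w + h n))"
        by (simp only: Re_divide_of_real minus_complex.sel R_def of_real_add) (simp add: divide_inverse algebra_simps)
    qed
    also have "- Re ((- 1) ^ j * (deriv ^^ Suc j) \<Psi> (of_real w)) = Re ((- 1) ^ Suc j * (deriv ^^ Suc j) \<Psi> (of_real w))"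
      by simp
    finally show "(\<lambda>n. inverse (h n) * (R w - R (w + h n))) \<longlonglongrightarrow> Re ((- 1) ^ Suc j * (deriv ^^ Suc j) \<Psi> (of_real w))" .
  qed
qed

text \<open>In the variable t the Taylor series of Re (\<Psi> (3 - t)) has nonnegative coefficients,
  so it is nondecreasing for t \<ge> 0. The radius 5 reaches from 3 exactly to -2 = 2 cos \<pi>,
  hence covers every point 2 cos \<eta> with 0 \<le> \<eta> < \<pi>.\<close>

lemma Re_mono_left_of_alternating:
  fixes \<Psi> :: "complex \<Rightarrow> complex" and f :: "real \<Rightarrow> real"
  assumes hol: "\<Psi> holomorphic_on D" "open D" and D: "\<And>w. 2 \<le> w \<Longrightarrow> of_real w \<in> D" "ball 3 5 \<subseteq> D"
    and eq: "\<And>w. 2 \<le> w \<Longrightarrow> \<Psi> (of_real w) = of_real (f w)" and alt: "alternating_differences f"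
    and st: "0 \<le> s" "s \<le> t" "t < 5"
  shows "Re (\<Psi> (of_real (3 - s))) \<le> Re (\<Psi> (of_real (3 - t)))"
proof -
  define c where "c = (\<lambda>j. Re ((- 1) ^ j * (deriv ^^ j) \<Psi> (of_real 3)))"
  have c: "0 \<le> c j" for j
    using alternating_differences_derivs[OF hol D(1) eq alt, of j]
    unfolding alternating_differences_def c_def by (metis mixed_difference.simps(1) empty_iff list.set(1) numeral_le_iff semiring_norm(69) semiring_norm(72) order_refl semiring_norm(71))
  have ser: "(\<lambda>j. c j / fact j * t ^ j) sums Re (\<Psi> (of_real (3 - t)))" if t: "0 \<le> t" "t < 5" for t
  proof -
    have "(\<lambda>j. (deriv ^^ j) \<Psi> 3 / fact j * (of_real (3 - t) - 3) ^ j) sums \<Psi> (of_real (3 - t))"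
      by (rule holomorphic_power_series[of _ _ 5]) (use hol D t in \<open>auto intro: holomorphic_on_subset simp: dist_norm\<close>)
    then have "(\<lambda>j. Re ((deriv ^^ j) \<Psi> 3 / fact j * (of_real (3 - t) - 3) ^ j)) sums Re (\<Psi> (of_real (3 - t)))"
      by (rule sums_Re)
    moreover have "Re ((deriv ^^ j) \<Psi> 3 / fact j * (of_real (3 - t) - 3) ^ j) = c j / fact j * t ^ j" for j
    proof -
      have "(deriv ^^ j) \<Psi> 3 / fact j * (of_real (3 - t) - 3) ^ j = (t ^ j / fact j) *\<^sub>R ((- 1) ^ j * (deriv ^^ j) \<Psi> (of_real 3))"
        by (simp add: power_minus[of "complex_of_real t"] scaleR_conv_of_real)
      then show ?thesis by (simp only: scaleR_complex.sel c_def) simp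
    qed
    ultimately show ?thesis by simp
  qed
  show ?thesis
    by (rule sums_le[OF _ ser ser]) (use st c in \<open>auto intro!: mult_left_mono power_mono divide_right_mono\<close>)
qed

lemma square_notin_nonpos_Reals:
  assumes "0 < Re z" "0 < u"
  shows "of_real u * z\<^sup>2 \<notin> \<real>\<^sub>\<le>\<^sub>0"
proof
  assume "of_real u * z\<^sup>2 \<in> \<real>\<^sub>\<le>\<^sub>0"
  then have 1: "Im (of_real u * z\<^sup>2) = 0" "Re (of_real u * z\<^sup>2) \<le> 0" by (auto simp: complex_nonpos_Reals_iff)
  then have "Im z = 0" using assms by (simp add: power2_eq_square)
  then have "Re (of_real u * z\<^sup>2) = u * (Re z)\<^sup>2" by (simp add: power2_eq_square)
  then show False using 1(2) assms by (simp add: mult_le_0_iff)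
qed

lemma Re_csqrt_pos:
  assumes "w \<notin> \<real>\<^sub>\<le>\<^sub>0" shows "0 < Re (csqrt w)"
proof (rule ccontr)
  assume "\<not> 0 < Re (csqrt w)"
  then have "Re (csqrt w) = 0" using Re_csqrt[of w] by linarith
  then have "(csqrt w)\<^sup>2 = - of_real ((Im (csqrt w))\<^sup>2)"
    by (simp add: complex_eq_iff power2_eq_square)
  then have "w = of_real (- ((Im (csqrt w))\<^sup>2))" by simp
  then have "w \<in> \<real>\<^sub>\<le>\<^sub>0" by (metis nonpos_Reals_of_real_iff neg_le_0_iff_le zero_le_power2)
  then show False using assms by simp
qed

text \<open>Since (a + b) (a - b) = 4, the second factor is a positive multiple of the conjugate of
  the first. The real parts therefore have the same sign, and their sum 2 Re a is positive.\<close>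

lemma Re_pos_of_product:
  fixes a b :: complex
  assumes "0 < Re a" "a\<^sup>2 - b\<^sup>2 = 4"
  shows "0 < Re (a + b)" "0 < Re (a - b)"
proof -
  have p: "(a + b) * (a - b) = 4" using assms(2) by (simp add: power2_eq_square algebra_simps)
  define s where "s = a + b"
  have s0: "s \<noteq> 0" using p by (auto simp: s_def)
  have "a - b = 4 / s" using p s0 by (simp add: s_def field_simps)
  then have Re: "Re (a - b) = 4 * Re s / (norm s)\<^sup>2" by (simp add: Re_divide cmod_power2)
  have n: "0 < (norm s)\<^sup>2" using s0 by simp
  have sum: "Re s + Re (a - b) = 2 * Re a" by (simp add: s_def)
  have "0 < Re s"
  proof (rule ccontr)
    assume "\<not> 0 < Re s"
    then have "Re (a - b) \<le> 0" unfolding Re using n by (intro divide_nonpos_pos) auto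
    then show False using sum assms(1) \<open>\<not> 0 < Re s\<close> by linarith
  qed
  then show "0 < Re (a + b)" "0 < Re (a - b)" unfolding Re using n by (auto simp: s_def)
qed

section \<open>Growth of the modulus along circles\<close>

locale alternating_mixture = power_mixture +
  assumes alt: "\<And>u. 0 < u \<Longrightarrow> alternating_differences (\<lambda>w. G (u * joukowski_inverse w) * G (u / joukowski_inverse w))"
begin

text \<open>
  With \<open>a = csqrt (w + 2)\<close> and \<open>b = csqrt (w - 2)\<close>, the solutions of \<open>v + 1 / v = w\<close> are
  \<open>((a + b) / 2)\<^sup>2\<close> and \<open>((a - b) / 2)\<^sup>2\<close>. The product is even in \<open>b\<close>, which removes the cut of \<open>b\<close>.
\<close>

definition \<Psi>0 :: "real \<Rightarrow> complex \<Rightarrow> complex \<Rightarrow> complex" where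
  "\<Psi>0 u a b = F (of_real u * ((a + b) / 2)\<^sup>2) * F (of_real u * ((a - b) / 2)\<^sup>2)"

definition \<Psi> :: "real \<Rightarrow> complex \<Rightarrow> complex" where
  "\<Psi> u w = \<Psi>0 u (csqrt (w + 2)) (csqrt (w - 2))"

definition D :: "complex set" where "D = {w. w + 2 \<notin> \<real>\<^sub>\<le>\<^sub>0}"

lemma \<Psi>0_minus: "\<Psi>0 u a (- b) = \<Psi>0 u a b"
  by (simp add: \<Psi>0_def mult.commute)

lemma open_D: "open D"
proof -
  have "open ((\<lambda>w. w + 2) -` (- \<real>\<^sub>\<le>\<^sub>0 :: complex set))"
    by (intro open_vimage continuous_intros) (simp add: open_Compl)
  then show ?thesis by (simp add: D_def vimage_def)
qed

lemma D_pos: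
  assumes "w \<in> D" "b\<^sup>2 = w - 2"
  shows "0 < Re ((csqrt (w + 2) + b) / 2)" "0 < Re ((csqrt (w + 2) - b) / 2)"
  using Re_pos_of_product[of "csqrt (w + 2)" b] Re_csqrt_pos[of "w + 2"] assms by (auto simp: D_def)

lemma \<Psi>0_holomorphic:
  assumes u: "0 < u" and U: "U \<subseteq> D" and b: "b holomorphic_on U" "\<And>w. w \<in> U \<Longrightarrow> (b w)\<^sup>2 = w - 2"
  shows "(\<lambda>w. \<Psi>0 u (csqrt (w + 2)) (b w)) holomorphic_on U"
proof -
  have c: "(\<lambda>w. csqrt (w + 2)) holomorphic_on U"
    using U by (intro holomorphic_intros) (auto simp: D_def)
  have "(\<lambda>w. F (of_real u * ((csqrt (w + 2) + b w) / 2)\<^sup>2)) holomorphic_on U"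
    "(\<lambda>w. F (of_real u * ((csqrt (w + 2) - b w) / 2)\<^sup>2)) holomorphic_on U"
    using square_notin_nonpos_Reals[OF D_pos(1)[OF subsetD[OF U] b(2)] u] square_notin_nonpos_Reals[OF D_pos(2)[OF subsetD[OF U] b(2)] u]
    by (auto simp del: csqrt.simps intro!: holomorphic_on_compose_gen[OF _ F_holomorphic, unfolded o_def] holomorphic_intros c b)
  then show ?thesis unfolding \<Psi>0_def by (rule holomorphic_on_mult)
qed

text \<open>The root \<open>csqrt (w - 2)\<close> is holomorphic off (-\<infinity>, 2]. Off [2,
  \<infinity>) it may be replaced by i times \<open>csqrt (2 - w)\<close>, which agrees with it up
  to sign, and evenness makes the sign immaterial. The two regions leave out only the point 2, where
  continuity removes the singularity.\<close>

lemma \<Psi>_holomorphic: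
  assumes u: "0 < u"
  shows "\<Psi> u holomorphic_on D"
proof (rule no_isolated_singularity[where K="{2}"])
  define U1 where "U1 = D \<inter> {w. w - 2 \<notin> \<real>\<^sub>\<le>\<^sub>0}"
  define U2 where "U2 = D \<inter> {w. 2 - w \<notin> \<real>\<^sub>\<le>\<^sub>0}"
  have o: "open U1" "open U2"
  proof -
    have "open ((\<lambda>w. w - 2) -` (- \<real>\<^sub>\<le>\<^sub>0 :: complex set))" "open ((\<lambda>w. 2 - w) -` (- \<real>\<^sub>\<le>\<^sub>0 :: complex set))"
      by (intro open_vimage continuous_intros; simp add: open_Compl)+
    then show "open U1" "open U2" unfolding U1_def U2_def using open_D by (auto simp: vimage_def)
  qed
  have 1: "\<Psi> u holomorphic_on U1"
    unfolding \<Psi>_def by (rule \<Psi>0_holomorphic[OF u]) (auto simp: U1_def intro!: holomorphic_intros)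
  have "(\<lambda>w. \<Psi>0 u (csqrt (w + 2)) (\<i> * csqrt (2 - w))) holomorphic_on U2"
    by (rule \<Psi>0_holomorphic[OF u]) (auto simp: U2_def power_mult_distrib intro!: holomorphic_intros)
  moreover have "\<Psi>0 u (csqrt (w + 2)) (\<i> * csqrt (2 - w)) = \<Psi> u w" for w
  proof -
    have "(csqrt (w - 2))\<^sup>2 = (\<i> * csqrt (2 - w))\<^sup>2" by (simp add: power_mult_distrib)
    then have "csqrt (w - 2) = \<i> * csqrt (2 - w) \<or> csqrt (w - 2) = - (\<i> * csqrt (2 - w))" by (simp only: power2_eq_iff)
    then show ?thesis unfolding \<Psi>_def by (metis \<Psi>0_minus)
  qed
  ultimately have 2: "\<Psi> u holomorphic_on U2" by simp
  have "D - {2} \<subseteq> U1 \<union> U2"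
    by (auto simp: U1_def U2_def complex_nonpos_Reals_iff complex_eq_iff)
  then show hol: "\<Psi> u holomorphic_on D - {2}"
    using holomorphic_on_Un[OF 1 2 o] holomorphic_on_subset by blast
  show "continuous_on D (\<Psi> u)"
    unfolding continuous_on_eq_continuous_at[OF open_D]
  proof
    fix w assume w: "w \<in> D"
    show "isCont (\<Psi> u) w"
    proof (cases "w = 2")
      case False
      have "open (D - {2})" using open_D by auto
      then show ?thesis using holomorphic_on_imp_continuous_on[OF hol] w False
        by (simp add: continuous_on_eq_continuous_at)
    next
      case True
      have bt: "((\<lambda>w. csqrt (w - 2)) \<longlongrightarrow> 0) (at 2)"
      proof (rule tendsto_norm_zero_cancel)
        have "((\<lambda>w::complex. sqrt (norm (w - 2))) \<longlongrightarrow> sqrt (norm (2 - 2 :: complex))) (at 2)"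
          by (intro tendsto_intros)
        then show "((\<lambda>w. norm (csqrt (w - 2))) \<longlongrightarrow> 0) (at 2)" by simp
      qed
      have at: "((\<lambda>w. csqrt (w + 2)) \<longlongrightarrow> csqrt (2 + 2)) (at 2)"
      proof -
        have "isCont (\<lambda>w. csqrt (w + 2)) 2"
          by (intro isCont_csqrt' continuous_intros) (auto simp: complex_nonpos_Reals_iff)
        then show ?thesis by (simp only: isCont_def)
      qed
      have c4: "csqrt (2 + 2) = 2" using csqrt_of_real_nonneg[of 4] by (simp add: real_sqrt_eq_iff)
      have Fc: "isCont F (of_real u)"
        using u by (intro DERIV_isCont[OF F_has_field_derivative]) simp
      have "((\<lambda>w. of_real u * ((csqrt (w + 2) + csqrt (w - 2)) / 2)\<^sup>2) \<longlongrightarrow> of_real u * ((2 + 0) / 2)\<^sup>2) (at 2)"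
        "((\<lambda>w. of_real u * ((csqrt (w + 2) - csqrt (w - 2)) / 2)\<^sup>2) \<longlongrightarrow> of_real u * ((2 - 0) / 2)\<^sup>2) (at 2)"
        using at bt unfolding c4 by (intro tendsto_intros; simp)+
      then have "((\<lambda>w. \<Psi> u w) \<longlongrightarrow> F (of_real u) * F (of_real u)) (at 2)"
        unfolding \<Psi>_def \<Psi>0_def by (intro tendsto_mult isCont_tendsto_compose[OF Fc]) simp_all
      moreover have "\<Psi> u 2 = F (of_real u) * F (of_real u)"
        unfolding \<Psi>_def \<Psi>0_def c4 by simp
      ultimately show ?thesis by (simp add: isCont_def True)
    qed
  qed
qed (auto simp: open_D)

lemma \<Psi>_of_real:
  assumes u: "0 < u" and w: "2 \<le> w"
  shows "\<Psi> u (of_real w) = of_real (G (u * joukowski_inverse w) * G (u / joukowski_inverse w))"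
proof -
  define a where "a = sqrt (w + 2)"
  define b where "b = sqrt (w - 2)"
  have c: "csqrt (of_real w + 2) = of_real a" "csqrt (of_real w - 2) = of_real b"
    using csqrt_of_real_nonneg[of "w + 2"] csqrt_of_real_nonneg[of "w - 2"] w by (simp_all add: a_def b_def)
  have ab: "a\<^sup>2 = w + 2" "b\<^sup>2 = w - 2" "a * b = sqrt (w\<^sup>2 - 4)"
    using w by (simp_all add: a_def b_def real_sqrt_mult[symmetric] algebra_simps power2_eq_square)
  have J: "((a + b) / 2)\<^sup>2 = joukowski_inverse w"
    using ab by (simp add: joukowski_inverse_def power2_eq_square field_simps)
  have J0: "joukowski_inverse w > 0" by (rule joukowski_inverse(1)[OF w])
  have "((a - b) / 2)\<^sup>2 * ((a + b) / 2)\<^sup>2 = ((a\<^sup>2 - b\<^sup>2) / 4)\<^sup>2" by (simp add: power2_eq_square field_simps)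
  also have "\<dots> = 1" using ab by simp
  finally have J': "((a - b) / 2)\<^sup>2 = 1 / joukowski_inverse w" using J J0 by (simp add: field_simps)
  have "of_real u * ((of_real a + of_real b) / 2)\<^sup>2 = complex_of_real (u * ((a + b) / 2)\<^sup>2)" by simp
  moreover have "of_real u * ((of_real a - of_real b) / 2)\<^sup>2 = complex_of_real (u * ((a - b) / 2)\<^sup>2)" by simp
  ultimately show ?thesis
    unfolding \<Psi>_def \<Psi>0_def c J J' using u J0 by (simp only: F_of_real mult_pos_pos J J' divide_pos_pos zero_less_one) (simp add: F_of_real)
qed

text \<open>At w = 2 cos \<eta> the two roots are 2 cos (\<eta> / 2) and 2 i sin (\<eta> / 2), so
  the two arguments of \<open>F\<close> are u e^(i \<eta>) and its conjugate, and so are the values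
  of \<open>F\<close>.\<close>

lemma \<Psi>_cos:
  assumes u: "0 < u" and \<eta>: "0 \<le> \<eta>" "\<eta> < pi"
  shows "\<Psi> u (of_real (2 * cos \<eta>)) = of_real ((norm (F (of_real u * cis \<eta>)))\<^sup>2)"
proof -
  have c0: "0 < cos (\<eta> / 2)" using \<eta> by (intro cos_gt_zero_pi) auto
  have s0: "0 \<le> sin (\<eta> / 2)" using \<eta> by (intro sin_ge_zero) auto
  have c2: "2 * cos \<eta> + 2 = (2 * cos (\<eta> / 2))\<^sup>2" "2 * cos \<eta> - 2 = - ((2 * sin (\<eta> / 2))\<^sup>2)"
    using cos_double_cos[of "\<eta> / 2"] cos_double_sin[of "\<eta> / 2"] by (simp_all add: power2_eq_square sin_cos_squared_add3)
  have a: "csqrt (of_real (2 * cos \<eta>) + 2) = of_real (2 * cos (\<eta> / 2))"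
  proof -
    have "of_real (2 * cos \<eta>) + 2 = (complex_of_real (2 * cos (\<eta> / 2)))\<^sup>2"
      using arg_cong[OF c2(1), of complex_of_real] by simp
    then show ?thesis using c0 by (simp only:) (rule csqrt_square, simp)
  qed
  have b: "csqrt (of_real (2 * cos \<eta>) - 2) = \<i> * of_real (2 * sin (\<eta> / 2))"
  proof -
    have "of_real (2 * cos \<eta>) - 2 = (\<i> * complex_of_real (2 * sin (\<eta> / 2)))\<^sup>2"
      using arg_cong[OF c2(2), of complex_of_real] by (simp add: power_mult_distrib)
    then show ?thesis using s0 by (simp only:) (rule csqrt_square, auto)
  qed
  have e1: "((of_real (2 * cos (\<eta> / 2)) + \<i> * of_real (2 * sin (\<eta> / 2))) / 2)\<^sup>2 = cis \<eta>"
  proof -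
    have "(of_real (2 * cos (\<eta> / 2)) + \<i> * of_real (2 * sin (\<eta> / 2))) / 2 = cis (\<eta> / 2)"
      by (simp add: complex_eq_iff)
    then show ?thesis by (simp add: power2_eq_square cis_mult)
  qed
  have e2: "((of_real (2 * cos (\<eta> / 2)) - \<i> * of_real (2 * sin (\<eta> / 2))) / 2)\<^sup>2 = cnj (cis \<eta>)"
  proof -
    have "(of_real (2 * cos (\<eta> / 2)) - \<i> * of_real (2 * sin (\<eta> / 2))) / 2 = cis (- (\<eta> / 2))"
      by (simp add: complex_eq_iff)
    then show ?thesis by (simp add: power2_eq_square cis_mult cis_cnj)
  qed
  have "of_real u * cnj (cis \<eta>) = cnj (of_real u * cis \<eta>)" by simp
  then show ?thesis
    unfolding \<Psi>_def \<Psi>0_def a b e1 e2 by (simp only: F_cnj complex_norm_square)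
qed

lemma F_modulus_mono:
  assumes u: "0 < u" and \<eta>: "0 \<le> \<eta>1" "\<eta>1 \<le> \<eta>2" "\<eta>2 < pi"
  shows "norm (F (of_real u * cis \<eta>1)) \<le> norm (F (of_real u * cis \<eta>2))"
proof -
  have cm: "cos \<eta>2 \<le> cos \<eta>1" using \<eta> by (intro cos_monotone_0_pi_le) auto
  have c1: "- 1 < cos \<eta>2" using \<eta> cos_monotone_0_pi[of \<eta>2 pi] by simp
  have "Re (\<Psi> u (of_real (3 - (3 - 2 * cos \<eta>1)))) \<le> Re (\<Psi> u (of_real (3 - (3 - 2 * cos \<eta>2))))"
  proof (rule Re_mono_left_of_alternating[OF \<Psi>_holomorphic[OF u] open_D])
    show "of_real w \<in> D" if "2 \<le> w" for w using that by (auto simp: D_def complex_nonpos_Reals_iff)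
    show "ball 3 5 \<subseteq> D"
    proof
      fix w :: complex assume "w \<in> ball 3 5"
      then have "norm (3 - w) < 5" by (simp add: dist_norm)
      then have "\<bar>Re (3 - w)\<bar> < 5" using abs_Re_le_cmod[of "3 - w"] by linarith
      then show "w \<in> D" by (auto simp: D_def complex_nonpos_Reals_iff)
    qed
    show "\<Psi> u (of_real w) = of_real (G (u * joukowski_inverse w) * G (u / joukowski_inverse w))" if "2 \<le> w" for w
      by (rule \<Psi>_of_real[OF u that])
    show "0 \<le> 3 - 2 * cos \<eta>1" using cos_le_one[of \<eta>1] by linarith
  qed (use alt[OF u] cm c1 in auto)
  then have "(norm (F (of_real u * cis \<eta>1)))\<^sup>2 \<le> (norm (F (of_real u * cis \<eta>2)))\<^sup>2"
    using \<Psi>_cos[OF u, of \<eta>1] \<Psi>_cos[OF u, of \<eta>2] \<eta> by simp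
  then show ?thesis by (rule power2_le_imp_le) simp
qed

lemma F_modulus_ge:
  assumes u: "0 < u" and \<eta>: "\<bar>\<eta>\<bar> < pi"
  shows "G u \<le> norm (F (of_real u * cis \<eta>))"
proof -
  have pos: "G u \<le> norm (F (of_real u * cis \<eta>))" if "0 \<le> \<eta>" "\<eta> < pi" for \<eta>
    using F_modulus_mono[OF u, of 0 \<eta>] that u F_of_real[OF u] G_pos[of u] by simp
  show ?thesis
  proof (cases "0 \<le> \<eta>")
    case False
    have "of_real u * cis \<eta> = cnj (of_real u * cis (- \<eta>))" by (simp add: cis_cnj)
    then have "norm (F (of_real u * cis \<eta>)) = norm (F (of_real u * cis (- \<eta>)))"
      by (simp only: F_cnj complex_mod_cnj)
    then show ?thesis using pos[of "- \<eta>"] False \<eta> by simp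
  qed (use pos \<eta> in auto)
qed

end

section \<open>Representation of the logarithm on a strip\<close>

lemma has_contour_integral_linepath_shift:
  "(f has_contour_integral I) (linepath (a + w) (b + w)) \<longleftrightarrow> ((\<lambda>z. f (z + w)) has_contour_integral I) (linepath a b)"
proof -
  have "linepath (a + w) (b + w) t = linepath a b t + w" for t
    by (simp add: linepath_def algebra_simps scaleR_conv_of_real)
  then show ?thesis by (simp add: has_contour_integral_linepath)
qed

lemma contour_integral_linepath_same_Im:
  assumes "a < b" "f contour_integrable_on linepath (Complex a c) (Complex b c)"
  shows "((\<lambda>t. f (Complex t c)) has_integral contour_integral (linepath (Complex a c) (Complex b c)) f) {a..b}"
proof -
  have e: "Complex a c = of_real a + \<i> * of_real c" "Complex b c = of_real b + \<i> * of_real c"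
    by (simp_all add: complex_eq_iff)
  have "(f has_contour_integral contour_integral (linepath (Complex a c) (Complex b c)) f) (linepath (of_real a + \<i> * of_real c) (of_real b + \<i> * of_real c))"
    using has_contour_integral_integral[OF assms(2)] by (simp only: e)
  then have "((\<lambda>t. f (of_real t + \<i> * of_real c)) has_integral contour_integral (linepath (Complex a c) (Complex b c)) f) {a..b}"
    using assms(1) by (simp add: has_contour_integral_linepath_shift has_contour_integral_linepath_Reals_iff)
  moreover have "of_real t + \<i> * of_real c = Complex t c" for t by (simp add: complex_eq_iff)
  ultimately show ?thesis by simp
qed

lemma exp_minus_one_nonzero:
  fixes z :: complex
  assumes "z \<noteq> 0" "\<bar>Im z\<bar> < 2 * pi"
  shows "exp z - 1 \<noteq> 0"
proof
  assume "exp z - 1 = 0"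
  then have "exp z = 1" by simp
  then obtain n :: int where n: "Re z = 0" "Im z = of_int (2 * n) * pi" by (auto simp: exp_eq_1)
  have "n \<noteq> 0" using n assms(1) by (auto simp: complex_eq_iff)
  then have "1 \<le> \<bar>real_of_int n\<bar>" by linarith
  then have "2 * pi * 1 \<le> 2 * pi * \<bar>real_of_int n\<bar>" by (intro mult_left_mono) auto
  then show False using assms(2) n(2) by (simp add: abs_mult)
qed

text \<open>
  Cauchy's formula on the rectangle \<open>[-R, R] \<times> [-\<pi>, \<pi>]\<close> with the kernel \<open>1 / (exp (z - x) - 1)\<close>,
  which is real on the horizontal sides.
\<close>

lemma strip_Cauchy:
  fixes f :: "complex \<Rightarrow> complex" and c x R :: real
  assumes c: "pi < c" "c < 2 * pi" and hol: "f holomorphic_on {z. \<bar>Im z\<bar> < c}"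
    and cnj: "\<And>z. \<bar>Im z\<bar> < c \<Longrightarrow> f (cnj z) = cnj (f z)"
    and R: "\<bar>x\<bar> < R"
    and bR: "\<And>y. \<bar>y\<bar> \<le> pi \<Longrightarrow> norm (f (Complex R y)) \<le> BR" and bL: "\<And>y. \<bar>y\<bar> \<le> pi \<Longrightarrow> norm (f (Complex (- R) y)) \<le> BL"
  shows "\<exists>V. norm V \<le> BR / (exp (R - x) - 1) + BL / (1 - exp (- R - x)) \<and>
     ((\<lambda>t. Im (f (Complex t pi)) / pi / (1 + exp (t - x))) has_integral Re (f (of_real x) - V)) {-R..R}"
proof -
  define S where "S = {z :: complex. \<bar>Im z\<bar> < c}"
  have S_box: "S = {z. Im z < c} \<inter> {z. - c < Im z}" by (auto simp: S_def abs_less_iff)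
  have oS: "open S" and cS: "convex S"
    unfolding S_box by (auto intro!: open_Int convex_Int simp: open_halfspace_Im_lt open_halfspace_Im_gt convex_halfspace_Im_lt convex_halfspace_Im_gt)
  have xS: "of_real x \<in> S" using c by (auto simp: S_def intro: less_trans[OF pi_gt_zero])
  \<comment> \<open>Division by \<open>E\<close> leaves the simple pole at \<open>x\<close> to the
    factor 1 / (z - x) of Cauchy's formula. The other zeros of exp (z - x) - 1 are at distance at
    least 2 \<pi> from the real axis, outside the strip since c < 2 \<pi>.\<close>
  define E where "E = (\<lambda>z. if z = of_real x then 1 else (exp (z - of_real x) - 1) / (z - of_real x) :: complex)"
  have "(\<lambda>z. if z = of_real x then deriv (\<lambda>z. exp (z - of_real x)) (of_real x) else (exp (z - of_real x) - exp (of_real x - of_real x)) / (z - of_real x)) holomorphic_on S"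
    by (rule pole_lemma) (use oS xS in \<open>auto intro!: holomorphic_intros simp: interior_open\<close>)
  moreover have "deriv (\<lambda>z. exp (z - of_real x)) (of_real x) = (1 :: complex)"
    by (intro DERIV_imp_deriv) (auto intro!: derivative_eq_intros)
  ultimately have Eh: "E holomorphic_on S" unfolding E_def by (simp cong: if_cong)
  have E0: "E z \<noteq> 0" if "z \<in> S" for z
    using exp_minus_one_nonzero[of "z - of_real x"] that c by (auto simp: E_def S_def)
  define q where "q = (\<lambda>z. f z / E z)"
  have qh: "q holomorphic_on S" unfolding q_def using hol Eh E0 by (intro holomorphic_on_divide) (auto simp: S_def)
  define h where "h = (\<lambda>z. f z / (exp (z - of_real x) - 1))"
  define a1 where "a1 = Complex (- R) (- pi)"
  define a3 where "a3 = Complex R pi"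
  have R0: "0 < R" using R by linarith
  have xb: "of_real x \<in> box a1 a3" using R by (auto simp: a1_def a3_def in_box_complex_iff abs_less_iff)
  have pS: "path_image (rectpath a1 a3) \<subseteq> S - {of_real x}"
  proof -
    have "path_image (rectpath a1 a3) \<subseteq> cbox a1 a3"
      by (rule path_image_rectpath_subset_cbox) (use R0 in \<open>auto simp: a1_def a3_def\<close>)
    moreover have "cbox a1 a3 \<subseteq> S" using c by (auto simp: a1_def a3_def S_def in_cbox_complex_iff)
    moreover have "path_image (rectpath a1 a3) \<inter> box a1 a3 = {}"
      by (rule path_image_rectpath_inter_box) (use R0 in \<open>auto simp: a1_def a3_def\<close>)
    ultimately show ?thesis using xb by blast
  qed
  have "((\<lambda>w. q w / (w - of_real x)) has_contour_integral (2 * pi * \<i> * winding_number (rectpath a1 a3) (of_real x) * q (of_real x))) (rectpath a1 a3)"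
    by (rule Cauchy_integral_formula_convex_simple[OF cS qh]) (use oS xS pS in \<open>auto simp: interior_open\<close>)
  then have "((\<lambda>w. q w / (w - of_real x)) has_contour_integral (2 * pi * \<i> * f (of_real x))) (rectpath a1 a3)"
    using winding_number_rectpath[OF xb] by (simp add: q_def E_def)
  moreover have "q w / (w - of_real x) = h w" if "w \<in> path_image (rectpath a1 a3)" for w
    using that pS by (auto simp: q_def E_def h_def)
  ultimately have tot: "(h has_contour_integral (2 * pi * \<i> * f (of_real x))) (rectpath a1 a3)"
    by (rule has_contour_integral_eq)
  define a2 where "a2 = Complex R (- pi)"
  define a4 where "a4 = Complex (- R) pi"
  have rp: "rectpath a1 a3 = linepath a1 a2 +++ linepath a2 a3 +++ linepath a3 a4 +++ linepath a4 a1"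
    by (simp add: rectpath_def Let_def a1_def a2_def a3_def a4_def)
  have ex0: "exp (z - of_real x) - 1 \<noteq> 0" if "z \<in> S - {of_real x}" for z
    using exp_minus_one_nonzero[of "z - of_real x"] that c by (auto simp: S_def)
  have hc: "continuous_on (S - {of_real x}) h"
    unfolding h_def using holomorphic_on_imp_continuous_on[OF hol] ex0
    by (intro continuous_intros) (auto intro: continuous_on_subset simp: S_def)
  have pim: "path_image (rectpath a1 a3) = closed_segment a1 a2 \<union> (closed_segment a2 a3 \<union> (closed_segment a3 a4 \<union> closed_segment a4 a1))"
    unfolding rp by (simp add: path_image_join)
  have i: "h contour_integrable_on linepath a1 a2" "h contour_integrable_on linepath a2 a3"
     "h contour_integrable_on linepath a3 a4" "h contour_integrable_on linepath a4 a1"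
    using pS unfolding pim by (auto intro!: contour_integrable_continuous_linepath continuous_on_subset[OF hc])
  have sum: "2 * pi * \<i> * f (of_real x) = contour_integral (linepath a1 a2) h + contour_integral (linepath a2 a3) h + contour_integral (linepath a3 a4) h + contour_integral (linepath a4 a1) h"
    using contour_integral_unique[OF tot] i unfolding rp by (simp add: contour_integrable_join contour_integral_join add.assoc)
  have I1: "((\<lambda>t. h (Complex t (- pi))) has_integral contour_integral (linepath a1 a2) h) {-R..R}"
    using contour_integral_linepath_same_Im[of "- R" R h "- pi"] R0 i(1) by (simp add: a1_def a2_def)
  have rev: "contour_integral (linepath a3 a4) h = - contour_integral (linepath a4 a3) h"
    by (rule contour_integral_reverse_linepath) (use pS pim in \<open>auto simp: closed_segment_commute intro!: continuous_on_subset[OF hc]\<close>)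
  have i43: "h contour_integrable_on linepath a4 a3"
    using pS unfolding pim by (auto intro!: contour_integrable_continuous_linepath continuous_on_subset[OF hc] simp: closed_segment_commute[of a4])
  have I3: "((\<lambda>t. h (Complex t pi)) has_integral - contour_integral (linepath a3 a4) h) {-R..R}"
    using contour_integral_linepath_same_Im[of "- R" R h pi] R0 i43 unfolding rev by (simp add: a3_def a4_def)
  define V where "V = (contour_integral (linepath a2 a3) h + contour_integral (linepath a4 a1) h) / (2 * pi * \<i>)"
  have I: "((\<lambda>t. h (Complex t (- pi)) - h (Complex t pi)) has_integral 2 * pi * \<i> * (f (of_real x) - V)) {-R..R}"
  proof -
    have "2 * pi * \<i> * (f (of_real x) - V) = contour_integral (linepath a1 a2) h - - contour_integral (linepath a3 a4) h"
      unfolding V_def right_diff_distrib sum by simp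
    then show ?thesis using has_integral_diff[OF I1 I3] by simp
  qed
  \<comment> \<open>On both horizontal sides exp (z - x) equals - exp (t - x), and \<open>f\<close>
    takes conjugate values there; so the real parts cancel and only Im f on the upper side
    survives.\<close>
  have hh: "h (Complex t (- pi)) - h (Complex t pi) = 2 * pi * \<i> * of_real (Im (f (Complex t pi)) / pi / (1 + exp (t - x)))" for t
  proof -
    have e: "exp (Complex t (- pi) - of_real x) = - of_real (exp (t - x))" "exp (Complex t pi - of_real x) = - of_real (exp (t - x))"
      by (simp_all add: complex_eq_iff Re_exp Im_exp)
    have f: "f (Complex t (- pi)) = cnj (f (Complex t pi))"
      using cnj[of "Complex t pi"] c by (simp add: complex_cnj)
    define p where "p = 1 + exp (t - x)"
    have d: "- of_real (exp (t - x)) - 1 = - complex_of_real p" by (simp add: p_def)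
    have "h (Complex t (- pi)) - h (Complex t pi) = (f (Complex t pi) - cnj (f (Complex t pi))) / of_real p"
      unfolding h_def e f d by (simp add: diff_divide_distrib)
    also have "f (Complex t pi) - cnj (f (Complex t pi)) = 2 * \<i> * of_real (Im (f (Complex t pi)))"
      by (simp add: complex_diff_cnj mult_ac)
    also have "2 * \<i> * of_real (Im (f (Complex t pi))) / of_real p = 2 * pi * \<i> * of_real (Im (f (Complex t pi)) / pi / p)"
      by simp
    finally show ?thesis unfolding p_def .
  qed
  have "((\<lambda>t. (2 * pi * \<i> * of_real (Im (f (Complex t pi)) / pi / (1 + exp (t - x)))) / (2 * pi * \<i>)) has_integral (2 * pi * \<i> * (f (of_real x) - V)) / (2 * pi * \<i>)) {-R..R}"
    by (rule has_integral_divide) (use I hh in simp)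
  then have "((\<lambda>t. complex_of_real (Im (f (Complex t pi)) / pi / (1 + exp (t - x)))) has_integral (f (of_real x) - V)) {-R..R}"
    by (simp add: mult.commute)
  from has_integral_linear[OF this bounded_linear_Re]
  have "((\<lambda>t. Im (f (Complex t pi)) / pi / (1 + exp (t - x))) has_integral Re (f (of_real x) - V)) {-R..R}"
    unfolding o_def Re_complex_of_real .
  moreover have "norm V \<le> BR / (exp (R - x) - 1) + BL / (1 - exp (- R - x))"
  proof -
    have g: "1 < exp (R - x)" "exp (- R - x) < 1" using R by auto
    have B0: "0 \<le> BR" "0 \<le> BL" using bR[of 0] bL[of 0] order_trans[OF norm_ge_zero] by auto
    have v1: "norm (contour_integral (linepath a2 a3) h) \<le> BR / (exp (R - x) - 1) * norm (a3 - a2)"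
    proof (rule contour_integral_bound_linepath[OF i(2)])
      fix z assume "z \<in> closed_segment a2 a3"
      then have z: "Re z = R" "\<bar>Im z\<bar> \<le> pi"
        unfolding a2_def a3_def by (auto simp: closed_segment_same_Re closed_segment_eq_real_ivl)
      then have "z = Complex R (Im z)" by (simp add: complex_eq_iff)
      then have "norm (f z) \<le> BR" using bR[OF z(2)] by simp
      moreover have "exp (R - x) - 1 \<le> norm (exp (z - of_real x) - 1)"
        using norm_triangle_ineq2[of "exp (z - of_real x)" 1] z(1) by simp
      ultimately show "norm (h z) \<le> BR / (exp (R - x) - 1)"
        unfolding h_def norm_divide using g B0 by (intro frac_le) auto
    qed (use B0 g in auto)
    have v2: "norm (contour_integral (linepath a4 a1) h) \<le> BL / (1 - exp (- R - x)) * norm (a1 - a4)"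
    proof (rule contour_integral_bound_linepath[OF i(4)])
      fix z assume "z \<in> closed_segment a4 a1"
      then have z: "Re z = - R" "\<bar>Im z\<bar> \<le> pi"
        unfolding a4_def a1_def by (auto simp: closed_segment_same_Re closed_segment_eq_real_ivl split: if_splits)
      then have "z = Complex (- R) (Im z)" by (simp add: complex_eq_iff)
      then have "norm (f z) \<le> BL" using bL[OF z(2)] by simp
      moreover have "1 - exp (- R - x) \<le> norm (exp (z - of_real x) - 1)"
        using norm_triangle_ineq2[of 1 "exp (z - of_real x)"] z(1) by (simp add: norm_minus_commute)
      ultimately show "norm (h z) \<le> BL / (1 - exp (- R - x))"
        unfolding h_def norm_divide using g B0 by (intro frac_le) auto
    qed (use B0 g in auto)
    have n: "norm (a3 - a2) = 2 * pi" "norm (a1 - a4) = 2 * pi"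
      by (simp_all add: a1_def a2_def a3_def a4_def cmod_def real_sqrt_mult)
    have "norm V = norm (contour_integral (linepath a2 a3) h + contour_integral (linepath a4 a1) h) / (2 * pi)"
      by (simp add: V_def norm_divide norm_mult)
    also have "\<dots> \<le> (BR / (exp (R - x) - 1) * (2 * pi) + BL / (1 - exp (- R - x)) * (2 * pi)) / (2 * pi)"
      using v1 v2 unfolding n by (intro divide_right_mono order_trans[OF norm_triangle_ineq] add_mono) auto
    also have "\<dots> = BR / (exp (R - x) - 1) + BL / (1 - exp (- R - x))"
      by (simp add: field_simps)
    finally show ?thesis .
  qed
  ultimately show ?thesis by blast
qed

text \<open>The difference d satisfies exp d = 1, so its derivative vanishes and it is constant; the
  point \<open>z0\<close> fixes the constant. This serves to show that the chosen logarithm commutes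
  with conjugation.\<close>

lemma exp_eq_imp_eq_convex:
  fixes g1 g2 :: "complex \<Rightarrow> complex"
  assumes S: "open S" "convex S" and hol: "g1 holomorphic_on S" "g2 holomorphic_on S"
    and e: "\<And>z. z \<in> S \<Longrightarrow> exp (g1 z) = exp (g2 z)" and z0: "z0 \<in> S" "g1 z0 = g2 z0" and z: "z \<in> S"
  shows "g1 z = g2 z"
proof -
  define d where "d = (\<lambda>z. g1 z - g2 z)"
  have dh: "d holomorphic_on S" unfolding d_def by (intro holomorphic_intros hol)
  have ed: "exp (d z) = 1" if "z \<in> S" for z using e[OF that] by (simp add: d_def exp_diff)
  have "(d has_field_derivative 0) (at z within S)" if z: "z \<in> S" for z
  proof -
    have d: "(d has_field_derivative deriv d z) (at z)" by (rule holomorphic_derivI[OF dh S(1) z])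
    then have "((\<lambda>z. exp (d z)) has_field_derivative exp (d z) * deriv d z) (at z)"
      by (rule DERIV_fun_exp)
    moreover have "((\<lambda>z. exp (d z)) has_field_derivative 0) (at z)"
      by (rule has_field_derivative_transform_within_open[where f="\<lambda>_. 1", OF _ S(1) z]) (auto simp: ed)
    ultimately have "exp (d z) * deriv d z = 0" by (rule DERIV_unique)
    then have "deriv d z = 0" by simp
    then have "(d has_field_derivative 0) (at z)" using d by simp
    then show ?thesis by (rule has_field_derivative_at_within)
  qed
  then obtain c where c: "\<And>z. z \<in> S \<Longrightarrow> d z = c" using has_field_derivative_zero_constant[OF S(2)] by metis
  have "d z0 = 0" using z0 by (simp add: d_def)
  then show ?thesis using c[OF z] c[OF z0(1)] by (simp add: d_def)
qed

lemma nn_integral_symmetric_limit: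
  fixes f :: "real \<Rightarrow> ennreal"
  assumes [measurable]: "f \<in> borel_measurable borel"
  shows "(\<lambda>n. \<integral>\<^sup>+t. f t * indicator {- real n..real n} t \<partial>lborel) \<longlonglongrightarrow> (\<integral>\<^sup>+t. f t \<partial>lborel)"
proof (rule nn_integral_LIMSEQ)
  show "incseq (\<lambda>n t. f t * indicator {- real n..real n} t)"
    by (intro incseq_SucI le_funI mult_left_mono) (auto simp: indicator_def)
  show "(\<lambda>n. f t * indicator {- real n..real n} t) \<longlonglongrightarrow> f t" for t
  proof (rule tendsto_eventually)
    obtain m where m: "\<bar>t\<bar> \<le> real m" using real_arch_simple by blast
    show "\<forall>\<^sub>F n in sequentially. f t * indicator {- real n..real n} t = f t"
      using eventually_ge_at_top[of m]
    proof eventually_elim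
      case (elim n)
      then have "\<bar>t\<bar> \<le> real n" using m by linarith
      then show ?case by (simp add: abs_le_iff minus_le_iff)
    qed
  qed
qed measurable

lemma nn_integral_eq_of_symmetric_limit:
  fixes f :: "real \<Rightarrow> real"
  assumes [measurable]: "f \<in> borel_measurable borel" and nn: "\<And>t. 0 \<le> f t"
    and I: "\<And>n. start \<le> n \<Longrightarrow> (f has_integral I n) {- real n..real n}" and lim: "I \<longlonglongrightarrow> L"
  shows "(\<integral>\<^sup>+t. ennreal (f t) \<partial>lborel) = ennreal L"
proof -
  have "(\<lambda>n. \<integral>\<^sup>+t. ennreal (f t) * indicator {- real n..real n} t \<partial>lborel) \<longlonglongrightarrow> (\<integral>\<^sup>+t. ennreal (f t) \<partial>lborel)"
    by (rule nn_integral_symmetric_limit) measurable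
  moreover have "(\<lambda>n. \<integral>\<^sup>+t. ennreal (f t) * indicator {- real n..real n} t \<partial>lborel) \<longlonglongrightarrow> ennreal L"
  proof (rule Lim_transform_eventually[OF tendsto_ennrealI[OF lim]])
    show "\<forall>\<^sub>F n in sequentially. ennreal (I n) = (\<integral>\<^sup>+t. ennreal (f t) * indicator {- real n..real n} t \<partial>lborel)"
      using eventually_ge_at_top[of start] by eventually_elim (subst nn_integral_has_integral_lebesgue'[OF nn I], auto)
  qed
  ultimately show ?thesis by (rule LIMSEQ_unique)
qed

context alternating_mixture
begin

theorem strip_representation:
  fixes \<beta> :: real
  assumes \<beta>: "1 / 2 < \<beta>" "\<beta> < 1"
  shows "\<exists>K. mono K \<and> (\<forall>t. 0 \<le> K t) \<and> continuous_on UNIV K \<and>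
    (\<forall>x. (\<integral>\<^sup>+t. ennreal (K t / (1 + exp (t - x))) \<partial>lborel) = ennreal (- ln (G (exp (\<beta> * x)))))"
proof -
  \<comment> \<open>The half-width for which exp (\<beta> z) stays off the cut. The bounds on
    \<open>\<beta>\<close> say exactly that \<pi> < c < 2 \<pi>, as \<open>strip_Cauchy\<close>
    requires.\<close>
  define c where "c = pi / \<beta>"
  have c: "pi < c" "c < 2 * pi" using \<beta> by (simp_all add: c_def field_simps)
  have \<beta>c: "\<bar>\<beta> * y\<bar> < pi \<longleftrightarrow> \<bar>y\<bar> < c" for y using \<beta> by (simp add: c_def abs_mult field_simps)
  define S where "S = {z :: complex. \<bar>Im z\<bar> < c}"
  have S_box: "S = {z. Im z < c} \<inter> {z. - c < Im z}" by (auto simp: S_def abs_less_iff)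
  have oS: "open S" and cS: "convex S"
    unfolding S_box by (auto intro!: open_Int convex_Int simp: open_halfspace_Im_lt open_halfspace_Im_gt convex_halfspace_Im_lt convex_halfspace_Im_gt)
  define Z where "Z = (\<lambda>z::complex. exp (of_real \<beta> * z))"
  have Zp: "Z z = of_real (exp (\<beta> * Re z)) * cis (\<beta> * Im z)" for z
    by (simp add: Z_def exp_eq_polar)
  have nZ: "norm (Z z) = exp (\<beta> * Re z)" for z by (simp add: Z_def)
  have ReZ: "Re (Z z) / norm (Z z) = cos (\<beta> * Im z)" for z by (simp add: Zp norm_mult)
  have Zs: "Z z \<notin> \<real>\<^sub>\<le>\<^sub>0" if "z \<in> S" for z
  proof
    assume "Z z \<in> \<real>\<^sub>\<le>\<^sub>0"
    then have 1: "Re (Z z) \<le> 0" "Im (Z z) = 0" by (auto simp: complex_nonpos_Reals_iff)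
    then have s: "sin (\<beta> * Im z) = 0" "cos (\<beta> * Im z) \<le> 0" by (auto simp: Zp mult_le_0_iff)
    have "\<bar>\<beta> * Im z\<bar> < pi" using that by (simp add: S_def \<beta>c)
    then have bz: "\<beta> * Im z = 0" using s(1) sin_gt_zero[of "\<beta> * Im z"] sin_gt_zero[of "- (\<beta> * Im z)"] by (smt (verit) sin_minus)
    show False using s(2) unfolding bz by simp
  qed
  define P where "P = (\<lambda>z. F (Z z))"
  have Pge: "G (exp (\<beta> * Re z)) \<le> norm (P z)" if "z \<in> S" for z
    unfolding P_def Zp using that by (intro F_modulus_ge) (auto simp: S_def \<beta>c)
  have P0: "P z \<noteq> 0" if "z \<in> S" for z using Pge[OF that] G_pos[of "exp (\<beta> * Re z)"] by auto
  \<comment> \<open>The logarithmic derivative of \<open>P\<close>. It is \<beta> z F'(z) / F(z) at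
    the point \<open>Z z\<close>, so \<open>F'_norm_le\<close> bounds its numerator.\<close>
  define \<theta> where "\<theta> = (\<lambda>z. of_real \<beta> * (Z z * F' (Z z)) / P z)"
  have Pd: "(P has_field_derivative \<theta> z * P z) (at z)" if "z \<in> S" for z
  proof -
    have "(Z has_field_derivative of_real \<beta> * Z z) (at z)"
      unfolding Z_def by (auto intro!: derivative_eq_intros)
    then have "(P has_field_derivative F' (Z z) * (of_real \<beta> * Z z)) (at z)"
      unfolding P_def by (rule DERIV_chain2[where f=F and g=Z, OF F_has_field_derivative[OF Zs[OF that]]])
    moreover have "F' (Z z) * (of_real \<beta> * Z z) = \<theta> z * P z" using P0[OF that] by (simp add: \<theta>_def)
    ultimately show ?thesis by simp
  qed
  have Ph: "P holomorphic_on S" using Pd oS by (auto simp: holomorphic_on_open)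
  obtain g0 where g0: "g0 holomorphic_on S" "\<And>z. z \<in> S \<Longrightarrow> P z = exp (g0 z)"
    using contractible_imp_holomorphic_log[OF Ph convex_imp_contractible[OF cS] P0] by blast
  have S0: "0 \<in> S" using c by (simp add: S_def)
  have Preal: "P (of_real x) = of_real (G (exp (\<beta> * x)))" for x
    using F_of_real[of "exp (\<beta> * x)"] unfolding P_def Z_def by (simp add: exp_of_real[symmetric])
  \<comment> \<open>A holomorphic logarithm is unique up to a constant; here it is chosen real at 0,
    which makes it real on the whole real axis.\<close>
  define g where "g = (\<lambda>z. g0 z - (g0 0 - of_real (ln (G 1))))"
  have gh: "g holomorphic_on S" unfolding g_def by (intro holomorphic_intros g0)
  have ge: "exp (g z) = P z" if "z \<in> S" for z
  proof -
    have "exp (g0 0) = of_real (G 1)" using g0(2)[OF S0] Preal[of 0] by simp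
    moreover have "exp (complex_of_real (ln (G 1))) = of_real (G 1)" using G_pos[of 1] by (simp add: exp_of_real)
    ultimately have "exp (g0 0 - of_real (ln (G 1))) = 1" using G_pos[of 1] by (simp add: exp_diff)
    then show ?thesis using g0(2)[OF that] by (simp add: g_def exp_diff)
  qed
  have g00: "g 0 = of_real (ln (G 1))" by (simp add: g_def)
  have gd: "(g has_field_derivative \<theta> z) (at z)" if "z \<in> S" for z
  proof -
    have d: "(g has_field_derivative deriv g z) (at z)" by (rule holomorphic_derivI[OF gh oS that])
    then have "((\<lambda>z. exp (g z)) has_field_derivative exp (g z) * deriv g z) (at z)" by (rule DERIV_fun_exp)
    moreover have "((\<lambda>z. exp (g z)) has_field_derivative \<theta> z * P z) (at z)"
      by (rule has_field_derivative_transform_within_open[OF Pd[OF that] oS that]) (auto simp: ge)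
    ultimately have "exp (g z) * deriv g z = \<theta> z * P z" by (rule DERIV_unique)
    then have "deriv g z = \<theta> z" using ge[OF that] P0[OF that] by (simp add: mult.commute)
    then show ?thesis using d by simp
  qed
  have Re_g: "Re (g z) = ln (norm (P z))" if "z \<in> S" for z
    using arg_cong[OF ge[OF that], of norm] P0[OF that] by (metis ln_exp norm_exp_eq_Re)
  have gc: "g (cnj z) = cnj (g z)" if z: "z \<in> S" for z
  proof -
    have im: "cnj ` S = S" by (auto simp: S_def image_iff intro!: exI[of _ "cnj _"] bexI[of _ "cnj _"])
    have h2: "(cnj \<circ> g \<circ> cnj) holomorphic_on S"
      using holomorphic_on_compose_cnj_cnj[of g S] gh oS im by simp
    have "g z = (cnj \<circ> g \<circ> cnj) z"
    proof (rule exp_eq_imp_eq_convex[OF oS cS gh h2 _ S0 _ z])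
      fix w assume w: "w \<in> S"
      then have "cnj w \<in> S" by (simp add: S_def)
      then have "exp ((cnj \<circ> g \<circ> cnj) w) = cnj (P (cnj w))" by (simp add: ge exp_cnj[symmetric])
      also have "\<dots> = P w" unfolding P_def Z_def by (simp add: F_cnj[symmetric] exp_cnj)
      finally show "exp (g w) = exp ((cnj \<circ> g \<circ> cnj) w)" using ge[OF w] by simp
    qed (simp add: g00)
    then show ?thesis by (metis complex_cnj_cnj comp_apply)
  qed
  have greal: "g (of_real x) = of_real (ln (G (exp (\<beta> * x))))" for x
  proof -
    have xS: "of_real x \<in> S" using S0 by (simp add: S_def)
    have "Im (g (of_real x)) = 0" using gc[OF xS] by (simp add: complex_eq_iff)
    moreover have "Re (g (of_real x)) = ln (G (exp (\<beta> * x)))"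
      using Re_g[OF xS] Preal[of x] G_pos[of "exp (\<beta> * x)"] by simp
    ultimately show ?thesis by (simp add: complex_eq_iff)
  qed
  \<comment> \<open>This is cos (\<beta> \<pi> / 2), the smallest value of
    \<open>slit_angle (Z z)\<close> for |Im z| \<le> \<pi>. It is positive because \<beta> <
    1.\<close>
  define \<kappa> where "\<kappa> = sqrt ((1 + cos (\<beta> * pi)) / 2)"
  have \<kappa>0: "0 < \<kappa>"
  proof -
    have "cos pi < cos (\<beta> * pi)" using \<beta> by (intro cos_monotone_0_pi) auto
    then show ?thesis by (simp add: \<kappa>_def)
  qed
  have T: "z \<in> S" "\<kappa> \<le> slit_angle (Z z)" if "\<bar>Im z\<bar> \<le> pi" for z
  proof -
    show "z \<in> S" using that c by (simp add: S_def)
    have "cos (\<beta> * pi) \<le> cos \<bar>\<beta> * Im z\<bar>"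
      using that \<beta> by (intro cos_monotone_0_pi_le) (auto simp: abs_mult)
    then show "\<kappa> \<le> slit_angle (Z z)" unfolding \<kappa>_def slit_angle_def ReZ by simp
  qed
  \<comment> \<open>A second bound for \<open>\<theta>\<close>, at the radius r = exp (\<beta> Re
    z). It tends to 0 with r, while the uniform bound \<open>real k / \<kappa> ^ Suc k\<close> does
    not.\<close>
  define \<iota> where "\<iota> = (\<lambda>r. real k * (1 - (LINT x|\<mu>. 1 / (1 + r * x))) / (\<kappa> ^ Suc k * G r))"
  have \<theta>b: "norm (\<theta> z) \<le> real k / \<kappa> ^ Suc k" "norm (\<theta> z) \<le> \<iota> (exp (\<beta> * Re z))" if z: "\<bar>Im z\<bar> \<le> pi" for z
  proof -
    define r where "r = exp (\<beta> * Re z)"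
    have G: "0 < G r" by (simp add: r_def G_pos)
    have sk: "\<kappa> ^ Suc k \<le> slit_angle (Z z) ^ Suc k" using T(2)[OF z] \<kappa>0 by (intro power_mono) auto
    have sp: "0 < \<kappa> ^ Suc k" using \<kappa>0 by simp
    have "norm (\<theta> z) = \<beta> * norm (Z z * F' (Z z)) / norm (P z)" using \<beta> by (simp add: \<theta>_def norm_mult norm_divide)
    also have "\<dots> \<le> 1 * norm (Z z * F' (Z z)) / G r"
      using \<beta> Pge[OF T(1)[OF z]] G by (intro frac_le mult_right_mono) (auto simp: r_def)
    finally have *: "norm (\<theta> z) \<le> norm (Z z * F' (Z z)) / G r" by simp
    have "norm (Z z * F' (Z z)) \<le> real k * G r / slit_angle (Z z) ^ Suc k"
      using F'_norm_le(2)[OF Zs[OF T(1)[OF z]]] by (simp only: nZ r_def)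
    also have "\<dots> \<le> real k * G r / \<kappa> ^ Suc k" using sk sp G by (intro divide_left_mono) (auto intro!: mult_pos_pos elim: less_le_trans)
    finally have "norm (Z z * F' (Z z)) / G r \<le> (real k * G r / \<kappa> ^ Suc k) / G r" using G by (intro divide_right_mono) auto
    then show "norm (\<theta> z) \<le> real k / \<kappa> ^ Suc k" using * G by simp
    define J where "J = (LINT x|\<mu>. 1 / (1 + r * x))"
    have "norm (Z z * F' (Z z)) \<le> real k * (1 - J) / slit_angle (Z z) ^ Suc k"
      using F'_norm_le(1)[OF Zs[OF T(1)[OF z]]] by (simp only: nZ r_def J_def)
    moreover have "0 \<le> real k * (1 - J)"
      using order_trans[OF norm_ge_zero calculation] slit_angle_pos[OF Zs[OF T(1)[OF z]]]
      by (simp add: zero_le_divide_iff) (smt (verit) zero_less_power mult_pos_pos)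
    ultimately have "norm (Z z * F' (Z z)) \<le> real k * (1 - J) / \<kappa> ^ Suc k"
      using sk sp by (smt (verit) divide_left_mono mult_pos_pos)
    then have "norm (Z z * F' (Z z)) / G r \<le> real k * (1 - J) / \<kappa> ^ Suc k / G r" using G by (intro divide_right_mono) auto
    then show "norm (\<theta> z) \<le> \<iota> (exp (\<beta> * Re z))" using * by (simp add: \<iota>_def r_def J_def)
  qed
  define C where "C = real k / \<kappa> ^ Suc k"
  have C0: "0 \<le> C" using \<kappa>0 by (simp add: C_def)
  have ivl: "closed_segment u v \<subseteq> {z. \<bar>Im z\<bar> \<le> pi}" if "\<bar>Im u\<bar> \<le> pi" "\<bar>Im v\<bar> \<le> pi" for u v :: complex
  proof -
    have "{z. \<bar>Im z\<bar> \<le> pi} = {z. Im z \<le> pi} \<inter> {z. - pi \<le> Im z}" by auto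
    then have "convex {z :: complex. \<bar>Im z\<bar> \<le> pi}"
      by (auto intro!: convex_Int simp: convex_halfspace_Im_le convex_halfspace_Im_ge)
    then show ?thesis using that by (intro closed_segment_subset) auto
  qed
  \<comment> \<open>On the right end linear growth of \<open>g\<close> is enough, because the Cauchy
    kernel decays exponentially there.\<close>
  have gbound: "norm (g z) \<le> norm (g 0) + C * (\<bar>Re z\<bar> + pi)" if z: "\<bar>Im z\<bar> \<le> pi" for z
  proof -
    have "norm (g z - g 0) \<le> C * norm (z - 0)"
    proof (rule field_differentiable_bound[where S="closed_segment 0 z" and f'=\<theta>])
      fix w assume "w \<in> closed_segment 0 z"
      then have w: "\<bar>Im w\<bar> \<le> pi" using ivl[of 0 z] z by auto
      show "(g has_field_derivative \<theta> w) (at w within closed_segment 0 z)"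
        by (rule has_field_derivative_at_within[OF gd[OF T(1)[OF w]]])
      show "norm (\<theta> w) \<le> C" using \<theta>b(1)[OF w] by (simp add: C_def)
    qed auto
    also have "C * norm (z - 0) \<le> C * (\<bar>Re z\<bar> + pi)"
      using C0 z cmod_le[of z] by (intro mult_left_mono) auto
    finally show ?thesis using norm_triangle_ineq2[of "g z" "g 0"] by linarith
  qed
  \<comment> \<open>On the left end the Cauchy kernel tends in modulus to 1, so \<open>g\<close>
    itself has to vanish there: on the real axis because G tends to 1, and off it because
    \<open>\<iota>\<close> controls the vertical variation.\<close>
  define BL where "BL = (\<lambda>R. \<bar>ln (G (exp (- (\<beta> * R))))\<bar> + \<iota> (exp (- (\<beta> * R))) * pi)"
  have gleft: "norm (g (Complex (- R) y)) \<le> BL R" if y: "\<bar>y\<bar> \<le> pi" for R y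
  proof -
    have "norm (g (Complex (- R) y) - g (Complex (- R) 0)) \<le> \<iota> (exp (- (\<beta> * R))) * norm (Complex (- R) y - Complex (- R) 0)"
    proof (rule field_differentiable_bound[where S="closed_segment (Complex (- R) 0) (Complex (- R) y)" and f'=\<theta>])
      fix w assume w': "w \<in> closed_segment (Complex (- R) 0) (Complex (- R) y)"
      then have w: "\<bar>Im w\<bar> \<le> pi" using ivl[of "Complex (- R) 0" "Complex (- R) y"] y by auto
      have re: "Re w = - R" using w' by (simp add: closed_segment_same_Re)
      show "(g has_field_derivative \<theta> w) (at w within closed_segment (Complex (- R) 0) (Complex (- R) y))"
        by (rule has_field_derivative_at_within[OF gd[OF T(1)[OF w]]])
      show "norm (\<theta> w) \<le> \<iota> (exp (- (\<beta> * R)))" using \<theta>b(2)[OF w] by (simp add: re)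
    qed auto
    also have "norm (Complex (- R) y - Complex (- R) 0) = \<bar>y\<bar>" by (simp add: cmod_def)
    also have "\<iota> (exp (- (\<beta> * R))) * \<bar>y\<bar> \<le> \<iota> (exp (- (\<beta> * R))) * pi"
      using y order_trans[OF norm_ge_zero \<theta>b(2)[of "Complex (- R) 0"]] by (intro mult_left_mono) auto
    finally have "norm (g (Complex (- R) y)) \<le> norm (g (Complex (- R) 0)) + \<iota> (exp (- (\<beta> * R))) * pi"
      using norm_triangle_ineq2[of "g (Complex (- R) y)" "g (Complex (- R) 0)"] by linarith
    also have "g (Complex (- R) 0) = of_real (ln (G (exp (- (\<beta> * R)))))"
      using greal[of "- R"] by (simp add: complex_of_real_def)
    finally show ?thesis by (simp add: BL_def)
  qed
  have e0: "filterlim (\<lambda>n. exp (- (\<beta> * real n))) (at_right 0) sequentially"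
  proof -
    have "((\<lambda>n. exp (- (\<beta> * real n))) \<longlongrightarrow> 0) sequentially" using \<beta> by real_asymp
    then show ?thesis by (auto simp: filterlim_at)
  qed
  have BL0: "(\<lambda>n. BL (real n)) \<longlonglongrightarrow> 0"
  proof -
    have G1: "(\<lambda>n. G (exp (- (\<beta> * real n)))) \<longlonglongrightarrow> 1" by (rule filterlim_compose[OF G_tendsto_1 e0])
    have J1: "(\<lambda>n. LINT x|\<mu>. 1 / (1 + exp (- (\<beta> * real n)) * x)) \<longlonglongrightarrow> 1"
      by (rule filterlim_compose[OF inverse_tendsto_1 e0])
    have "(\<lambda>n. BL (real n)) \<longlonglongrightarrow> \<bar>ln 1\<bar> + real k * (1 - 1) / (\<kappa> ^ Suc k * 1) * pi"
      unfolding BL_def \<iota>_def using \<kappa>0 by (intro tendsto_intros G1 J1) auto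
    then show ?thesis by simp
  qed
  define K where "K = (\<lambda>t. - Im (g (Complex t pi)) / pi)"
  have Kd: "(K has_real_derivative - Im (\<theta> (Complex t pi)) / pi) (at t)" for t
  proof -
    have tS: "Complex t pi \<in> S" by (rule T) simp
    have "((\<lambda>t. Complex t pi) has_vector_derivative 1) (at t)"
      unfolding has_vector_derivative_complex_iff by (auto intro!: derivative_eq_intros)
    from field_vector_diff_chain_at[OF this gd[OF tS]]
    have "((\<lambda>t. g (Complex t pi)) has_vector_derivative 1 * \<theta> (Complex t pi)) (at t)"
      unfolding o_def .
    then have "((\<lambda>t. Im (g (Complex t pi))) has_real_derivative Im (1 * \<theta> (Complex t pi))) (at t)"
      unfolding has_vector_derivative_complex_iff by blast
    then have "((\<lambda>t. Im (g (Complex t pi))) has_real_derivative Im (\<theta> (Complex t pi))) (at t)"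
      by (simp only: mult_1)
    from DERIV_cdivide[OF DERIV_minus[OF this], of pi] show ?thesis unfolding K_def .
  qed
  \<comment> \<open>The derivative of Re g in the vertical direction is Re (i \<theta>) = - Im
    \<theta>. Since Re g = ln |P| is nondecreasing in the angle for 0 < Im z < c, and \<pi> is an
    interior point of this range, the sign follows.\<close>
  have Im\<theta>: "Im (\<theta> (Complex t pi)) \<le> 0" for t
  proof -
    define \<phi> where "\<phi> = (\<lambda>y. Re (g (Complex t y)))"
    have "((\<lambda>y. Complex t y) has_vector_derivative \<i>) (at pi)"
      unfolding has_vector_derivative_complex_iff by (auto intro!: derivative_eq_intros)
    moreover have "Complex t pi \<in> S" by (rule T) simp
    ultimately have "((\<lambda>y. g (Complex t y)) has_vector_derivative \<i> * \<theta> (Complex t pi)) (at pi)"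
      using field_vector_diff_chain_at[OF _ gd, of "\<lambda>y. Complex t y" \<i> pi] unfolding o_def by blast
    then have d: "(\<phi> has_real_derivative Re (\<i> * \<theta> (Complex t pi))) (at pi)"
      unfolding has_vector_derivative_complex_iff \<phi>_def by blast
    have "mono_on {0<..<c} \<phi>"
    proof (rule mono_onI)
      fix y1 y2 assume y: "y1 \<in> {0<..<c}" "y2 \<in> {0<..<c}" "y1 \<le> y2"
      have S12: "Complex t y1 \<in> S" "Complex t y2 \<in> S" using y by (auto simp: S_def)
      have "\<beta> * y2 < pi" using y \<beta> by (simp add: c_def field_simps)
      then have "norm (P (Complex t y1)) \<le> norm (P (Complex t y2))"
        unfolding P_def Zp complex.sel using y \<beta> by (intro F_modulus_mono) auto
      then show "\<phi> y1 \<le> \<phi> y2" unfolding \<phi>_def Re_g[OF S12(1)] Re_g[OF S12(2)] using P0[OF S12(1)] P0[OF S12(2)] by (subst ln_le_cancel_iff) auto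
    qed
    then have "0 \<le> Re (\<i> * \<theta> (Complex t pi))"
      by (rule mono_on_imp_deriv_nonneg[OF _ d]) (use c in \<open>auto simp: interior_open\<close>)
    then show ?thesis by simp
  qed
  have mK: "mono K"
  proof (rule monoI)
    fix s t :: real assume "s \<le> t"
    then show "K s \<le> K t"
      by (rule DERIV_nonneg_imp_nondecreasing) (use Kd Im\<theta> in \<open>auto intro!: exI[of _ "- Im (\<theta> (Complex _ pi)) / pi"] divide_nonneg_pos\<close>)
  qed
  have cK: "continuous_on UNIV K" using Kd by (intro DERIV_continuous_on) auto
  \<comment> \<open>A nondecreasing function that tends to 0 at -\<infinity> is nonnegative; the
    limit comes from the left-end bound \<open>BL\<close>.\<close>
  have K0: "0 \<le> K t" for t
  proof (rule LIMSEQ_le_const2)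
    have "(\<lambda>n. - BL (real n) / pi) \<longlonglongrightarrow> - 0 / pi" by (intro tendsto_intros BL0) auto
    then show "(\<lambda>n. - BL (real n) / pi) \<longlonglongrightarrow> 0" by simp
    obtain m where m: "- t \<le> real m" using real_arch_simple by blast
    show "\<exists>N. \<forall>n\<ge>N. - BL (real n) / pi \<le> K t"
    proof (intro exI[of _ m] allI impI)
      fix n assume "m \<le> n"
      then have "- real n \<le> t" using m by linarith
      then have "K (- real n) \<le> K t" by (rule monoD[OF mK])
      moreover have "\<bar>Im (g (Complex (- real n) pi))\<bar> \<le> BL (real n)"
        using abs_Im_le_cmod gleft[of pi "real n"] by (rule order_trans) simp
      then have "- BL (real n) / pi \<le> K (- real n)"
        unfolding K_def by (intro divide_right_mono) auto
      ultimately show "- BL (real n) / pi \<le> K t" by linarith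
    qed
  qed
  have "(\<integral>\<^sup>+t. ennreal (K t / (1 + exp (t - x))) \<partial>lborel) = ennreal (- ln (G (exp (\<beta> * x))))" for x
  proof -
    define f where "f = (\<lambda>z. - g z)"
    define n0 where "n0 = nat \<lceil>\<bar>x\<bar>\<rceil> + 1"
    define BR where "BR = (\<lambda>n. norm (g 0) + C * (n + pi))"
    have ex: "\<exists>V. norm V \<le> BR (real n) / (exp (real n - x) - 1) + BL (real n) / (1 - exp (- real n - x)) \<and>
       ((\<lambda>t. Im (f (Complex t pi)) / pi / (1 + exp (t - x))) has_integral Re (f (of_real x) - V)) {- real n..real n}" if n: "n0 \<le> n" for n
    proof (rule strip_Cauchy[OF c])
      show "f holomorphic_on {z. \<bar>Im z\<bar> < c}" using gh unfolding f_def S_def by (intro holomorphic_intros)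
      show "f (cnj z) = cnj (f z)" if "\<bar>Im z\<bar> < c" for z using gc[of z] that by (simp add: f_def S_def)
      show "\<bar>x\<bar> < real n" using n unfolding n0_def by linarith
      show "norm (f (Complex (real n) y)) \<le> BR (real n)" if "\<bar>y\<bar> \<le> pi" for y
        using gbound[of "Complex (real n) y"] that by (simp add: f_def BR_def)
      show "norm (f (Complex (- real n) y)) \<le> BL (real n)" if "\<bar>y\<bar> \<le> pi" for y
        using gleft[OF that] by (simp add: f_def)
    qed
    define V where "V = (\<lambda>n. SOME V. norm V \<le> BR (real n) / (exp (real n - x) - 1) + BL (real n) / (1 - exp (- real n - x)) \<and>
       ((\<lambda>t. Im (f (Complex t pi)) / pi / (1 + exp (t - x))) has_integral Re (f (of_real x) - V)) {- real n..real n})"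
    have VV: "norm (V n) \<le> BR (real n) / (exp (real n - x) - 1) + BL (real n) / (1 - exp (- real n - x)) \<and>
       ((\<lambda>t. Im (f (Complex t pi)) / pi / (1 + exp (t - x))) has_integral Re (f (of_real x) - V n)) {- real n..real n}" if "n0 \<le> n" for n
      unfolding V_def by (rule someI_ex[OF ex[OF that]])
    note V = conjunct1[OF VV] conjunct2[OF VV]
    have V0: "V \<longlonglongrightarrow> 0"
    proof (rule Lim_null_comparison)
      show "\<forall>\<^sub>F n in sequentially. norm (V n) \<le> BR (real n) / (exp (real n - x) - 1) + BL (real n) / (1 - exp (- real n - x))"
        using eventually_ge_at_top[of n0] by eventually_elim (rule V)
      have 1: "(\<lambda>n. BR (real n) / (exp (real n - x) - 1)) \<longlonglongrightarrow> 0"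
      proof -
        have "(\<lambda>n. (A + C * (real n + p)) / (exp (real n - x) - 1)) \<longlonglongrightarrow> 0" for A p :: real by real_asymp
        then show ?thesis by (simp add: BR_def)
      qed
      have "(\<lambda>n. exp (- real n - x)) \<longlonglongrightarrow> 0" by real_asymp
      then have "(\<lambda>n. BL (real n) / (1 - exp (- real n - x))) \<longlonglongrightarrow> 0 / (1 - 0)"
        by (intro tendsto_intros BL0) auto
      then show "(\<lambda>n. BR (real n) / (exp (real n - x) - 1) + BL (real n) / (1 - exp (- real n - x))) \<longlonglongrightarrow> 0"
        using tendsto_add[OF 1] by fastforce
    qed
    have [measurable]: "K \<in> borel_measurable borel" using cK by (rule borel_measurable_continuous_onI)
    show ?thesis
    proof (rule nn_integral_eq_of_symmetric_limit[where start=n0])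
      show "0 \<le> K t / (1 + exp (t - x))" for t using K0[of t] by (intro divide_nonneg_pos) (auto intro: add_pos_pos)
      show "((\<lambda>t. K t / (1 + exp (t - x))) has_integral Re (f (of_real x) - V n)) {- real n..real n}" if "n0 \<le> n" for n
        using V(2)[OF that] by (simp add: f_def K_def)
      have "(\<lambda>n. Re (f (of_real x) - V n)) \<longlonglongrightarrow> Re (f (of_real x) - 0)"
        by (intro tendsto_intros V0)
      then show "(\<lambda>n. Re (f (of_real x) - V n)) \<longlonglongrightarrow> - ln (G (exp (\<beta> * x)))"
        by (simp add: f_def greal)
    qed measurable
  qed
  then show ?thesis using mK K0 cK by blast
qed

end

text \<open>
  Helly selection for the representing functions. Comparing with the arguments \<open>x = -T\<close> and \<open>x = T\<close>
  shows that no mass escapes to \<open>-\<infinity>\<close> (since \<open>\<Lambda> (-T) \<longlonglongrightarrow> 0\<close>) or to \<open>\<infinity>\<close> (since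
  \<open>\<Lambda> T / exp T \<longlonglongrightarrow> 0\<close>).
\<close>

lemma logistic_limit:
  fixes K :: "nat \<Rightarrow> real \<Rightarrow> real" and \<Lambda> :: "real \<Rightarrow> real"
  assumes mono: "\<And>n. mono (K n)" and nn: "\<And>n t. 0 \<le> K n t" and cont: "\<And>n. continuous_on UNIV (K n)"
    and lim: "\<And>x. (\<lambda>n. \<integral>\<^sup>+t. ennreal (K n t / (1 + exp (t - x))) \<partial>lborel) \<longlonglongrightarrow> ennreal (\<Lambda> x)"
    and \<Lambda>0: "\<And>x. 0 \<le> \<Lambda> x" and left: "((\<lambda>n. \<Lambda> (- real n)) \<longlonglongrightarrow> 0)" and right: "(\<lambda>n. \<Lambda> (real n) / exp (real n)) \<longlonglongrightarrow> 0"
  shows "\<exists>K'. mono K' \<and> (\<forall>t. 0 \<le> K' t) \<and>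
    (\<forall>x. (\<integral>\<^sup>+t. ennreal (K' t / (1 + exp (t - x))) \<partial>lborel) = ennreal (\<Lambda> x))"
proof -
  define w where "w = (\<lambda>x t::real. 1 / (1 + exp (t - x)))"
  have w0: "0 < w x t" for x t by (simp add: w_def add_pos_pos)
  have [measurable]: "w x \<in> borel_measurable borel" for x unfolding w_def by measurable
  have [measurable]: "K n \<in> borel_measurable borel" for n using cont by (rule borel_measurable_continuous_onI)
  define I where "I = (\<lambda>n x. \<integral>\<^sup>+t. ennreal (K n t * w x t) \<partial>lborel)"
  have limI: "(\<lambda>n. I n x) \<longlonglongrightarrow> ennreal (\<Lambda> x)" for x using lim[of x] by (simp add: I_def w_def)
  have w_ge: "1 / 2 \<le> w x t" if "t \<le> x" for x t
  proof -
    have "exp (t - x) \<le> 1" using that by simp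
    then show ?thesis unfolding w_def by (intro divide_left_mono mult_pos_pos add_pos_pos) auto
  qed
  have w1: "w x t \<le> 1" for x t
    using divide_left_mono[of 1 "1 + exp (t - x)" 1] by (simp add: w_def add_pos_pos)
  have w_anti: "w x t \<le> w x s" if "s \<le> t" for x s t
    using that by (auto simp: w_def intro!: divide_left_mono mult_pos_pos add_pos_pos)
  have Kb: "ennreal (K n t * w (t + 1) (t + 1)) \<le> I n (t + 1)" for n t
  proof -
    have "ennreal (K n t * w (t + 1) (t + 1)) = (\<integral>\<^sup>+s. ennreal (K n t * w (t + 1) (t + 1)) * indicator {t..t + 1} s \<partial>lborel)"
      by (simp add: nn_integral_cmult)
    also have "\<dots> \<le> I n (t + 1)" unfolding I_def
    proof (intro nn_integral_mono)
      fix s show "ennreal (K n t * w (t + 1) (t + 1)) * indicator {t..t + 1} s \<le> ennreal (K n s * w (t + 1) s)"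
        using nn w0 monoD[OF mono, of t s n] w_anti[of s "t + 1" "t + 1"]
        by (auto simp: indicator_def less_imp_le intro!: ennreal_leI mult_mono)
    qed
    finally show ?thesis .
  qed
  have bdd: "\<exists>B. \<forall>\<^sub>F n in sequentially. K n t \<le> B" for t
  proof -
    have "\<forall>\<^sub>F n in sequentially. I n (t + 1) < ennreal (\<Lambda> (t + 1) + 1)"
      by (rule order_tendstoD(2)[OF limI]) (use \<Lambda>0[of "t + 1"] in \<open>auto simp: ennreal_less_iff\<close>)
    then have "\<forall>\<^sub>F n in sequentially. K n t \<le> (\<Lambda> (t + 1) + 1) / w (t + 1) (t + 1)"
    proof eventually_elim
      case (elim n)
      then have "ennreal (K n t * w (t + 1) (t + 1)) < ennreal (\<Lambda> (t + 1) + 1)"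
        using Kb[of n t] by (rule le_less_trans[rotated])
      then have "K n t * w (t + 1) (t + 1) < \<Lambda> (t + 1) + 1"
        using nn[of n t] w0[of "t + 1" "t + 1"] by (subst (asm) ennreal_less_iff) (auto simp: less_imp_le)
      then show ?case using w0[of "t + 1" "t + 1"] by (simp add: pos_le_divide_eq less_imp_le)
    qed
    then show ?thesis by blast
  qed
  \<comment> \<open>Helly's theorem needs a uniform bound, while the \<open>K n\<close> are bounded
    only locally. The increasing map y / (1 + y) sends them into [0, 1) and is inverted after the
    selection.\<close>
  define p where "p = (\<lambda>n t. K n t / (1 + K n t))"
  have pb: "0 \<le> p n t" "p n t < 1" and pK: "K n t = p n t / (1 - p n t)" for n t
    using nn[of n t] by (auto simp: p_def field_simps)
  have pmono: "mono (p n)" for n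
  proof (rule monoI)
    fix s t :: real assume "s \<le> t"
    then have "K n s \<le> K n t" by (rule monoD[OF mono])
    then show "p n s \<le> p n t" using nn[of n s] nn[of n t] by (simp add: p_def field_simps)
  qed
  have pcont: "continuous (at_right t) (p n)" for t n
  proof -
    have "continuous_on UNIV (p n)" unfolding p_def
      using nn by (intro continuous_intros cont) (smt (verit))
    then have "continuous (at t) (p n)" by (simp add: continuous_on_eq_continuous_at)
    then show ?thesis by (rule continuous_within_subset) auto
  qed
  obtain s q where s: "strict_mono (s :: nat \<Rightarrow> nat)" and q: "mono q" and
    qlim: "\<And>t. continuous (at t) q \<Longrightarrow> (\<lambda>n. p (s n) t) \<longlonglongrightarrow> q t"
    using Helly_selection[of p 1] pcont pmono pb by (metis abs_of_nonneg less_imp_le)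
  have ctble: "countable {t. \<not> isCont q t}" using mono_ctble_discont[OF q] by simp
  have AEq: "AE t in lborel. isCont q t"
    by (rule AE_I'[OF countable_imp_null_set_lborel[OF ctble]]) auto
  have cont_point: "\<exists>t'>t. isCont q t'" for t
  proof -
    have "uncountable {t<..<t + 1}" by (rule uncountable_open_interval[THEN iffD2]) simp
    then have "\<not> {t<..<t + 1} \<subseteq> {t. \<not> isCont q t}" using ctble countable_subset by blast
    then show ?thesis by auto
  qed
  have q0: "0 \<le> q t" if "isCont q t" for t
    by (rule LIMSEQ_le_const[OF qlim[OF that]]) (use pb in auto)
  \<comment> \<open>The limit stays below 1, hence can be mapped back, because at each point the
    \<open>K n\<close> are eventually bounded: the integrals converge and control the values through
    \<open>Kb\<close>.\<close>
  have q1': "q t < 1" if "isCont q t" for t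
  proof -
    obtain B where B: "\<forall>\<^sub>F n in sequentially. K n t \<le> B" using bdd by blast
    have ev: "\<forall>\<^sub>F n in sequentially. K (s n) t \<le> B" using B s by (rule eventually_subseq[rotated])
    have B0: "0 \<le> B" using eventually_happens'[OF _ B] nn[of _ t] order_trans by (metis sequentially_bot)
    have "q t \<le> B / (1 + B)"
    proof (rule tendsto_upperbound[OF qlim[OF that]])
      show "\<forall>\<^sub>F n in sequentially. p (s n) t \<le> B / (1 + B)"
        using ev
      proof eventually_elim
        case (elim n)
        then show ?case using nn[of "s n" t] B0 by (simp add: p_def field_simps)
      qed
    qed simp
    also have "\<dots> < 1" using B0 by simp
    finally show ?thesis .
  qed
  have q1: "q t < 1" for t
  proof -
    obtain t' where "t < t'" "isCont q t'" using cont_point by blast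
    then show ?thesis using q1'[of t'] monoD[OF q, of t t'] by simp
  qed
  \<comment> \<open>Convergence, and with it nonnegativity of \<open>q\<close>, has been shown at
    continuity points; \<open>max 0\<close> provides nonnegativity at every point without changing
    \<open>q\<close> at continuity points.\<close>
  define K' where "K' = (\<lambda>t. max 0 (q t) / (1 - max 0 (q t)))"
  have m1: "max 0 (q t) < 1" for t using q1[of t] by simp
  have K'0: "0 \<le> K' t" for t using m1[of t] unfolding K'_def by (intro divide_nonneg_pos) auto
  have K'm: "mono K'"
  proof (rule monoI)
    fix s t :: real assume "s \<le> t"
    then have "max 0 (q s) \<le> max 0 (q t)" by (intro max.mono order_refl monoD[OF q])
    then show "K' s \<le> K' t" unfolding K'_def using m1[of s] m1[of t] by (intro frac_le) auto
  qed
  have [measurable]: "K' \<in> borel_measurable borel" by (rule borel_measurable_mono[OF K'm])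
  have Klim: "(\<lambda>n. K (s n) t) \<longlonglongrightarrow> K' t" if "isCont q t" for t
  proof -
    have "(\<lambda>n. p (s n) t / (1 - p (s n) t)) \<longlonglongrightarrow> q t / (1 - q t)"
      using q1[of t] by (intro tendsto_intros qlim that) auto
    then show ?thesis using q0[OF that] by (simp add: pK[symmetric] K'_def max_def)
  qed
  define tail where "tail = (\<lambda>T::real. - {-T..T})"
  have "(\<integral>\<^sup>+t. ennreal (K' t * w x t) \<partial>lborel) = ennreal (\<Lambda> x)" for x
  proof (rule antisym)
    define J where "J = (\<integral>\<^sup>+t. ennreal (K' t * w x t) \<partial>lborel)"
    have lims: "(\<lambda>n. I (s n) y) \<longlonglongrightarrow> ennreal (\<Lambda> y)" for y
      using LIMSEQ_subseq_LIMSEQ[OF limI s] by (simp add: o_def)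
    have mid: "(\<lambda>n. \<integral>\<^sup>+t. ennreal (K (s n) t * w x t) * indicator {-T..T} t \<partial>lborel) \<longlonglongrightarrow>
       (\<integral>\<^sup>+t. ennreal (K' t * w x t) * indicator {-T..T} t \<partial>lborel)" for T
    proof -
      obtain B where "\<forall>\<^sub>F n in sequentially. K n T \<le> B" using bdd by blast
      then have "\<forall>\<^sub>F n in sequentially. K (s n) T \<le> B" using s by (rule eventually_subseq[rotated])
      then obtain m where m: "\<And>n. m \<le> n \<Longrightarrow> K (s n) T \<le> B" by (auto simp: eventually_sequentially)
      have "(\<lambda>n. \<integral>\<^sup>+t. ennreal (K (s (n + m)) t * w x t) * indicator {-T..T} t \<partial>lborel) \<longlonglongrightarrow>
         (\<integral>\<^sup>+t. ennreal (K' t * w x t) * indicator {-T..T} t \<partial>lborel)"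
      proof (rule nn_integral_dominated_convergence[where w="\<lambda>t. ennreal B * indicator {-T..T} t"])
        show "AE t in lborel. ennreal (K (s (n + m)) t * w x t) * indicator {-T..T} t \<le> ennreal B * indicator {-T..T} t" for n
        proof (rule AE_I2)
          fix t
          have "K (s (n + m)) t * w x t \<le> B" if "t \<le> T"
          proof -
            have "K (s (n + m)) t \<le> B" using monoD[OF mono that, of "s (n + m)"] m[of "n + m"] by simp
            moreover have "w x t \<le> 1" by (rule w1)
            ultimately show ?thesis using mult_mono[of "K (s (n + m)) t" B "w x t" 1] nn[of "s (n + m)" t] w0[of x t] by simp
          qed
          then show "ennreal (K (s (n + m)) t * w x t) * indicator {-T..T} t \<le> ennreal B * indicator {-T..T} t"
            by (auto simp: indicator_def intro!: ennreal_leI)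
        qed
        show "(\<integral>\<^sup>+t. ennreal B * indicator {-T..T} t \<partial>lborel) < \<infinity>"
          by (simp add: nn_integral_cmult_indicator ennreal_mult_less_top emeasure_lborel_Icc_eq)
        show "AE t in lborel. (\<lambda>n. ennreal (K (s (n + m)) t * w x t) * indicator {-T..T} t) \<longlonglongrightarrow> ennreal (K' t * w x t) * indicator {-T..T} t"
          using AEq
        proof eventually_elim
          case (elim t)
          have "(\<lambda>n. K (s (n + m)) t) \<longlonglongrightarrow> K' t" by (rule LIMSEQ_ignore_initial_segment[OF Klim[OF elim]])
          then have "(\<lambda>n. ennreal (K (s (n + m)) t * w x t)) \<longlonglongrightarrow> ennreal (K' t * w x t)"
            by (intro tendsto_ennrealI tendsto_mult tendsto_const)
          then show ?case by (cases "t \<in> {-T..T}") auto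
        qed
      qed measurable
      then show ?thesis by (rule LIMSEQ_offset)
    qed
    show "J \<le> ennreal (\<Lambda> x)" unfolding J_def
    proof (rule LIMSEQ_le_const2)
      show "(\<lambda>n. \<integral>\<^sup>+t. ennreal (K' t * w x t) * indicator {-real n..real n} t \<partial>lborel) \<longlonglongrightarrow> (\<integral>\<^sup>+t. ennreal (K' t * w x t) \<partial>lborel)"
        by (rule nn_integral_symmetric_limit) measurable
      show "\<exists>N. \<forall>n\<ge>N. (\<integral>\<^sup>+t. ennreal (K' t * w x t) * indicator {-real n..real n} t \<partial>lborel) \<le> ennreal (\<Lambda> x)"
      proof (intro exI allI impI)
        fix n :: nat
        show "(\<integral>\<^sup>+t. ennreal (K' t * w x t) * indicator {-real n..real n} t \<partial>lborel) \<le> ennreal (\<Lambda> x)"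
          by (rule LIMSEQ_le[OF mid lims]) (auto simp: I_def intro!: nn_integral_mono mult_right_le_one_le simp: indicator_def)
      qed
    qed
    \<comment> \<open>For t < -T the weight with argument -T is at least 1/2, while
      \<open>w x t\<close> is at most 1. For t > T the weights with arguments x and T are comparable
      to exp (x - t) and exp (T - t), and their ratio is at most 2 exp (x - T).\<close>
    have tails: "I n x \<le> (\<integral>\<^sup>+t. ennreal (K n t * w x t) * indicator {-T..T} t \<partial>lborel) + 2 * I n (- T) + ennreal (2 * exp (x - T)) * I n T" for n T
    proof -
      have "I n x \<le> (\<integral>\<^sup>+t. ennreal (K n t * w x t) * indicator {-T..T} t + ennreal 2 * ennreal (K n t * w (- T) t) + ennreal (2 * exp (x - T)) * ennreal (K n t * w T t) \<partial>lborel)"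
        unfolding I_def
      proof (intro nn_integral_mono)
        fix t
        consider "t \<in> {-T..T}" | "t < - T" | "T < t" by fastforce
        then show "ennreal (K n t * w x t) \<le> ennreal (K n t * w x t) * indicator {-T..T} t + ennreal 2 * ennreal (K n t * w (- T) t) + ennreal (2 * exp (x - T)) * ennreal (K n t * w T t)"
        proof cases
          case 1 then show ?thesis by (simp add: add.assoc)
        next
          case 2
          have "w x t \<le> 1" by (rule w1)
          also have "1 \<le> 2 * w (- T) t" using w_ge[of t "- T"] 2 by simp
          finally have "K n t * w x t \<le> K n t * (2 * w (- T) t)" using nn[of n t] by (intro mult_left_mono)
          then have "ennreal (K n t * w x t) \<le> ennreal (2 * (K n t * w (- T) t))" by (intro ennreal_leI) (simp add: mult_ac)
          also have "\<dots> = ennreal 2 * ennreal (K n t * w (- T) t)" by (rule ennreal_mult') simp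
          finally show ?thesis by (simp add: add_increasing add_increasing2)
        next
          case 3
          have "w x t \<le> 2 * exp (x - T) * w T t"
          proof -
            have frac: "1 / A \<le> C * (1 / B)" if "0 < A" "0 < B" "B \<le> C * A" for A B C :: real
              using that by (simp add: field_simps)
            have "1 \<le> exp (t - T)" using 3 by simp
            then have "1 + exp (t - T) \<le> 2 * exp (t - T)" by linarith
            also have "2 * exp (t - T) = 2 * (exp (t - x) * exp (x - T))" by (simp add: exp_add[symmetric])
            also have "2 * (exp (t - x) * exp (x - T)) \<le> 2 * exp (x - T) * (1 + exp (t - x))" by (simp add: ring_distribs)
            finally have "1 + exp (t - T) \<le> 2 * exp (x - T) * (1 + exp (t - x))" .
            then show ?thesis unfolding w_def by (intro frac add_pos_pos) simp_all
          qed
          then have "K n t * w x t \<le> K n t * (2 * exp (x - T) * w T t)" using nn[of n t] by (intro mult_left_mono)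
          then have "ennreal (K n t * w x t) \<le> ennreal (2 * exp (x - T) * (K n t * w T t))" by (intro ennreal_leI) (simp add: mult_ac)
          also have "\<dots> = ennreal (2 * exp (x - T)) * ennreal (K n t * w T t)" by (rule ennreal_mult') simp
          finally show ?thesis by (simp add: add_increasing)
        qed
      qed
      also have "\<dots> = (\<integral>\<^sup>+t. ennreal (K n t * w x t) * indicator {-T..T} t \<partial>lborel) + ennreal 2 * I n (- T) + ennreal (2 * exp (x - T)) * I n T"
        unfolding I_def by (subst nn_integral_add, measurable, subst nn_integral_add, measurable, subst nn_integral_cmult, measurable, subst nn_integral_cmult, measurable)
      finally show ?thesis by simp
    qed
    have bound: "ennreal (\<Lambda> x) \<le> J + 2 * ennreal (\<Lambda> (- T)) + ennreal (2 * exp (x - T)) * ennreal (\<Lambda> T)" for T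
    proof -
      have "ennreal (\<Lambda> x) \<le> (\<integral>\<^sup>+t. ennreal (K' t * w x t) * indicator {-T..T} t \<partial>lborel) + 2 * ennreal (\<Lambda> (- T)) + ennreal (2 * exp (x - T)) * ennreal (\<Lambda> T)"
        by (rule LIMSEQ_le[OF lims tendsto_add[OF tendsto_add[OF mid ennreal_tendsto_cmult[OF _ lims]] ennreal_tendsto_cmult[OF _ lims]]])
           (use tails in auto)
      also have "(\<integral>\<^sup>+t. ennreal (K' t * w x t) * indicator {-T..T} t \<partial>lborel) \<le> J"
        unfolding J_def by (intro nn_integral_mono) (auto simp: indicator_def)
      finally show ?thesis by (simp add: add_mono)
    qed
    show "ennreal (\<Lambda> x) \<le> J"
    proof (rule LIMSEQ_le_const)
      have "(\<lambda>n. J + ennreal (2 * \<Lambda> (- real n) + 2 * exp x * (\<Lambda> (real n) / exp (real n)))) \<longlonglongrightarrow> J + ennreal (2 * 0 + 2 * exp x * 0)"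
        by (intro tendsto_add tendsto_const tendsto_ennrealI tendsto_mult left right)
      then show "(\<lambda>n. J + ennreal (2 * \<Lambda> (- real n) + 2 * exp x * (\<Lambda> (real n) / exp (real n)))) \<longlonglongrightarrow> J" by simp
      show "\<exists>N. \<forall>n\<ge>N. ennreal (\<Lambda> x) \<le> J + ennreal (2 * \<Lambda> (- real n) + 2 * exp x * (\<Lambda> (real n) / exp (real n)))"
      proof (intro exI allI impI)
        fix n :: nat
        have "2 * ennreal (\<Lambda> (- real n)) + ennreal (2 * exp (x - real n)) * ennreal (\<Lambda> (real n)) =
          ennreal (2 * \<Lambda> (- real n) + 2 * exp x * (\<Lambda> (real n) / exp (real n)))"
          using \<Lambda>0[of "- real n"] \<Lambda>0[of "real n"] by (simp add: exp_diff ennreal_plus ennreal_mult'[symmetric] flip: ennreal_numeral)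
        then show "ennreal (\<Lambda> x) \<le> J + ennreal (2 * \<Lambda> (- real n) + 2 * exp x * (\<Lambda> (real n) / exp (real n)))"
          using bound[of "real n"] by (simp add: add.assoc)
      qed
    qed
  qed
  then have "(\<integral>\<^sup>+t. ennreal (K' t / (1 + exp (t - x))) \<partial>lborel) = ennreal (\<Lambda> x)" for x by (simp add: w_def)
  then show ?thesis using K'm K'0 by blast
qed

section \<open>Laplace transforms\<close>

definition laplace :: "real measure \<Rightarrow> real \<Rightarrow> real" where
  "laplace \<mu> u = (LINT x|\<mu>. exp (- u * x))"

text \<open>The indicator makes the integrand bounded by 1 for every real x when Re z > 0, so that
  differentiation under the integral applies to it pointwise.\<close>

definition claplace :: "real measure \<Rightarrow> complex \<Rightarrow> complex" where
  "claplace \<mu> z = (LINT x|\<mu>. indicator {0..} x * exp (- z * of_real x))"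

lemma integrable_laplace:
  fixes \<mu> :: "real measure" and u :: real
  assumes "finite_measure \<mu>" "sets \<mu> = sets borel" "AE x in \<mu>. 0 \<le> x" "0 \<le> u"
  shows "integrable \<mu> (\<lambda>x. exp (- u * x))"
proof -
  interpret finite_measure \<mu> by fact
  have [measurable_cong]: "sets \<mu> = sets borel" by fact
  show ?thesis
  proof (rule integrable_const_bound[where B=1])
    show "AE x in \<mu>. norm (exp (- u * x)) \<le> 1"
      using assms(3)
    proof eventually_elim
      case (elim x)
      then have "0 \<le> u * x" using assms(4) by simp
      then show ?case by simp
    qed
  qed measurable
qed

lemma claplace_of_real:
  assumes "sets \<mu> = sets borel" "AE x in \<mu>. 0 \<le> x"
  shows "claplace \<mu> (of_real u) = of_real (laplace \<mu> u)"
proof -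
  have [measurable_cong]: "sets \<mu> = sets borel" by fact
  have "claplace \<mu> (of_real u) = (LINT x|\<mu>. of_real (exp (- u * x)))"
    unfolding claplace_def
    by (rule integral_cong_AE, measurable, use assms(2) in eventually_elim) (simp add: exp_of_real[symmetric])
  then show ?thesis by (simp add: laplace_def)
qed

lemma claplace_holomorphic:
  assumes fin: "finite_measure \<mu>" and s: "sets \<mu> = sets borel"
  shows "claplace \<mu> holomorphic_on {z. 0 < Re z}"
proof -
  have [measurable_cong]: "sets \<mu> = sets borel" by fact
  have "(claplace \<mu> has_field_derivative (LINT x|\<mu>. - of_real x * (indicator {0..} x * exp (- z * of_real x)))) (at z)" if "0 < Re z" for z
    unfolding claplace_def
  proof (rule has_field_derivative_integral[OF fin, where S="{z. 0 < Re z}"])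
    show "open {z. 0 < Re z}" by (rule open_halfspace_Re_gt)
    show "(\<lambda>x. indicator {0..} x * exp (- z * of_real x)) \<in> borel_measurable \<mu>" for z :: complex by measurable
    show "((\<lambda>z. indicator {0..} x * exp (- z * of_real x)) has_field_derivative - of_real x * (indicator {0..} x * exp (- z * of_real x))) (at z)" for z and x :: real
      by (cases "x \<ge> 0") (auto intro!: derivative_eq_intros)
    fix z :: complex assume "z \<in> {z. 0 < Re z}"
    then obtain r where r: "0 < r" "cball z r \<subseteq> {z. 0 < Re z}"
      using open_halfspace_Re_gt open_contains_cball by blast
    have "norm (indicator {0..} x * exp (- w * of_real x)) \<le> 1" if "w \<in> cball z r" for w and x :: real
    proof (cases "0 \<le> x")
      case True
      have "0 < Re w" using that r by auto
      then have "0 \<le> Re w * x" using True by simp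
      then show ?thesis using True by simp
    qed simp
    then show "\<exists>r>0. \<exists>B. cball z r \<subseteq> {z. 0 < Re z} \<and> (\<forall>w\<in>cball z r. \<forall>x\<in>space \<mu>. norm (indicator {0..} x * exp (- w * of_real x)) \<le> B)"
      using r by blast
  qed (use that in auto)
  then show ?thesis by (auto simp: holomorphic_on_open open_halfspace_Re_gt)
qed

text \<open>Equality on the positive reals extends to the open right half plane by the identity
  theorem. Letting Re z tend to 0 gives equal characteristic functions, and Levy's uniqueness
  theorem applies.\<close>

lemma laplace_unique_prob:
  assumes M: "prob_space \<mu>" "sets \<mu> = sets borel" "AE x in \<mu>. 0 \<le> x"
    and N: "prob_space \<nu>" "sets \<nu> = sets borel" "AE x in \<nu>. 0 \<le> x"
    and eq: "\<And>u. 0 < u \<Longrightarrow> laplace \<mu> u = laplace \<nu> u"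
  shows "\<mu> = \<nu>"
proof (rule Levy_uniqueness)
  have d: "real_distribution \<mu>" if "prob_space \<mu>" "sets \<mu> = sets borel" for \<mu> :: "real measure"
    using that by (auto simp: real_distribution_def real_distribution_axioms_def dest: sets_eq_imp_space_eq)
  show "real_distribution \<mu>" "real_distribution \<nu>" using d M N by auto
  have ceq: "claplace \<mu> z = claplace \<nu> z" if z: "0 < Re z" for z
  proof -
    define S where "S = {z :: complex. 0 < Re z}"
    have "(\<lambda>z. claplace \<mu> z - claplace \<nu> z) holomorphic_on S"
      unfolding S_def using M N by (intro holomorphic_intros claplace_holomorphic) (auto intro: prob_space.finite_measure)
    moreover have "of_real ` {0<..} \<subseteq> S" by (auto simp: S_def)
    moreover have "1 islimpt (of_real ` {0<..} :: complex set)"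
      unfolding islimpt_sequential
    proof (intro exI[of _ "\<lambda>n. of_real (1 + inverse (real (Suc n)))"] conjI allI)
      show "of_real (1 + inverse (real (Suc n))) \<in> of_real ` {0<..} - {1 :: complex}" for n
      proof
        show "complex_of_real (1 + inverse (real (Suc n))) \<in> of_real ` {0<..}" by (intro imageI) (simp add: add_pos_pos)
        show "complex_of_real (1 + inverse (real (Suc n))) \<notin> {1}" by (simp add: complex_eq_iff)
      qed
      have "(\<lambda>n. complex_of_real (1 + inverse (real (Suc n)))) \<longlonglongrightarrow> of_real (1 + 0)"
        by (intro tendsto_intros LIMSEQ_inverse_real_of_nat)
      then show "(\<lambda>n. complex_of_real (1 + inverse (real (Suc n)))) \<longlonglongrightarrow> 1" by simp
    qed
    moreover have "claplace \<mu> w - claplace \<nu> w = 0" if w: "w \<in> of_real ` {0<..}" for w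
      using w M N eq by (auto simp: claplace_of_real)
    ultimately have "claplace \<mu> z - claplace \<nu> z = 0"
      by (intro analytic_continuation[of "\<lambda>z. claplace \<mu> z - claplace \<nu> z" S "of_real ` {0<..}" 1 z])
         (use z in \<open>auto simp: S_def open_halfspace_Re_gt convex_connected convex_halfspace_Re_gt\<close>)
    then show ?thesis by simp
  qed
  have lim: "(\<lambda>n. claplace \<mu> (Complex (inverse (real (Suc n))) (- t))) \<longlonglongrightarrow> char \<mu> t"
    if "prob_space \<mu>" "sets \<mu> = sets borel" "AE x in \<mu>. 0 \<le> x" for \<mu> t
  proof -
    interpret prob_space \<mu> by fact
    have [measurable_cong]: "sets \<mu> = sets borel" by fact
    show ?thesis unfolding claplace_def char_def
    proof (rule integral_dominated_convergence[where w="\<lambda>_. 1"])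
      show "AE x in \<mu>. (\<lambda>n. indicator {0..} x * exp (- Complex (inverse (real (Suc n))) (- t) * of_real x)) \<longlonglongrightarrow> iexp (t * x)"
        using that(3)
      proof eventually_elim
        case (elim x)
        have "(\<lambda>n. exp (- (of_real (inverse (real (Suc n))) - \<i> * of_real t) * of_real x)) \<longlonglongrightarrow> exp (- (of_real 0 - \<i> * of_real t) * of_real x)"
          by (intro tendsto_intros LIMSEQ_inverse_real_of_nat)
        moreover have "Complex r (- t) = of_real r - \<i> * of_real t" for r by (simp add: complex_eq_iff)
        ultimately show ?case using elim by (simp add: mult.assoc)
      qed
      show "AE x in \<mu>. norm (indicator {0..} x * exp (- Complex (inverse (real (Suc n))) (- t) * of_real x)) \<le> 1" for n
        by (intro AE_I2) (auto simp: indicator_def)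
      show "(\<lambda>x. indicator {0..} x * exp (- Complex (inverse (real (Suc n))) (- t) * of_real x)) \<in> borel_measurable \<mu>" for n
        by measurable
    qed (auto simp: )
  qed
  show "char \<mu> = char \<nu>"
  proof
    fix t
    show "char \<mu> t = char \<nu> t"
    proof (rule LIMSEQ_unique[OF lim[OF M]])
      have "(\<lambda>n. claplace \<mu> (Complex (inverse (real (Suc n))) (- t))) = (\<lambda>n. claplace \<nu> (Complex (inverse (real (Suc n))) (- t)))"
        by (intro ext ceq) (simp add: complex.sel)
      then show "(\<lambda>n. claplace \<mu> (Complex (inverse (real (Suc n))) (- t))) \<longlonglongrightarrow> char \<nu> t" using lim[OF N] by simp
    qed
  qed
qed

text \<open>The value at u = 0 is the total mass, so both measures are normalised by the same
  constant. The form for finite measures is wanted for laws weighted by a bounded density.\<close>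

lemma laplace_unique:
  assumes M: "finite_measure \<mu>" "sets \<mu> = sets borel" "AE x in \<mu>. 0 \<le> x"
    and N: "finite_measure \<nu>" "sets \<nu> = sets borel" "AE x in \<nu>. 0 \<le> x"
    and eq: "\<And>u. 0 \<le> u \<Longrightarrow> laplace \<mu> u = laplace \<nu> u"
  shows "\<mu> = \<nu>"
proof -
  interpret M: finite_measure \<mu> by fact
  interpret N: finite_measure \<nu> by fact
  have [measurable_cong]: "sets \<mu> = sets borel" "sets \<nu> = sets borel" by fact+
  have sp: "space \<mu> = UNIV" "space \<nu> = UNIV" using sets_eq_imp_space_eq[OF M(2)] sets_eq_imp_space_eq[OF N(2)] by auto
  define c where "c = measure \<mu> UNIV"
  have c: "measure \<nu> UNIV = c" using eq[of 0] by (simp add: laplace_def c_def sp)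
  show ?thesis
  proof (cases "c = 0")
    case True
    show ?thesis
    proof (rule measure_eqI)
      fix A assume "A \<in> sets \<mu>"
      have "measure \<mu> A \<le> measure \<mu> UNIV" "measure \<nu> A \<le> measure \<nu> UNIV"
        using M.bounded_measure[of A] N.bounded_measure[of A] by (simp_all add: sp)
      then have "measure \<mu> A = 0" "measure \<nu> A = 0" using True c by (auto simp: c_def intro: antisym)
      then show "emeasure \<mu> A = emeasure \<nu> A" by (simp add: M.emeasure_eq_measure N.emeasure_eq_measure)
    qed (simp add: M N)
  next
    case False
    then have c0: "0 < c" using measure_nonneg[of \<mu> UNIV] unfolding c_def by linarith
    define P where "P = (\<lambda>\<mu>::real measure. density \<mu> (\<lambda>_. ennreal (1 / c)))"
    have P: "prob_space (P \<mu>)" "sets (P \<mu>) = sets borel" "AE x in P \<mu>. 0 \<le> x" "laplace (P \<mu>) u = laplace \<mu> u / c"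
      if "finite_measure \<mu>" "sets \<mu> = sets borel" "measure \<mu> UNIV = c" "AE x in \<mu>. 0 \<le> x" for \<mu> u
    proof -
      interpret finite_measure \<mu> by fact
      have [measurable_cong]: "sets \<mu> = sets borel" by fact
      have "space \<mu> = UNIV" using sets_eq_imp_space_eq[OF that(2)] by simp
      then show "prob_space (P \<mu>)" unfolding P_def using c0 that(3)
        by (intro prob_spaceI) (simp add: emeasure_density emeasure_eq_measure flip: ennreal_mult')
      show "sets (P \<mu>) = sets borel" by (simp add: P_def that)
      show "AE x in P \<mu>. 0 \<le> x" unfolding P_def using that(4) by (subst AE_density) auto
      show "laplace (P \<mu>) u = laplace \<mu> u / c" unfolding P_def laplace_def using c0
        by (subst integral_density) (auto simp: divide_inverse mult.commute)
    qed
    note PM = P[OF M(1) M(2) c_def[symmetric] M(3)]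
    note PN = P[OF N(1) N(2) c N(3)]
    have "P \<mu> = P \<nu>"
      by (rule laplace_unique_prob[OF PM(1-3) PN(1-3)]) (simp add: PM(4) PN(4) eq)
    have rescale: "\<mu> = density (P \<mu>) (\<lambda>_. ennreal c)" for \<mu> :: "real measure"
      unfolding P_def using c0 by (subst density_density_eq) (auto simp: density_1 simp flip: ennreal_mult')
    show ?thesis using rescale[of \<mu>] rescale[of \<nu>] \<open>P \<mu> = P \<nu>\<close> by simp
  qed
qed

text \<open>The exponentials are replaced by indicators one coordinate at a time: \<open>h m\<close>
  has indicators of \<open>A i\<close> for i < m and exponentials afterwards. With the other factors
  fixed as a weight \<open>W\<close>, the law of \<open>X m\<close> under the weighted measure has
  the Laplace transform of a constant multiple \<open>c\<close> of its own law, hence equals it, and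
  the two measures agree on \<open>A m\<close>.\<close>

lemma (in prob_space) indep_vars_of_laplace:
  fixes X :: "nat \<Rightarrow> 'a \<Rightarrow> real"
  assumes X [measurable]: "\<And>i. i < n \<Longrightarrow> X i \<in> borel_measurable M" and X0: "\<And>i \<omega>. i < n \<Longrightarrow> \<omega> \<in> space M \<Longrightarrow> 0 \<le> X i \<omega>"
    and eq: "\<And>u :: nat \<Rightarrow> real. (\<And>i. 0 \<le> u i) \<Longrightarrow>
      expectation (\<lambda>\<omega>. \<Prod>i<n. exp (- u i * X i \<omega>)) = (\<Prod>i<n. expectation (\<lambda>\<omega>. exp (- u i * X i \<omega>)))"
  shows "indep_vars (\<lambda>_. borel) X {..<n}"
proof -
  define h where "h = (\<lambda>m A u (i :: nat) (x::real). if i < m then indicator (A i) x else exp (- u i * x) :: real)"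
  have hm [measurable]: "h m A u i \<in> borel_measurable borel" if "i < n" "\<forall>i<n. A i \<in> sets borel" for m A u i
    using that unfolding h_def by (cases "i < m") auto
  have h01: "0 \<le> h m A u i x" "0 \<le> x \<Longrightarrow> 0 \<le> u i \<Longrightarrow> h m A u i x \<le> 1" for m A u i x
    by (auto simp: h_def indicator_def)
  have main: "expectation (\<lambda>\<omega>. \<Prod>i<n. h m A u i (X i \<omega>)) = (\<Prod>i<n. expectation (\<lambda>\<omega>. h m A u i (X i \<omega>)))"
    if "m \<le> n" "\<forall>i<n. A i \<in> sets borel" "\<forall>i. 0 \<le> u i" for m and A :: "nat \<Rightarrow> real set" and u
    using that
  proof (induction m arbitrary: u)
    case 0
    then show ?case using eq[of u] by (simp add: h_def)
  next
    case (Suc m)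
    then have m: "m < n" by simp
    have split: "(\<Prod>i<n. f i) = f m * (\<Prod>i\<in>{..<n} - {m}. f i)" for f :: "nat \<Rightarrow> real"
      using m by (subst prod.remove[of "{..<n}" m]) auto
    have h_eq: "h (Suc m) A u i = h m A (u(m := v)) i" if "i \<noteq> m" for i v using that by (auto simp: h_def)
    define W where "W = (\<lambda>\<omega>. \<Prod>i\<in>{..<n} - {m}. h (Suc m) A u i (X i \<omega>))"
    define c where "c = (\<Prod>i\<in>{..<n} - {m}. expectation (\<lambda>\<omega>. h (Suc m) A u i (X i \<omega>)))"
    have Wm [measurable]: "W \<in> borel_measurable M" unfolding W_def
      using Suc.prems by (intro borel_measurable_prod measurable_compose[OF X] hm) auto
    have W0: "0 \<le> W \<omega>" for \<omega> unfolding W_def by (intro prod_nonneg) (auto simp: h01)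
    have W1: "W \<omega> \<le> 1" if "\<omega> \<in> space M" for \<omega> unfolding W_def
      using X0[OF _ that] Suc.prems by (intro prod_le_1) (auto intro!: h01)
    have c0: "0 \<le> c" unfolding c_def by (intro prod_nonneg) (auto intro!: integral_nonneg simp: h01)
    have Xm: "X m \<in> borel_measurable M" by (rule X[OF m])
    define \<nu>1 where "\<nu>1 = distr (density M (\<lambda>\<omega>. ennreal (W \<omega>))) borel (X m)"
    define \<nu>2 where "\<nu>2 = distr (density M (\<lambda>_. ennreal c)) borel (X m)"
    have I: "(LINT x|distr (density M (\<lambda>\<omega>. ennreal (V \<omega>))) borel (X m). f x) = expectation (\<lambda>\<omega>. V \<omega> * f (X m \<omega>))"
      if "V \<in> borel_measurable M" "\<And>\<omega>. 0 \<le> V \<omega>" "f \<in> borel_measurable borel" for V and f :: "real \<Rightarrow> real"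
      using that Xm by (subst integral_distr, simp, simp, subst integral_density) auto
    \<comment> \<open>The induction hypothesis is applied with the m-th parameter replaced by the
      free variable \<open>v\<close>; this is why it is stated for all \<open>u\<close>.\<close>
    have "\<nu>1 = \<nu>2"
    proof (rule laplace_unique)
      have fin: "finite_measure (density M (\<lambda>\<omega>. ennreal (V \<omega>)))" if "V \<in> borel_measurable M" "\<And>\<omega>. \<omega> \<in> space M \<Longrightarrow> V \<omega> \<le> B" for V B
      proof (rule finite_measureI)
        have "emeasure (density M (\<lambda>\<omega>. ennreal (V \<omega>))) (space M) = (\<integral>\<^sup>+\<omega>. ennreal (V \<omega>) \<partial>M)"
          using that by (subst emeasure_density) (auto intro!: nn_integral_cong)
        also have "\<dots> \<le> (\<integral>\<^sup>+\<omega>. ennreal B \<partial>M)" using that by (intro nn_integral_mono ennreal_leI) auto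
        also have "\<dots> < \<infinity>" by (simp add: emeasure_space_1)
        finally show "emeasure (density M (\<lambda>\<omega>. ennreal (V \<omega>))) (space (density M (\<lambda>\<omega>. ennreal (V \<omega>)))) \<noteq> \<infinity>" by simp
      qed
      show "finite_measure \<nu>1" "finite_measure \<nu>2"
        unfolding \<nu>1_def \<nu>2_def using W1 Xm by (auto intro!: finite_measure.finite_measure_distr fin)
      show "AE x in \<nu>1. 0 \<le> x" "AE x in \<nu>2. 0 \<le> x"
        unfolding \<nu>1_def \<nu>2_def using Xm X0[OF m] by (auto simp: AE_distr_iff AE_density intro!: AE_I2)
      show "laplace \<nu>1 v = laplace \<nu>2 v" if v: "0 \<le> v" for v
      proof -
        define u' where "u' = u(m := v)"
        have 1: "h m A u' m x = exp (- v * x)" for x by (simp add: h_def u'_def)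
        have 2: "h m A u' i = h (Suc m) A u i" if "i \<noteq> m" for i using h_eq[OF that, of v] by (simp add: u'_def)
        have "laplace \<nu>1 v = expectation (\<lambda>\<omega>. W \<omega> * exp (- v * X m \<omega>))"
          unfolding laplace_def \<nu>1_def using W0 by (subst I) auto
        also have "\<dots> = expectation (\<lambda>\<omega>. \<Prod>i<n. h m A u' i (X i \<omega>))"
          unfolding split W_def by (intro Bochner_Integration.integral_cong refl) (simp add: 1 2 mult.commute)
        also have "\<dots> = (\<Prod>i<n. expectation (\<lambda>\<omega>. h m A u' i (X i \<omega>)))"
          using Suc.prems v by (intro Suc.IH) (auto simp: u'_def)
        also have "\<dots> = expectation (\<lambda>\<omega>. exp (- v * X m \<omega>)) * c"
          unfolding split c_def by (simp add: 1 2)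
        also have "\<dots> = laplace \<nu>2 v"
          unfolding laplace_def \<nu>2_def using c0 by (subst I) auto
        finally show ?thesis .
      qed
    qed (simp_all add: \<nu>1_def \<nu>2_def)
    then have "(LINT x|\<nu>1. indicator (A m) x) = (LINT x|\<nu>2. indicator (A m) x)" by simp
    moreover have [measurable]: "A m \<in> sets borel" using Suc.prems m by auto
    ultimately have "expectation (\<lambda>\<omega>. W \<omega> * indicator (A m) (X m \<omega>)) = expectation (\<lambda>\<omega>. c * indicator (A m) (X m \<omega>))"
      unfolding \<nu>1_def \<nu>2_def using W0 c0 m Suc.prems by (subst (asm) (1 2) I) auto
    then show ?case unfolding split W_def c_def[symmetric] by (simp add: h_def mult.commute)
  qed
  show ?thesis
  proof (cases "n = 0")
    case True
    then show ?thesis by (simp add: indep_vars_def2 indep_sets_def)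
  next
    case False
    show ?thesis unfolding indep_vars_def2
    proof (intro conjI ballI)
      show "X i \<in> borel_measurable M" if "i \<in> {..<n}" for i using that X by auto
      show "indep_sets (\<lambda>i. {X i -` A \<inter> space M |A. A \<in> sets borel}) {..<n}"
      proof (subst indep_sets_finite)
        show "{..<n} \<noteq> {}" "finite {..<n}" using False by auto
        show "{X i -` A \<inter> space M |A. A \<in> sets borel} \<subseteq> events" if "i \<in> {..<n}" for i
          using that X by (auto intro: measurable_sets)
        show "space M \<in> {X i -` A \<inter> space M |A. A \<in> sets borel}" if "i \<in> {..<n}" for i
          by (intro CollectI exI[of _ UNIV]) auto
        show "\<forall>A\<in>\<Pi> i\<in>{..<n}. {X i -` A \<inter> space M |A. A \<in> sets borel}. prob (\<Inter>j\<in>{..<n}. A j) = (\<Prod>j\<in>{..<n}. prob (A j))"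
        proof
          fix B assume "B \<in> (\<Pi> i\<in>{..<n}. {X i -` A \<inter> space M |A. A \<in> sets borel})"
          then have "\<forall>i\<in>{..<n}. \<exists>A. B i = X i -` A \<inter> space M \<and> A \<in> sets borel" by auto
          then obtain A where A: "\<And>i. i < n \<Longrightarrow> B i = X i -` A i \<inter> space M" "\<And>i. i < n \<Longrightarrow> A i \<in> sets borel"
            using bchoice[of "{..<n}" "\<lambda>i A. B i = X i -` A \<inter> space M \<and> A \<in> sets borel"] by auto
          have Bs: "B i \<in> events" if "i < n" for i using A[OF that] X[OF that] by (auto intro: measurable_sets)
          have "prob (\<Inter>j\<in>{..<n}. B j) = expectation (indicator (\<Inter>j\<in>{..<n}. B j))"
          proof -
            have "(\<Inter>j\<in>{..<n}. B j) \<in> events" using Bs False by (intro sets.finite_INT) auto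
            then show ?thesis by (simp add: sets.Int_space_eq2)
          qed
          also have "\<dots> = expectation (\<lambda>\<omega>. \<Prod>i<n. h n A (\<lambda>_. 0) i (X i \<omega>))"
            using A False by (intro Bochner_Integration.integral_cong refl) (auto simp: h_def indicator_def prod_zero_iff)
          also have "\<dots> = (\<Prod>i<n. expectation (\<lambda>\<omega>. h n A (\<lambda>_. 0) i (X i \<omega>)))"
            using A by (intro main) auto
          also have "\<dots> = (\<Prod>i<n. prob (B i))"
          proof (intro prod.cong refl)
            fix i assume i: "i \<in> {..<n}"
            have "expectation (\<lambda>\<omega>. h n A (\<lambda>_. 0) i (X i \<omega>)) = expectation (indicator (B i))"
              using A i by (intro Bochner_Integration.integral_cong refl) (auto simp: h_def indicator_def)
            also have "\<dots> = prob (B i)" using Bs[of i] i by (simp add: sets.Int_space_eq2)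
            finally show "expectation (\<lambda>\<omega>. h n A (\<lambda>_. 0) i (X i \<omega>)) = prob (B i)" .
          qed
          finally show "prob (\<Inter>j\<in>{..<n}. B j) = (\<Prod>j\<in>{..<n}. prob (B j))" .
        qed
      qed
    qed
  qed
qed

section \<open>A Poisson process of marks\<close>

text \<open>The function exp (- x) extended by 0 at infinity, so that Laplace functionals of sums of
  jumps can be written before the sums are known to be finite.\<close>

definition nexp :: "ennreal \<Rightarrow> ennreal" where
  "nexp x = (if x = \<top> then 0 else ennreal (exp (- enn2real x)))"

lemma nexp_ennreal [simp]: "0 \<le> r \<Longrightarrow> nexp (ennreal r) = ennreal (exp (- r))"
  by (simp add: nexp_def)

lemma nexp_0 [simp]: "nexp 0 = 1"
  by (simp add: nexp_def)

lemma nexp_top [simp]: "nexp \<top> = 0"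
  by (simp add: nexp_def)

lemma nexp_le_1: "nexp x \<le> 1"
  by (simp add: nexp_def)

lemma nexp_measurable [measurable]: "nexp \<in> borel_measurable borel"
  unfolding nexp_def by measurable

lemma nexp_add: "nexp (x + y) = nexp x * nexp y"
proof (cases x; cases y)
  fix r s assume "x = ennreal r" "0 \<le> r" "y = ennreal s" "0 \<le> s"
  moreover have "exp (- (r + s)) = exp (- r) * exp (- s)" by (simp flip: exp_add)
  ultimately show ?thesis by (simp add: ennreal_mult del: exp_minus minus_add_distrib flip: ennreal_plus)
qed auto

lemma nexp_sum: "finite A \<Longrightarrow> nexp (\<Sum>i\<in>A. f i) = (\<Prod>i\<in>A. nexp (f i))"
  by (induction A rule: finite_induct) (auto simp: nexp_add)

lemma nexp_antimono: "x \<le> y \<Longrightarrow> nexp y \<le> nexp x"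
proof (cases y)
  case (real r)
  assume "x \<le> y"
  then have "x \<noteq> \<top>" using real by (auto simp: top_unique)
  then show ?thesis using \<open>x \<le> y\<close> real by (cases x) auto
qed simp

lemma nexp_tendsto_SUP:
  assumes "incseq S"
  shows "(\<lambda>n. nexp (S n)) \<longlonglongrightarrow> nexp (SUP n. S n)"
proof -
  define L where "L = (SUP n. S n)"
  have S: "S \<longlonglongrightarrow> L" unfolding L_def by (rule LIMSEQ_SUP[OF assms])
  have le: "S n \<le> L" for n unfolding L_def by (rule SUP_upper) simp
  have "(\<lambda>n. nexp (S n)) \<longlonglongrightarrow> nexp L"
  proof (cases L)
    case (real r)
    have "S n \<noteq> \<top>" for n using le[of n] real by (auto simp: top_unique)
    then have eq: "nexp (S n) = ennreal (exp (- enn2real (S n)))" for n by (simp add: nexp_def)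
    have "(\<lambda>n. enn2real (S n)) \<longlonglongrightarrow> r"
      using S real by (intro tendsto_enn2real) auto
    then have "(\<lambda>n. ennreal (exp (- enn2real (S n)))) \<longlonglongrightarrow> ennreal (exp (- r))"
      by (intro tendsto_ennrealI tendsto_exp tendsto_minus)
    then show ?thesis using real by (simp add: eq)
  next
    case top
    show ?thesis unfolding top nexp_top
    proof (rule order_tendstoI)
      fix e :: ennreal assume "0 < e"
      then have "\<exists>r>0. ennreal r < e"
      proof (cases e)
        case (real s)
        then show ?thesis using \<open>0 < e\<close> by (intro exI[of _ "s / 2"]) (auto simp: ennreal_less_iff)
      qed (auto intro: exI[of _ 1])
      then obtain r where r: "0 < r" "ennreal r < e" by blast
      have "\<forall>\<^sub>F n in sequentially. ennreal (\<bar>ln r\<bar>) < S n"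
        using S top by (intro order_tendstoD(1)) auto
      then show "\<forall>\<^sub>F n in sequentially. nexp (S n) < e"
      proof eventually_elim
        case (elim n)
        have "nexp (S n) \<le> nexp (ennreal \<bar>ln r\<bar>)" using elim by (intro nexp_antimono) simp
        also have "\<dots> = ennreal (exp (- \<bar>ln r\<bar>))" by simp
        also have "\<dots> \<le> ennreal (exp (ln r))" by (intro ennreal_leI) auto
        also have "\<dots> = ennreal r" using r by simp
        finally show ?case using r(2) by (rule le_less_trans)
      qed
    qed simp
  qed
  then show ?thesis by (simp add: L_def)
qed

lemma nexp_tendsto_suminf: "(\<lambda>m. nexp (\<Sum>k<m. f k)) \<longlonglongrightarrow> nexp (\<Sum>k. f k)"
proof -
  have "incseq (\<lambda>m. \<Sum>k<m. f k)" by (intro incseq_SucI) (simp add: add_increasing2)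
  then show ?thesis using nexp_tendsto_SUP[of "\<lambda>m. \<Sum>k<m. f k"] by (simp add: suminf_eq_SUP)
qed

lemma (in product_prob_space) nn_integral_PiM_prod:
  assumes J: "finite J" "J \<subseteq> I" and f: "\<And>j. j \<in> J \<Longrightarrow> f j \<in> borel_measurable (M j)"
  shows "(\<integral>\<^sup>+x. (\<Prod>j\<in>J. f j (x j)) \<partial>PiM I M) = (\<Prod>j\<in>J. integral\<^sup>N (M j) (f j))"
proof -
  have "(\<Prod>j\<in>J. integral\<^sup>N (M j) (f j)) = (\<integral>\<^sup>+x. (\<Prod>j\<in>J. f j (x j)) \<partial>PiM J M)"
    using J f by (intro product_nn_integral_prod[symmetric]) auto
  also have "\<dots> = (\<integral>\<^sup>+x. (\<Prod>j\<in>J. f j (x j)) \<partial>distr (PiM I M) (PiM J M) (\<lambda>x. restrict x J))"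
    using J by (simp add: distr_PiM_restrict_finite)
  also have "\<dots> = (\<integral>\<^sup>+x. (\<Prod>j\<in>J. f j (restrict x J j)) \<partial>PiM I M)"
  proof -
    have "(\<lambda>x. f j (x j)) \<in> borel_measurable (PiM J M)" if "j \<in> J" for j
      by (rule measurable_compose[where f="\<lambda>x. x j" and g="f j" and N="M j"]) (use that f in auto)
    then have m: "(\<lambda>x. \<Prod>j\<in>J. f j (x j)) \<in> borel_measurable (PiM J M)" by (rule borel_measurable_prod_ennreal)
    show ?thesis by (rule nn_integral_distr[OF measurable_restrict_subset[OF J(2)]]) (simp add: m)
  qed
  also have "\<dots> = (\<integral>\<^sup>+x. (\<Prod>j\<in>J. f j (x j)) \<partial>PiM I M)"
    by (intro nn_integral_cong prod.cong) auto
  finally show ?thesis by simp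
qed

text \<open>A Poisson process with intensity \<open>D\<close>, coded as a Poisson number of points
  with mean 1 and an infinite sequence of independent marks; the functionals below read only as many
  marks as the number says.\<close>

definition poisson_piece :: "'p measure \<Rightarrow> (nat \<times> (nat \<Rightarrow> 'p)) measure" where
  "poisson_piece D = measure_pmf (poisson_pmf 1) \<Otimes>\<^sub>M (\<Pi>\<^sub>M _\<in>UNIV. D)"

lemma prob_space_poisson_piece: "prob_space D \<Longrightarrow> prob_space (poisson_piece D)"
proof -
  assume "prob_space D"
  then interpret P: prob_space "\<Pi>\<^sub>M _\<in>(UNIV :: nat set). D" by (intro prob_space_PiM)
  interpret Q: pair_prob_space "measure_pmf (poisson_pmf 1)" "\<Pi>\<^sub>M _\<in>(UNIV :: nat set). D" by unfold_locales
  show ?thesis unfolding poisson_piece_def by (rule Q.prob_space_axioms)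
qed

lemma measurable_poisson_piece [measurable (raw)]:
  "f \<in> M \<rightarrow>\<^sub>M poisson_piece D \<Longrightarrow> (\<lambda>x. fst (f x)) \<in> M \<rightarrow>\<^sub>M count_space UNIV"
  "f \<in> M \<rightarrow>\<^sub>M poisson_piece D \<Longrightarrow> (\<lambda>x. snd (f x) l) \<in> M \<rightarrow>\<^sub>M D"
proof -
  assume f: "f \<in> M \<rightarrow>\<^sub>M poisson_piece D"
  have "(\<lambda>x. fst (f x)) \<in> M \<rightarrow>\<^sub>M measure_pmf (poisson_pmf 1)"
    using f unfolding poisson_piece_def by measurable
  then show "(\<lambda>x. fst (f x)) \<in> M \<rightarrow>\<^sub>M count_space UNIV" by simp
  have "(\<lambda>x. snd (f x)) \<in> M \<rightarrow>\<^sub>M (\<Pi>\<^sub>M _\<in>(UNIV :: nat set). D)"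
    using f unfolding poisson_piece_def by measurable
  then show "(\<lambda>x. snd (f x) l) \<in> M \<rightarrow>\<^sub>M D" by (rule measurable_compose) simp
qed

text \<open>Given n points, independence yields c^n, where c is the mean of
  \<open>nexp (h p)\<close>; the generating function of the Poisson law then yields exp (c - 1). The
  relation c + d = 1 is stated as a sum because subtraction in \<open>ennreal\<close> is
  truncated.\<close>

lemma nn_integral_poisson_piece:
  assumes D: "prob_space D" and [measurable]: "h \<in> borel_measurable D"
    and d: "(\<integral>\<^sup>+p. nexp (h p) \<partial>D) + d = 1"
  shows "(\<integral>\<^sup>+\<omega>. nexp (\<Sum>l. if l < fst \<omega> then h (snd \<omega> l) else 0) \<partial>poisson_piece D) = nexp d"
proof -
  interpret D: prob_space D by fact
  interpret DP: product_prob_space "\<lambda>_::nat. D" UNIV by unfold_locales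
  have d_le: "d \<le> 1" using d by (metis add_increasing le_zero_eq order_refl zero_le)
  then obtain r where r: "d = ennreal r" "0 \<le> r" "r \<le> 1" by (cases d) (auto simp: top_unique)
  have c: "(\<integral>\<^sup>+p. nexp (h p) \<partial>D) = ennreal (1 - r)"
  proof -
    have "(\<integral>\<^sup>+p. nexp (h p) \<partial>D) \<noteq> \<top>" using d by auto
    then obtain c where c: "(\<integral>\<^sup>+p. nexp (h p) \<partial>D) = ennreal c" "0 \<le> c"
      by (cases "\<integral>\<^sup>+p. nexp (h p) \<partial>D") auto
    then have "ennreal (c + r) = ennreal 1" using d r by (simp add: ennreal_plus)
    then have "c + r = 1" using c r by (subst (asm) ennreal_inj) auto
    then show ?thesis using c by (auto simp: algebra_simps)
  qed
  have [measurable]: "(\<lambda>\<omega>. \<omega>) \<in> poisson_piece D \<rightarrow>\<^sub>M poisson_piece D" by simp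
  have "(\<integral>\<^sup>+\<omega>. nexp (\<Sum>l. if l < fst \<omega> then h (snd \<omega> l) else 0) \<partial>poisson_piece D) =
    (\<integral>\<^sup>+n. (\<integral>\<^sup>+p. nexp (\<Sum>l. if l < fst (n, p) then h (snd (n, p) l) else 0) \<partial>(\<Pi>\<^sub>M _\<in>UNIV. D)) \<partial>measure_pmf (poisson_pmf 1))"
    unfolding poisson_piece_def
  proof (rule DP.P.nn_integral_fst[symmetric])
    have "(\<lambda>\<omega>. nexp (\<Sum>l. if l < fst \<omega> then h (snd \<omega> l) else 0)) \<in> borel_measurable (poisson_piece D)" by measurable
    then show "(\<lambda>\<omega>. nexp (\<Sum>l. if l < fst \<omega> then h (snd \<omega> l) else 0)) \<in> borel_measurable (measure_pmf (poisson_pmf 1) \<Otimes>\<^sub>M (\<Pi>\<^sub>M _\<in>UNIV. D))"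
      by (simp add: poisson_piece_def)
  qed
  also have "\<dots> = (\<integral>\<^sup>+n. ennreal ((1 - r) ^ n) \<partial>measure_pmf (poisson_pmf 1))"
  proof (intro nn_integral_cong)
    fix n :: nat
    have "(\<integral>\<^sup>+p. nexp (\<Sum>l. if l < fst (n, p) then h (snd (n, p) l) else 0) \<partial>(\<Pi>\<^sub>M _\<in>UNIV. D)) =
      (\<integral>\<^sup>+p. (\<Prod>l\<in>{..<n}. nexp (h (p l))) \<partial>(\<Pi>\<^sub>M _\<in>UNIV. D))"
    proof (intro nn_integral_cong)
      fix p :: "nat \<Rightarrow> 'a"
      have "(\<Sum>l. if l < n then h (p l) else 0) = (\<Sum>l\<in>{..<n}. if l < n then h (p l) else 0)"
        by (intro suminf_finite) auto
      also have "\<dots> = (\<Sum>l\<in>{..<n}. h (p l))" by (intro sum.cong) auto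
      finally show "nexp (\<Sum>l. if l < fst (n, p) then h (snd (n, p) l) else 0) = (\<Prod>l\<in>{..<n}. nexp (h (p l)))"
        by (simp add: nexp_sum cong: if_cong)
    qed
    also have "\<dots> = (\<Prod>l\<in>{..<n}. \<integral>\<^sup>+p. nexp (h p) \<partial>D)"
      by (rule DP.nn_integral_PiM_prod) auto
    also have "\<dots> = ennreal ((1 - r) ^ n)" using r by (simp add: c ennreal_power)
    finally show "(\<integral>\<^sup>+p. nexp (\<Sum>l. if l < fst (n, p) then h (snd (n, p) l) else 0) \<partial>(\<Pi>\<^sub>M _\<in>UNIV. D)) = ennreal ((1 - r) ^ n)" .
  qed
  also have "\<dots> = (\<Sum>n. ennreal (exp (- 1) / fact n * (1 - r) ^ n))"
  proof -
    have "ennreal (pmf (poisson_pmf 1) n) * ennreal ((1 - r) ^ n) = ennreal (exp (- 1) / fact n * (1 - r) ^ n)" for n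
      using r by (simp add: mult.commute flip: ennreal_mult)
    then show ?thesis by (simp only: nn_integral_measure_pmf nn_integral_count_space_nat)
  qed
  also have "\<dots> = ennreal (exp (- 1) * exp (1 - r))"
  proof (rule suminf_ennreal_eq)
    have "(\<lambda>n. exp (- 1) * ((1 - r) ^ n /\<^sub>R fact n)) sums (exp (- 1) * exp (1 - r))"
      by (intro sums_mult exp_converges)
    then show "(\<lambda>n. exp (- 1) / fact n * (1 - r) ^ n) sums (exp (- 1) * exp (1 - r))"
      by (simp add: field_simps)
  qed (use r in auto)
  also have "\<dots> = nexp d" using r by (simp flip: exp_add)
  finally show ?thesis .
qed

text \<open>Finitely many independent pieces give a product, which \<open>nexp\<close> turns into a
  sum. All integrands are at most 1, so dominated convergence handles infinitely many pieces even
  when the sums diverge.\<close>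

lemma nn_integral_poisson_pieces:
  fixes h :: "nat \<Rightarrow> 'p \<Rightarrow> ennreal"
  assumes D: "prob_space D" and [measurable]: "\<And>k. h k \<in> borel_measurable D"
    and d: "\<And>k. (\<integral>\<^sup>+p. nexp (h k p) \<partial>D) + d k = 1"
  shows "(\<integral>\<^sup>+\<omega>. nexp (\<Sum>k. \<Sum>l. if l < fst (\<omega> k) then h k (snd (\<omega> k) l) else 0) \<partial>(\<Pi>\<^sub>M _\<in>UNIV. poisson_piece D)) = nexp (\<Sum>k. d k)"
proof -
  interpret PP: prob_space "poisson_piece D" by (rule prob_space_poisson_piece[OF D])
  interpret P: product_prob_space "\<lambda>_::nat. poisson_piece D" UNIV by unfold_locales
  define Y where "Y = (\<lambda>k (w :: nat \<times> (nat \<Rightarrow> 'p)). \<Sum>l. if l < fst w then h k (snd w l) else 0)"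
  have Ym [measurable]: "Y k \<in> borel_measurable (poisson_piece D)" for k
    unfolding Y_def by measurable
  have eq: "(\<integral>\<^sup>+\<omega>. nexp (\<Sum>k<m. Y k (\<omega> k)) \<partial>(\<Pi>\<^sub>M _\<in>UNIV. poisson_piece D)) = nexp (\<Sum>k<m. d k)" for m
  proof -
    have "(\<integral>\<^sup>+\<omega>. nexp (\<Sum>k<m. Y k (\<omega> k)) \<partial>(\<Pi>\<^sub>M _\<in>UNIV. poisson_piece D)) = (\<integral>\<^sup>+\<omega>. (\<Prod>k\<in>{..<m}. nexp (Y k (\<omega> k))) \<partial>(\<Pi>\<^sub>M _\<in>UNIV. poisson_piece D))"
      by (simp add: nexp_sum)
    also have "\<dots> = (\<Prod>k\<in>{..<m}. \<integral>\<^sup>+w. nexp (Y k w) \<partial>poisson_piece D)"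
      by (rule P.nn_integral_PiM_prod) auto
    also have "\<dots> = (\<Prod>k\<in>{..<m}. nexp (d k))"
      unfolding Y_def by (intro prod.cong refl nn_integral_poisson_piece D d) auto
    finally show ?thesis by (simp add: nexp_sum)
  qed
  have "(\<lambda>m. \<integral>\<^sup>+\<omega>. nexp (\<Sum>k<m. Y k (\<omega> k)) \<partial>(\<Pi>\<^sub>M _\<in>UNIV. poisson_piece D)) \<longlonglongrightarrow> (\<integral>\<^sup>+\<omega>. nexp (\<Sum>k. Y k (\<omega> k)) \<partial>(\<Pi>\<^sub>M _\<in>UNIV. poisson_piece D))"
  proof (rule nn_integral_dominated_convergence[where w="\<lambda>_. 1"])
    show "(\<integral>\<^sup>+\<omega>. 1 \<partial>(\<Pi>\<^sub>M _\<in>(UNIV :: nat set). poisson_piece D)) < \<infinity>"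
      using P.P.emeasure_space_1 by simp
  qed (auto intro!: AE_I2 nexp_le_1 nexp_tendsto_suminf)
  then have "(\<lambda>m. nexp (\<Sum>k<m. d k)) \<longlonglongrightarrow> (\<integral>\<^sup>+\<omega>. nexp (\<Sum>k. Y k (\<omega> k)) \<partial>(\<Pi>\<^sub>M _\<in>UNIV. poisson_piece D))"
    by (simp add: eq)
  then have "(\<integral>\<^sup>+\<omega>. nexp (\<Sum>k. Y k (\<omega> k)) \<partial>(\<Pi>\<^sub>M _\<in>UNIV. poisson_piece D)) = nexp (\<Sum>k. d k)"
    using nexp_tendsto_suminf by (rule LIMSEQ_unique)
  then show ?thesis by (simp add: Y_def)
qed

section \<open>The jumps of the Gamma process and their Laplace functional\<close>

definition unit_uniform :: "real measure" where
  "unit_uniform = density lborel (indicator {0..<1})"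

definition unit_exponential :: "real measure" where
  "unit_exponential = density lborel (\<lambda>x. ennreal (indicator {0<..} x * exp (- x)))"

definition mark_space :: "(real \<times> real \<times> real) measure" where
  "mark_space = unit_uniform \<Otimes>\<^sub>M (unit_uniform \<Otimes>\<^sub>M unit_exponential)"

definition gamma_space :: "(nat \<Rightarrow> nat \<times> (nat \<Rightarrow> real \<times> real \<times> real)) measure" where
  "gamma_space = (\<Pi>\<^sub>M _\<in>UNIV. poisson_piece mark_space)"

text \<open>
  The jumps of the Gamma subordinator form a Poisson process with intensity \<open>e\<^sup>-\<^sup>x/x\<close>, which is
  the image of the unit exponential law and Lebesgue measure on \<open>(0, \<infinity>)\<close> under
  \<open>(e, v) \<mapsto> e \<cdot> exp (-v)\<close>. The time-level quadrant is cut into unit squares, numbered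
  by \<open>prod_decode\<close>.
\<close>

definition mark_time :: "nat \<Rightarrow> real \<times> real \<times> real \<Rightarrow> real" where
  "mark_time k p = real (fst (prod_decode k)) + fst p"

text \<open>The truncation \<open>max 0\<close> makes jumps nonnegative for every mark, not only for
  almost every one.\<close>

definition mark_jump :: "nat \<Rightarrow> real \<times> real \<times> real \<Rightarrow> real" where
  "mark_jump k p = max 0 (snd (snd p)) * exp (- (real (snd (prod_decode k)) + fst (snd p)))"

text \<open>The sum of point masses at the mark times, each weighted by its jump. Writing it as the
  image of a weighted counting measure over all pairs (k, l) makes it a measure for every outcome,
  possibly of infinite mass.\<close>

definition jump_measure :: "(nat \<Rightarrow> nat \<times> (nat \<Rightarrow> real \<times> real \<times> real)) \<Rightarrow> real measure" where
  "jump_measure \<omega> = distr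
     (density (count_space UNIV) (\<lambda>(k, l). ennreal (if l < fst (\<omega> k) then mark_jump k (snd (\<omega> k) l) else 0)))
     borel (\<lambda>(k, l). mark_time k (snd (\<omega> k) l))"

lemma sets_jump_measure [simp, measurable_cong]: "sets (jump_measure \<omega>) = sets borel"
  by (simp add: jump_measure_def)

lemma sets_unit [simp, measurable_cong]: "sets unit_uniform = sets borel" "sets unit_exponential = sets borel"
  by (simp_all add: unit_uniform_def unit_exponential_def)

lemma prob_space_unit_uniform: "prob_space unit_uniform"
  by (intro prob_spaceI) (simp add: unit_uniform_def emeasure_density)

lemma nn_integral_unit_exponential:
  assumes "0 \<le> y"
  shows "(\<integral>\<^sup>+e. nexp (ennreal (y * max 0 e)) \<partial>unit_exponential) = ennreal (1 / (1 + y))"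
proof -
  have "(\<integral>\<^sup>+e. nexp (ennreal (y * max 0 e)) \<partial>unit_exponential) =
    (\<integral>\<^sup>+e. ennreal (indicator {0<..} e * exp (- e)) * nexp (ennreal (y * max 0 e)) \<partial>lborel)"
    unfolding unit_exponential_def by (rule nn_integral_density) measurable
  also have "\<dots> = (\<integral>\<^sup>+e. ennreal (indicator {0<..} e * exp (- (e * (1 + y)))) \<partial>lborel)"
  proof (rule nn_integral_cong)
    fix e :: real
    show "ennreal (indicator {0<..} e * exp (- e)) * nexp (ennreal (y * max 0 e)) = ennreal (indicator {0<..} e * exp (- (e * (1 + y))))"
    proof (cases "0 < e")
      case True
      have "exp (- (e * (1 + y))) = exp (- e) * exp (- (y * e))"
        by (simp add: algebra_simps flip: exp_add)
      moreover have "nexp (ennreal (y * max 0 e)) = ennreal (exp (- (y * e)))" using True assms by simp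
      ultimately show ?thesis using True by (simp flip: ennreal_mult)
    qed simp
  qed
  also have "\<dots> = ennreal (1 / (1 + y))"
    using assms by (intro ennreal_inverse_eq_nn_integral[symmetric]) simp
  finally show ?thesis .
qed

lemma prob_space_unit_exponential: "prob_space unit_exponential"
proof (rule prob_spaceI)
  show "emeasure unit_exponential (space unit_exponential) = 1"
    using nn_integral_unit_exponential[of 0] by simp
qed

lemma prob_space_mark_space: "prob_space mark_space"
proof -
  interpret U: prob_space unit_uniform by (rule prob_space_unit_uniform)
  interpret E: prob_space unit_exponential by (rule prob_space_unit_exponential)
  interpret UE: pair_prob_space unit_uniform unit_exponential by unfold_locales
  interpret UUE: pair_prob_space unit_uniform "unit_uniform \<Otimes>\<^sub>M unit_exponential" by unfold_locales
  show ?thesis unfolding mark_space_def by (rule UUE.prob_space_axioms)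
qed

lemma nn_integral_mark_space:
  assumes [measurable]: "f \<in> borel_measurable (borel \<Otimes>\<^sub>M (borel \<Otimes>\<^sub>M borel))"
  shows "(\<integral>\<^sup>+p. f p \<partial>mark_space) = (\<integral>\<^sup>+u. (\<integral>\<^sup>+v. (\<integral>\<^sup>+e. f (u, v, e) \<partial>unit_exponential) \<partial>unit_uniform) \<partial>unit_uniform)"
proof -
  interpret U: prob_space unit_uniform by (rule prob_space_unit_uniform)
  interpret E: prob_space unit_exponential by (rule prob_space_unit_exponential)
  interpret UE: pair_prob_space unit_uniform unit_exponential by unfold_locales
  have fm: "f \<in> borel_measurable (unit_uniform \<Otimes>\<^sub>M (unit_uniform \<Otimes>\<^sub>M unit_exponential))" by measurable
  have "(\<integral>\<^sup>+p. f p \<partial>mark_space) = (\<integral>\<^sup>+u. (\<integral>\<^sup>+q. f (u, q) \<partial>(unit_uniform \<Otimes>\<^sub>M unit_exponential)) \<partial>unit_uniform)"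
    unfolding mark_space_def by (rule UE.nn_integral_fst[symmetric, OF fm])
  also have "\<dots> = (\<integral>\<^sup>+u. (\<integral>\<^sup>+v. (\<integral>\<^sup>+e. f (u, v, e) \<partial>unit_exponential) \<partial>unit_uniform) \<partial>unit_uniform)"
    by (intro nn_integral_cong E.nn_integral_fst[symmetric]) measurable
  finally show ?thesis .
qed

lemma suminf_indicator_unit: "(\<Sum>i. indicator {0..<1} (s - real i) * c) = (indicator {0..} s * c :: ennreal)"
proof (cases "0 \<le> s")
  case True
  define n where "n = nat \<lfloor>s\<rfloor>"
  have n: "real n \<le> s" "s < real n + 1" using True by (auto simp: n_def)
  have "indicator {0..<1} (s - real i) * c = 0" if "i \<noteq> n" for i
  proof -
    have "real i + 1 \<le> real n \<or> real n + 1 \<le> real i" using that by linarith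
    then show ?thesis using n by (auto simp: indicator_def)
  qed
  then have "(\<Sum>i. indicator {0..<1} (s - real i) * c) = (\<Sum>i\<in>{n}. indicator {0..<1} (s - real i) * c)"
    by (intro suminf_finite) auto
  then show ?thesis using True n by (simp add: indicator_def)
next
  case False
  then have "indicator {0..<1} (s - real i) * c = 0" for i by (auto simp: indicator_def)
  then show ?thesis using False by simp
qed

lemma suminf_nn_integral_unit_uniform:
  assumes [measurable]: "g \<in> borel_measurable borel"
  shows "(\<Sum>i. \<integral>\<^sup>+u. g (real i + u) \<partial>unit_uniform) = (\<integral>\<^sup>+s. indicator {0..} s * g s \<partial>lborel)"
proof -
  have "(\<integral>\<^sup>+u. g (real i + u) \<partial>unit_uniform) = (\<integral>\<^sup>+s. indicator {0..<1} (s - real i) * g s \<partial>lborel)" for i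
  proof -
    have "(\<integral>\<^sup>+u. g (real i + u) \<partial>unit_uniform) = (\<integral>\<^sup>+u. indicator {0..<1} u * g (real i + u) \<partial>lborel)"
      unfolding unit_uniform_def by (rule nn_integral_density) measurable
    also have "\<dots> = (\<integral>\<^sup>+s. indicator {0..<1} (s - real i) * g s \<partial>lborel)"
      by (subst nn_integral_real_affine[where t="real i" and c=1 and f="\<lambda>s. indicator {0..<1} (s - real i) * g s"]) auto
    finally show ?thesis .
  qed
  then have "(\<Sum>i. \<integral>\<^sup>+u. g (real i + u) \<partial>unit_uniform) = (\<Sum>i. \<integral>\<^sup>+s. indicator {0..<1} (s - real i) * g s \<partial>lborel)"
    by (simp only:)
  also have "\<dots> = (\<integral>\<^sup>+s. (\<Sum>i. indicator {0..<1} (s - real i) * g s) \<partial>lborel)"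
    by (rule nn_integral_suminf[symmetric]) measurable
  finally show ?thesis by (simp only: suminf_indicator_unit)
qed

text \<open>Here the logarithm of the Gamma exponent arises: the integrand is the derivative of - ln
  (1 + r e^(-w)), and 1 / (1 + y) is the Laplace transform of the exponential mark.\<close>

lemma nn_integral_level:
  assumes r: "0 \<le> (r::real)"
  shows "(\<integral>\<^sup>+w. indicator {0..} w * ennreal (1 - 1 / (1 + r * exp (- w))) \<partial>lborel) = ennreal (ln (1 + r))"
proof -
  have pos: "0 < 1 + r * exp (- w)" for w :: real using r by (intro add_pos_nonneg) auto
  have "(\<integral>\<^sup>+w. ennreal (1 - 1 / (1 + r * exp (- w))) * indicator {0..} w \<partial>lborel) = ennreal (0 - (- ln (1 + r * exp (- 0))))"
  proof (rule nn_integral_FTC_atLeast)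
    show "((\<lambda>w. - ln (1 + r * exp (- w))) has_real_derivative 1 - 1 / (1 + r * exp (- x))) (at x)" for x
      using pos[of x] by (auto intro!: derivative_eq_intros simp: divide_simps)
    show "0 \<le> 1 - 1 / (1 + r * exp (- x))" for x :: real
      using pos[of x] r by (simp add: divide_simps)
    have "((\<lambda>w. - ln (1 + r * exp (- w))) \<longlongrightarrow> - ln (1 + r * 0)) at_top"
      by (intro tendsto_intros filterlim_compose[OF exp_at_bot filterlim_uminus_at_bot_at_top]) auto
    then show "((\<lambda>w. - ln (1 + r * exp (- w))) \<longlongrightarrow> 0) at_top" by simp
  qed measurable
  then show ?thesis by (simp add: mult.commute)
qed

lemma mark_measurable [measurable]:
  "mark_time k \<in> borel_measurable mark_space" "mark_jump k \<in> borel_measurable mark_space"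
  unfolding mark_time_def mark_jump_def mark_space_def by measurable

lemma nn_integral_jump_measure:
  assumes [measurable]: "f \<in> borel_measurable borel"
  shows "(\<integral>\<^sup>+t. f t \<partial>jump_measure \<omega>) =
    (\<Sum>k. \<Sum>l. if l < fst (\<omega> k) then ennreal (mark_jump k (snd (\<omega> k) l)) * f (mark_time k (snd (\<omega> k) l)) else 0)"
proof -
  define w where "w = (\<lambda>(k, l). ennreal (if l < fst (\<omega> k) then mark_jump k (snd (\<omega> k) l) else 0))"
  have "(\<integral>\<^sup>+t. f t \<partial>jump_measure \<omega>) =
    (\<integral>\<^sup>+x. f (case x of (k, l) \<Rightarrow> mark_time k (snd (\<omega> k) l)) \<partial>density (count_space UNIV) w)"
    unfolding jump_measure_def w_def by (rule nn_integral_distr) auto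
  also have "\<dots> = (\<integral>\<^sup>+x. w x * f (case x of (k, l) \<Rightarrow> mark_time k (snd (\<omega> k) l)) \<partial>count_space UNIV)"
    by (rule nn_integral_density) auto
  also have "\<dots> = (\<integral>\<^sup>+k. \<integral>\<^sup>+l. w (k, l) * f (mark_time k (snd (\<omega> k) l)) \<partial>count_space UNIV \<partial>count_space UNIV)"
    by (subst nn_integral_fst_count_space[symmetric]) simp
  also have "\<dots> = (\<Sum>k. \<Sum>l. if l < fst (\<omega> k) then ennreal (mark_jump k (snd (\<omega> k) l)) * f (mark_time k (snd (\<omega> k) l)) else 0)"
    by (auto simp: nn_integral_count_space_nat w_def intro!: suminf_cong)
  finally show ?thesis .
qed

lemma measurable_nn_integral_jump_measure [measurable]:
  assumes [measurable]: "f \<in> borel_measurable borel"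
  shows "(\<lambda>\<omega>. \<integral>\<^sup>+t. f t \<partial>jump_measure \<omega>) \<in> borel_measurable gamma_space"
proof -
  have [measurable]: "(\<lambda>\<omega>. \<omega> k) \<in> gamma_space \<rightarrow>\<^sub>M poisson_piece mark_space" for k
    unfolding gamma_space_def by measurable
  show ?thesis unfolding nn_integral_jump_measure[OF assms] by measurable
qed

lemma prob_space_gamma_space: "prob_space gamma_space"
  unfolding gamma_space_def by (intro prob_space_PiM prob_space_poisson_piece prob_space_mark_space)

text \<open>The exponent of the square (i, j) is the integral of \<open>F\<close> over that square.
  Summing over j covers all levels and \<open>nn_integral_level\<close> evaluates the result to ln
  (1 + f s); summing over i covers all times s \<ge> 0.\<close>

theorem laplace_jump_measure:
  fixes f :: "real \<Rightarrow> real"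
  assumes [measurable]: "f \<in> borel_measurable borel" and f: "\<And>t. 0 \<le> f t"
  shows "(\<integral>\<^sup>+\<omega>. nexp (\<integral>\<^sup>+t. ennreal (f t) \<partial>jump_measure \<omega>) \<partial>gamma_space) =
    nexp (\<integral>\<^sup>+s. indicator {0..} s * ennreal (ln (1 + f s)) \<partial>lborel)"
proof -
  define F where "F = (\<lambda>s w. 1 - 1 / (1 + f s * exp (- w)))"
  have F: "0 \<le> F s w" "F s w \<le> 1" for s w
  proof -
    have "0 \<le> f s * exp (- w)" using f[of s] by simp
    then show "0 \<le> F s w" "F s w \<le> 1" by (simp_all add: F_def divide_simps)
  qed
  have [measurable]: "(\<lambda>x. F (g x) (h x)) \<in> borel_measurable N" if [measurable]: "g \<in> borel_measurable N" "h \<in> borel_measurable N" for g h and N :: "'z measure"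
    unfolding F_def by measurable
  define h where "h = (\<lambda>k p. ennreal (mark_jump k p) * ennreal (f (mark_time k p)))"
  define d where "d = (\<lambda>i j. \<integral>\<^sup>+u. \<integral>\<^sup>+v. ennreal (F (real i + u) (real j + v)) \<partial>unit_uniform \<partial>unit_uniform)"
  have hm: "h k \<in> borel_measurable mark_space" for k unfolding h_def by measurable
  interpret U: prob_space unit_uniform by (rule prob_space_unit_uniform)
  have d: "(\<integral>\<^sup>+p. nexp (h k p) \<partial>mark_space) + (case prod_decode k of (i, j) \<Rightarrow> d i j) = 1" for k
  proof -
    obtain i j where k: "prod_decode k = (i, j)" by (cases "prod_decode k")
    have "(\<integral>\<^sup>+p. nexp (h k p) \<partial>mark_space) =
      (\<integral>\<^sup>+u. (\<integral>\<^sup>+v. (\<integral>\<^sup>+e. nexp (h k (u, v, e)) \<partial>unit_exponential) \<partial>unit_uniform) \<partial>unit_uniform)"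
      unfolding h_def mark_jump_def mark_time_def by (intro nn_integral_mark_space) measurable
    also have "\<dots> = (\<integral>\<^sup>+u. (\<integral>\<^sup>+v. ennreal (1 - F (real i + u) (real j + v)) \<partial>unit_uniform) \<partial>unit_uniform)"
    proof (intro nn_integral_cong)
      fix u v
      have hk: "h k (u, v, e) = ennreal (f (real i + u) * exp (- (real j + v)) * max 0 e)" for e
        using f[of "real i + u"] by (simp add: h_def mark_jump_def mark_time_def k mult_ac flip: ennreal_mult)
      then show "(\<integral>\<^sup>+e. nexp (h k (u, v, e)) \<partial>unit_exponential) = ennreal (1 - F (real i + u) (real j + v))"
      proof -
        have "0 \<le> f (real i + u) * exp (- (real j + v))" using f[of "real i + u"] by simp
        then have "(\<integral>\<^sup>+e. nexp (h k (u, v, e)) \<partial>unit_exponential) = ennreal (1 / (1 + f (real i + u) * exp (- (real j + v))))"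
          by (simp only: hk nn_integral_unit_exponential)
        then show ?thesis by (simp only: F_def diff_diff_eq2 add_diff_cancel_left')
      qed
    qed
    finally have "(\<integral>\<^sup>+p. nexp (h k p) \<partial>mark_space) + d i j =
      (\<integral>\<^sup>+u. (\<integral>\<^sup>+v. ennreal (1 - F (real i + u) (real j + v)) + ennreal (F (real i + u) (real j + v)) \<partial>unit_uniform) \<partial>unit_uniform)"
      unfolding d_def by (simp add: nn_integral_add)
    also have "\<dots> = (\<integral>\<^sup>+u. (\<integral>\<^sup>+v. 1 \<partial>unit_uniform) \<partial>unit_uniform)"
      by (intro nn_integral_cong) (use F in \<open>simp flip: ennreal_plus\<close>)
    also have "\<dots> = 1" by (simp add: U.emeasure_space_1)
    finally show ?thesis by (simp add: k)
  qed
  have "(\<integral>\<^sup>+\<omega>. nexp (\<integral>\<^sup>+t. ennreal (f t) \<partial>jump_measure \<omega>) \<partial>gamma_space) =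
    (\<integral>\<^sup>+\<omega>. nexp (\<Sum>k. \<Sum>l. if l < fst (\<omega> k) then h k (snd (\<omega> k) l) else 0) \<partial>gamma_space)"
    by (simp add: nn_integral_jump_measure h_def cong: if_cong)
  also have "\<dots> = nexp (\<Sum>k. case prod_decode k of (i, j) \<Rightarrow> d i j)"
    unfolding gamma_space_def by (rule nn_integral_poisson_pieces[OF prob_space_mark_space hm d])
  also have "(\<Sum>k. case prod_decode k of (i, j) \<Rightarrow> d i j) = (\<Sum>i. \<Sum>j. d i j)"
    by (rule suminf_ennreal_2dimen) simp
  also have "\<dots> = (\<Sum>i. \<integral>\<^sup>+u. (\<integral>\<^sup>+w. indicator {0..} w * ennreal (F (real i + u) w) \<partial>lborel) \<partial>unit_uniform)"
  proof (intro suminf_cong)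
    fix i
    have "(\<Sum>j. d i j) = (\<integral>\<^sup>+u. (\<Sum>j. \<integral>\<^sup>+v. ennreal (F (real i + u) (real j + v)) \<partial>unit_uniform) \<partial>unit_uniform)"
      unfolding d_def by (intro nn_integral_suminf[symmetric]) measurable
    also have "\<dots> = (\<integral>\<^sup>+u. (\<integral>\<^sup>+w. indicator {0..} w * ennreal (F (real i + u) w) \<partial>lborel) \<partial>unit_uniform)"
      by (intro nn_integral_cong suminf_nn_integral_unit_uniform) measurable
    finally show "(\<Sum>j. d i j) = (\<integral>\<^sup>+u. (\<integral>\<^sup>+w. indicator {0..} w * ennreal (F (real i + u) w) \<partial>lborel) \<partial>unit_uniform)" .
  qed
  also have "\<dots> = (\<integral>\<^sup>+s. indicator {0..} s * (\<integral>\<^sup>+w. indicator {0..} w * ennreal (F s w) \<partial>lborel) \<partial>lborel)"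
    by (rule suminf_nn_integral_unit_uniform) measurable
  also have "\<dots> = (\<integral>\<^sup>+s. indicator {0..} s * ennreal (ln (1 + f s)) \<partial>lborel)"
    unfolding F_def using f by (simp add: nn_integral_level)
  finally show ?thesis .
qed

text \<open>For \<epsilon> > 0 the variable \<open>nexp\<close> of \<epsilon> S vanishes where S is
  infinite, so its mean is at most the probability that S is finite. As \<epsilon> = 1 / (n + 1)
  tends to 0, dominated convergence sends the exponent to 0 and the mean to 1.\<close>

theorem AE_jump_measure_finite:
  fixes f :: "real \<Rightarrow> real"
  assumes [measurable]: "f \<in> borel_measurable borel" and f: "\<And>t. 0 \<le> f t"
    and fin: "(\<integral>\<^sup>+s. indicator {0..} s * ennreal (ln (1 + f s)) \<partial>lborel) < \<top>"
  shows "AE \<omega> in gamma_space. (\<integral>\<^sup>+t. ennreal (f t) \<partial>jump_measure \<omega>) \<noteq> \<top>"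
proof -
  interpret prob_space gamma_space by (rule prob_space_gamma_space)
  define S where "S = (\<lambda>\<omega>. \<integral>\<^sup>+t. ennreal (f t) \<partial>jump_measure \<omega>)"
  have [measurable]: "S \<in> borel_measurable gamma_space" unfolding S_def by measurable
  define c where "c = (\<lambda>n. \<integral>\<^sup>+s. indicator {0..} s * ennreal (ln (1 + inverse (real (Suc n)) * f s)) \<partial>lborel)"
  have bound: "ln (1 + inverse (real (Suc n)) * f s) \<le> ln (1 + f s)" for n s
  proof -
    have "inverse (real (Suc n)) * f s \<le> 1 * f s" using f by (intro mult_right_mono) (auto simp: field_simps)
    moreover have "0 \<le> inverse (real (Suc n)) * f s" using f by simp
    ultimately show ?thesis by simp
  qed
  have "c \<longlonglongrightarrow> (\<integral>\<^sup>+s. 0 \<partial>(lborel :: real measure))" unfolding c_def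
  proof (rule nn_integral_dominated_convergence[where w="\<lambda>s. indicator {0..} s * ennreal (ln (1 + f s))"])
    show "AE s in lborel. (\<lambda>n. indicator {0..} s * ennreal (ln (1 + inverse (real (Suc n)) * f s))) \<longlonglongrightarrow> (0::ennreal)"
    proof (rule AE_I2)
      fix s
      have "(\<lambda>n. ln (1 + inverse (real (Suc n)) * f s)) \<longlonglongrightarrow> ln (1 + 0 * f s)"
        by (intro tendsto_intros LIMSEQ_inverse_real_of_nat) auto
      then have "(\<lambda>n. ennreal (ln (1 + inverse (real (Suc n)) * f s))) \<longlonglongrightarrow> ennreal 0"
        by (intro tendsto_ennrealI) simp
      then have "(\<lambda>n. indicator {0..} s * ennreal (ln (1 + inverse (real (Suc n)) * f s))) \<longlonglongrightarrow> indicator {0..} s * ennreal 0"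
        by (intro ennreal_tendsto_cmult) (auto simp: indicator_def)
      then show "(\<lambda>n. indicator {0..} s * ennreal (ln (1 + inverse (real (Suc n)) * f s))) \<longlonglongrightarrow> (0::ennreal)" by simp
    qed
  qed (use fin bound in \<open>auto intro!: AE_I2 mult_left_mono ennreal_leI\<close>)
  then have c0: "c \<longlonglongrightarrow> ennreal 0" by simp
  have cfin: "c n \<noteq> \<top>" for n
  proof -
    have "c n \<le> (\<integral>\<^sup>+s. indicator {0..} s * ennreal (ln (1 + f s)) \<partial>lborel)"
      unfolding c_def by (intro nn_integral_mono mult_left_mono ennreal_leI bound) simp
    then show ?thesis using fin by (auto simp: top_unique)
  qed
  have "(\<lambda>n. enn2real (c n)) \<longlonglongrightarrow> 0" using c0 by (intro tendsto_enn2real) auto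
  then have "(\<lambda>n. ennreal (exp (- enn2real (c n)))) \<longlonglongrightarrow> ennreal (exp (- 0))"
    by (intro tendsto_ennrealI tendsto_exp tendsto_minus)
  then have lim: "(\<lambda>n. nexp (c n)) \<longlonglongrightarrow> 1" using cfin by (simp add: nexp_def)
  have "nexp (c n) \<le> emeasure gamma_space {\<omega>\<in>space gamma_space. S \<omega> \<noteq> \<top>}" for n
  proof -
    have "nexp (c n) = (\<integral>\<^sup>+\<omega>. nexp (\<integral>\<^sup>+t. ennreal (inverse (real (Suc n)) * f t) \<partial>jump_measure \<omega>) \<partial>gamma_space)"
      unfolding c_def using f by (intro laplace_jump_measure[symmetric]) auto
    also have "\<dots> = (\<integral>\<^sup>+\<omega>. nexp (ennreal (inverse (real (Suc n))) * S \<omega>) \<partial>gamma_space)"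
      unfolding S_def using f by (simp add: ennreal_mult nn_integral_cmult del: of_nat_Suc inverse_Suc)
    also have "\<dots> \<le> (\<integral>\<^sup>+\<omega>. indicator {\<omega>\<in>space gamma_space. S \<omega> \<noteq> \<top>} \<omega> \<partial>gamma_space)"
    proof (rule nn_integral_mono)
      fix \<omega> assume "\<omega> \<in> space gamma_space"
      moreover have "ennreal (inverse (real (Suc n))) * \<top> = \<top>" by (simp add: ennreal_mult_top)
      ultimately show "nexp (ennreal (inverse (real (Suc n))) * S \<omega>) \<le> indicator {\<omega>\<in>space gamma_space. S \<omega> \<noteq> \<top>} \<omega>"
        by (cases "S \<omega> = \<top>") (auto simp: nexp_le_1 simp del: of_nat_Suc)
    qed
    also have "\<dots> = emeasure gamma_space {\<omega>\<in>space gamma_space. S \<omega> \<noteq> \<top>}"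
      by (rule nn_integral_indicator) measurable
    finally show ?thesis .
  qed
  then have "1 \<le> emeasure gamma_space {\<omega>\<in>space gamma_space. S \<omega> \<noteq> \<top>}"
    using lim by (intro LIMSEQ_le_const2) auto
  then have "prob {\<omega>\<in>space gamma_space. S \<omega> \<noteq> \<top>} = 1"
    using emeasure_le_1[of "{\<omega>\<in>space gamma_space. S \<omega> \<noteq> \<top>}"] by (simp add: emeasure_eq_measure antisym)
  then have "AE \<omega> in gamma_space. \<omega> \<in> {\<omega>\<in>space gamma_space. S \<omega> \<noteq> \<top>}" by (rule AE_prob_1)
  then show ?thesis unfolding S_def by simp
qed

section \<open>The Gamma subordinator\<close>

text \<open>The joint Laplace transform of increments contains all distributional axioms at once: it
  factorises, which gives independence, and each factor depends on the length of the time interval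
  alone, which gives stationarity and the Gamma marginals.\<close>

lemma standard_gamma_subordinatorI:
  assumes M: "prob_space M"
    and X: "\<And>t. 0 \<le> t \<Longrightarrow> X t \<in> borel_measurable M"
    and start: "\<And>\<omega>. \<omega> \<in> space M \<Longrightarrow> X 0 \<omega> = 0"
    and mono: "\<And>\<omega>. \<omega> \<in> space M \<Longrightarrow> mono_on {0..} (\<lambda>t. X t \<omega>)"
    and rc: "\<And>\<omega> t. \<omega> \<in> space M \<Longrightarrow> 0 \<le> t \<Longrightarrow> continuous (at_right t) (\<lambda>s. X s \<omega>)"
    and E: "\<And>(t :: nat \<Rightarrow> real) u n. 0 \<le> t 0 \<Longrightarrow> mono t \<Longrightarrow> (\<And>i. 0 \<le> u i) \<Longrightarrow>
      (LINT \<omega>|M. (\<Prod>i<n. exp (- u i * (X (t (Suc i)) \<omega> - X (t i) \<omega>)))) = (\<Prod>i<n. (1 + u i) powr (- (t (Suc i) - t i)))"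
  shows "standard_gamma_subordinator M X"
proof -
  interpret prob_space M by fact
  \<comment> \<open>A single increment is the case n = 1 of the joint formula, for the time sequence
    s, s', s', ...\<close>
  have E1: "(LINT \<omega>|M. exp (- u * (X s' \<omega> - X s \<omega>))) = (1 + u) powr (- (s' - s))"
    if "0 \<le> s" "s \<le> s'" "0 \<le> u" for s s' u
    using E[of "\<lambda>i. if i = 0 then s else s'" "\<lambda>_. u" 1] that by (auto simp: mono_def)
  have incr: "X s \<omega> \<le> X s' \<omega>" if "\<omega> \<in> space M" "0 \<le> s" "s \<le> s'" for s s' \<omega>
    using mono_onD[OF mono[OF that(1)], of s s'] that by simp
  have XD: "(\<lambda>\<omega>. X s' \<omega> - X s \<omega>) \<in> borel_measurable M" if "0 \<le> s" "s \<le> s'" for s s'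
    using X[of s] X[of s'] that by simp
  have L: "laplace (distr M borel Y) u = (LINT \<omega>|M. exp (- u * Y \<omega>))" if [measurable]: "Y \<in> borel_measurable M" for Y u
    unfolding laplace_def by (rule integral_distr) measurable
  have LT: "(LINT \<omega>|M. exp (- u * X t \<omega>)) = (1 + u) powr (- t)" if "0 \<le> u" "0 \<le> t" for u t
  proof -
    have "(LINT \<omega>|M. exp (- u * X t \<omega>)) = (LINT \<omega>|M. exp (- u * (X t \<omega> - X 0 \<omega>)))"
      by (intro Bochner_Integration.integral_cong refl) (simp add: start)
    then show ?thesis using E1[of 0 t u] that by simp
  qed
  show ?thesis
  proof
    fix t :: "nat \<Rightarrow> real" and n
    assume t: "0 \<le> t 0" "mono t"
    have t0: "0 \<le> t i" "t i \<le> t (Suc i)" for i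
      using t(1) monoD[OF t(2), of 0 i] monoD[OF t(2), of i "Suc i"] by auto
    show "indep_vars (\<lambda>_. borel) (\<lambda>i \<omega>. X (t (Suc i)) \<omega> - X (t i) \<omega>) {..<n}"
    proof (rule indep_vars_of_laplace)
      show "(\<lambda>\<omega>. X (t (Suc i)) \<omega> - X (t i) \<omega>) \<in> borel_measurable M" for i
        by (rule XD[OF t0])
      show "0 \<le> X (t (Suc i)) \<omega> - X (t i) \<omega>" if "\<omega> \<in> space M" for i \<omega>
        using incr[OF that t0(1)[of i] t0(2)[of i]] by simp
      show "(LINT \<omega>|M. (\<Prod>i<n. exp (- u i * (X (t (Suc i)) \<omega> - X (t i) \<omega>)))) = (\<Prod>i<n. LINT \<omega>|M. exp (- u i * (X (t (Suc i)) \<omega> - X (t i) \<omega>)))"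
        if "\<And>i. 0 \<le> u i" for u
      proof -
        have "(LINT \<omega>|M. exp (- u i * (X (t (Suc i)) \<omega> - X (t i) \<omega>))) = (1 + u i) powr (- (t (Suc i) - t i))" for i
          by (rule E1[OF t0(1) t0(2) that])
        then show ?thesis using E[OF t that, where n=n] by simp
      qed
    qed
  next
    fix s t :: real assume st: "0 \<le> s" "0 \<le> t"
    show "distr M borel (\<lambda>\<omega>. X (s + t) \<omega> - X s \<omega>) = distr M borel (X t)"
    proof (rule laplace_unique_prob)
      have m: "(\<lambda>\<omega>. X (s + t) \<omega> - X s \<omega>) \<in> borel_measurable M" "X t \<in> borel_measurable M"
        using XD[of s "s + t"] X st by auto
      show "prob_space (distr M borel (\<lambda>\<omega>. X (s + t) \<omega> - X s \<omega>))" "prob_space (distr M borel (X t))"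
        using m by (auto intro: prob_space_distr)
      show "AE x in distr M borel (\<lambda>\<omega>. X (s + t) \<omega> - X s \<omega>). 0 \<le> x"
        using m(1) incr[of _ s "s + t"] st by (subst AE_distr_iff) (auto intro!: AE_I2)
      show "AE x in distr M borel (X t). 0 \<le> x"
        using m(2) incr[of _ 0 t] st start by (subst AE_distr_iff) (auto intro!: AE_I2)
      show "laplace (distr M borel (\<lambda>\<omega>. X (s + t) \<omega> - X s \<omega>)) u = laplace (distr M borel (X t)) u" if "0 < u" for u
        unfolding L[OF m(1)] L[OF m(2)] using E1[of s "s + t" u] LT[of u t] st that by simp
    qed simp_all
  qed (use X start mono rc LT in auto)
qed

definition regular :: "(nat \<Rightarrow> nat \<times> (nat \<Rightarrow> real \<times> real \<times> real)) \<Rightarrow> bool" where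
  "regular \<omega> \<longleftrightarrow> (\<forall>n::nat. emeasure (jump_measure \<omega>) {0<..real n} \<noteq> \<top>)"

text \<open>A subordinator must have its path properties for every outcome, so the null set of
  irregular outcomes gets the zero path. The interval is open at 0, which makes the process start at
  0.\<close>

definition gamma_process :: "real \<Rightarrow> (nat \<Rightarrow> nat \<times> (nat \<Rightarrow> real \<times> real \<times> real)) \<Rightarrow> real" where
  "gamma_process t \<omega> = (if regular \<omega> then enn2real (emeasure (jump_measure \<omega>) {0<..t}) else 0)"

lemma measurable_emeasure_jump_measure [measurable]:
  assumes [measurable]: "A \<in> sets borel"
  shows "(\<lambda>\<omega>. emeasure (jump_measure \<omega>) A) \<in> borel_measurable gamma_space"
proof -
  have "(\<lambda>\<omega>. \<integral>\<^sup>+t. indicator A t \<partial>jump_measure \<omega>) \<in> borel_measurable gamma_space" by measurable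
  then show ?thesis by simp
qed

lemma measurable_regular [measurable]: "Measurable.pred gamma_space regular"
  unfolding regular_def by measurable

lemma measurable_gamma_process [measurable]: "gamma_process t \<in> borel_measurable gamma_space"
  unfolding gamma_process_def by measurable

lemma AE_regular: "AE \<omega> in gamma_space. regular \<omega>"
  unfolding regular_def
proof (subst AE_all_countable, intro allI)
  fix n :: nat
  have "AE \<omega> in gamma_space. (\<integral>\<^sup>+t. ennreal (indicator {0<..real n} t) \<partial>jump_measure \<omega>) \<noteq> \<top>"
  proof (rule AE_jump_measure_finite)
    have "(\<integral>\<^sup>+s. indicator {0..} s * ennreal (ln (1 + indicator {0<..real n} s)) \<partial>lborel) \<le> (\<integral>\<^sup>+s. indicator {0<..real n} s \<partial>lborel)"
      using ln_add_one_self_le_self[of 1] by (intro nn_integral_mono) (auto simp: indicator_def)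
    also have "\<dots> < \<top>" by simp
    finally show "(\<integral>\<^sup>+s. indicator {0..} s * ennreal (ln (1 + indicator {0<..real n} s)) \<partial>lborel) < \<top>" .
  qed auto
  then show "AE \<omega> in gamma_space. emeasure (jump_measure \<omega>) {0<..real n} \<noteq> \<top>"
    by (simp add: ennreal_indicator)
qed

lemma regular_finite: "regular \<omega> \<Longrightarrow> emeasure (jump_measure \<omega>) {0<..t} \<noteq> \<top>"
proof -
  assume r: "regular \<omega>"
  obtain n :: nat where "t \<le> real n" using real_arch_simple by blast
  then have "emeasure (jump_measure \<omega>) {0<..t} \<le> emeasure (jump_measure \<omega>) {0<..real n}"
    by (intro emeasure_mono) auto
  then show ?thesis using r unfolding regular_def by (metis top_unique)
qed

lemma gamma_process_increment:
  assumes r: "regular \<omega>" and st: "0 \<le> s" "s \<le> t"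
  shows "emeasure (jump_measure \<omega>) {s<..t} = ennreal (gamma_process t \<omega> - gamma_process s \<omega>)"
proof -
  have "emeasure (jump_measure \<omega>) {0<..t} = emeasure (jump_measure \<omega>) ({0<..s} \<union> {s<..t})"
    using st by (intro arg_cong2[where f=emeasure] refl) auto
  also have "\<dots> = emeasure (jump_measure \<omega>) {0<..s} + emeasure (jump_measure \<omega>) {s<..t}"
    by (intro plus_emeasure[symmetric]) auto
  finally have eq: "emeasure (jump_measure \<omega>) {0<..t} = emeasure (jump_measure \<omega>) {0<..s} + emeasure (jump_measure \<omega>) {s<..t}" .
  obtain p where p: "emeasure (jump_measure \<omega>) {0<..s} = ennreal p" "0 \<le> p"
    using regular_finite[OF r, of s] by (cases "emeasure (jump_measure \<omega>) {0<..s}") auto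
  have "emeasure (jump_measure \<omega>) {s<..t} \<noteq> \<top>" using eq regular_finite[OF r, of t] by auto
  then obtain q where q: "emeasure (jump_measure \<omega>) {s<..t} = ennreal q" "0 \<le> q"
    by (cases "emeasure (jump_measure \<omega>) {s<..t}") auto
  have "emeasure (jump_measure \<omega>) {0<..t} = ennreal (p + q)" using eq p q by simp
  then show ?thesis using p q r by (simp add: gamma_process_def del: ennreal_plus)
qed

lemma gamma_process_nonpos [simp]: "t \<le> 0 \<Longrightarrow> gamma_process t \<omega> = 0"
  by (simp add: gamma_process_def)

lemma gamma_process_mono: "mono (\<lambda>t. gamma_process t \<omega>)"
proof (cases "regular \<omega>")
  case True
  have "enn2real (emeasure (jump_measure \<omega>) {0<..s}) \<le> enn2real (emeasure (jump_measure \<omega>) {0<..t})" if "s \<le> t" for s t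
    using that regular_finite[OF True, of t] by (intro enn2real_mono emeasure_mono) (auto simp: top.not_eq_extremum)
  then show ?thesis using True by (auto simp: mono_def gamma_process_def)
qed (simp add: mono_def gamma_process_def)

text \<open>Near t the path is the distribution function of the jump measure restricted to a bounded
  interval (0, n] with n \<ge> t + 1. That restriction is a finite measure, and distribution
  functions of finite measures are right continuous.\<close>

lemma gamma_process_right_continuous: "continuous (at_right t) (\<lambda>s. gamma_process s \<omega>)"
proof (cases "regular \<omega>")
  case True
  obtain n :: nat where n: "t + 1 \<le> real n" using real_arch_simple by blast
  define J where "J = density (jump_measure \<omega>) (indicator {0<..real n})"
  have J: "emeasure J A = emeasure (jump_measure \<omega>) ({0<..real n} \<inter> A)" if "A \<in> sets borel" for A
    unfolding J_def using that by (intro emeasure_restricted) auto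
  have sJ: "sets J = sets borel" by (simp add: J_def)
  have "space J = UNIV" using sets_eq_imp_space_eq[OF sJ] by simp
  then have "finite_measure J" using J[of UNIV] regular_finite[OF True, of "real n"] by (intro finite_measureI) simp
  then interpret finite_borel_measure J
    by (intro finite_borel_measure.intro finite_borel_measure_axioms.intro sJ)
  have eq: "cdf J s = gamma_process s \<omega>" if "s < t + 1" for s
  proof -
    have "{0<..real n} \<inter> {..s} = {0<..s}" using that n by auto
    then show ?thesis using True J[of "{..s}"] by (simp add: cdf_def measure_def gamma_process_def)
  qed
  have "(cdf J \<longlongrightarrow> cdf J t) (at_right t)"
    using cdf_is_right_cont[of t] by (simp add: continuous_within)
  moreover have "\<forall>\<^sub>F s in at_right t. cdf J s = gamma_process s \<omega>"
    using eventually_at_right_less[of t] unfolding eventually_at_right_field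
    by (intro exI[of _ "t + 1"]) (auto simp: eq)
  ultimately show ?thesis by (simp add: continuous_within eq tendsto_cong)
qed (simp add: gamma_process_def)

text \<open>A linear combination of increments is the integral of the step function with values
  \<open>u i\<close> on the intervals between successive times. These are disjoint, so ln (1 + f) is
  the step function with values ln (1 + u i), and the Laplace functional splits into powers.\<close>

lemma expectation_gamma_process:
  fixes t u :: "nat \<Rightarrow> real"
  assumes t: "0 \<le> t 0" "mono t" and u: "\<And>i. 0 \<le> u i"
  shows "(LINT \<omega>|gamma_space. (\<Prod>i<n. exp (- u i * (gamma_process (t (Suc i)) \<omega> - gamma_process (t i) \<omega>)))) =
    (\<Prod>i<n. (1 + u i) powr (- (t (Suc i) - t i)))"
proof -
  interpret prob_space gamma_space by (rule prob_space_gamma_space)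
  have t0: "0 \<le> t i" "t i \<le> t (Suc i)" for i
    using t(1) monoD[OF t(2), of 0 i] monoD[OF t(2), of i "Suc i"] by auto
  define A where "A = (\<lambda>i. {t i<..t (Suc i)})"
  have A [measurable]: "A i \<in> sets borel" for i by (simp add: A_def)
  define f where "f = (\<lambda>s. \<Sum>i<n. u i * indicator (A i) s)"
  have f0: "0 \<le> f s" for s unfolding f_def using u by (intro sum_nonneg) simp
  have single: "(\<Sum>j<n. g j * indicator (A j) s) = g i" if i: "i < n" "s \<in> A i" for g :: "nat \<Rightarrow> real" and s i
  proof -
    have z: "g j * indicator (A j) s = 0" if "j \<noteq> i" for j
    proof -
      have "t (Suc j) \<le> t i \<or> t (Suc i) \<le> t j" using that monoD[OF t(2)] by (metis Suc_leI linorder_neqE_nat)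
      then show ?thesis using i(2) by (auto simp: A_def)
    qed
    have "(\<Sum>j\<in>{..<n} - {i}. g j * indicator (A j) s) = 0" by (intro sum.neutral ballI z) auto
    then show ?thesis using i by (subst sum.remove[of "{..<n}" i]) auto
  qed
  have ln_f: "ln (1 + f s) = (\<Sum>i<n. ln (1 + u i) * indicator (A i) s)" for s
  proof (cases "\<exists>i<n. s \<in> A i")
    case True
    then obtain i where i: "i < n" "s \<in> A i" by blast
    show ?thesis using single[OF i] by (simp add: f_def)
  next
    case False
    then have "(\<Sum>i<n. g i * indicator (A i) s) = 0" for g :: "nat \<Rightarrow> real"
      by (intro sum.neutral ballI) (auto simp: indicator_def)
    then show ?thesis by (simp only: f_def) simp
  qed
  have [measurable]: "f \<in> borel_measurable borel" unfolding f_def by measurable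
  have sum_ivl: "(\<integral>\<^sup>+s. ennreal (\<Sum>i<n. v i * indicator (A i) s) \<partial>N) = ennreal (\<Sum>i<n. v i * m i)"
    if N: "sets N = sets borel" and v: "\<And>i. 0 \<le> v i" and m: "\<And>i. emeasure N (A i) = ennreal (m i)" "\<And>i. 0 \<le> m i" for N v m
  proof -
    have [measurable_cong]: "sets N = sets borel" by fact
    have "(\<integral>\<^sup>+s. ennreal (\<Sum>i<n. v i * indicator (A i) s) \<partial>N) = (\<integral>\<^sup>+s. (\<Sum>i<n. ennreal (v i) * indicator (A i) s) \<partial>N)"
      using v by (intro nn_integral_cong) (simp add: ennreal_mult ennreal_indicator flip: sum_ennreal)
    also have "\<dots> = (\<Sum>i<n. \<integral>\<^sup>+s. ennreal (v i) * indicator (A i) s \<partial>N)"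
      by (rule nn_integral_sum) measurable
    also have "\<dots> = (\<Sum>i<n. ennreal (v i) * emeasure N (A i))"
      by (intro sum.cong refl nn_integral_cmult_indicator) (simp add: N)
    also have "\<dots> = ennreal (\<Sum>i<n. v i * m i)"
      using v m by (simp add: ennreal_mult flip: sum_ennreal)
    finally show ?thesis .
  qed
  define Y where "Y = (\<lambda>\<omega>. \<Prod>i<n. exp (- u i * (gamma_process (t (Suc i)) \<omega> - gamma_process (t i) \<omega>)))"
  have Y0: "0 \<le> Y \<omega>" for \<omega> unfolding Y_def by (intro prod_nonneg) simp
  have Y1: "Y \<omega> \<le> 1" for \<omega> unfolding Y_def
  proof (intro prod_le_1 conjI)
    fix i
    have "gamma_process (t i) \<omega> \<le> gamma_process (t (Suc i)) \<omega>" by (rule monoD[OF gamma_process_mono t0(2)])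
    then show "exp (- u i * (gamma_process (t (Suc i)) \<omega> - gamma_process (t i) \<omega>)) \<le> 1" using u[of i] by simp
  qed simp
  have [measurable]: "Y \<in> borel_measurable gamma_space" unfolding Y_def by measurable
  have "ennreal (LINT \<omega>|gamma_space. Y \<omega>) = (\<integral>\<^sup>+\<omega>. ennreal (Y \<omega>) \<partial>gamma_space)"
    using Y0 Y1 by (intro nn_integral_eq_integral[symmetric] integrable_const_bound[where B=1]) (auto intro!: AE_I2)
  also have "\<dots> = (\<integral>\<^sup>+\<omega>. nexp (\<integral>\<^sup>+s. ennreal (f s) \<partial>jump_measure \<omega>) \<partial>gamma_space)"
  proof (rule nn_integral_cong_AE, use AE_regular in eventually_elim)
    case (elim \<omega>)
    define m where "m = (\<lambda>i. gamma_process (t (Suc i)) \<omega> - gamma_process (t i) \<omega>)"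
    have m0: "0 \<le> m i" for i unfolding m_def using monoD[OF gamma_process_mono t0(2)[of i], of \<omega>] by simp
    have "(\<integral>\<^sup>+s. ennreal (f s) \<partial>jump_measure \<omega>) = ennreal (\<Sum>i<n. u i * m i)" unfolding f_def
      by (intro sum_ivl u m0) (auto simp: A_def m_def gamma_process_increment[OF elim t0])
    moreover have "0 \<le> (\<Sum>i<n. u i * m i)" by (intro sum_nonneg mult_nonneg_nonneg u m0)
    ultimately show ?case by (simp add: Y_def exp_sum m_def flip: sum_negf)
  qed
  also have "\<dots> = nexp (\<integral>\<^sup>+s. indicator {0..} s * ennreal (ln (1 + f s)) \<partial>lborel)"
    using f0 by (intro laplace_jump_measure) auto
  also have "(\<integral>\<^sup>+s. indicator {0..} s * ennreal (ln (1 + f s)) \<partial>lborel) = (\<integral>\<^sup>+s. ennreal (\<Sum>i<n. ln (1 + u i) * indicator (A i) s) \<partial>lborel)"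
  proof (rule nn_integral_cong)
    fix s
    have "s \<notin> A i" if "s < 0" for i using that t0(1)[of i] by (auto simp: A_def)
    then show "indicator {0..} s * ennreal (ln (1 + f s)) = ennreal (\<Sum>i<n. ln (1 + u i) * indicator (A i) s)"
      unfolding ln_f by (cases "0 \<le> s") auto
  qed
  also have "\<dots> = ennreal (\<Sum>i<n. ln (1 + u i) * (t (Suc i) - t i))"
    using u t0 by (intro sum_ivl) (auto simp: A_def)
  also have "nexp \<dots> = ennreal (exp (- (\<Sum>i<n. ln (1 + u i) * (t (Suc i) - t i))))"
    using u t0 by (intro nexp_ennreal sum_nonneg) simp
  also have "exp (- (\<Sum>i<n. ln (1 + u i) * (t (Suc i) - t i))) = (\<Prod>i<n. (1 + u i) powr (- (t (Suc i) - t i)))"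
  proof -
    have "(1 + u i) powr (- D) = exp (- (ln (1 + u i) * D))" for i D
      using u[of i] by (simp add: powr_def mult.commute)
    then show ?thesis by (simp only: exp_sum[OF finite_lessThan] flip: sum_negf)
  qed
  finally show ?thesis unfolding Y_def[symmetric]
    using Y0 by (subst (asm) ennreal_inj) (auto intro!: integral_nonneg prod_nonneg)
qed

text \<open>Both measures give a half-open interval the increment of the path over it, and these
  intervals form a generator stable under intersection. Restricting to positive times discards the
  mass a jump measure might have at time 0, which the path does not see.\<close>

lemma interval_measure_gamma_process:
  assumes r: "regular \<omega>"
  shows "interval_measure (\<lambda>s. gamma_process (max 0 s) \<omega>) = density (jump_measure \<omega>) (indicator {0<..})"
proof -
  have "gamma_process (max 0 s) \<omega> = gamma_process s \<omega>" for s by (auto simp: max_def)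
  then have F: "(\<lambda>s. gamma_process (max 0 s) \<omega>) = (\<lambda>s. gamma_process s \<omega>)" by simp
  have I: "emeasure (interval_measure (\<lambda>s. gamma_process s \<omega>)) {a<..b} = ennreal (gamma_process b \<omega> - gamma_process a \<omega>)" if "a \<le> b" for a b
    using that gamma_process_right_continuous monoD[OF gamma_process_mono] by (intro emeasure_interval_measure_Ioc) auto
  have J: "emeasure (density (jump_measure \<omega>) (indicator {0<..})) {a<..b} = ennreal (gamma_process b \<omega> - gamma_process a \<omega>)" if "a \<le> b" for a b
  proof -
    have "emeasure (density (jump_measure \<omega>) (indicator {0<..})) {a<..b} = emeasure (jump_measure \<omega>) ({0<..} \<inter> {a<..b})"
      by (intro emeasure_restricted) auto
    also have "{0<..} \<inter> {a<..b} = {max 0 a<..max 0 b}" by auto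
    also have "emeasure (jump_measure \<omega>) {max 0 a<..max 0 b} = ennreal (gamma_process (max 0 b) \<omega> - gamma_process (max 0 a) \<omega>)"
      using that by (intro gamma_process_increment r) auto
    finally show ?thesis by (simp only: fun_cong[OF F])
  qed
  show ?thesis unfolding F
  proof (rule measure_eqI_generator_eq[where E="range (\<lambda>(a, b). {a<..b})" and \<Omega>=UNIV and A="\<lambda>i. {- real i<..real i}"])
    show "Int_stable (range (\<lambda>(a, b). {a<..b :: real}))"
    proof (rule Int_stableI)
      fix X Y assume "X \<in> range (\<lambda>(a, b). {a<..b :: real})" "Y \<in> range (\<lambda>(a, b). {a<..b :: real})"
      then obtain a b c d where "X = {a<..b}" "Y = {c<..d}" by auto
      then have "X \<inter> Y = (\<lambda>(a, b). {a<..b}) (max a c, min b d)" by auto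
      then show "X \<inter> Y \<in> range (\<lambda>(a, b). {a<..b})" by blast
    qed
    show "emeasure (interval_measure (\<lambda>s. gamma_process s \<omega>)) X = emeasure (density (jump_measure \<omega>) (indicator {0<..})) X"
      if XE: "X \<in> range (\<lambda>(a, b). {a<..b})" for X
    proof -
      obtain a b where X: "X = {a<..b}" using XE by auto
      show ?thesis unfolding X using I[of a b] J[of a b] by (cases "a \<le> b") auto
    qed
    have "\<exists>i. x \<in> {- real i<..real i}" for x
    proof -
      obtain i :: nat where "\<bar>x\<bar> < real i" using reals_Archimedean2 by blast
      then show ?thesis by (intro exI[of _ i]) auto
    qed
    then show "(\<Union>i. {- real i<..real i}) = UNIV" by auto
    show "emeasure (interval_measure (\<lambda>s. gamma_process s \<omega>)) {- real i<..real i} \<noteq> \<infinity>" for i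
      by (subst I) auto
    show "sets (interval_measure (\<lambda>s. gamma_process s \<omega>)) = sigma_sets UNIV (range (\<lambda>(a, b). {a<..b}))"
      "sets (density (jump_measure \<omega>) (indicator {0<..})) = sigma_sets UNIV (range (\<lambda>(a, b). {a<..b}))"
      by (simp_all add: borel_sigma_sets_Ioc)
  qed auto
qed

lemma path_integral_gamma_process:
  assumes [measurable]: "a \<in> borel_measurable borel" and r: "regular \<omega>"
  shows "path_integral a gamma_process \<omega> = enn2real (\<integral>\<^sup>+t. ennreal (indicator {0<..} t * a t) \<partial>jump_measure \<omega>)"
proof -
  have "(\<integral>\<^sup>+t\<in>{0..}. ennreal (a t) \<partial>interval_measure (\<lambda>s. gamma_process (max 0 s) \<omega>)) =
    (\<integral>\<^sup>+t. indicator {0<..} t * (ennreal (a t) * indicator {0..} t) \<partial>jump_measure \<omega>)"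
    unfolding interval_measure_gamma_process[OF r] by (rule nn_integral_density) measurable
  also have "\<dots> = (\<integral>\<^sup>+t. ennreal (indicator {0<..} t * a t) \<partial>jump_measure \<omega>)"
    by (intro nn_integral_cong) (auto simp: indicator_def)
  finally show ?thesis by (simp add: path_integral_def)
qed

text \<open>For irregular outcomes the path is zero and the integral is one fixed number, whatever
  it is; this case split makes measurability evident.\<close>

lemma path_integral_gamma_process_cases:
  assumes "a \<in> borel_measurable borel"
  shows "path_integral a gamma_process \<omega> = (if regular \<omega>
    then enn2real (\<integral>\<^sup>+t. ennreal (indicator {0<..} t * a t) \<partial>jump_measure \<omega>) else path_integral a (\<lambda>_ _. 0) ())"
proof (cases "regular \<omega>")
  case False
  then show ?thesis by (simp add: path_integral_def gamma_process_def)
qed (simp add: path_integral_gamma_process assms)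

lemma measurable_path_integral:
  assumes [measurable]: "a \<in> borel_measurable borel"
  shows "path_integral a gamma_process \<in> borel_measurable gamma_space"
  unfolding path_integral_gamma_process_cases[OF assms, abs_def] by measurable

theorem laplace_path_integral:
  assumes a: "a \<in> borel_measurable borel" "\<And>t. 0 \<le> a t"
    and fin: "(\<integral>\<^sup>+s. indicator {0..} s * ennreal (ln (1 + a s)) \<partial>lborel) < \<top>" and u: "0 \<le> u"
  shows "ennreal (laplace (distr gamma_space borel (path_integral a gamma_process)) u) =
    nexp (\<integral>\<^sup>+s. indicator {0..} s * ennreal (ln (1 + u * a s)) \<partial>lborel)"
proof -
  interpret prob_space gamma_space by (rule prob_space_gamma_space)
  note [measurable] = a(1) measurable_path_integral[OF a(1)]
  \<comment> \<open>The path integral ignores time 0, so \<open>a\<close> is replaced by a function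
    vanishing there; for Lebesgue integrals the change is invisible.\<close>
  define b where "b = (\<lambda>t. indicator {0<..} t * a t)"
  have [measurable]: "b \<in> borel_measurable borel" unfolding b_def by measurable
  have b0: "0 \<le> b t" for t using a(2) by (simp add: b_def)
  have ae: "AE s::real in lborel. s \<noteq> 0" by (rule AE_lborel_singleton)
  have ln_b: "(\<integral>\<^sup>+s. indicator {0..} s * ennreal (ln (1 + v * b s)) \<partial>lborel) = (\<integral>\<^sup>+s. indicator {0..} s * ennreal (ln (1 + v * a s)) \<partial>lborel)" for v
    by (rule nn_integral_cong_AE, use ae in eventually_elim) (auto simp: b_def indicator_def)
  have P0: "0 \<le> path_integral a gamma_process \<omega>" for \<omega> by (simp add: path_integral_def)
  have "laplace (distr gamma_space borel (path_integral a gamma_process)) u = expectation (\<lambda>\<omega>. exp (- u * path_integral a gamma_process \<omega>))"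
    unfolding laplace_def by (rule integral_distr) measurable
  also have "ennreal \<dots> = (\<integral>\<^sup>+\<omega>. ennreal (exp (- u * path_integral a gamma_process \<omega>)) \<partial>gamma_space)"
    using P0 u by (intro nn_integral_eq_integral[symmetric] integrable_const_bound[where B=1]) (auto intro!: AE_I2)
  also have "\<dots> = (\<integral>\<^sup>+\<omega>. nexp (\<integral>\<^sup>+t. ennreal (u * b t) \<partial>jump_measure \<omega>) \<partial>gamma_space)"
  proof (rule nn_integral_cong_AE)
    have "AE \<omega> in gamma_space. (\<integral>\<^sup>+t. ennreal (b t) \<partial>jump_measure \<omega>) \<noteq> \<top>"
      using b0 ln_b[of 1] fin by (intro AE_jump_measure_finite) auto
    then show "AE \<omega> in gamma_space. ennreal (exp (- u * path_integral a gamma_process \<omega>)) = nexp (\<integral>\<^sup>+t. ennreal (u * b t) \<partial>jump_measure \<omega>)"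
      using AE_regular
    proof eventually_elim
      case (elim \<omega>)
      obtain r where r: "(\<integral>\<^sup>+t. ennreal (b t) \<partial>jump_measure \<omega>) = ennreal r" "0 \<le> r"
        using elim(1) by (cases "\<integral>\<^sup>+t. ennreal (b t) \<partial>jump_measure \<omega>") auto
      have "(\<integral>\<^sup>+t. ennreal (u * b t) \<partial>jump_measure \<omega>) = (\<integral>\<^sup>+t. ennreal u * ennreal (b t) \<partial>jump_measure \<omega>)"
        using u b0 by (intro nn_integral_cong) (simp add: ennreal_mult)
      also have "\<dots> = ennreal u * ennreal r" by (subst nn_integral_cmult) (auto simp: r)
      also have "\<dots> = ennreal (u * r)" using u r by (simp add: ennreal_mult)
      finally have "nexp (\<integral>\<^sup>+t. ennreal (u * b t) \<partial>jump_measure \<omega>) = ennreal (exp (- (u * r)))" using u r by simp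
      moreover have "path_integral a gamma_process \<omega> = r"
        using path_integral_gamma_process[OF a(1) elim(2)] r by (simp add: b_def)
      ultimately show ?case by simp
    qed
  qed
  also have "\<dots> = nexp (\<integral>\<^sup>+s. indicator {0..} s * ennreal (ln (1 + u * b s)) \<partial>lborel)"
    using u b0 by (intro laplace_jump_measure) auto
  finally show ?thesis by (simp only: ln_b)
qed

text \<open>
  Paths are given the final \<open>\<sigma>\<close>-algebra, for which every functional of the path is measurable as
  soon as it is measurable on the space where the process was built.
\<close>

lemma final_sigma_algebra:
  fixes e :: "'a \<Rightarrow> 'b"
  shows "sigma_algebra (e ` space M) {A. A \<subseteq> e ` space M \<and> e -` A \<inter> space M \<in> sets M}"
proof (subst sigma_algebra_iff2, intro conjI ballI allI impI)
  fix A assume "A \<in> {A. A \<subseteq> e ` space M \<and> e -` A \<inter> space M \<in> sets M}"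
  then have "space M - (e -` A \<inter> space M) \<in> sets M" by auto
  moreover have "e -` (e ` space M - A) \<inter> space M = space M - (e -` A \<inter> space M)" by auto
  ultimately show "e ` space M - A \<in> {A. A \<subseteq> e ` space M \<and> e -` A \<inter> space M \<in> sets M}" by auto
next
  fix A :: "nat \<Rightarrow> 'b set" assume A: "range A \<subseteq> {A. A \<subseteq> e ` space M \<and> e -` A \<inter> space M \<in> sets M}"
  have "e -` (\<Union>i. A i) \<inter> space M = (\<Union>i. e -` A i \<inter> space M)" by auto
  also have "\<dots> \<in> sets M" using A by (intro sets.countable_UN) auto
  finally show "(\<Union>i. A i) \<in> {A. A \<subseteq> e ` space M \<and> e -` A \<inter> space M \<in> sets M}" using A by auto
qed auto

text \<open>The definition of a generalised Gamma convolution fixes the outcomes to be real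
  functions, so the process is transported to its own paths by \<open>e\<close>. The integral
  depends on an outcome only through its path, hence keeps its law.\<close>

theorem gamma_path_space:
  shows "\<exists>(M :: (real \<Rightarrow> real) measure) G. standard_gamma_subordinator M G \<and>
    (\<forall>a\<in>borel_measurable borel. distr M borel (path_integral a G) = distr gamma_space borel (path_integral a gamma_process))"
proof -
  define e where "e = (\<lambda>\<omega> t. gamma_process t \<omega>)"
  define N where "N = sigma (e ` space gamma_space) {A. A \<subseteq> e ` space gamma_space \<and> e -` A \<inter> space gamma_space \<in> sets gamma_space}"
  have sN: "space N = e ` space gamma_space" unfolding N_def by (rule space_measure_of) auto
  have sets_N: "sets N = {A. A \<subseteq> e ` space gamma_space \<and> e -` A \<inter> space gamma_space \<in> sets gamma_space}"
    unfolding N_def by (rule sigma_algebra.sets_measure_of_eq[OF final_sigma_algebra])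
  have e [measurable]: "e \<in> gamma_space \<rightarrow>\<^sub>M N"
    by (rule measurableI) (auto simp: sN sets_N)
  have N: "g \<in> borel_measurable N" if "(\<lambda>\<omega>. g (e \<omega>)) \<in> borel_measurable gamma_space" for g :: "(real \<Rightarrow> real) \<Rightarrow> real"
  proof (rule measurableI)
    fix A :: "real set" assume "A \<in> sets borel"
    then have "(\<lambda>\<omega>. g (e \<omega>)) -` A \<inter> space gamma_space \<in> sets gamma_space" by (rule measurable_sets[OF that])
    moreover have "e -` (g -` A \<inter> e ` space gamma_space) \<inter> space gamma_space = (\<lambda>\<omega>. g (e \<omega>)) -` A \<inter> space gamma_space" by auto
    ultimately show "g -` A \<inter> space N \<in> sets N" by (simp add: sN sets_N)
  qed simp
  define M where "M = distr gamma_space N e"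
  define G where "G = (\<lambda>(t::real) (x :: real \<Rightarrow> real). x t)"
  interpret prob_space gamma_space by (rule prob_space_gamma_space)
  have Gm: "G t \<in> borel_measurable N" for t by (rule N) (simp add: G_def e_def)
  have "standard_gamma_subordinator M G"
  proof (rule standard_gamma_subordinatorI)
    show "prob_space M" unfolding M_def by (rule prob_space_distr[OF e])
    show "G t \<in> borel_measurable M" for t using Gm by (simp add: M_def)
    fix x assume "x \<in> space M"
    then obtain \<omega> where x: "x = e \<omega>" by (auto simp: M_def sN)
    show "G 0 x = 0" by (simp add: x G_def e_def)
    show "mono_on {0..} (\<lambda>t. G t x)" using monoD[OF gamma_process_mono[of \<omega>]] by (auto simp: mono_on_def x G_def e_def)
    show "continuous (at_right t) (\<lambda>s. G s x)" for t
      using gamma_process_right_continuous[of t \<omega>] by (simp add: x G_def e_def)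
  next
    fix t u :: "nat \<Rightarrow> real" and n
    assume t: "0 \<le> t 0" "mono t" and u: "\<And>i. 0 \<le> u i"
    have "(LINT x|M. (\<Prod>i<n. exp (- u i * (G (t (Suc i)) x - G (t i) x)))) =
      (LINT \<omega>|gamma_space. (\<Prod>i<n. exp (- u i * (G (t (Suc i)) (e \<omega>) - G (t i) (e \<omega>)))))"
      unfolding M_def by (rule integral_distr[OF e]) (use Gm in measurable)
    then show "(LINT x|M. (\<Prod>i<n. exp (- u i * (G (t (Suc i)) x - G (t i) x)))) = (\<Prod>i<n. (1 + u i) powr (- (t (Suc i) - t i)))"
      using expectation_gamma_process[OF t u, where n=n] by (simp add: G_def e_def)
  qed
  moreover have "distr M borel (path_integral a G) = distr gamma_space borel (path_integral a gamma_process)"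
    if a: "a \<in> borel_measurable borel" for a
  proof -
    have eq: "path_integral a G (e \<omega>) = path_integral a gamma_process \<omega>" for \<omega>
      by (simp add: path_integral_def G_def e_def)
    have "path_integral a G \<in> borel_measurable N"
      by (rule N) (simp add: eq measurable_path_integral[OF a])
    then show ?thesis unfolding M_def by (simp add: distr_distr[OF _ e] comp_def eq)
  qed
  ultimately show ?thesis by blast
qed

section \<open>From the logistic representation to a Gamma integral\<close>

text \<open>The contribution of a unit step at \<open>s\<close>. It equals ln (1 + e^x c) with c =
  e^(-s), the Gamma exponent of the constant c per unit of time.\<close>

lemma nn_integral_logistic:
  "(\<integral>\<^sup>+\<tau>. ennreal (1 / (1 + exp (\<tau> - x))) * indicator {s..} \<tau> \<partial>lborel) = ennreal (ln (1 + exp (x - s)))"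
  for x s :: real
proof -
  have "(\<integral>\<^sup>+\<tau>. ennreal (1 / (1 + exp (\<tau> - x))) * indicator {s..} \<tau> \<partial>lborel) = ennreal (0 - (- ln (1 + exp (x - s))))"
  proof (rule nn_integral_FTC_atLeast)
    show "((\<lambda>\<tau>. - ln (1 + exp (x - \<tau>))) has_real_derivative 1 / (1 + exp (\<tau> - x))) (at \<tau>)" for \<tau>
    proof -
      have p: "0 < 1 + exp (x - \<tau>)" "0 < 1 + exp (\<tau> - x)" by (simp_all add: add_pos_pos)
      have "exp (\<tau> - x) * exp (x - \<tau>) = 1" by (simp flip: exp_add)
      then have "exp (x - \<tau>) / (1 + exp (x - \<tau>)) = 1 / (1 + exp (\<tau> - x))" using p by (simp add: divide_simps algebra_simps)
      then show ?thesis using p by (auto intro!: derivative_eq_intros)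
    qed
    show "0 \<le> 1 / (1 + exp (\<tau> - x))" for \<tau> by (simp add: add_nonneg_nonneg)
    have "((\<lambda>\<tau>. - ln (1 + exp x * exp (- \<tau>))) \<longlongrightarrow> - ln (1 + exp x * 0)) at_top"
      by (intro tendsto_intros filterlim_compose[OF exp_at_bot filterlim_uminus_at_bot_at_top]) auto
    then show "((\<lambda>\<tau>. - ln (1 + exp (x - \<tau>))) \<longlongrightarrow> 0) at_top" by (simp add: exp_diff exp_minus divide_inverse)
  qed measurable
  then show ?thesis by simp
qed

lemma laplace_pos_le_1:
  assumes \<mu>: "prob_space \<mu>" "sets \<mu> = sets borel" "AE x in \<mu>. 0 < x" and u: "0 \<le> u"
  shows "0 < laplace \<mu> u" "laplace \<mu> u \<le> 1"
proof -
  interpret prob_space \<mu> by fact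
  have nonneg: "AE x in \<mu>. 0 \<le> x" using \<mu>(3) by eventually_elim simp
  have int: "integrable \<mu> (\<lambda>x. exp (- u * x))" by (rule integrable_laplace[OF finite_measure_axioms \<mu>(2) nonneg u])
  show "0 < laplace \<mu> u" unfolding laplace_def
    by (rule expectation_greater[OF int]) simp
  show "laplace \<mu> u \<le> 1" unfolding laplace_def
  proof (rule integral_le_const[OF int])
    show "AE x in \<mu>. exp (- u * x) \<le> 1" using nonneg
    proof eventually_elim
      case (elim x)
      then have "0 \<le> u * x" using u by simp
      then show ?case by simp
    qed
  qed
qed

text \<open>
  The function \<open>exp \<circ> uminus \<circ> (generalized inverse of K)\<close> is the integrand \<open>a\<close>: up to its end point
  the superlevel set \<open>{\<tau>. t < K \<tau>}\<close> is \<open>{- ln (a t)..}\<close>. It is written in terms of the logistic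
  mass of that set to make its measurability evident.
\<close>

lemma logistic_superlevel:
  fixes K :: "real \<Rightarrow> real"
  assumes mono: "mono K" and K0: "\<And>t. 0 \<le> K t"
    and fin: "(\<integral>\<^sup>+\<tau>. ennreal (K \<tau> / (1 + exp (\<tau> - 0))) \<partial>lborel) < \<top>" and t: "0 < t"
  shows "\<exists>c\<ge>0. \<forall>x. (\<integral>\<^sup>+\<tau>. ennreal (indicator {t<..} (K \<tau>) / (1 + exp (\<tau> - x))) \<partial>lborel) = ennreal (ln (1 + exp x * c))"
proof (cases "\<exists>\<tau>. t < K \<tau>")
  case False
  then have "indicator {t<..} (K \<tau>) = (0::real)" for \<tau> by (auto simp: indicator_def)
  then show ?thesis by (intro exI[of _ 0]) simp
next
  case True
  define B where "B = {\<tau>. t < K \<tau>}"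
  have up: "\<sigma> \<in> B" if "\<tau> \<in> B" "\<tau> \<le> \<sigma>" for \<tau> \<sigma> using that monoD[OF mono that(2)] by (auto simp: B_def)
  have "bdd_below B"
  proof (rule ccontr)
    assume nb: "\<not> bdd_below B"
    have all: "t < K \<tau>" for \<tau>
    proof -
      obtain \<sigma> where "\<sigma> \<in> B" "\<sigma> < \<tau>" using nb unfolding bdd_below_def by (meson not_le)
      then show ?thesis using up[of \<sigma> \<tau>] by (simp add: B_def)
    qed
    obtain L where L: "(\<integral>\<^sup>+\<tau>. ennreal (K \<tau> / (1 + exp (\<tau> - 0))) \<partial>lborel) = ennreal L" "0 \<le> L"
      using fin by (cases "\<integral>\<^sup>+\<tau>. ennreal (K \<tau> / (1 + exp (\<tau> - 0))) \<partial>lborel") auto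
    \<comment> \<open>If the set were unbounded below, K would exceed \<open>t\<close> everywhere
      and the integral over [-m, \<infinity>) alone would be at least t ln (1 + e^m) \<ge> t m = L +
      1, more than the total \<open>L\<close>.\<close>
    define m where "m = (L + 1) / t"
    have "0 \<le> ln (1 + exp m)" by (rule ln_ge_zero) simp
    then have "ennreal (t * ln (1 + exp m)) = ennreal t * (\<integral>\<^sup>+\<tau>. ennreal (1 / (1 + exp (\<tau> - 0))) * indicator {- m..} \<tau> \<partial>lborel)"
      unfolding nn_integral_logistic using t by (simp add: ennreal_mult)
    also have "\<dots> = (\<integral>\<^sup>+\<tau>. ennreal t * (ennreal (1 / (1 + exp (\<tau> - 0))) * indicator {- m..} \<tau>) \<partial>lborel)"
      by (rule nn_integral_cmult[symmetric]) measurable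
    also have "\<dots> \<le> (\<integral>\<^sup>+\<tau>. ennreal (K \<tau> / (1 + exp (\<tau> - 0))) \<partial>lborel)"
    proof (rule nn_integral_mono)
      fix \<tau>
      have "ennreal t * ennreal (1 / (1 + exp (\<tau> - 0))) = ennreal (t / (1 + exp (\<tau> - 0)))" using t by (simp flip: ennreal_mult')
      also have "\<dots> \<le> ennreal (K \<tau> / (1 + exp (\<tau> - 0)))" using all[of \<tau>] by (intro ennreal_leI divide_right_mono) (auto simp: add_nonneg_nonneg)
      finally show "ennreal t * (ennreal (1 / (1 + exp (\<tau> - 0))) * indicator {- m..} \<tau>) \<le> ennreal (K \<tau> / (1 + exp (\<tau> - 0)))"
        by (auto simp: indicator_def)
    qed
    finally have "t * ln (1 + exp m) \<le> L" using L by simp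
    moreover have "m \<le> ln (1 + exp m)"
    proof -
      have "ln (exp m) \<le> ln (1 + exp m)" by (subst ln_le_cancel_iff) (auto simp: add_pos_pos)
      then show ?thesis by simp
    qed
    ultimately have "t * m \<le> L" using t by (meson mult_left_mono less_imp_le order_trans)
    then show False using t by (simp add: m_def)
  qed
  have Bne: "B \<noteq> {}" using True by (auto simp: B_def)
  define s where "s = Inf B"
  have ind: "indicator {t<..} (K \<tau>) = (indicator {s..} \<tau> :: real)" if "\<tau> \<noteq> s" for \<tau>
  proof (cases "\<tau> < s")
    case True
    then have "\<tau> \<notin> B" using cInf_lower[OF _ \<open>bdd_below B\<close>, of \<tau>] unfolding s_def by linarith
    then show ?thesis using True by (simp add: B_def indicator_def)
  next
    case False
    then have "Inf B < \<tau>" using that by (simp add: s_def)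
    then obtain \<sigma> where "\<sigma> \<in> B" "\<sigma> < \<tau>" using cInf_less_iff[OF Bne \<open>bdd_below B\<close>] by auto
    then show ?thesis using up[of \<sigma> \<tau>] False by (simp add: B_def indicator_def)
  qed
  have "(\<integral>\<^sup>+\<tau>. ennreal (indicator {t<..} (K \<tau>) / (1 + exp (\<tau> - x))) \<partial>lborel) = ennreal (ln (1 + exp x * exp (- s)))" for x
  proof -
    have "(\<integral>\<^sup>+\<tau>. ennreal (indicator {t<..} (K \<tau>) / (1 + exp (\<tau> - x))) \<partial>lborel) =
      (\<integral>\<^sup>+\<tau>. ennreal (1 / (1 + exp (\<tau> - x))) * indicator {s..} \<tau> \<partial>lborel)"
    proof (rule nn_integral_cong_AE)
      show "AE \<tau> in lborel. ennreal (indicator {t<..} (K \<tau>) / (1 + exp (\<tau> - x))) = ennreal (1 / (1 + exp (\<tau> - x))) * indicator {s..} \<tau>"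
        using AE_lborel_singleton[of s]
      proof eventually_elim
        case (elim \<tau>)
        show ?case unfolding ind[OF elim] by (simp add: indicator_def)
      qed
    qed
    also have "\<dots> = ennreal (ln (1 + exp (x - s)))" by (rule nn_integral_logistic)
    finally show ?thesis by (simp add: exp_diff exp_minus divide_inverse)
  qed
  then show ?thesis by (intro exI[of _ "exp (- s)"]) simp
qed

theorem generalized_gamma_convolutionI:
  fixes K :: "real \<Rightarrow> real"
  assumes \<mu>: "prob_space \<mu>" "sets \<mu> = sets borel" "AE x in \<mu>. 0 < x"
    and mono: "mono K" and K0: "\<And>t. 0 \<le> K t"
    and eq: "\<And>x. (\<integral>\<^sup>+t. ennreal (K t / (1 + exp (t - x))) \<partial>lborel) = ennreal (- ln (laplace \<mu> (exp x)))"
  shows "generalized_gamma_convolution \<mu>"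
proof -
  have [measurable]: "K \<in> borel_measurable borel" by (rule borel_measurable_mono[OF mono])
  define c where "c = (\<lambda>t. \<integral>\<^sup>+\<tau>. ennreal (indicator {t<..} (K \<tau>) / (1 + exp (\<tau> - 0))) \<partial>lborel)"
  define a where "a = (\<lambda>t. indicator {0<..} t * (exp (enn2real (c t)) - 1))"
  have [measurable]: "Measurable.pred (borel \<Otimes>\<^sub>M borel) (\<lambda>p. fst p < K (snd p))" by measurable
  have ind_eq: "indicator {t<..} (K \<tau>) = (if t < K \<tau> then 1 else 0 :: real)" for t \<tau> by (simp add: indicator_def)
  have [measurable]: "c \<in> borel_measurable borel" unfolding c_def ind_eq by measurable
  have am [measurable]: "a \<in> borel_measurable borel" unfolding a_def by measurable
  have a0: "0 \<le> a t" for t by (simp add: a_def)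
  have slice: "(\<integral>\<^sup>+\<tau>. ennreal (indicator {t<..} (K \<tau>) / (1 + exp (\<tau> - x))) \<partial>lborel) = ennreal (ln (1 + exp x * a t))"
    if t: "0 < t" for t x
  proof -
    have "(\<integral>\<^sup>+\<tau>. ennreal (K \<tau> / (1 + exp (\<tau> - 0))) \<partial>lborel) < \<top>" by (subst eq) simp
    from logistic_superlevel[OF mono K0 this t]
    obtain d where d: "0 \<le> d" "\<And>x. (\<integral>\<^sup>+\<tau>. ennreal (indicator {t<..} (K \<tau>) / (1 + exp (\<tau> - x))) \<partial>lborel) = ennreal (ln (1 + exp x * d))"
      by blast
    have "a t = d" using t d(1) d(2)[of 0] by (simp add: a_def c_def)
    then show ?thesis using d(2) by simp
  qed
  have key: "(\<integral>\<^sup>+t. indicator {0..} t * ennreal (ln (1 + exp x * a t)) \<partial>lborel) = ennreal (- ln (laplace \<mu> (exp x)))" for x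
  proof -
    \<comment> \<open>Layer-cake decomposition: K \<tau> is the length of the set of t with 0 < t <
      K \<tau>. Tonelli's theorem exchanges slicing in t with integration in \<tau>.\<close>
    define q where "q = (\<lambda>t \<tau>. ennreal (if 0 < t \<and> t < K \<tau> then 1 / (1 + exp (\<tau> - x)) else 0))"
    have qm: "case_prod q \<in> borel_measurable (lborel \<Otimes>\<^sub>M lborel)" unfolding q_def by measurable
    have "(\<integral>\<^sup>+t. indicator {0..} t * ennreal (ln (1 + exp x * a t)) \<partial>lborel) = (\<integral>\<^sup>+t. \<integral>\<^sup>+\<tau>. q t \<tau> \<partial>lborel \<partial>lborel)"
    proof (rule nn_integral_cong)
      fix t :: real
      show "indicator {0..} t * ennreal (ln (1 + exp x * a t)) = (\<integral>\<^sup>+\<tau>. q t \<tau> \<partial>lborel)"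
      proof (cases "0 < t")
        case True
        have "q t = (\<lambda>\<tau>. ennreal (indicator {t<..} (K \<tau>) / (1 + exp (\<tau> - x))))" using True by (auto simp: q_def indicator_def)
        then show ?thesis using True by (simp add: slice)
      next
        case False
        then show ?thesis by (simp add: q_def a_def)
      qed
    qed
    also have "\<dots> = (\<integral>\<^sup>+\<tau>. \<integral>\<^sup>+t. q t \<tau> \<partial>lborel \<partial>lborel)"
      by (rule lborel_pair.Fubini'[symmetric, OF qm])
    also have "\<dots> = (\<integral>\<^sup>+\<tau>. ennreal (K \<tau> / (1 + exp (\<tau> - x))) \<partial>lborel)"
    proof (rule nn_integral_cong)
      fix \<tau> :: real
      have p: "0 < 1 + exp (\<tau> - x)" by (simp add: add_pos_pos)
      have "(\<integral>\<^sup>+t. q t \<tau> \<partial>lborel) = (\<integral>\<^sup>+t. ennreal (1 / (1 + exp (\<tau> - x))) * indicator {0<..<K \<tau>} t \<partial>lborel)"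
        by (intro nn_integral_cong) (simp add: q_def indicator_def)
      also have "\<dots> = ennreal (1 / (1 + exp (\<tau> - x))) * ennreal (K \<tau>)"
        using K0[of \<tau>] by (simp add: nn_integral_cmult_indicator)
      also have "\<dots> = ennreal (K \<tau> / (1 + exp (\<tau> - x)))" using K0[of \<tau>] p by (simp flip: ennreal_mult)
      finally show "(\<integral>\<^sup>+t. q t \<tau> \<partial>lborel) = ennreal (K \<tau> / (1 + exp (\<tau> - x)))" .
    qed
    finally show ?thesis by (simp only: eq)
  qed
  have fin: "(\<integral>\<^sup>+t. indicator {0..} t * ennreal (ln (1 + a t)) \<partial>lborel) < \<top>"
    using key[of 0] by simp
  define \<nu> where "\<nu> = distr gamma_space borel (path_integral a gamma_process)"
  have \<nu>: "\<mu> = \<nu>"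
  proof (rule laplace_unique_prob[OF \<mu>(1,2)])
    show "AE x in \<mu>. 0 \<le> x" using \<mu>(3) by eventually_elim simp
    show "prob_space \<nu>" unfolding \<nu>_def
      by (rule prob_space.prob_space_distr[OF prob_space_gamma_space measurable_path_integral[OF am]])
    show "sets \<nu> = sets borel" by (simp add: \<nu>_def)
    show "AE x in \<nu>. 0 \<le> x" unfolding \<nu>_def
      by (subst AE_distr_iff[OF measurable_path_integral[OF am]]) (auto simp: path_integral_def intro!: AE_I2)
    show "laplace \<mu> u = laplace \<nu> u" if u: "0 < u" for u
    proof -
      have L: "0 < laplace \<mu> u" "laplace \<mu> u \<le> 1" using laplace_pos_le_1[OF \<mu>] u by auto
      have "ennreal (laplace \<nu> u) = nexp (\<integral>\<^sup>+s. indicator {0..} s * ennreal (ln (1 + u * a s)) \<partial>lborel)"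
        unfolding \<nu>_def using u by (intro laplace_path_integral am a0 fin) simp
      also have "\<dots> = nexp (ennreal (- ln (laplace \<mu> u)))" using key[of "ln u"] u by simp
      also have "\<dots> = ennreal (laplace \<mu> u)" using L by simp
      finally show ?thesis using L unfolding laplace_def
        by (subst (asm) ennreal_inj) (auto intro!: integral_nonneg)
    qed
  qed
  obtain M :: "(real \<Rightarrow> real) measure" and G where MG: "standard_gamma_subordinator M G"
    and dist: "\<forall>a\<in>borel_measurable borel. distr M borel (path_integral a G) = distr gamma_space borel (path_integral a gamma_process)"
    using gamma_path_space by blast
  show ?thesis unfolding generalized_gamma_convolution_def
  proof (intro conjI exI)
    show "a \<in> borel_measurable (restrict_space borel {0..})" by (rule measurable_restrict_space1[OF am])
    show "\<forall>t\<ge>0. 0 \<le> a t" using a0 by simp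
    show "(\<integral>\<^sup>+t\<in>{0..}. ennreal (ln (1 + a t)) \<partial>lborel) < \<infinity>" using fin by (simp add: mult.commute)
    show "\<mu> = distr M borel (path_integral a G)" using dist am \<nu> by (simp add: \<nu>_def)
  qed (fact \<mu>(3) MG)+
qed

section \<open>The Sun law\<close>

text \<open>From x - x^2 \<le> ln (1 + x) \<le> x with x = c n / (n + 1), the exponents are squeezed
  between c n - c n * x and c n. The sequence \<open>c\<close> varies because the argument exp
  (\<beta> x) will change along with the order.\<close>

lemma tendsto_inverse_power_exp:
  fixes c :: "nat \<Rightarrow> real"
  assumes c: "c \<longlonglongrightarrow> l" and c0: "\<And>n. 0 \<le> c n"
  shows "(\<lambda>n. (1 + c n / real (Suc n)) powr (- real (Suc n))) \<longlonglongrightarrow> exp (- l)"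
proof -
  define d where "d = (\<lambda>n. real (Suc n) * ln (1 + c n / real (Suc n)))"
  have inv: "(\<lambda>n. inverse (real (Suc n))) \<longlonglongrightarrow> 0" by (rule LIMSEQ_inverse_real_of_nat)
  have small: "(\<lambda>n. c n / real (Suc n)) \<longlonglongrightarrow> 0"
    using tendsto_mult[OF c inv] by (simp add: divide_inverse)
  have "d \<longlonglongrightarrow> l"
  proof (rule tendsto_sandwich)
    show "(\<lambda>n. c n - c n * (c n / real (Suc n))) \<longlonglongrightarrow> l"
      using tendsto_diff[OF c tendsto_mult[OF c small]] by simp
    show "c \<longlonglongrightarrow> l" by fact
    have le: "d n \<le> c n" for n
    proof -
      have "ln (1 + c n / real (Suc n)) \<le> c n / real (Suc n)" using c0[of n] by (intro ln_add_one_self_le_self) simp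
      then show ?thesis unfolding d_def by (simp add: pos_le_divide_eq mult.commute del: of_nat_Suc)
    qed
    then show "\<forall>\<^sub>F n in sequentially. d n \<le> c n" by simp
    have "\<forall>\<^sub>F n in sequentially. c n / real (Suc n) < 1" using small by (rule order_tendstoD(2)) simp
    then show "\<forall>\<^sub>F n in sequentially. c n - c n * (c n / real (Suc n)) \<le> d n"
    proof eventually_elim
      case (elim n)
      define x where "x = c n / real (Suc n)"
      have "x - x\<^sup>2 \<le> ln (1 + x)" using elim c0[of n] unfolding x_def by (intro ln_one_plus_pos_lower_bound) auto
      then have "real (Suc n) * (x - x\<^sup>2) \<le> d n" unfolding d_def x_def[symmetric] by (intro mult_left_mono) auto
      moreover have "real (Suc n) * x = c n" by (simp add: x_def del: of_nat_Suc)
      moreover have "real (Suc n) * (x - x\<^sup>2) = real (Suc n) * x - (real (Suc n) * x) * x" by (simp add: algebra_simps power2_eq_square)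
      ultimately have "c n - c n * x \<le> d n" by simp
      then show ?case by (simp add: x_def)
    qed
  qed
  then have "(\<lambda>n. exp (- d n)) \<longlonglongrightarrow> exp (- l)" by (intro tendsto_intros)
  moreover have "exp (- d n) = (1 + c n / real (Suc n)) powr (- real (Suc n))" for n
  proof -
    have "0 < 1 + c n / real (Suc n)" using c0[of n] by (intro add_pos_nonneg) auto
    then show ?thesis by (simp add: d_def powr_def del: of_nat_Suc)
  qed
  ultimately show ?thesis by simp
qed

context sun_law
begin

definition rescaled :: "nat \<Rightarrow> real measure" where
  "rescaled N = distr (density lborel f) borel (\<lambda>x. x / real N)"

lemma power_mixture_rescaled:
  assumes N: "1 \<le> N"
  shows "power_mixture (rescaled N) N"
proof (rule power_mixture.intro)
  show "prob_space (rescaled N)" unfolding rescaled_def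
    by (rule prob_space.prob_space_distr[OF prob_space_f]) measurable
  show "AE x in rescaled N. 0 < x" unfolding rescaled_def using AE_f_pos N
    by (subst AE_distr_iff) (auto elim!: eventually_mono)
qed (use N in \<open>simp_all add: rescaled_def\<close>)

lemma rescaled_G:
  assumes N: "1 \<le> N"
  shows "power_mixture.G (rescaled N) N l = power_transform N (l / real N)"
proof -
  interpret power_mixture "rescaled N" N by (rule power_mixture_rescaled[OF N])
  have "G l = (LINT x|density lborel f. (1 + l * (x / real N)) powr (- real N))"
    unfolding G_def unfolding rescaled_def by (rule integral_distr) measurable
  then show ?thesis by (simp add: power_transform_def)
qed

lemma alternating_mixture_rescaled:
  assumes N: "1 \<le> N"
  shows "alternating_mixture (rescaled N) N"
proof -
  interpret power_mixture "rescaled N" N by (rule power_mixture_rescaled[OF N])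
  have "alternating_differences (\<lambda>w. G (u * joukowski_inverse w) * G (u / joukowski_inverse w))" if u: "0 < u" for u
  proof -
    have "u / real N * c = u * c / real N" "u / real N / c = u / c / real N" for c :: real by simp_all
    moreover have "0 < u / real N" using N u by simp
    ultimately show ?thesis using alternating_power_transform[OF N, of "u / real N"]
      by (simp only: rescaled_G[OF N])
  qed
  then show ?thesis
    by (intro alternating_mixture.intro alternating_mixture_axioms.intro power_mixture_axioms)
qed

abbreviation law :: "real measure" where "law \<equiv> density lborel f"

lemma AE_law_nonneg: "AE x in law. 0 \<le> x"
  using AE_f_pos by eventually_elim simp

lemma power_transform_tendsto_laplace:
  assumes c: "c \<longlonglongrightarrow> l" and c0: "\<And>n. 0 \<le> c n"
  shows "(\<lambda>n. power_transform (Suc n) (c n / real (Suc n))) \<longlonglongrightarrow> laplace law l"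
proof -
  interpret prob_space law by (rule prob_space_f)
  show ?thesis unfolding power_transform_def laplace_def
  proof (rule integral_dominated_convergence[where w="\<lambda>_. 1"])
    show "AE x in law. (\<lambda>n. (1 + c n / real (Suc n) * x) powr (- real (Suc n))) \<longlonglongrightarrow> exp (- l * x)"
      using AE_law_nonneg
    proof eventually_elim
      case (elim x)
      have "(\<lambda>n. (1 + c n * x / real (Suc n)) powr (- real (Suc n))) \<longlonglongrightarrow> exp (- (l * x))"
        using c0 elim by (intro tendsto_inverse_power_exp tendsto_mult c tendsto_const) simp
      then show ?case by simp
    qed
    show "AE x in law. norm ((1 + c n / real (Suc n) * x) powr (- real (Suc n))) \<le> 1" for n
      using AE_law_nonneg
    proof eventually_elim
      case (elim x)
      have "0 \<le> c n / real (Suc n) * x" using elim c0[of n] by simp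
      then show ?case using powr_mono[of "- real (Suc n)" 0 "1 + c n / real (Suc n) * x"] by simp
    qed
  qed auto
qed

lemma laplace_law_pos: "0 \<le> u \<Longrightarrow> 0 < laplace law u" "0 \<le> u \<Longrightarrow> laplace law u \<le> 1"
  using laplace_pos_le_1[OF prob_space_f _ AE_f_pos] by simp_all

lemma laplace_law_at_0: "(\<lambda>n. - ln (laplace law (exp (- real n)))) \<longlonglongrightarrow> 0"
proof -
  interpret prob_space law by (rule prob_space_f)
  have e: "(\<lambda>n. exp (- real n)) \<longlonglongrightarrow> 0"
    by (intro filterlim_compose[OF exp_at_bot] filterlim_compose[OF filterlim_uminus_at_bot_at_top] filterlim_real_sequentially)
  have "(\<lambda>n. laplace law (exp (- real n))) \<longlonglongrightarrow> (LINT x|law. 1)" unfolding laplace_def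
  proof (rule integral_dominated_convergence[where w="\<lambda>_. 1"])
    show "AE x in law. (\<lambda>n. exp (- exp (- real n) * x)) \<longlonglongrightarrow> 1"
    proof (rule AE_I2)
      fix x
      have "(\<lambda>n. exp (- exp (- real n) * x)) \<longlonglongrightarrow> exp (- 0 * x)" by (intro tendsto_intros e)
      then show "(\<lambda>n. exp (- exp (- real n) * x)) \<longlonglongrightarrow> 1" by simp
    qed
    show "AE x in law. norm (exp (- exp (- real n) * x)) \<le> 1" for n
      using AE_law_nonneg by eventually_elim simp
  qed auto
  then have "(\<lambda>n. laplace law (exp (- real n))) \<longlonglongrightarrow> 1" using prob_space by simp
  then have "(\<lambda>n. - ln (laplace law (exp (- real n)))) \<longlonglongrightarrow> - ln 1" by (intro tendsto_intros) auto
  then show ?thesis by simp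
qed

text \<open>Keeping only the event that the variable is at most \<open>e\<close> bounds the
  transform from below by exp (- u e) times the probability of that event, which is positive by
  \<open>f_mass_near_zero\<close>. Since \<open>e\<close> is arbitrary, the exponent grows more
  slowly than linearly.\<close>

lemma laplace_law_lower:
  assumes u: "0 \<le> u" and e: "0 < e"
  shows "- ln (laplace law u) \<le> u * e - ln (measure law {..e})"
proof -
  interpret prob_space law by (rule prob_space_f)
  have m: "0 < measure law {..e}" by (rule f_mass_near_zero[OF e])
  have "exp (- u * e) * measure law {..e} = (LINT x|law. exp (- u * e) * indicator {..e} x)" by simp
  also have "\<dots> \<le> laplace law u" unfolding laplace_def
  proof (rule integral_mono)
    show "integrable law (\<lambda>x. exp (- u * x))"
      by (rule integrable_laplace[OF finite_measure_axioms _ AE_law_nonneg u]) simp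
    show "exp (- u * e) * indicator {..e} x \<le> exp (- u * x)" for x
      using u by (auto simp: indicator_def intro: mult_left_mono)
  qed (auto intro!: integrable_mult_right integrable_real_indicator simp: emeasure_eq_measure)
  finally have "ln (exp (- u * e) * measure law {..e}) \<le> ln (laplace law u)"
    using m laplace_law_pos[OF u] by (subst ln_le_cancel_iff) auto
  then show ?thesis using m by (simp add: ln_mult)
qed

lemma laplace_law_at_top: "(\<lambda>n. - ln (laplace law (exp (real n))) / exp (real n)) \<longlonglongrightarrow> 0"
proof (rule order_tendstoI)
  fix b :: real assume "b < 0"
  moreover have "0 \<le> - ln (laplace law (exp (real n))) / exp (real n)" for n
    using laplace_law_pos[of "exp (real n)"] by (intro divide_nonneg_nonneg) auto
  ultimately show "\<forall>\<^sub>F n in sequentially. b < - ln (laplace law (exp (real n))) / exp (real n)"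
    by (intro always_eventually allI) (rule less_le_trans)
next
  fix b :: real assume b: "0 < b"
  \<comment> \<open>With e = b / 2 the linear part uses up half of the margin b; the constant C
    divided by exp n eventually fits into the other half.\<close>
  define C where "C = - ln (measure law {..b / 2})"
  have "(\<lambda>n. C / exp (real n)) \<longlonglongrightarrow> 0"
    by (intro tendsto_divide_0[OF tendsto_const] filterlim_at_top_imp_at_infinity filterlim_compose[OF exp_at_top filterlim_real_sequentially])
  then have "\<forall>\<^sub>F n in sequentially. C / exp (real n) < b / 2" by (rule order_tendstoD(2)) (use b in simp)
  then show "\<forall>\<^sub>F n in sequentially. - ln (laplace law (exp (real n))) / exp (real n) < b"
  proof eventually_elim
    case (elim n)
    have "- ln (laplace law (exp (real n))) / exp (real n) \<le> (exp (real n) * (b / 2) + C) / exp (real n)"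
      using laplace_law_lower[of "exp (real n)" "b / 2"] b by (intro divide_right_mono) (auto simp: C_def)
    also have "\<dots> = b / 2 + C / exp (real n)" by (simp add: add_divide_distrib)
    also have "\<dots> < b" using elim by linarith
    finally show ?case .
  qed
qed

theorem generalized_gamma_convolution_law: "generalized_gamma_convolution law"
proof -
  \<comment> \<open>This is 1 - 1 / (n + 3): the shift by 2 keeps it above 1/2 from n = 0 on, and it
    tends to 1.\<close>
  define \<beta> where "\<beta> = (\<lambda>n. 1 - inverse (real (Suc (n + 2))))"
  have \<beta>: "1 / 2 < \<beta> n" "\<beta> n < 1" for n by (simp_all add: \<beta>_def field_simps)
  have \<beta>_lim: "\<beta> \<longlonglongrightarrow> 1 - 0" unfolding \<beta>_def
    by (intro tendsto_diff tendsto_const LIMSEQ_ignore_initial_segment LIMSEQ_inverse_real_of_nat)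
  define P where "P = (\<lambda>n K. mono K \<and> (\<forall>t. 0 \<le> K t) \<and> continuous_on UNIV K \<and>
    (\<forall>x. (\<integral>\<^sup>+t. ennreal (K t / (1 + exp (t - x))) \<partial>lborel) = ennreal (- ln (power_transform (Suc n) (exp (\<beta> n * x) / real (Suc n))))))"
  have "\<exists>K. P n K" for n
  proof -
    have N: "1 \<le> Suc n" by simp
    interpret alternating_mixture "rescaled (Suc n)" "Suc n" by (rule alternating_mixture_rescaled[OF N])
    show ?thesis using strip_representation[OF \<beta>] unfolding rescaled_G[OF N] P_def .
  qed
  then obtain K where "\<And>n. P n (K n)" using choice[of P] by blast
  then have K: "\<And>n. mono (K n)" "\<And>n t. 0 \<le> K n t" "\<And>n. continuous_on UNIV (K n)"
    "\<And>n x. (\<integral>\<^sup>+t. ennreal (K n t / (1 + exp (t - x))) \<partial>lborel) = ennreal (- ln (power_transform (Suc n) (exp (\<beta> n * x) / real (Suc n))))"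
    unfolding P_def by auto
  have "\<exists>K'. mono K' \<and> (\<forall>t. 0 \<le> K' t) \<and>
    (\<forall>x. (\<integral>\<^sup>+t. ennreal (K' t / (1 + exp (t - x))) \<partial>lborel) = ennreal (- ln (laplace law (exp x))))"
  proof (rule logistic_limit[OF K(1-3)])
    fix x
    have "(\<lambda>n. exp (\<beta> n * x)) \<longlonglongrightarrow> exp ((1 - 0) * x)" by (intro tendsto_intros \<beta>_lim)
    then have "(\<lambda>n. power_transform (Suc n) (exp (\<beta> n * x) / real (Suc n))) \<longlonglongrightarrow> laplace law (exp ((1 - 0) * x))"
      by (intro power_transform_tendsto_laplace) auto
    then have "(\<lambda>n. - ln (power_transform (Suc n) (exp (\<beta> n * x) / real (Suc n)))) \<longlonglongrightarrow> - ln (laplace law (exp ((1 - 0) * x)))"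
      using laplace_law_pos[of "exp x"] by (intro tendsto_intros) auto
    then show "(\<lambda>n. \<integral>\<^sup>+t. ennreal (K n t / (1 + exp (t - x))) \<partial>lborel) \<longlonglongrightarrow> ennreal (- ln (laplace law (exp x)))"
      unfolding K(4) by (intro tendsto_ennrealI) simp
    show "0 \<le> - ln (laplace law (exp x))" using laplace_law_pos[of "exp x"] by simp
  qed (fact laplace_law_at_0 laplace_law_at_top)+
  then show ?thesis
    using generalized_gamma_convolutionI[OF prob_space_f _ AE_f_pos] by auto
qed

end

text \<open>The equation for \<open>h\<close> is stated with a Bochner integral, which is 0 by
  convention for a function that is not integrable. Integrability is therefore established before
  passing to nonnegative integrals: for 0 < u < x the denominator base x - \<alpha> u exceeds (1 -
  \<alpha>) x, so the kernel is bounded.\<close>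

lemma sun_law_of_density:
  fixes h :: "real \<Rightarrow> real"
  assumes p: "0 < \<alpha>" "\<alpha> < 1" "0 < \<gamma>" and h: "alpha_sun_density \<alpha> \<gamma> h"
    and f_def: "f = (\<lambda>x. ennreal (h x) * indicator {0<..} x)"
    and f [measurable]: "f \<in> borel_measurable borel" and mass: "(\<integral>\<^sup>+x. f x \<partial>lborel) = 1"
  shows "sun_law \<alpha> \<gamma> f"
proof
  show "f x = 0" if "x \<le> 0" for x using that by (simp add: f_def)
  fix x :: real assume x: "0 < x"
  have h0: "0 \<le> h u" if "0 < u" for u using h that unfolding alpha_sun_density_def by auto
  \<comment> \<open>Measurability is available for \<open>f\<close>, which vanishes off the positive
    half-line, so \<open>h\<close> is replaced by a real version of \<open>f\<close> that agrees
    with it at positive arguments.\<close>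
  define H where "H = (\<lambda>u. enn2real (f u))"
  have [measurable]: "H \<in> borel_measurable borel" unfolding H_def by measurable
  have H: "H u = h u" if "0 < u" for u using that h0[OF that] by (simp add: H_def f_def)
  have fH: "f u = ennreal (h u)" if "0 < u" for u using that by (simp add: f_def)
  define q where "q = (\<lambda>u. indicator {0<..<x} u * (H u / (x - \<alpha> * u) powr \<gamma>))"
  have [measurable]: "q \<in> borel_measurable borel" unfolding q_def by measurable
  have q0: "0 \<le> q u" for u unfolding q_def H_def by simp
  have lower: "(1 - \<alpha>) * x < x - \<alpha> * u" if "0 < u" "u < x" for u
  proof -
    have "\<alpha> * u < \<alpha> * x" using that p by simp
    then show ?thesis by (simp add: algebra_simps)
  qed
  have pos: "0 < (1 - \<alpha>) * x" using p x by simp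
  have q_eq: "ennreal (q u) = ennreal (indicator {0<..<x} u * (x - \<alpha> * u) powr (- \<gamma>)) * f u" for u
  proof (cases "0 < u \<and> u < x")
    case True
    then show ?thesis using H[of u] fH[of u] h0[of u] by (simp add: q_def powr_minus divide_inverse mult.commute flip: ennreal_mult)
  qed (simp add: q_def)
  have "(\<integral>\<^sup>+u. ennreal (q u) \<partial>lborel) \<le> (\<integral>\<^sup>+u. ennreal (((1 - \<alpha>) * x) powr (- \<gamma>)) * f u \<partial>lborel)"
  proof (rule nn_integral_mono)
    fix u
    show "ennreal (q u) \<le> ennreal (((1 - \<alpha>) * x) powr (- \<gamma>)) * f u"
    proof (cases "0 < u \<and> u < x")
      case True
      then have "(x - \<alpha> * u) powr (- \<gamma>) \<le> ((1 - \<alpha>) * x) powr (- \<gamma>)"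
        using lower[of u] pos p by (intro powr_mono2') auto
      then show ?thesis unfolding q_eq using True by (intro mult_right_mono ennreal_leI) auto
    qed (simp add: q_def)
  qed
  also have "\<dots> < \<infinity>" by (simp add: nn_integral_cmult mass)
  finally have int: "integrable lborel q" using q0 by (intro integrableI_nonneg) auto
  have "h x = \<gamma> / x * (LINT u:{0<..<x}|lborel. h u / (x - \<alpha> * u) powr \<gamma>)"
    using h x unfolding alpha_sun_density_def by blast
  also have "(LINT u:{0<..<x}|lborel. h u / (x - \<alpha> * u) powr \<gamma>) = (LINT u|lborel. q u)"
    unfolding set_lebesgue_integral_def by (intro Bochner_Integration.integral_cong refl) (simp add: q_def indicator_def H)
  finally have "f x = ennreal (\<gamma> / x * (LINT u|lborel. q u))" using x by (simp add: f_def)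
  also have "\<dots> = ennreal (\<gamma> / x) * (\<integral>\<^sup>+u. ennreal (q u) \<partial>lborel)"
  proof -
    have "(\<integral>\<^sup>+u. ennreal (q u) \<partial>lborel) = ennreal (LINT u|lborel. q u)"
      by (rule nn_integral_eq_integral[OF int]) (simp add: q0)
    then show ?thesis using p x by (simp only:) (intro ennreal_mult, auto intro!: Bochner_Integration.integral_nonneg q0)
  qed
  also have "\<dots> = (\<integral>\<^sup>+u. ennreal (\<gamma> / x) * ennreal (q u) \<partial>lborel)"
    by (rule nn_integral_cmult[symmetric]) measurable
  also have "\<dots> = (\<integral>\<^sup>+u. ennreal (indicator {0<..<x} u * (\<gamma> / x * (x - \<alpha> * u) powr (- \<gamma>))) * f u \<partial>lborel)"
  proof (rule nn_integral_cong)
    fix u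
    have "ennreal (\<gamma> / x) * ennreal (indicator {0<..<x} u * (x - \<alpha> * u) powr (- \<gamma>)) = ennreal (indicator {0<..<x} u * (\<gamma> / x * (x - \<alpha> * u) powr (- \<gamma>)))"
      using p x by (subst ennreal_mult[symmetric]) (auto simp: mult_ac)
    then show "ennreal (\<gamma> / x) * ennreal (q u) = ennreal (indicator {0<..<x} u * (\<gamma> / x * (x - \<alpha> * u) powr (- \<gamma>))) * f u"
      unfolding q_eq by (simp only: mult.assoc[symmetric])
  qed
  finally show "f x = (\<integral>\<^sup>+u. ennreal (indicator {0<..<x} u * (\<gamma> / x * (x - \<alpha> * u) powr (- \<gamma>))) * f u \<partial>lborel)" .
qed (use p mass in auto)

theorem theorem1:
  fixes \<alpha> \<gamma> :: real and M :: "'a measure" and X :: "'a \<Rightarrow> real"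
  assumes "0 < \<alpha>" and "\<alpha> < 1" and "0 < \<gamma>"
    and "prob_space M"
    and "alpha_sun_variable M \<alpha> \<gamma> X"
  shows "generalized_gamma_convolution (distr M borel X)"
proof -
  obtain h where h: "alpha_sun_density \<alpha> \<gamma> h"
    and D: "distributed M lborel X (\<lambda>x. ennreal (h x) * indicator {0<..} x)"
    using assms(5) unfolding alpha_sun_variable_def by blast
  define f where "f = (\<lambda>x. ennreal (h x) * indicator {0<..} x)"
  note D = D[folded f_def]
  have fm: "f \<in> borel_measurable borel" using distributed_borel_measurable[OF D] by simp
  have Xm: "X \<in> borel_measurable M" using distributed_measurable[OF D] by simp
  have law: "distr M borel X = density lborel f"
    using distributed_distr_eq_density[OF D] by (simp cong: distr_cong)
  have "prob_space (density lborel f)"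
    unfolding law[symmetric] by (rule prob_space.prob_space_distr[OF assms(4) Xm])
  then have "emeasure (density lborel f) UNIV = 1" using prob_space.emeasure_space_1 by fastforce
  then have "(\<integral>\<^sup>+x. f x \<partial>lborel) = 1" using fm by (simp add: emeasure_density)
  then interpret sun_law \<alpha> \<gamma> f using sun_law_of_density[OF assms(1-3) h f_def fm] by blast
  show ?thesis unfolding law by (rule generalized_gamma_convolution_law)
qed

end
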